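(* For the imaging function $$I_{cavity}(z):=\big|\langle \mathrm{N}_{\partial C}\psi_z,\psi_z\rangle_{\partial C}\big|,$$ there exist positive constants $c_1$ and $c_2$, independent of the sampling point $z\in\mathbb{R}^2$, such that $$c_1\,\|\mathrm{S}\psi_z\|^2_{H^{1/2}(\partial D)}\le I_{cavity}(z)\le c_2\,\|\mathrm{S}\psi_z\|^2_{H^{1/2}(\partial D)} .$$
   Context: Let $k>0$ and $\phi(x;y)=\frac{i}{4}H_0^{(1)}(k|x-y|)$, $x\neq y$, in $\mathbb{R}^2$, where $H_n^{(1)}$ denotes the Hankel function of the first kind of order $n$ and $J_n$ the Bessel function of order $n$. Let $D\subset\mathbb{R}^2$ be an open, connected and bounded domain (the cavity) with Lipschitz boundary $\partial D$. Let $r_i>0$, let $C=\{x\in\mathbb{R}^2:|x|<r_i\}$ lie in the interior of $D$ (with $\overline{C}\subset D$), and let $\partial C=\{|x|=r_i\}$ be the measurement circle. Assume that $k^2$ is neither an eigenvalue of $-\Delta$ (with Dirichlet boundary condition) in $D$ nor in $C$. For $y\in\partial C$, the scattered field $u^s(\cdot;y)$ is the unique solution of $\Delta_x u^s(\cdot;y)+k^2u^s(\cdot;y)=0$ in $D$, $u^s(\cdot;y)=-\phi(\cdot;y)$ on $\partial D$. The near field operator $\mathrm{N}_{\partial C}:L^2(\partial C)\to L^2(\partial C)$ is $(\mathrm{N}_{\partial C}g)(x)=\int_{\partial C}u^s(x;y)g(y)\,ds_y$, $x\in\partial C$. The operator $\mathrm{S}:L^2(\partial C)\to H^{1/2}(\partial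 D)$ is $(\mathrm{S}g)(x)=\int_{\partial C}\phi(x;y)g(y)\,ds_y$, $x\in\partial D$. $\langle\cdot,\cdot\rangle_{\partial C}$ is the $L^2(\partial C)$ inner product (conjugate-linear in the second argument). Let $\mathfrak{M}$ be a chosen positive integer, $\delta_{0n}$ the Kronecker delta, and $\theta_{yz}$ the angle between $y$ and $z$. For $y\in\partial C$, $$\psi_z(y)=\sum_{n=-\mathfrak{M}}^{\mathfrak{M}}\frac{4}{i|y|\pi(1+\delta_{0n})}\frac{J_n(k|z|)}{J_n(k|y|)}\cos(n\theta_{yz}).$$ Here $J_n(kr_i)\neq0$ for all $n$ because $k^2$ is not an eigenvalue of $-\Delta$ in $C$, so $\psi_z$ is well-defined. *)

theory Defs
  imports "HOL-Analysis.Analysis"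
begin

section \<open>Bessel and Hankel functions\<close>

definition bessel_J_nat :: "nat \<Rightarrow> real \<Rightarrow> real" where
  "bessel_J_nat n x = (\<Sum>m. (-1) ^ m / (fact m * fact (m + n)) * (x / 2) ^ (2 * m + n))"

definition bessel_J :: "int \<Rightarrow> real \<Rightarrow> real" where
  "bessel_J n x =
     (if n \<ge> 0 then bessel_J_nat (nat n) x else (-1) ^ nat (- n) * bessel_J_nat (nat (- n)) x)"

definition bessel_Y0 :: "real \<Rightarrow> real" where
  "bessel_Y0 x = 2 / pi * ((ln (x / 2) + euler_mascheroni) * bessel_J 0 x
     - (\<Sum>m. (-1) ^ m * harm m / (fact m)\<^sup>2 * (x / 2) ^ (2 * m)))"

definition hankel1_0 :: "real \<Rightarrow> complex" where
  "hankel1_0 x = complex_of_real (bessel_J 0 x) + \<i> * complex_of_real (bessel_Y0 x)"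

definition fund_sol :: "real \<Rightarrow> real^2 \<Rightarrow> real^2 \<Rightarrow> complex" where
  "fund_sol k x y = \<i> / 4 * hankel1_0 (k * norm (x - y))"

section \<open>Classical derivatives\<close>

definition partial_deriv :: "2 \<Rightarrow> (real^2 \<Rightarrow> 'b::real_normed_vector) \<Rightarrow> real^2 \<Rightarrow> 'b" where
  "partial_deriv j u x = frechet_derivative u (at x) (axis j 1)"

text \<open>The following two notions are meant for open \<open>S\<close>.\<close>

definition C1_on :: "(real^2) set \<Rightarrow> (real^2 \<Rightarrow> 'b::real_normed_vector) \<Rightarrow> bool" where
  "C1_on S u \<longleftrightarrow> (\<forall>x\<in>S. u differentiable (at x)) \<and> (\<forall>j. continuous_on S (partial_deriv j u))"

definition C2_on :: "(real^2) set \<Rightarrow> (real^2 \<Rightarrow> 'b::real_normed_vector) \<Rightarrow> bool" where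
  "C2_on S u \<longleftrightarrow> C1_on S u \<and> (\<forall>j. C1_on S (partial_deriv j u))"

definition laplacian :: "(real^2 \<Rightarrow> complex) \<Rightarrow> real^2 \<Rightarrow> complex" where
  "laplacian u x = (\<Sum>j\<in>UNIV. partial_deriv j (partial_deriv j u) x)"

section \<open>The Sobolev space of order one\<close>

definition L2 :: "'a measure \<Rightarrow> ('a \<Rightarrow> complex) set" where
  "L2 M = {u \<in> borel_measurable M. integrable M (\<lambda>x. (cmod (u x))\<^sup>2)}"

definition test_functions :: "(real^2) set \<Rightarrow> (real^2 \<Rightarrow> real) set" where
  "test_functions D =
     {\<eta>. C1_on UNIV \<eta> \<and> compact (closure {x. \<eta> x \<noteq> 0}) \<and> closure {x. \<eta> x \<noteq> 0} \<subseteq> D}"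

definition is_weak_deriv ::
    "(real^2) set \<Rightarrow> 2 \<Rightarrow> (real^2 \<Rightarrow> complex) \<Rightarrow> (real^2 \<Rightarrow> complex) \<Rightarrow> bool" where
  "is_weak_deriv D j u v \<longleftrightarrow> v \<in> L2 (lebesgue_on D) \<and>
     (\<forall>\<eta>\<in>test_functions D.
        (LINT x|lebesgue_on D. u x * of_real (partial_deriv j \<eta> x)) =
        - (LINT x|lebesgue_on D. v x * of_real (\<eta> x)))"

text \<open>Weak derivatives are unique almost everywhere, so the choice does not affect norms.\<close>

definition weak_deriv :: "(real^2) set \<Rightarrow> 2 \<Rightarrow> (real^2 \<Rightarrow> complex) \<Rightarrow> real^2 \<Rightarrow> complex" where
  "weak_deriv D j u = (SOME v. is_weak_deriv D j u v)"

definition H1 :: "(real^2) set \<Rightarrow> (real^2 \<Rightarrow> complex) set" where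
  "H1 D = {u \<in> L2 (lebesgue_on D). \<forall>j. \<exists>v. is_weak_deriv D j u v}"

definition H1_norm :: "(real^2) set \<Rightarrow> (real^2 \<Rightarrow> complex) \<Rightarrow> real" where
  "H1_norm D u = sqrt ((LINT x|lebesgue_on D. (cmod (u x))\<^sup>2)
     + (\<Sum>j\<in>UNIV. LINT x|lebesgue_on D. (cmod (weak_deriv D j u x))\<^sup>2))"

section \<open>Lipschitz boundaries, traces and the trace space\<close>

text \<open>Locally, and up to a choice of orthonormal axes \<open>e1\<close>, \<open>e2\<close>, the set lies strictly above
  the graph of a Lipschitz function.\<close>

definition lipschitz_boundary :: "(real^2) set \<Rightarrow> bool" where
  "lipschitz_boundary D \<longleftrightarrow>
     (\<forall>p\<in>frontier D. \<exists>\<rho>>0. \<exists>e1 e2 L \<gamma>.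
        norm e1 = 1 \<and> norm e2 = 1 \<and> e1 \<bullet> e2 = 0 \<and> L-lipschitz_on UNIV (\<gamma> :: real \<Rightarrow> real) \<and>
        (\<forall>x\<in>ball p \<rho>. x \<in> D \<longleftrightarrow> \<gamma> (e1 \<bullet> x) < e2 \<bullet> x))"

definition hausdorff1_outer :: "(real^2) set \<Rightarrow> ennreal" where
  "hausdorff1_outer A =
     (SUP \<delta>\<in>{0::real<..}.
        INF U\<in>{U :: nat \<Rightarrow> (real^2) set. A \<subseteq> (\<Union>i. U i) \<and> (\<forall>i. bounded (U i) \<and> diameter (U i) \<le> \<delta>)}.
          \<Sum>i. ennreal (diameter (U i)))"

text \<open>Arc length on a boundary curve is one-dimensional Hausdorff measure.  The outer measure above
  is a metric outer measure, hence countably additive on the Borel sets.\<close>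

definition boundary_measure :: "(real^2) set \<Rightarrow> (real^2) measure" where
  "boundary_measure D =
     restrict_space (measure_of UNIV (sets borel) hausdorff1_outer) (frontier D)"

text \<open>The trace on the boundary: the extension, by density, of the restriction of functions that are
  continuously differentiable up to the boundary, as a map from \<open>H1 D\<close> to the square integrable
  functions on the boundary.  The values of \<open>u\<close> outside \<open>D\<close> and of \<open>f\<close> off the boundary play no
  role.\<close>

definition has_trace :: "(real^2) set \<Rightarrow> (real^2 \<Rightarrow> complex) \<Rightarrow> (real^2 \<Rightarrow> complex) \<Rightarrow> bool" where
  "has_trace D u f \<longleftrightarrow> u \<in> H1 D \<and> f \<in> borel_measurable (boundary_measure D) \<and>
     (\<exists>v :: nat \<Rightarrow> real^2 \<Rightarrow> complex. (\<forall>n. C1_on UNIV (v n)) \<and>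
        (\<lambda>n. H1_norm D (\<lambda>x. u x - v n x)) \<longlonglongrightarrow> 0 \<and>
        (\<lambda>n. \<integral>\<^sup>+x. ennreal ((cmod (v n x - f x))\<^sup>2) \<partial>boundary_measure D) \<longlonglongrightarrow> 0)"

text \<open>The Sobolev space of order one half on the boundary is the range of the trace, with the
  quotient norm.\<close>

definition H_half_norm :: "(real^2) set \<Rightarrow> (real^2 \<Rightarrow> complex) \<Rightarrow> real" where
  "H_half_norm D f = Inf {H1_norm D u | u. has_trace D u f}"

section \<open>The Dirichlet problem for the Helmholtz equation\<close>

text \<open>Variational solutions are smooth inside \<open>D\<close> by interior regularity; working with the classical
  representative gives meaning to point values.\<close>

definition dirichlet_eigenvalue :: "(real^2) set \<Rightarrow> real \<Rightarrow> bool" where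
  "dirichlet_eigenvalue D \<mu> \<longleftrightarrow>
     (\<exists>u. u \<in> H1 D \<and> C2_on D u \<and> (\<forall>x\<in>D. - laplacian u x = of_real \<mu> * u x) \<and>
        has_trace D u (\<lambda>x. 0) \<and> (\<exists>x\<in>D. u x \<noteq> 0))"

definition helmholtz_dirichlet ::
    "(real^2) set \<Rightarrow> real \<Rightarrow> (real^2 \<Rightarrow> complex) \<Rightarrow> (real^2 \<Rightarrow> complex) \<Rightarrow> bool" where
  "helmholtz_dirichlet D k f u \<longleftrightarrow>
     u \<in> H1 D \<and> C2_on D u \<and> (\<forall>x\<in>D. laplacian u x + of_real (k\<^sup>2) * u x = 0) \<and> has_trace D u f"

section \<open>Operators on the measurement circle and the imaging function\<close>

definition circle_integral :: "real \<Rightarrow> (real^2 \<Rightarrow> complex) \<Rightarrow> complex" where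
  "circle_integral r g =
     of_real r * (LINT t:{0..2*pi}|lborel. g (vector [r * cos t, r * sin t]))"

definition circle_inner :: "real \<Rightarrow> (real^2 \<Rightarrow> complex) \<Rightarrow> (real^2 \<Rightarrow> complex) \<Rightarrow> complex" where
  "circle_inner r f g = circle_integral r (\<lambda>x. f x * cnj (g x))"

definition near_field_op ::
    "real \<Rightarrow> (real^2 \<Rightarrow> real^2 \<Rightarrow> complex) \<Rightarrow> (real^2 \<Rightarrow> complex) \<Rightarrow> real^2 \<Rightarrow> complex" where
  "near_field_op r us g x = circle_integral r (\<lambda>y. us x y * g y)"

definition single_layer_op :: "real \<Rightarrow> real \<Rightarrow> (real^2 \<Rightarrow> complex) \<Rightarrow> real^2 \<Rightarrow> complex" where
  "single_layer_op k r g x = circle_integral r (\<lambda>y. fund_sol k x y * g y)"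

text \<open>For \<open>z = 0\<close> the angle is undefined in the mathematics and has a junk value here; it is
  irrelevant, since \<open>bessel_J n 0 = 0\<close> unless \<open>n = 0\<close>.\<close>

definition angle_between :: "real^2 \<Rightarrow> real^2 \<Rightarrow> real" where
  "angle_between y z = arccos ((y \<bullet> z) / (norm y * norm z))"

definition psi_fun :: "real \<Rightarrow> nat \<Rightarrow> real^2 \<Rightarrow> real^2 \<Rightarrow> complex" where
  "psi_fun k M z y =
     (\<Sum>n = - int M..int M.
        4 / (\<i> * of_real (norm y) * of_real pi * (1 + (if n = 0 then 1 else 0)))
        * of_real (bessel_J n (k * norm z) / bessel_J n (k * norm y))
        * of_real (cos (of_int n * angle_between y z)))"

definition I_cavity ::
    "real \<Rightarrow> real \<Rightarrow> nat \<Rightarrow> (real^2 \<Rightarrow> real^2 \<Rightarrow> complex) \<Rightarrow> real^2 \<Rightarrow> real" where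
  "I_cavity k r M us z = cmod (circle_inner r (near_field_op r us (psi_fun k M z)) (psi_fun k M z))"

end

theory Submission
  imports Defs
begin

text \<open>
On the circle, \<open>\<psi>\<^sub>z\<close> is \<open>- \<i>\<close> times a real trigonometric polynomial. Expanding
\<open>cos (n \<theta>)\<close> in the angles of \<open>y\<close> and \<open>z\<close> writes this polynomial as a combination of finitely many functions
\<open>cos (n t)\<close> and \<open>sin (n t)\<close> with real coefficients \<open>a = a z\<close>; a mode with \<open>J\<^sub>n (k r) = 0\<close> has coefficient zero,
because division by zero gives zero. The point \<open>z\<close> enters both sides only through \<open>a\<close>, and both sides are
quadratic in \<open>a\<close>, so each of them is compared with the sum of the \<open>a\<^sub>i\<^sup>2\<close>.

The imaging function is at most a constant times this sum because it is the modulus of a quadratic form on a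
finite-dimensional space. It is at least a constant times this sum because of its imaginary part. The
imaginary part of the fundamental solution is \<open>J\<^sub>0 (k |x - y|) / 4\<close>, an entire solution of the Helmholtz
equation, so the imaginary part of the scattered field is \<open>- J\<^sub>0 (k |x - y|) / 4\<close>
(\<open>near_field_imaginary_part\<close>). This kernel is diagonal in the trigonometric basis with eigenvalues
proportional to \<open>J\<^sub>n (k r)\<^sup>2 > 0\<close> (\<open>jf_fourier\<close>), so there is no cancellation.

The trace norm of \<open>S \<psi>\<close> is bounded above because finitely many smooth potentials extend it into \<open>D\<close>. The
lower bound is a compactness argument (\<open>trace_coercivity\<close>): otherwise some unit vector \<open>a\<close> would give
a density for which \<open>S \<psi>\<close> is also the trace of the zero function. As \<open>k\<^sup>2\<close> is not a Dirichlet eigenvalue, the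
field scattered from this density vanishes (\<open>near_field_vanishes\<close>), contradicting the lower bound for the
imaging function.

This uses the near field operator as an operator, while the scattered fields are given for one source point at
a time, with no regularity in that point. A solution operator of the Dirichlet problem is therefore built: the
closure of the test functions is a Hilbert space on which the weak problem satisfies a Fredholm alternative
(\<open>compact_perturbation_solvable\<close>, \<open>cell_poincare\<close>), and a regularity theorem (\<open>weyl_helmholtz\<close>) turns weak solutions
into classical ones, so that uniqueness identifies them with the given fields. The operator is
symmetric, which makes the field at a point of the circle an integral of the source against a fixed integrable
function (\<open>us_value\<close>); integration over the source circle is then an application of Fubini's theorem.
\<close>

abbreviation (input) "cts \<equiv> continuous_on UNIV"

abbreviation (input) "pd \<equiv> partial_deriv"

abbreviation (input) "intble \<equiv> integrable lborel"

abbreviation (input) "cor \<equiv> complex_of_real"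

notation LIMSEQ (infixr "--->" 60)

notation scaleR (infixr "*R" 75)

lemmas Bintegrable_add = Bochner_Integration.integrable_add
 and Bintegrable_bound = Bochner_Integration.integrable_bound
 and Bintegrable_cong = Bochner_Integration.integrable_cong
 and Bintegrable_diff = Bochner_Integration.integrable_diff
 and Bintegrable_sum = Bochner_Integration.integrable_sum
 and Bintegral_add = Bochner_Integration.integral_add
 and Bintegral_cong = Bochner_Integration.integral_cong
 and Bintegral_diff = Bochner_Integration.integral_diff
 and Bintegral_nonneg = Bochner_Integration.integral_nonneg
 and Bintegral_norm_bound_integral = Bochner_Integration.integral_norm_bound_integral
 and Bintegral_sum = Bochner_Integration.integral_sum

section \<open>Projection and a Fredholm alternative in Hilbert space\<close>

lemma tendsto_inverse_Suc: "(%n. 1 / (real n + 1)) ---> 0"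
 using LIMSEQ_inverse_real_of_nat by (simp add: inverse_eq_divide add.commute)

text \<open>A minimising sequence for the distance from \<open>x\<close> to \<open>V\<close> is
Cauchy by the parallelogram law.\<close>

lemma closed_subspace_projection:
 fixes V :: "'a::{real_inner,complete_space} set"
 assumes "subspace V" "closed V"
 shows "\<exists>p\<in>V. \<forall>v\<in>V. inner (x - p) v = 0"
proof -
 have V0: "0 \<in> V" using assms(1) by (rule subspace_0)
 define d where "d = infdist x V"
 have d0: "d >= 0" by (simp add: d_def infdist_nonneg)
 have d_le: "d <= norm (x - v)" if "v \<in> V" for v
  using infdist_le[OF that, of x] by (simp add: d_def dist_norm)
 have "\<exists>v\<in>V. norm (x - v) < d + 1 / (real n + 1)" for n
 proof -
  have "Inf (dist x ` V) < d + 1 / (real n + 1)"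
   using V0 by (auto simp: d_def infdist_def)
  then obtain y where "y \<in> dist x ` V" "y < d + 1 / (real n + 1)"
   using V0 by (metis cInf_lessD empty_iff imageI)
  then show ?thesis by (auto simp: dist_norm)
 qed
 then obtain p where p: "!!n. p n \<in> V" "!!n. norm (x - p n) < d + 1 / (real n + 1)"
  by metis
 have key: "(norm (p m - p n))^2 <= (8 * d + 4) * (1 / (real N + 1))" if mn: "m >= N" "n >= N" for m n N
 proof -
  define e where "e = 1 / (real N + 1)"
  have e: "e > 0" "e <= 1" by (auto simp: e_def)
  have le: "1 / (real i + 1) <= e" if "i >= N" for i
   using that by (auto simp: e_def intro!: divide_left_mono)
  have a: "norm (x - p m) <= d + e" "norm (x - p n) <= d + e"
   using p(2)[of m] p(2)[of n] le[OF mn(1)] le[OF mn(2)] by linarith+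
  have "(1/2) *R (p m + p n) \<in> V"
   using p(1) assms(1) by (intro subspace_scale subspace_add) auto
  from d_le[OF this] have "d^2 <= (norm (x - (1/2) *R (p m + p n)))^2"
   using d0 by (intro power_mono)
  also have "x - (1/2) *R (p m + p n) = (1/2) *R ((x - p m) + (x - p n))"
   by (simp add: algebra_simps flip: scaleR_add_left)
  also have "(norm ...)^2 = (1/4) * (norm ((x - p m) + (x - p n)))^2"
   by (simp add: power_mult_distrib power_divide power2_norm_eq_inner)
  finally have b: "4 * d^2 <= (norm ((x - p m) + (x - p n)))^2" by simp
  have "(norm (p m - p n))^2 = (norm ((x - p m) - (x - p n)))^2"
   by (simp add: norm_minus_commute)
  also have "... = 2 * (norm (x - p m))^2 + 2 * (norm (x - p n))^2 - (norm ((x - p m) + (x - p n)))^2"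
   by (simp add: power2_norm_eq_inner inner_simps inner_commute)
  also have "... <= 2 * (d + e)^2 + 2 * (d + e)^2 - 4 * d^2"
   using b power_mono[OF a(1), of 2] power_mono[OF a(2), of 2] by simp
  also have "... = 8 * d * e + 4 * e * e" by (simp add: power2_eq_square algebra_simps)
  also have "... <= 8 * d * e + 4 * e" using e by simp
  finally show ?thesis by (simp add: e_def algebra_simps)
 qed
 have "Cauchy p"
 proof (rule metric_CauchyI)
  fix e :: real assume e: "e > 0"
  have "(%N. (8 * d + 4) * (1 / (real N + 1))) ---> (8*d+4) * 0"
   by (intro tendsto_intros tendsto_inverse_Suc)
  then have "eventually (%N. (8 * d + 4) * (1 / (real N + 1)) < e^2) sequentially"
   using e by (intro order_tendstoD(2)[where y=0]) auto
  then obtain N where N: "(8 * d + 4) * (1 / (real N + 1)) < e^2"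
   by (auto simp: eventually_sequentially)
  show "\<exists>M. \<forall>m\<ge>M. \<forall>n\<ge>M. dist (p m) (p n) < e"
  proof (intro exI allI impI)
   fix m n assume "m >= N" "n >= N"
   from key[OF this] N have "(norm (p m - p n))^2 < e^2" by linarith
   then show "dist (p m) (p n) < e" using e by (simp add: dist_norm power_less_imp_less_base)
  qed
 qed
 then obtain q where q: "p ---> q" by (metis Cauchy_convergent convergent_def)
 have qV: "q \<in> V" using closed_sequentially[OF assms(2)] p(1) q by blast
 have "(%n. norm (x - p n)) ---> norm (x - q)" by (intro tendsto_intros q)
 moreover have "(%n. d + 1 / (real n + 1)) ---> d + 0"
  by (intro tendsto_intros) (rule tendsto_inverse_Suc)
 ultimately have qd: "norm (x - q) <= d"
  by (intro LIMSEQ_le[where X="%n. norm (x - p n)"]) (use p(2) in \<open>auto intro!: less_imp_le\<close>)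
 show ?thesis
 proof (intro bexI[OF _ qV] ballI)
  fix v assume v: "v \<in> V"
  show "inner (x - q) v = 0"
  proof (cases "v = 0")
   case False
   define t where "t = inner (x - q) v / (norm v)^2"
   have "q + t *R v \<in> V" using qV v assms(1) by (intro subspace_add subspace_scale)
   from d_le[OF this] have "(norm (x - q))^2 <= (norm (x - (q + t *R v)))^2"
    using qd by (intro power_mono) auto
   also have "x - (q + t *R v) = (x - q) - t *R v" by simp
   also have "(norm ...)^2 = (norm (x - q))^2 - 2 * t * inner (x - q) v + t^2 * (norm v)^2"
    unfolding power2_norm_eq_inner inner_diff_left inner_diff_right inner_scaleR_left inner_scaleR_right
    by (simp add: inner_commute power2_eq_square algebra_simps)
   also have "t^2 * (norm v)^2 = t * inner (x - q) v"
    using False by (simp add: t_def power2_eq_square)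
   finally have "t * inner (x - q) v <= 0" by simp
   then have "(inner (x - q) v)^2 <= 0" using False
    by (simp add: t_def power2_eq_square divide_le_0_iff mult_le_0_iff zero_le_mult_iff)
   then show ?thesis by simp
  qed simp
 qed
qed

lemma bounded_family_convergent_subsequence:
 fixes X :: "'i => nat => real"
 assumes "finite I" "!!i. i \<in> I ==> bounded (range (X i))"
 shows "\<exists>r. strict_mono (r :: nat => nat) \<and> (\<forall>i\<in>I. convergent (%n. X i (r n)))"
 using assms
proof (induction I rule: finite_induct)
 case empty
 show ?case by (rule exI[of _ id]) (auto simp: strict_mono_def)
next
 case (insert j I)
 then obtain r where r: "strict_mono r" "\<forall>i\<in>I. convergent (%n. X i (r n))" by auto
 have "bounded (range (%n. X j (r n)))"
  using insert.prems[of j] by (auto intro: bounded_subset)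
 then obtain l s where s: "strict_mono s" "((%n. X j (r n)) \<circ> s) ---> l"
  using bounded_imp_convergent_subsequence by blast
 show ?case
 proof (intro exI[of _ "r \<circ> s"] conjI ballI)
  show "strict_mono (r \<circ> s)" using r s by (simp add: strict_mono_o)
  fix i assume "i \<in> insert j I"
  then show "convergent (%n. X i ((r \<circ> s) n))"
  proof
   assume "i = j" then show ?thesis using s by (auto simp: convergent_def o_def)
  next
   assume "i \<in> I"
   then obtain l where "(%n. X i (r n)) ---> l" using r by (auto simp: convergent_def)
   from LIMSEQ_subseq_LIMSEQ[OF this s(1)] show ?thesis by (auto simp: convergent_def o_def)
  qed
 qed
qed

text \<open>The hypothesis \<open>fin\<close> stands for compactness of \<open>J\<close> on
\<open>V\<close>. Unit vectors on which the compression \<open>B\<close> of \<open>1 - c J\<close>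
to \<open>V\<close> tends to zero have, along a subsequence, convergent values under the
functionals; then they are Cauchy by \<open>fin\<close>, and their limit is a unit vector in the
kernel, which \<open>inj\<close> excludes. So \<open>B\<close> is bounded below and its range is
closed, and by symmetry the orthogonal complement of the range is the kernel.\<close>

theorem compact_perturbation_solvable:
 fixes V :: "'a::{real_inner,complete_space} set" and J :: "'a => 'a" and e :: "'i => 'a"
 assumes V: "subspace V" "closed V"
  and J: "bounded_linear J" "!!u v. inner (J u) v = inner u (J v)"
  and fin: "finite I"
   "!!v. v \<in> V ==> c * inner (J v) v <= (1/2) * (norm v)^2 + (\<Sum>i\<in>I. (inner (e i) v)^2)"
  and inj: "!!u. u \<in> V ==> (!!v. v \<in> V ==> inner (u - c *R J u) v = 0) ==> u = 0"
 shows "\<exists>u\<in>V. \<forall>v\<in>V. inner (u - c *R J u) v = inner f v"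
proof -
 interpret J: bounded_linear J by fact
 obtain Q where Q: "!!x. Q x \<in> V" "!!x v. v \<in> V ==> inner (x - Q x) v = 0"
  using closed_subspace_projection[OF V] by metis
 have eqI: "u = w" if "u \<in> V" "w \<in> V" "!!v. v \<in> V ==> inner u v = inner w v" for u w
 proof -
  have "inner (u - w) (u - w) = 0"
   using that(3)[of "u - w"] that(1,2) V(1) by (simp add: subspace_diff inner_diff_left)
  then show ?thesis by simp
 qed
 define A where "A u = u - c *R J u" for u
 have A_diff: "A (u - w) = A u - A w" for u w by (simp add: A_def J.diff algebra_simps)
 have A_add: "A (u + w) = A u + A w" for u w by (simp add: A_def J.add algebra_simps)
 have A_scale: "A (t *R u) = t *R A u" for t u by (simp add: A_def J.scaleR algebra_simps)
 have A_sym: "inner (A u) v = inner u (A v)" for u v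
  by (simp add: A_def inner_diff_left inner_diff_right J(2))
 have A_lim: "(%n. A (u n)) ---> A l" if "u ---> l" for u l
  unfolding A_def by (intro tendsto_intros that J.tendsto)
 define B where "B u = Q (A u)" for u
 have BV: "B u \<in> V" for u by (simp add: B_def Q)
 have B: "inner (B u) v = inner (A u) v" if "v \<in> V" for u v
  using Q(2)[OF that, of "A u"] by (simp add: B_def inner_diff_left)
 have B_diff: "B (u - w) = B u - B w" for u w
  by (rule eqI) (auto simp: BV subspace_diff[OF V(1)] B A_diff inner_diff_left)
 have B_add: "B (u + w) = B u + B w" for u w
  by (rule eqI) (auto simp: BV subspace_add[OF V(1)] B A_add inner_add_left)
 have B_scale: "B (t *R u) = t *R B u" for t u
  by (rule eqI) (auto simp: BV subspace_scale[OF V(1)] B A_scale)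
 have "\<exists>\<delta>>0. \<forall>u\<in>V. \<delta> * norm u <= norm (B u)"
 proof (rule ccontr)
  assume "\<not> ?thesis"
  then have "\<exists>u\<in>V. norm (B u) < 1 / (real n + 1) * norm u" for n
   by (metis not_le of_nat_0_le_iff zero_less_divide_1_iff add_nonneg_pos zero_less_one)
  then obtain u' where u': "!!n. u' n \<in> V" "!!n. norm (B (u' n)) < 1 / (real n + 1) * norm (u' n)"
   by metis
  have nz: "u' n \<noteq> 0" for n using u'(2)[of n] norm_ge_zero[of "B (u' n)"] by auto
  define u where "u n = (1 / norm (u' n)) *R u' n" for n
  have u: "u n \<in> V" "norm (u n) = 1" for n
   using u'(1) nz by (auto simp: u_def V(1) intro!: subspace_scale)
  have Bu: "norm (B (u n)) <= 1 / (real n + 1)" for n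
   using u'(2)[of n] nz[of n] by (simp add: u_def B_scale field_simps)
  have Bu0: "(%n. B (u n)) ---> 0"
  proof (rule Lim_null_comparison[OF always_eventually])
   show "\<forall>n. norm (B (u n)) <= 1 / (real n + 1)" using Bu by blast
   show "(%n. 1 / (real n + 1)) ---> 0"
    by (rule tendsto_inverse_Suc)
  qed
  have bd: "bounded (range (%n. inner (e i) (u n)))" for i
   unfolding bounded_iff
  proof (intro exI[of _ "norm (e i)"] ballI)
   fix x assume "x \<in> range (%n. inner (e i) (u n))"
   then obtain n where "x = inner (e i) (u n)" by blast
   then show "norm x <= norm (e i)" using Cauchy_Schwarz_ineq2[of "e i" "u n"] u(2)[of n] by simp
  qed
  obtain r where r: "strict_mono r" "!!i. i \<in> I ==> convergent (%n. inner (e i) (u (r n)))"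
   using bounded_family_convergent_subsequence[OF fin(1), of "%i n. inner (e i) (u n)"] bd by metis
  define w where "w n = u (r n)" for n
  have w: "w n \<in> V" "norm (w n) = 1" for n using u by (auto simp: w_def)
  have Bw0: "(%n. B (w n)) ---> 0"
   using LIMSEQ_subseq_LIMSEQ[OF Bu0 r(1)] by (simp add: w_def o_def)
  define s where "s m n = 4 * norm (B (w m) - B (w n)) + (\<Sum>i\<in>I. 2 * (inner (e i) (w m) - inner (e i) (w n))^2)" for m n
  have est: "(norm (w m - w n))^2 <= s m n" for m n
  proof -
   let ?d = "w m - w n"
   have dV: "?d \<in> V" using w V(1) by (simp add: subspace_diff)
   have nd: "norm ?d <= 2" using norm_triangle_ineq4[of "w m" "w n"] w by simp
   have "(norm ?d)^2 = inner (B ?d) ?d + c * inner (J ?d) ?d"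
    using B[OF dV, of ?d] by (simp add: A_def inner_diff_left power2_norm_eq_inner)
   also have "inner (B ?d) ?d <= norm (B ?d) * 2"
    using norm_cauchy_schwarz[of "B ?d" ?d] nd mult_left_mono[OF nd, of "norm (B ?d)"] by simp
   also note fin(2)[OF dV]
   finally show ?thesis
    by (simp add: s_def B_diff inner_diff_right flip: sum_distrib_left)
  qed
  have "Cauchy w"
  proof (rule metric_CauchyI)
   fix ep :: real assume ep: "ep > 0"
   have "((%(m,n). s m n) \<longlongrightarrow> 4 * norm (0 - 0 :: 'a) + (\<Sum>i\<in>I. 2 * (lim (%n. inner (e i) (w n)) - lim (%n. inner (e i) (w n)))^2))
      (sequentially \<times>\<^sub>F sequentially)"
    unfolding s_def split_beta
    by (intro tendsto_intros filterlim_compose[OF Bw0 filterlim_fst] filterlim_compose[OF Bw0 filterlim_snd]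
       filterlim_compose[OF _ filterlim_fst, of "%n. inner (e i) (w n)" for i]
       filterlim_compose[OF _ filterlim_snd, of "%n. inner (e i) (w n)" for i]
       convergent_LIMSEQ_iff[THEN iffD1])
      (use r(2) in \<open>auto simp: w_def\<close>)
   then have "((%(m,n). s m n) \<longlongrightarrow> 0) (sequentially \<times>\<^sub>F sequentially)" by simp
   then have "\<forall>\<^sub>F x in sequentially \<times>\<^sub>F sequentially. (%(m,n). s m n) x < ep^2"
    using ep by (intro order_tendstoD(2)) auto
   then obtain N where N: "!!m n. m >= N ==> n >= N ==> s m n < ep^2"
    unfolding eventually_prod_sequentially by auto
   show "\<exists>M. \<forall>m\<ge>M. \<forall>n\<ge>M. dist (w m) (w n) < ep"
   proof (intro exI allI impI)
    fix m n assume "m >= N" "n >= N"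
    then have "(norm (w m - w n))^2 < ep^2" using est[of m n] N[of m n] by linarith
    then show "dist (w m) (w n) < ep" using ep by (simp add: dist_norm power_less_imp_less_base)
   qed
  qed
  then obtain l where l: "w ---> l" by (metis Cauchy_convergent convergent_def)
  have lV: "l \<in> V" using closed_sequentially[OF V(2)] w(1) l by blast
  have "norm l = 1" using tendsto_norm[OF l] w(2) by (simp add: LIMSEQ_const_iff)
  moreover have "l = 0"
  proof (rule inj[OF lV])
   fix v assume v: "v \<in> V"
   have "(%n. inner (A (w n)) v) ---> inner (A l) v" by (intro tendsto_intros A_lim l)
   moreover have "(%n. inner (B (w n)) v) ---> inner 0 v" by (intro tendsto_intros Bw0)
   ultimately have "inner (A l) v = 0"
    unfolding B[OF v] using LIMSEQ_unique by fastforce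
   then show "inner (l - c *R J l) v = 0" by (simp add: A_def)
  qed
  ultimately show False by simp
 qed
 then obtain \<delta> where \<delta>: "\<delta> > 0" "!!u. u \<in> V ==> \<delta> * norm u <= norm (B u)" by blast
 define W where "W = B ` V"
 have W: "subspace W"
  unfolding W_def subspace_def
 proof (intro conjI ballI allI)
  have "B 0 = 0" using B_diff[of 0 0] by simp
  then show "0 \<in> B ` V" using V(1) subspace_0 by (metis imageI)
  show "x + y \<in> B ` V" if "x \<in> B ` V" "y \<in> B ` V" for x y
   using that B_add V(1) by (auto simp: subspace_add simp flip: B_add)
  show "t *R x \<in> B ` V" if "x \<in> B ` V" for x t
   using that V(1) by (auto simp: subspace_scale simp flip: B_scale)
 qed
 have "closed W"
  unfolding closed_sequential_limits
 proof (intro allI impI, elim conjE)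
  fix x l assume x: "\<forall>n. x n \<in> W" "x ---> l"
  then obtain u where u: "!!n. u n \<in> V" "!!n. x n = B (u n)" unfolding W_def image_iff by metis
  have "Cauchy u"
  proof (rule metric_CauchyI)
   fix ep :: real assume ep: "ep > 0"
   obtain N where N: "!!m n. m >= N ==> n >= N ==> dist (x m) (x n) < \<delta> * ep"
    using metric_CauchyD[OF LIMSEQ_imp_Cauchy[OF x(2)], of "\<delta> * ep"] \<delta> ep by (auto)
   show "\<exists>M. \<forall>m\<ge>M. \<forall>n\<ge>M. dist (u m) (u n) < ep"
   proof (intro exI allI impI)
    fix m n assume "m >= N" "n >= N"
    then have "norm (B (u m - u n)) < \<delta> * ep" using N by (simp add: dist_norm u B_diff)
    then have "\<delta> * norm (u m - u n) < \<delta> * ep"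
     using \<delta>(2)[of "u m - u n"] u(1) V(1) by (simp add: subspace_diff)
    then show "dist (u m) (u n) < ep" using \<delta>(1) by (simp add: dist_norm)
   qed
  qed
  then obtain v where v: "u ---> v" by (metis Cauchy_convergent convergent_def)
  have vV: "v \<in> V" using closed_sequentially[OF V(2)] u(1) v by blast
  have lV: "l \<in> V" using closed_sequentially[OF V(2), of x l] u(2) BV x(2) by auto
  have "l = B v"
  proof (rule eqI[OF lV BV])
   fix y assume y: "y \<in> V"
   have "(%n. inner (x n) y) ---> inner l y" by (intro tendsto_intros x(2))
   moreover have "(%n. inner (A (u n)) y) ---> inner (A v) y" by (intro tendsto_intros A_lim v)
   ultimately show "inner l y = inner (B v) y"
    by (simp add: u(2) B[OF y]) (metis LIMSEQ_unique)
  qed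
  then show "l \<in> W" using vV by (auto simp: W_def)
 qed
 then obtain p where p: "p \<in> W" "!!w. w \<in> W ==> inner (Q f - p) w = 0"
  using closed_subspace_projection[OF W] by metis
 then obtain u where u: "u \<in> V" "p = B u" by (auto simp: W_def)
 have "Q f - p = 0"
 proof (rule inj)
  show zV: "Q f - p \<in> V" using u BV Q V(1) by (simp add: subspace_diff)
  fix v assume v: "v \<in> V"
  have "inner (A (Q f - p)) v = inner (Q f - p) (A v)" by (rule A_sym)
  also have "... = inner (Q f - p) (B v)" using B[OF zV, of v] by (simp add: inner_commute)
  also have "... = 0" using v by (intro p(2)) (simp add: W_def)
  finally show "inner (Q f - p - c *R J (Q f - p)) v = 0" by (simp add: A_def)
 qed
 then have eq: "B u = Q f" using u by simp
 show ?thesis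
 proof (intro bexI[OF _ u(1)] ballI)
  fix v assume v: "v \<in> V"
  show "inner (u - c *R J u) v = inner f v"
   using B[OF v, of u] Q(2)[OF v, of f] eq by (simp add: A_def inner_diff_left)
 qed
qed

section \<open>The Hilbert space of square integrable functions\<close>

definition sqint :: "('a::euclidean_space => 'b::euclidean_space) => bool" where
 "sqint f \<longleftrightarrow> f \<in> borel_measurable lborel \<and> intble (%x. (norm (f x))^2)"

lemma sqint_measurable: "sqint f ==> f \<in> borel_measurable lborel"
 and sqint_norm: "sqint f ==> intble (%x. (norm (f x))^2)"
 by (simp_all add: sqint_def)

lemma sqint_bound:
 assumes f: "f \<in> borel_measurable lborel" and g: "intble g" "!!x. (norm (f x))^2 <= g x"
 shows "sqint f"
proof -
 have [measurable]: "f \<in> borel_measurable borel" using f by simp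
 have "intble (%x. (norm (f x))^2)"
 proof (rule Bintegrable_bound[OF g(1)])
  show "(%x. (norm (f x))^2) \<in> borel_measurable lborel" by measurable
  show "AE x in lborel. norm ((norm (f x))^2) <= norm (g x)" using order_trans[OF g(2) abs_ge_self] by simp
 qed
 then show ?thesis using f by (simp add: sqint_def)
qed

lemma norm_add_squared_le: "(norm (a + b))^2 <= 2 * (norm a)^2 + 2 * (norm (b :: 'a::real_inner))^2"
proof -
 have "0 <= (norm (a - b))^2" by simp
 then show ?thesis by (simp add: power2_norm_eq_inner inner_simps inner_commute)
qed

lemma sqint_zero: "sqint (%_. 0)"
 by (simp add: sqint_def)

lemma sqint_add:
 assumes "sqint f" "sqint g"
 shows "sqint (%x. f x + g x)"
proof (rule sqint_bound)
 show "(%x. f x + g x) \<in> borel_measurable lborel"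
  using assms by (intro borel_measurable_add sqint_measurable)
 show "intble (%x. 2 * (norm (f x))^2 + 2 * (norm (g x))^2)"
  using assms by (intro Bintegrable_add integrable_mult_right sqint_norm)
qed (rule norm_add_squared_le)

lemma sqint_scaleR:
 "sqint f ==> sqint (%x. c *R f x)"
 by (auto simp: sqint_def power_mult_distrib)

lemma sqint_uminus: "sqint f ==> sqint (%x. - f x)"
 by (auto simp: sqint_def)

lemma sqint_diff:
 "sqint f ==> sqint g ==> sqint (%x. f x - g x)"
 using sqint_add[of f "%x. - g x"] sqint_uminus[of g] by simp

lemma abs_inner_le_squares: "\<bar>inner a (b :: 'a::real_inner)\<bar> <= (norm a)^2 + (norm b)^2"
proof -
 have "\<bar>inner a b\<bar> <= norm a * norm b" by (rule Cauchy_Schwarz_ineq2)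
 moreover have "2 * norm a * norm b <= (norm a)^2 + (norm b)^2" by (rule sum_squares_bound)
 moreover have "0 <= (norm a)^2 + (norm b)^2" by simp
 ultimately show ?thesis by linarith
qed

lemma sqint_inner:
 assumes "sqint f" "sqint g"
 shows "intble (%x. inner (f x) (g x))"
proof (rule Bintegrable_bound)
 show "intble (%x. (norm (f x))^2 + (norm (g x))^2)"
  using assms by (intro Bintegrable_add sqint_norm)
 show "(%x. inner (f x) (g x)) \<in> borel_measurable lborel"
  using assms by (intro borel_measurable_inner sqint_measurable)
 show "AE x in lborel. norm (inner (f x) (g x)) <= norm ((norm (f x))^2 + (norm (g x))^2)"
  by (simp add: abs_inner_le_squares)
qed

definition l2_rel :: "('a::euclidean_space => 'b::euclidean_space) => ('a => 'b) => bool" where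
 "l2_rel f g \<longleftrightarrow> sqint f \<and> sqint g \<and> (AE x in lborel. f x = g x)"

quotient_type (overloaded) ('a, 'b) l2 =
 "'a::euclidean_space => 'b::euclidean_space" / partial: l2_rel
proof (rule part_equivpI)
 show "\<exists>x. l2_rel x x" by (rule exI[of _ "%_. 0"]) (simp add: l2_rel_def sqint_zero)
 show "symp l2_rel" by (auto intro!: sympI simp: l2_rel_def)
 show "transp l2_rel" by (auto intro!: transpI simp: l2_rel_def)
qed

instantiation l2 :: (euclidean_space, euclidean_space) real_vector
begin

lift_definition zero_l2 :: "('a, 'b) l2" is "%_. 0"
 by (simp add: l2_rel_def sqint_zero)

lift_definition plus_l2 :: "('a, 'b) l2 => ('a, 'b) l2 => ('a, 'b) l2" is "%f g x. f x + g x"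
 by (auto simp: l2_rel_def sqint_add)

lift_definition minus_l2 :: "('a, 'b) l2 => ('a, 'b) l2 => ('a, 'b) l2" is "%f g x. f x - g x"
 by (auto simp: l2_rel_def sqint_diff)

lift_definition uminus_l2 :: "('a, 'b) l2 => ('a, 'b) l2" is "%f x. - f x"
 by (auto simp: l2_rel_def sqint_uminus)

lift_definition scaleR_l2 :: "real => ('a, 'b) l2 => ('a, 'b) l2" is "%c f x. c *R f x"
 by (auto simp: l2_rel_def sqint_scaleR)

instance
proof
 fix f g h :: "('a, 'b) l2" and a b :: real
 show "f + g + h = f + (g + h)"
  by transfer (auto simp: l2_rel_def sqint_add add.assoc)
 show "f + g = g + f" by transfer (auto simp: l2_rel_def sqint_add add.commute)
 show "0 + f = f" by transfer (auto simp: l2_rel_def)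
 show "- f + f = 0" by transfer (auto simp: l2_rel_def sqint_zero)
 show "f - g = f + - g"
  by transfer (auto simp: l2_rel_def sqint_diff sqint_add sqint_uminus)
 show "a *R (f + g) = a *R f + a *R g"
  by transfer (auto simp: l2_rel_def sqint_scaleR sqint_add scaleR_add_right)
 show "(a + b) *R f = a *R f + b *R f"
  by transfer (auto simp: l2_rel_def sqint_scaleR sqint_add scaleR_add_left)
 show "a *R b *R f = (a * b) *R f"
  by transfer (auto simp: l2_rel_def sqint_scaleR)
 show "1 *R f = f" by transfer (auto simp: l2_rel_def)
qed

end

instantiation l2 :: (euclidean_space, euclidean_space) real_inner
begin

lift_definition inner_l2 :: "('a, 'b) l2 => ('a, 'b) l2 => real" is
 "%f g. LINT x|lborel. inner (f x) (g x)"
proof -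
 fix f1 f2 g1 g2 :: "'a => 'b"
 assume "l2_rel f1 f2" "l2_rel g1 g2"
 then show "(LINT x|lborel. inner (f1 x) (g1 x)) = (LINT x|lborel. inner (f2 x) (g2 x))"
  by (intro integral_cong_AE)
   (auto simp: l2_rel_def intro!: borel_measurable_inner dest!: sqint_measurable)
qed

definition norm_l2 :: "('a, 'b) l2 => real" where "norm_l2 f = sqrt (inner f f)"
definition dist_l2 :: "('a, 'b) l2 => ('a, 'b) l2 => real" where "dist_l2 f g = norm (f - g)"
definition sgn_l2 :: "('a, 'b) l2 => ('a, 'b) l2" where "sgn_l2 f = scaleR (inverse (norm f)) f"
definition uniformity_l2 :: "(('a, 'b) l2 \<times> ('a, 'b) l2) filter" where
 "uniformity_l2 = (INF e\<in>{0<..}. principal {(x, y). dist x y < e})"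
definition open_l2 :: "('a, 'b) l2 set => bool" where
 "open_l2 U \<longleftrightarrow> (\<forall>x\<in>U. eventually (%(x', y). x' = x --> y \<in> U) uniformity)"

instance
proof
 fix f g h :: "('a, 'b) l2" and a :: real and U :: "('a, 'b) l2 set"
 show "dist f g = norm (f - g)" by (rule dist_l2_def)
 show "sgn f = f /\<^sub>R norm f" by (simp add: sgn_l2_def divideR_right)
 show "uniformity = (INF e\<in>{0<..}. principal {(x :: ('a, 'b) l2, y). dist x y < e})"
  by (rule uniformity_l2_def)
 show "open U = (\<forall>x\<in>U. eventually (%(x', y). x' = x --> y \<in> U) uniformity)" by (rule open_l2_def)
 show "inner f g = inner g f" by transfer (simp add: inner_commute)
 show "inner (f + g) h = inner f h + inner g h"
  by transfer (auto simp: l2_rel_def inner_add_left sqint_inner intro!: Bintegral_add)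
 show "inner (a *R f) g = a * inner f g" by transfer simp
 show "0 <= inner f f" by transfer (auto intro!: integral_nonneg_AE)
 show "inner f f = 0 \<longleftrightarrow> f = 0"
 proof transfer
  fix f :: "'a => 'b" assume "l2_rel f f"
  then have f: "sqint f" by (simp add: l2_rel_def)
  have "(LINT x|lborel. inner (f x) (f x)) = 0 \<longleftrightarrow> (AE x in lborel. inner (f x) (f x) = 0)"
   using sqint_inner[OF f f] by (intro integral_nonneg_eq_0_iff_AE) auto
  then show "((LINT x|lborel. inner (f x) (f x)) = 0) = l2_rel f (%_. 0)"
   using f by (simp add: l2_rel_def sqint_zero)
 qed
 show "norm f = sqrt (inner f f)" by (rule norm_l2_def)
qed

end

lemma inner_abs_l2:
 assumes "sqint f" "sqint g"
 shows "inner (abs_l2 f) (abs_l2 g) = (LINT x|lborel. inner (f x) (g x))"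
 using assms by (intro inner_l2.abs_eq) (auto simp: l2_rel_def)

lemma l2_cases:
 fixes F :: "('a::euclidean_space, 'b::euclidean_space) l2"
 obtains f where "sqint f" "F = abs_l2 f"
proof -
 have "l2_rel (rep_l2 F) (rep_l2 F)" by (simp add: Quotient3_rep_reflp[OF Quotient3_l2])
 then show ?thesis
  using that[of "rep_l2 F"] by (simp add: l2_rel_def Quotient3_abs_rep[OF Quotient3_l2])
qed

lemma abs_l2_diff:
 "sqint f ==> sqint g ==> abs_l2 f - abs_l2 g = abs_l2 (%x. f x - g x)"
 by (intro minus_l2.abs_eq) (auto simp: l2_rel_def)

lemma abs_l2_add:
 "sqint f ==> sqint g ==> abs_l2 f + abs_l2 g = abs_l2 (%x. f x + g x)"
 by (intro plus_l2.abs_eq) (auto simp: l2_rel_def)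

lemma abs_l2_scaleR:
 "sqint f ==> c *R abs_l2 f = abs_l2 (%x. c *R f x)"
 by (intro scaleR_l2.abs_eq) (auto simp: l2_rel_def)

lemma norm_abs_l2:
 assumes "sqint f"
 shows "(norm (abs_l2 f))^2 = (LINT x|lborel. (norm (f x))^2)"
 by (simp add: power2_norm_eq_inner inner_abs_l2 assms)

text \<open>The weights \<open>2^k\<close> make the weighted sum of the squared increments
integrable, so at almost every point the increments decay geometrically and the sequence converges;
Fatou transfers the Cauchy estimate to the limit.\<close>

lemma fast_Cauchy_l2_convergent:
 fixes f :: "nat => 'a::euclidean_space => 'b::euclidean_space"
 assumes f: "!!k. sqint (f k)"
  and fast: "!!k. (LINT x|lborel. (norm (f (Suc k) x - f k x))^2) <= (1/4)^k"
  and Cau: "!!ep. ep > 0 ==> \<exists>N. \<forall>m\<ge>N. \<forall>n\<ge>N. (LINT x|lborel. (norm (f m x - f n x))^2) <= ep"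
 shows "\<exists>g. sqint g \<and> (%k. LINT x|lborel. (norm (f k x - g x))^2) ---> 0"
proof -
 have [measurable]: "f k \<in> borel_measurable borel" for k
  using sqint_measurable[OF f] by simp
 define d where "d k x = (norm (f (Suc k) x - f k x))^2" for k x
 have d_int: "intble (d k)" for k
  using sqint_norm[OF sqint_diff[OF f f]] by (simp add: d_def[abs_def])
 have d_meas[measurable]: "d k \<in> borel_measurable borel" for k unfolding d_def[abs_def] by measurable
 have nn: "(\<integral>\<^sup>+x. ennreal (2^k * d k x) \<partial>lborel) <= ennreal ((1/2)^k)" for k
 proof -
  have "(\<integral>\<^sup>+x. ennreal (2^k * d k x) \<partial>lborel) = ennreal (LINT x|lborel. 2^k * d k x)"
   by (intro nn_integral_eq_integral integrable_mult_right d_int) (simp add: d_def)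
  also have "(LINT x|lborel. 2^k * d k x) <= 2^k * (1/4)^k"
   using fast[of k] by (simp add: d_def)
  also have "(2::real)^k * (1/4)^k = (1/2)^k" by (simp flip: power_mult_distrib)
  finally show ?thesis by (simp add: ennreal_leI)
 qed
 have "(\<integral>\<^sup>+x. (\<Sum>k. ennreal (2^k * d k x)) \<partial>lborel) = (\<Sum>k. \<integral>\<^sup>+x. ennreal (2^k * d k x) \<partial>lborel)"
  by (intro nn_integral_suminf) auto
 also have "... <= (\<Sum>k. ennreal ((1/2)^k))" by (intro suminf_le nn) auto
 also have "... = ennreal (\<Sum>k. (1/2)^k)" by (intro suminf_ennreal2) (auto simp: summable_geometric)
 also have "... < \<infinity>" by simp
 finally have "AE x in lborel. (\<Sum>k. ennreal (2^k * d k x)) \<noteq> \<infinity>"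
  by (intro nn_integral_noteq_infinite) auto
 then have conv: "AE x in lborel. convergent (%k. f k x)"
 proof (rule AE_mp, intro AE_I2 impI)
  fix x assume "(\<Sum>k. ennreal (2^k * d k x)) \<noteq> \<infinity>"
  then have sm: "summable (%k. 2^k * d k x)"
   by (intro summable_suminf_not_top) (auto simp: d_def)
  then have "bounded (range (%k. 2^k * d k x))"
   by (rule convergent_imp_bounded[OF summable_LIMSEQ_zero])
  then obtain C where "\<forall>y\<in>range (%k. 2^k * d k x). norm y <= C"
   unfolding bounded_iff by blast
  then have C: "2^k * d k x <= C" for k by (auto simp: abs_le_iff)
  have bd: "norm (f (Suc k) x - f k x) <= sqrt C * (1 / sqrt 2) ^ k" for k
  proof -
   have "d k x <= C * (1/2)^k" using C[of k] by (simp add: field_simps power_divide)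
   then have "sqrt (d k x) <= sqrt (C * (1/2)^k)" by (rule real_sqrt_le_mono)
   then show ?thesis by (simp add: d_def real_sqrt_mult real_sqrt_power real_sqrt_divide)
  qed
  have "summable (%k. f (Suc k) x - f k x)"
   by (rule summable_comparison_test'[OF summable_mult[OF summable_geometric] bd]) simp
  then have "convergent (%n. \<Sum>k<n. f (Suc k) x - f k x)" by (simp add: summable_iff_convergent)
  then have "convergent (%n. f n x - f 0 x)"
   by (simp only: sum_lessThan_telescope[of "%k. f k x"])
  from convergent_add[OF this convergent_const[of "f 0 x"]] show "convergent (%k. f k x)" by simp
 qed
 define g where "g x = lim (%k. f k x)" for x
 have g_meas[measurable]: "g \<in> borel_measurable borel" unfolding g_def by measurable
 have lim: "AE x in lborel. (%k. f k x) ---> g x"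
  using conv by (simp add: convergent_LIMSEQ_iff g_def)
 have fatou: "(\<integral>\<^sup>+x. ennreal ((norm (f n x - g x))^2) \<partial>lborel) <= ennreal ep"
  if N: "\<forall>m\<ge>N. \<forall>n\<ge>N. (LINT x|lborel. (norm (f m x - f n x))^2) <= ep" and n: "n >= N" for n N ep
 proof -
  have "(\<integral>\<^sup>+x. ennreal ((norm (f n x - g x))^2) \<partial>lborel)
    = (\<integral>\<^sup>+x. liminf (%m. ennreal ((norm (f n x - f m x))^2)) \<partial>lborel)"
  proof (rule nn_integral_cong_AE, use lim in eventually_elim)
   fix x assume "(%k. f k x) ---> g x"
   then have "(%m. ennreal ((norm (f n x - f m x))^2)) ---> ennreal ((norm (f n x - g x))^2)"
    by (intro tendsto_intros)
   from lim_imp_Liminf[OF _ this] show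
    "ennreal ((norm (f n x - g x))^2) = liminf (%m. ennreal ((norm (f n x - f m x))^2))" by simp
  qed
  also have "... <= liminf (%m. \<integral>\<^sup>+x. ennreal ((norm (f n x - f m x))^2) \<partial>lborel)"
   by (intro nn_integral_liminf) auto
  also have "... <= liminf (%m. ennreal ep)"
  proof (rule Liminf_mono, unfold eventually_sequentially, intro exI allI impI)
   fix m assume "N <= m"
   have "(\<integral>\<^sup>+x. ennreal ((norm (f n x - f m x))^2) \<partial>lborel) = ennreal (LINT x|lborel. (norm (f n x - f m x))^2)"
    by (intro nn_integral_eq_integral sqint_norm sqint_diff f) auto
   then show "(\<integral>\<^sup>+x. ennreal ((norm (f n x - f m x))^2) \<partial>lborel) <= ennreal ep"
    using N n \<open>N <= m\<close> by (simp add: ennreal_leI)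
  qed
  finally show ?thesis by (simp add: Liminf_const)
 qed
 obtain N1 where N1: "\<forall>m\<ge>N1. \<forall>n\<ge>N1. (LINT x|lborel. (norm (f m x - f n x))^2) <= 1"
  using Cau[of 1] by auto
 have "sqint (%x. f N1 x - g x)"
  unfolding sqint_def
  using fatou[OF N1 order_refl] by (auto simp: integrable_iff_bounded intro: order_le_less_trans)
 from sqint_diff[OF f[of N1] this] have g: "sqint g" by simp
 have "(%k. LINT x|lborel. (norm (f k x - g x))^2) ---> 0"
 proof (rule LIMSEQ_I)
  fix r :: real assume r: "r > 0"
  obtain N where N: "\<forall>m\<ge>N. \<forall>n\<ge>N. (LINT x|lborel. (norm (f m x - f n x))^2) <= r/2"
   using Cau[of "r/2"] r by auto
  show "\<exists>no. \<forall>n\<ge>no. norm ((LINT x|lborel. (norm (f n x - g x))^2) - 0) < r"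
  proof (intro exI allI impI)
   fix n assume "N <= n"
   have "ennreal (LINT x|lborel. (norm (f n x - g x))^2) = (\<integral>\<^sup>+x. ennreal ((norm (f n x - g x))^2) \<partial>lborel)"
    by (intro nn_integral_eq_integral[symmetric] sqint_norm sqint_diff f g) auto
   also have "... <= ennreal (r/2)" by (rule fatou[OF N \<open>N <= n\<close>])
   finally have "(LINT x|lborel. (norm (f n x - g x))^2) <= r/2"
    using r by (subst (asm) ennreal_le_iff) auto
   moreover have "0 <= (LINT x|lborel. (norm (f n x - g x))^2)" by (intro integral_nonneg_AE) auto
   ultimately show "norm ((LINT x|lborel. (norm (f n x - g x))^2) - 0) < r" using r by simp
  qed
 qed
 with g show ?thesis by blast
qed

instance l2 :: (euclidean_space, euclidean_space) complete_space
proof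
 fix X :: "nat => ('a, 'b) l2" assume X: "Cauchy X"
 have "\<forall>n. \<exists>N. \<forall>i\<ge>N. \<forall>j\<ge>N. dist (X i) (X j) < (1/2)^n"
  using X by (auto simp: Cauchy_def)
 then obtain N where N: "!!n i j. i >= N n ==> j >= N n ==> dist (X i) (X j) < (1/2)^n" by metis
 define r where "r n = n + (\<Sum>i\<le>n. N i)" for n
 have r: "strict_mono r" unfolding r_def by (intro strict_monoI_Suc) auto
 have rN: "r n >= N n" for n unfolding r_def using member_le_sum[of n "{..n}" N] by simp
 have "\<exists>f. sqint f \<and> X (r n) = abs_l2 f" for n
  using l2_cases[of "X (r n)"] by metis
 then obtain f where f: "!!n. sqint (f n)" "!!n. X (r n) = abs_l2 (f n)" by metis
 have dist_f: "(dist (X (r m)) (X (r n)))^2 = (LINT x|lborel. (norm (f m x - f n x))^2)" for m n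
  by (simp add: dist_norm f abs_l2_diff norm_abs_l2 sqint_diff)
 have "\<exists>g. sqint g \<and> (%k. LINT x|lborel. (norm (f k x - g x))^2) ---> 0"
 proof (rule fast_Cauchy_l2_convergent[OF f(1)])
  fix k
  have "dist (X (r (Suc k))) (X (r k)) <= (1/2)^k"
   using N[of k "r (Suc k)" "r k"] rN[of k] strict_monoD[OF r, of k "Suc k"] by simp
  then have "(dist (X (r (Suc k))) (X (r k)))^2 <= ((1/2)^k)^2" by (intro power_mono) auto
  also have "((1/2)^k)^2 = ((1/4)^k :: real)" by (simp add: power2_eq_square flip: power_mult_distrib)
  finally show "(LINT x|lborel. (norm (f (Suc k) x - f k x))^2) <= (1/4)^k" by (simp add: dist_f)
 next
  fix ep :: real assume ep: "ep > 0"
  obtain M where M: "!!m n. m >= M ==> n >= M ==> dist (X m) (X n) < sqrt ep"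
   using metric_CauchyD[OF X, of "sqrt ep"] ep by auto
  have "(dist (X (r m)) (X (r n)))^2 <= ep" if "m >= M" "n >= M" for m n
  proof -
   have "dist (X (r m)) (X (r n)) < sqrt ep"
    using that seq_suble[OF r, of m] seq_suble[OF r, of n] by (intro M) auto
   then have "(dist (X (r m)) (X (r n)))^2 <= (sqrt ep)^2" by (intro power_mono) auto
   then show ?thesis using ep by simp
  qed
  then show "\<exists>N. \<forall>m\<ge>N. \<forall>n\<ge>N. (LINT x|lborel. (norm (f m x - f n x))^2) <= ep"
   by (auto simp: dist_f)
 qed
 then obtain g where g: "sqint g" "(%k. LINT x|lborel. (norm (f k x - g x))^2) ---> 0" by blast
 have "(%k. (dist (X (r k)) (abs_l2 g))^2) ---> 0"
  using g(2) by (simp add: dist_norm f abs_l2_diff g norm_abs_l2 sqint_diff)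
 from tendsto_real_sqrt[OF this] have "(%k. dist (X (r k)) (abs_l2 g)) ---> 0" by simp
 then have "(X \<circ> r) ---> abs_l2 g" by (subst tendsto_dist_iff) (simp add: o_def)
 from Cauchy_converges_subseq[OF X r this] show "convergent X" by (auto simp: convergent_def)
qed

section \<open>Gradients, integration by parts and translations\<close>

text \<open>Partial derivatives are indexed by the coordinate, so that a gradient is a family of
values and product rules for bilinear maps hold componentwise.\<close>

definition has_grad :: "(real^2 => 'b::real_normed_vector) => (2 => 'b) => real^2 => bool" where
 "has_grad u g x \<longleftrightarrow> (u has_derivative (%h. \<Sum>j\<in>UNIV. (h $ j) *R g j)) (at x)"

lemma has_grad_differentiable: "has_grad u g x ==> u differentiable (at x)"
 by (auto simp: has_grad_def differentiable_def)

lemma has_grad_partial_deriv: "has_grad u g x ==> pd j u x = g j"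
 unfolding has_grad_def partial_deriv_def
 by (drule frechet_derivative_at[symmetric])
   (simp add: axis_def if_distrib[where f="%c. c *R _"] cong: if_cong)

lemma differentiable_has_grad:
 assumes "u differentiable (at x)"
 shows "has_grad u (%j. pd j u x) x"
proof -
 let ?D = "frechet_derivative u (at x)"
 have D: "(u has_derivative ?D) (at x)" using assms by (simp add: frechet_derivative_works)
 then interpret D: bounded_linear ?D by (rule has_derivative_bounded_linear)
 have "?D h = (\<Sum>j\<in>UNIV. (h $ j) *R pd j u x)" for h
 proof -
  have "h = (\<Sum>j\<in>UNIV. (h $ j) *R axis j 1)"
   by (simp add: vec_eq_iff axis_def if_distrib cong: if_cong)
  then have "?D h = ?D (\<Sum>j\<in>UNIV. (h $ j) *R axis j 1)" by simp
  also have "... = (\<Sum>j\<in>UNIV. (h $ j) *R ?D (axis j 1))" by (simp add: D.sum D.scaleR)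
  finally show ?thesis by (simp add: partial_deriv_def)
 qed
 then have "?D = (%h. \<Sum>j\<in>UNIV. (h $ j) *R pd j u x)" by (rule ext)
 then show ?thesis using D by (simp add: has_grad_def)
qed

lemma C1_on_has_grad: "C1_on S u ==> x \<in> S ==> has_grad u (%j. pd j u x) x"
 by (auto simp: C1_on_def intro: differentiable_has_grad)

lemma C1_onI:
 assumes "!!x. x \<in> S ==> has_grad u (%j. G j x) x" "!!j. continuous_on S (G j)"
 shows "C1_on S u"
 unfolding C1_on_def
proof (intro conjI ballI allI)
 show "u differentiable (at x)" if "x \<in> S" for x using assms(1)[OF that] by (rule has_grad_differentiable)
 show "continuous_on S (pd j u)" for j
  using assms(2)[of j] by (rule continuous_on_eq) (simp add: has_grad_partial_deriv[OF assms(1)])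
qed

lemma has_grad_cong_open:
 assumes "has_grad u g x" "open S" "x \<in> S" "!!y. y \<in> S ==> u y = v y"
 shows "has_grad v g x"
 using has_derivative_transform_within_open[OF assms(1)[unfolded has_grad_def] assms(2,3)] assms(4)
 by (simp add: has_grad_def)

lemma partial_deriv_cong_open:
 assumes "open S" "x \<in> S" "!!y. y \<in> S ==> u y = v y"
 shows "pd j u x = pd j v x"
proof -
 have "(u has_derivative D) (at x) \<longleftrightarrow> (v has_derivative D) (at x)" for D
  using has_derivative_transform_within_open[where f=u and g=v, OF _ assms(1,2)]
   has_derivative_transform_within_open[where f=v and g=u, OF _ assms(1,2)] assms(3) by auto
 then show ?thesis by (simp add: partial_deriv_def frechet_derivative_def)
qed

lemma has_grad_const: "has_grad (%_. c) (%_. 0) x"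
 by (simp add: has_grad_def)

lemma has_grad_add:
 "has_grad u g x ==> has_grad v h x ==> has_grad (%y. u y + v y) (%j. g j + h j) x"
 unfolding has_grad_def by (drule (1) has_derivative_add) (simp add: scaleR_add_right sum.distrib)

lemma has_grad_linear:
 assumes "bounded_linear L" "has_grad u g x"
 shows "has_grad (%y. L (u y)) (%j. L (g j)) x"
 using bounded_linear.has_derivative[OF assms(1) assms(2)[unfolded has_grad_def]]
 by (simp add: has_grad_def linear_simps[OF assms(1)] bounded_linear.linear[OF assms(1)] linear_sum)

lemma has_grad_bilinear:
 assumes "bounded_bilinear B" "has_grad u g x" "has_grad v h x"
 shows "has_grad (%y. B (u y) (v y)) (%j. B (g j) (v x) + B (u x) (h j)) x"
proof -
 interpret B: bounded_bilinear B by fact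
 have "((%y. B (u y) (v y)) has_derivative
   (%z. B (u x) (\<Sum>j\<in>UNIV. (z $ j) *R h j) + B (\<Sum>j\<in>UNIV. (z $ j) *R g j) (v x))) (at x)"
  using assms(2,3) by (auto intro!: B.FDERIV simp: has_grad_def)
 then show ?thesis unfolding has_grad_def
  by (simp add: B.sum_left B.sum_right B.scaleR_left B.scaleR_right scaleR_add_right sum.distrib add.commute)
qed

lemma has_grad_continuous_on: "(!!x. x \<in> S ==> has_grad u (g x) x) ==> continuous_on S u"
 unfolding has_grad_def by (rule has_derivative_continuous_on) (blast intro: has_derivative_at_withinI)

lemma C1_on_continuous: "C1_on S u ==> continuous_on S u"
 by (rule has_grad_continuous_on) (rule C1_on_has_grad)

lemma partial_deriv_eq_0:
 assumes "!!y. norm y > R ==> th y = 0" "norm x > R"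
 shows "pd j th x = 0"
proof -
 have "open {y::real^2. norm y > R}" by (intro open_Collect_less continuous_intros)
 from partial_deriv_cong_open[OF this, of x th "%_. 0"] assms
 show ?thesis using has_grad_partial_deriv[OF has_grad_const] by simp
qed

lemma bdd_support:
 fixes g :: "'a::euclidean_space => 'b::euclidean_space"
 assumes g: "cts g" and z: "!!x. norm x > R ==> g x = 0"
 shows "intble g" "\<exists>B. \<forall>x. norm (g x) <= B"
proof -
 have "intble (%x. indicator (cball 0 R) x *R g x)"
  by (rule borel_integrable_compact) (auto intro: continuous_on_subset[OF g])
 moreover have "(%x. indicator (cball 0 R) x *R g x) = g"
  using z by (auto simp: fun_eq_iff indicator_def)
 ultimately show "intble g" by simp
 have "bounded (g ` cball 0 R)"
  by (intro compact_imp_bounded compact_continuous_image continuous_on_subset[OF g]) auto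
 then obtain B where B: "!!x. norm x <= R ==> norm (g x) <= B"
  unfolding bounded_iff by (metis imageI mem_cball_0)
 have "norm (g x) <= max B 0" for x
  using B[of x] z[of x] by (cases "norm x <= R") auto
 then show "\<exists>B. \<forall>x. norm (g x) <= B" by blast
qed

lemma lborel_integral_shift:
 fixes g :: "'a::euclidean_space => 'b::{banach,second_countable_topology}"
 assumes [measurable]: "g \<in> borel_measurable borel"
 shows "(LINT x|lborel. g (x + a)) = (LINT x|lborel. g x)"
  and "intble (%x. g (x + a)) \<longleftrightarrow> intble g"
proof -
 have "(LINT x|lborel. g x) = (LINT x|distr lborel borel ((+) a). g x)" by (simp add: lborel_distr_plus)
 also have "... = (LINT x|lborel. g (x + a))" by (subst integral_distr) (auto simp: add.commute)
 finally show "(LINT x|lborel. g (x + a)) = (LINT x|lborel. g x)" by simp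
 have "intble g \<longleftrightarrow> integrable (distr lborel borel ((+) a)) g" by (simp add: lborel_distr_plus)
 also have "... \<longleftrightarrow> intble (%x. g (x + a))" by (subst integrable_distr_eq) (auto simp: add.commute)
 finally show "intble (%x. g (x + a)) \<longleftrightarrow> intble g" by simp
qed

text \<open>The gradient is bounded, so the quotients have a common bound with compact support, as
dominated convergence needs.\<close>

lemma difference_quotients:
 fixes th :: "real^2 => 'b::euclidean_space"
 assumes C1: "C1_on UNIV th" and z: "!!x. norm x > R ==> th x = 0"
 defines "Q n h x \<equiv> (real n + 1) *R (th (x + (1 / (real n + 1)) *R h) - th x)"
 shows "(%n. Q n h x) ---> (\<Sum>j\<in>UNIV. (h $ j) *R pd j th x)"
  and "\<exists>C\<ge>0. \<forall>n x. norm (Q n h x) <= C * indicator (cball 0 (R + norm h)) x"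
proof -
 let ?D = "%x h. \<Sum>j\<in>UNIV. (h $ j) *R pd j th x"
 have D: "(th has_derivative ?D x) (at x)" for x
  using C1_on_has_grad[OF C1, of x] by (simp add: has_grad_def)
 have "((%t. th (x + t *R h)) has_derivative (%t. ?D x (t *R h))) (at 0)"
  by (rule has_derivative_compose[where g=th and f="%t. x + t *R h" and x=0 and s=UNIV, simplified])
    (auto intro!: derivative_eq_intros D)[2]
 then have lim0: "((%t. norm (th (x + t *R h) - th x - ?D x (t *R h)) / norm t) \<longlongrightarrow> 0) (at 0)"
  by (simp add: has_derivative_at)
 have "filterlim (%n. 1 / (real n + 1)) (at 0) sequentially"
  unfolding filterlim_at by (intro conjI tendsto_inverse_Suc) auto
 from filterlim_compose[OF lim0 this]
 have "(%n. norm (th (x + (1 / (real n + 1)) *R h) - th x - ?D x ((1 / (real n + 1)) *R h)) / norm (1 / (real n + 1))) ---> 0" .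
 moreover have "norm (th (x + (1 / (real n + 1)) *R h) - th x - ?D x ((1 / (real n + 1)) *R h)) / norm (1 / (real n + 1))
   = norm (Q n h x - ?D x h)" for n
 proof -
  have "?D x ((1 / (real n + 1)) *R h) = (1 / (real n + 1)) *R ?D x h" by (simp add: scaleR_sum_right)
  then have "Q n h x - ?D x h = (real n + 1) *R (th (x + (1 / (real n + 1)) *R h) - th x - ?D x ((1 / (real n + 1)) *R h))"
   unfolding Q_def by (simp add: scaleR_diff_right)
  then have "norm (Q n h x - ?D x h) = (real n + 1) * norm (th (x + (1 / (real n + 1)) *R h) - th x - ?D x ((1 / (real n + 1)) *R h))"
   by (simp only: norm_scaleR)
  then show ?thesis by (simp add: field_simps)
 qed
 ultimately have "(%n. norm (Q n h x - ?D x h)) ---> 0" by simp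
 then show "(%n. Q n h x) ---> ?D x h" by (simp add: LIM_zero_iff tendsto_norm_zero_iff)
 have "\<exists>B. \<forall>x. norm (pd j th x) <= B" for j
  using C1 by (intro bdd_support(2)[where R=R] partial_deriv_eq_0[OF z]) (auto simp: C1_on_def)
 then obtain B where B: "!!j x. norm (pd j th x) <= B j" by metis
 define C where "C = (\<Sum>j\<in>UNIV. B j)"
 have B0: "B j >= 0" for j using B[of j undefined] norm_ge_zero order_trans by blast
 have C0: "C >= 0" by (auto simp: C_def intro!: sum_nonneg B0)
 have onorm: "norm (?D x v) <= C * norm v" for x v
 proof -
  have "norm (?D x v) <= (\<Sum>j\<in>UNIV. norm ((v $ j) *R pd j th x))" by (rule norm_sum)
  also have "... <= (\<Sum>j\<in>UNIV. norm v * B j)"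
   by (intro sum_mono) (auto intro!: mult_mono B component_le_norm_cart)
  finally show ?thesis by (simp add: C_def sum_distrib_left mult.commute)
 qed
 have lip: "norm (th (x + v) - th x) <= C * norm v" for x v
 proof -
  have "norm (th (x + v) - th x) <= C * norm (x + v - x)"
   by (rule differentiable_bound[where S=UNIV and f'="?D"])
     (auto intro!: onorm_bound sum_nonneg B0 has_derivative_at_withinI[OF D] onorm[unfolded C_def] simp: C_def)
  then show ?thesis by simp
 qed
 have "norm (Q n h x) <= (C * norm h) * indicator (cball 0 (R + norm h)) x" for n x
 proof (cases "norm x <= R + norm h")
  case True
  have "norm (Q n h x) = (real n + 1) * norm (th (x + (1 / (real n + 1)) *R h) - th x)" by (simp add: Q_def)
  also have "... <= (real n + 1) * (C * norm ((1 / (real n + 1)) *R h))"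
   by (intro mult_left_mono lip) auto
  also have "... = C * norm h" by simp
  finally show ?thesis using True by simp
 next
  case False
  have "norm ((1 / (real n + 1)) *R h) <= norm h" by (simp add: divide_le_eq mult_le_cancel_left1 mult_right_le_one_le field_simps)
  moreover have "norm x <= norm (x + (1 / (real n + 1)) *R h) + norm ((1 / (real n + 1)) *R h)"
   using norm_triangle_ineq4[of "x + (1 / (real n + 1)) *R h" "(1 / (real n + 1)) *R h"] by simp
  ultimately have "norm (x + (1 / (real n + 1)) *R h) > R" using False by linarith
  moreover have "norm x > R" using False norm_ge_zero[of h] by linarith
  ultimately show ?thesis using C0 by (simp add: Q_def z)
 qed
 moreover have "C * norm h >= 0" using C0 by simp
 ultimately show "\<exists>C\<ge>0. \<forall>n x. norm (Q n h x) <= C * indicator (cball 0 (R + norm h)) x" by blast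
qed

lemma C1_measurable: "C1_on UNIV th ==> th \<in> borel_measurable borel"
 "C1_on UNIV th ==> pd j th \<in> borel_measurable borel"
 by (blast intro: borel_measurable_continuous_onI C1_on_continuous, rule borel_measurable_continuous_onI, simp add: C1_on_def)

text \<open>Translation invariance makes the integral of every difference quotient zero.\<close>

lemma integral_partial_deriv_eq_0:
 fixes th :: "real^2 => 'b::euclidean_space"
 assumes C1: "C1_on UNIV th" and z: "!!x. norm x > R ==> th x = 0"
 shows "(LINT x|lborel. pd j th x) = 0"
proof -
 note [measurable] = C1_measurable[OF C1]
 let ?h = "axis j 1 :: real^2"
 obtain C where C: "!!n x. norm ((real n + 1) *R (th (x + (1 / (real n + 1)) *R ?h) - th x)) <= C * indicator (cball 0 (R + norm ?h)) x"
  using difference_quotients(2)[OF C1 z, where h="?h"] by blast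
 have int: "intble th" using C1_on_continuous[OF C1] z by (rule bdd_support)
 have "(%n. LINT x|lborel. (real n + 1) *R (th (x + (1 / (real n + 1)) *R ?h) - th x))
   ---> (LINT x|lborel. (\<Sum>i\<in>UNIV. (?h $ i) *R pd i th x))"
 proof (rule integral_dominated_convergence)
  show "intble (%x::real^2. C * indicator (cball 0 (R + norm ?h)) x)"
   by (intro integrable_mult_right integrable_real_indicator) (auto simp: emeasure_lborel_cball_finite[unfolded infinity_ennreal_def])
  show "AE x in lborel. (%n. (real n + 1) *R (th (x + (1 / (real n + 1)) *R ?h) - th x))
    ---> (\<Sum>i\<in>UNIV. (?h $ i) *R pd i th x)"
   by (intro AE_I2 difference_quotients(1)[OF C1 z])
 qed (use C in auto)
 moreover have "(LINT x|lborel. (real n + 1) *R (th (x + (1 / (real n + 1)) *R ?h) - th x)) = 0" for n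
  using int by (simp add: lborel_integral_shift Bintegral_diff)
 moreover have "(\<Sum>i\<in>UNIV. (?h $ i) *R pd i th x) = pd j th x" for x
  by (simp add: axis_def if_distrib[where f="%c. c *R _"] cong: if_cong)
 ultimately show ?thesis by (simp add: LIMSEQ_const_iff)
qed

text \<open>A translation by \<open>h\<close> is split into \<open>n\<close> equal steps; by
translation invariance all steps cost the same, and letting \<open>n\<close> grow turns the
difference quotient into a directional derivative.\<close>

lemma translation_estimate:
 fixes th :: "real^2 => real"
 assumes C1: "C1_on UNIV th" and z: "!!x. norm x > R ==> th x = 0"
 shows "(LINT x|lborel. (th (x + h) - th x)^2) <= (norm h)^2 * (LINT x|lborel. (\<Sum>j\<in>UNIV. (pd j th x)^2))"
proof -
 note [measurable] = C1_measurable[OF C1]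
 have cont: "cts th" by (rule C1_on_continuous[OF C1])
 have cont': "cts (pd j th)" for j using C1 by (simp add: C1_on_def)
 obtain C where C: "C >= 0" "!!n x. norm ((real n + 1) *R (th (x + (1 / (real n + 1)) *R h) - th x)) <= C * indicator (cball 0 (R + norm h)) x"
  using difference_quotients(2)[OF C1 z, where h=h] by blast
 have sq_int: "intble (%x. (th (x + a) - th (x + b))^2)" for a b
 proof (rule bdd_support(1)[where R="R + norm a + norm b"])
  show "cts (%x. (th (x + a) - th (x + b))^2)"
   by (intro continuous_intros continuous_on_compose2[OF cont]) auto
  fix x :: "real^2" assume "R + norm a + norm b < norm x"
  then have "norm (x + a) > R" "norm (x + b) > R"
   using norm_triangle_ineq4[of "x + a" a] norm_triangle_ineq4[of "x + b" b] norm_ge_zero[of a] norm_ge_zero[of b]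
   by (simp_all, linarith+)
  then show "(th (x + a) - th (x + b))^2 = 0" by (simp add: z)
 qed
 let ?D = "%x. \<Sum>j\<in>UNIV. (h $ j) *R pd j th x"
 have lim: "(%n. LINT x|lborel. ((real n + 1) *R (th (x + (1 / (real n + 1)) *R h) - th x))^2)
   ---> (LINT x|lborel. (?D x)^2)"
 proof (rule integral_dominated_convergence)
  show "intble (%x::real^2. C^2 * indicator (cball 0 (R + norm h)) x)"
   by (intro integrable_mult_right integrable_real_indicator) (auto simp: emeasure_lborel_cball_finite[unfolded infinity_ennreal_def])
  show "AE x in lborel. (%n. ((real n + 1) *R (th (x + (1 / (real n + 1)) *R h) - th x))^2)
    ---> (?D x)^2"
   by (intro AE_I2 tendsto_power difference_quotients(1)[OF C1 z])
  fix n
  show "AE x in lborel. norm (((real n + 1) *R (th (x + (1 / (real n + 1)) *R h) - th x))^2)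
    <= C^2 * indicator (cball 0 (R + norm h)) x"
  proof (intro AE_I2)
   fix x
   have "(norm ((real n + 1) *R (th (x + (1 / (real n + 1)) *R h) - th x)))^2 <= (C * indicator (cball 0 (R + norm h)) x)^2"
    by (intro power_mono C(2)) auto
   also have "... = C^2 * indicator (cball 0 (R + norm h)) x" by (simp add: indicator_def)
   finally show "norm (((real n + 1) *R (th (x + (1 / (real n + 1)) *R h) - th x))^2)
    <= C^2 * indicator (cball 0 (R + norm h)) x" by (simp only: norm_power)
  qed
 qed measurable
 have le: "(LINT x|lborel. (th (x + h) - th x)^2)
   <= (LINT x|lborel. ((real n + 1) *R (th (x + (1 / (real n + 1)) *R h) - th x))^2)" for n
 proof -
  define a where "a i = (real i / (real n + 1)) *R h" for i :: nat
  have aS: "a (Suc i) = (1 / (real n + 1)) *R h + a i" for i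
   by (simp add: a_def add_divide_distrib scaleR_add_left add.commute)
  have aN: "a (Suc n) = h" "a 0 = 0" by (simp_all add: a_def add.commute)
  have shift: "(LINT x|lborel. (th (x + a (Suc i)) - th (x + a i))^2)
    = (LINT x|lborel. (th (x + (1 / (real n + 1)) *R h) - th x)^2)" for i
   using lborel_integral_shift(1)[of "%x. (th (x + (1 / (real n + 1)) *R h) - th x)^2" "a i"]
   by (simp add: aS ac_simps)
  have "(th (x + h) - th x)^2 <= (real n + 1) * (\<Sum>i<Suc n. (th (x + a (Suc i)) - th (x + a i))^2)" for x
  proof -
   have "th (x + h) - th x = (\<Sum>i<Suc n. th (x + a (Suc i)) - th (x + a i))"
    by (simp only: sum_lessThan_telescope[of "%i. th (x + a i)"] aN) simp
   then show ?thesis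
    using sum_squared_le_sum_of_squares[where I="{..<Suc n}" and f="%i. th (x + a (Suc i)) - th (x + a i)"]
    by (simp add: mult.commute add.commute)
  qed
  then have "(LINT x|lborel. (th (x + h) - th x)^2)
    <= (LINT x|lborel. (real n + 1) * (\<Sum>i<Suc n. (th (x + a (Suc i)) - th (x + a i))^2))"
   using sq_int[of h 0] by (intro integral_mono) (auto intro!: sq_int)
  also have "... = (real n + 1) * (\<Sum>i<Suc n. LINT x|lborel. (th (x + a (Suc i)) - th (x + a i))^2)"
   by (simp only: integral_mult_right_zero) (subst Bintegral_sum, auto intro: sq_int)
  also have "... = (real n + 1) * (\<Sum>i<Suc n. LINT x|lborel. (th (x + (1 / (real n + 1)) *R h) - th x)^2)"
   by (simp only: shift)
  also have "...
    = (LINT x|lborel. ((real n + 1) *R (th (x + (1 / (real n + 1)) *R h) - th x))^2)"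
   unfolding sum_constant card_lessThan real_scaleR_def power_mult_distrib integral_mult_right_zero
    of_nat_Suc power2_eq_square[of "real n + 1"]
   by (simp only: ac_simps)
  finally show ?thesis .
 qed
 have "(LINT x|lborel. (th (x + h) - th x)^2) <= (LINT x|lborel. (?D x)^2)"
  by (rule LIMSEQ_le_const[OF lim]) (use le in blast)
 also have "... <= (LINT x|lborel. (norm h)^2 * (\<Sum>j\<in>UNIV. (pd j th x)^2))"
 proof (rule integral_mono)
  show "intble (%x. (?D x)^2)"
   by (rule bdd_support(1)[where R=R])
     (auto intro!: continuous_intros cont' simp: partial_deriv_eq_0[OF z])
  show "intble (%x. (norm h)^2 * (\<Sum>j\<in>UNIV. (pd j th x)^2))"
   by (rule bdd_support(1)[where R=R])
     (auto intro!: continuous_intros cont' simp: partial_deriv_eq_0[OF z])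
  fix x
  show "(?D x)^2 <= (norm h)^2 * (\<Sum>j\<in>UNIV. (pd j th x)^2)"
   using Cauchy_Schwarz_ineq_sum[of "%j. h $ j" "%j. pd j th x" UNIV]
   by (simp add: norm_vec_def L2_set_def sum_nonneg)
 qed
 finally show ?thesis by simp
qed

section \<open>A Poincare inequality of finite rank\<close>

text \<open>Half-open squares of side \<open>s\<close>, numbered by the integer parts of the scaled
coordinates; they partition the plane.\<close>

definition cell :: "real => int \<times> int => (real^2) set" where
 "cell s q = {x. \<lfloor>x $ 1 / s\<rfloor> = fst q \<and> \<lfloor>x $ 2 / s\<rfloor> = snd q}"

lemma cell_measurable[measurable]: "cell s q \<in> sets borel"
 unfolding cell_def by measurable

lemma cell_iff: "s > 0 ==> x \<in> cell s q \<longleftrightarrow>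
 s * of_int (fst q) <= x $ 1 \<and> x $ 1 < s * of_int (fst q) + s \<and>
 s * of_int (snd q) <= x $ 2 \<and> x $ 2 < s * of_int (snd q) + s"
 by (auto simp: cell_def floor_eq_iff field_simps)

lemma emeasure_cell:
 assumes s: "s > 0"
 shows "emeasure lborel (cell s q) = ennreal (s^2)"
proof -
 define l u :: "real^2" where "l = vector [s * of_int (fst q), s * of_int (snd q)]"
  and "u = vector [s * of_int (fst q) + s, s * of_int (snd q) + s]"
 have lu: "l $ 1 = s * of_int (fst q)" "l $ 2 = s * of_int (snd q)"
  "u $ 1 = s * of_int (fst q) + s" "u $ 2 = s * of_int (snd q) + s"
  by (simp_all add: l_def u_def)
 have sub: "box l u \<subseteq> cell s q" "cell s q \<subseteq> cbox l u"
  using s by (auto simp: cell_iff mem_box_cart forall_2 lu)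
 have "l $ i <= u $ i" for i using s exhaust_2[of i] by (auto simp: lu)
 then have le: "!!b. b \<in> Basis ==> l \<bullet> b <= u \<bullet> b"
  by (auto simp: Basis_vec_def inner_axis)
 have "(\<Prod>b\<in>Basis. (u - l) \<bullet> b) = s^2"
 proof -
  have "(\<Prod>b\<in>Basis. (u - l) \<bullet> b) = (\<Prod>i\<in>(UNIV::2 set). (u - l) $ i)"
   unfolding Basis_vec_def
   by (subst prod.UNION_disjoint) (auto simp: inner_axis axis_eq_axis)
  also have "... = s^2" by (simp add: UNIV_2 lu power2_eq_square)
  finally show ?thesis .
 qed
 then have "emeasure lborel (box l u) = ennreal (s^2)" "emeasure lborel (cbox l u) = ennreal (s^2)"
  using le by (simp_all add: emeasure_lborel_box emeasure_lborel_cbox)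
 then show ?thesis
  using emeasure_mono[OF sub(1), of lborel] emeasure_mono[OF sub(2), of lborel] by simp
qed

lemma finite_cells:
 assumes "s > 0" "bounded D"
 shows "\<exists>I. finite I \<and> (\<forall>x\<in>D. \<exists>q\<in>I. x \<in> cell s q)"
proof -
 obtain R where R: "!!x. x \<in> D ==> norm x <= R" using assms(2) by (auto simp: bounded_iff)
 define N where "N = \<lceil>R / s\<rceil> + 1"
 have b: "\<lfloor>x $ i / s\<rfloor> \<in> {-N..N}" if "x \<in> D" for x i
 proof -
  have "\<bar>x $ i\<bar> <= R" using R[OF that] component_le_norm_cart[of x i] by linarith
  then have "x $ i / s <= R / s" "- (R / s) <= x $ i / s" using assms(1)
   by (auto simp: abs_le_iff divide_right_mono field_simps)
  then show ?thesis unfolding N_def by (auto simp: floor_le_iff le_floor_iff) linarith+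
 qed
 show ?thesis
 proof (intro exI[of _ "{-N..N} \<times> {-N..N}"] conjI ballI)
  fix x assume "x \<in> D"
  then show "\<exists>q\<in>{-N..N} \<times> {-N..N}. x \<in> cell s q"
   using b by (intro bexI[of _ "(\<lfloor>x $ 1 / s\<rfloor>, \<lfloor>x $ 2 / s\<rfloor>)"]) (auto simp: cell_def)
 qed simp
qed

lemma cell_disjoint: "x \<in> cell s p ==> x \<in> cell s q ==> p = q"
 by (auto simp: cell_def prod_eq_iff)

lemma indicator_cell: "x \<in> cell s q ==> indicator (cell s p) x = (if p = q then 1 else 0 :: real)"
 using cell_disjoint[of x s p q] by (cases "p = q") (auto simp: indicator_def)

lemma integral_linear_combination3:
 fixes a b c :: "'a => real"
 assumes "integrable M a" "integrable M b" "integrable M c"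
 shows "(LINT x|M. k * a x - l * b x + m * c x) = k * (LINT x|M. a x) - l * (LINT x|M. b x) + m * (LINT x|M. c x)"
 using assms by simp

text \<open>This inequality replaces the Rellich compactness theorem. On each square the variance is
half the normalised double integral of \<open>(th x - th y)^2\<close>. The pairs in a common square
differ by a vector of \<open>[- s, s]^2\<close>, so the sum over all squares is dominated by an
average of translation differences, which \<open>translation_estimate\<close> controls by the
Dirichlet integral.\<close>

lemma cell_poincare:
 assumes s: "s > 0" and D: "bounded D"
 shows "\<exists>I. finite I \<and> (\<forall>th::real^2 => real. C1_on UNIV th --> (\<forall>x. x \<notin> D --> th x = 0) -->
   (LINT x|lborel. (th x)^2) <= 4 * s^2 * (LINT x|lborel. (\<Sum>j\<in>UNIV. (pd j th x)^2))
    + (\<Sum>q\<in>I. (1 / s^2) * (LINT x|lborel. indicator (cell s q) x * th x)^2))"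
proof -
 obtain I where I: "finite I" "!!x. x \<in> D ==> \<exists>q\<in>I. x \<in> cell s q"
  using finite_cells[OF s D] by blast
 obtain R where R: "!!x. x \<in> D ==> norm x <= R" using D by (auto simp: bounded_iff)
 have fm: "emeasure lborel (cell s q) < \<infinity>" "measure lborel (cell s q) = s^2" for q
  using emeasure_cell[OF s, of q] by (simp_all add: measure_def)
 show ?thesis
 proof (intro exI[of _ I] conjI I(1) allI impI)
  fix th :: "real^2 => real" assume C1: "C1_on UNIV th" and "\<forall>x. x \<notin> D --> th x = 0"
  then have z: "x \<notin> D ==> th x = 0" for x by blast
  then have zR: "norm x > R ==> th x = 0" for x using R by force
  note [measurable] = C1_measurable[OF C1]
  have cont: "cts th" by (rule C1_on_continuous[OF C1])
  have int1: "intble th" by (rule bdd_support(1)[OF cont zR])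
  have int2: "intble (%x. (th x)^2)"
   by (rule bdd_support(1)[where R=R]) (auto intro!: continuous_intros cont simp: zR)
  define G where "G = (LINT x|lborel. (\<Sum>j\<in>UNIV. (pd j th x)^2))"
  have G0: "G >= 0" unfolding G_def by (intro integral_nonneg_AE AE_I2 sum_nonneg) auto
  define B :: "(real^2) set" where "B = cbox (- (\<chi> i. s)) (\<chi> i. s)"
  have B: "h \<in> B \<longleftrightarrow> \<bar>h $ 1\<bar> <= s \<and> \<bar>h $ 2\<bar> <= s" for h
   by (auto simp: B_def mem_box_cart forall_2 abs_le_iff)
  have B_norm: "(norm h)^2 <= 2 * s^2" if "h \<in> B" for h
  proof -
   have "(norm h)^2 = \<bar>h $ 1\<bar>^2 + \<bar>h $ 2\<bar>^2"
    by (simp add: norm_vec_def L2_set_def UNIV_2)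
   also have "... <= s^2 + s^2" using that by (intro add_mono power_mono) (auto simp: B)
   finally show ?thesis by simp
  qed
  have B_meas[measurable]: "B \<in> sets borel" by (simp add: B_def)
  have B_fin: "emeasure lborel B < \<infinity>" unfolding B_def by (rule emeasure_lborel_cbox_finite)
  have B_measure: "measure lborel B <= 4 * s^2"
  proof -
   have "measure lborel B = (\<Prod>b\<in>Basis. ((\<chi> i. s) - (- (\<chi> i. s)) :: real^2) \<bullet> b)"
    unfolding B_def using s by (subst measure_lborel_cbox_eq) (auto simp: Basis_vec_def inner_axis)
   also have "... = (\<Prod>i\<in>(UNIV::2 set). ((\<chi> i. s) - (- (\<chi> i. s)) :: real^2) $ i)"
    unfolding Basis_vec_def by (subst prod.UNION_disjoint) (auto simp: inner_axis axis_eq_axis)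
   also have "... = 4 * s^2" by (simp add: UNIV_2 power2_eq_square)
   finally show ?thesis by simp
  qed
  define g where "g x h = indicator B h * (th (x + h) - th x)^2" for x h
  have g0: "g x h >= 0" for x h by (simp add: g_def)
  have g_meas[measurable]: "(%(x, h). g x h) \<in> borel_measurable (lborel \<Otimes>\<^sub>M lborel)"
  proof -
   have "(%p. th (fst p + snd p) - th (fst p)) \<in> borel_measurable borel"
    by (intro borel_measurable_continuous_onI continuous_intros continuous_on_compose2[OF cont]) auto
   moreover have "(%p. indicator (UNIV \<times> B) p :: real) \<in> borel_measurable (borel :: ((real^2) \<times> (real^2)) measure)"
    by (intro borel_measurable_indicator) (simp add: borel_prod[symmetric])
   ultimately have "(%p. indicator (UNIV \<times> B) p * (th (fst p + snd p) - th (fst p))^2) \<in> borel_measurable borel"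
    by (intro borel_measurable_times borel_measurable_power)
   moreover have "(%(x, h). g x h) = (%p. indicator (UNIV \<times> B) p * (th (fst p + snd p) - th (fst p))^2)"
    by (auto simp: fun_eq_iff g_def indicator_def)
   ultimately show ?thesis by (simp add: lborel_prod)
  qed
  have trans: "intble (%x. g x h)" "(LINT x|lborel. g x h) <= indicator B h * (2 * s^2 * G)" for h
  proof -
   have "intble (%x. (th (x + h) - th x)^2)"
   proof (rule bdd_support(1)[where R="R + norm h"])
    show "cts (%x. (th (x + h) - th x)^2)"
     by (intro continuous_intros continuous_on_compose2[OF cont]) auto
    fix x :: "real^2" assume "R + norm h < norm x"
    then have "norm (x + h) > R" "norm x > R"
     using norm_triangle_ineq4[of "x + h" h] norm_ge_zero[of h] by (simp_all, linarith+)
    then show "(th (x + h) - th x)^2 = 0" by (simp add: zR)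
   qed
   then show "intble (%x. g x h)" by (simp add: g_def)
   show "(LINT x|lborel. g x h) <= indicator B h * (2 * s^2 * G)"
   proof (cases "h \<in> B")
    case True
    have "(LINT x|lborel. g x h) <= (norm h)^2 * G"
     using translation_estimate[OF C1 zR, where h=h] True by (simp add: g_def G_def)
    also have "... <= 2 * s^2 * G" using B_norm[OF True] G0 by (rule mult_right_mono)
    finally show ?thesis using True by simp
   qed (simp add: g_def)
  qed
  have bint: "intble (%h. indicator B h * (2 * s^2 * G) :: real)"
   by (intro integrable_mult_left integrable_real_indicator) (use B_fin in auto)
  have gint: "integrable (lborel \<Otimes>\<^sub>M lborel) (%(x, h). g x h)"
  proof -
   have "integrable (lborel \<Otimes>\<^sub>M lborel) (%(h, x). g x h)"
   proof (rule lborel_pair.Fubini_integrable)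
    show "AE h in lborel. intble (%x. case (h, x) of (h, x) => g x h)"
     by (simp add: trans)
    show "intble (%h. LINT x|lborel. norm (case (h, x) of (h, x) => g x h))"
    proof (rule Bintegrable_bound[OF bint])
     show "AE h in lborel. norm (LINT x|lborel. norm (case (h, x) of (h, x) => g x h))
       <= norm (indicator B h * (2 * s^2 * G) :: real)"
     proof (rule AE_I2)
      fix h
      have "0 <= (LINT x|lborel. g x h)" by (intro integral_nonneg_AE AE_I2 g0)
      then show "norm (LINT x|lborel. norm (case (h, x) of (h, x) => g x h))
       <= norm (indicator B h * (2 * s^2 * G) :: real)"
       using trans(2)[of h] g0 by simp
     qed
    qed (use measurable_pair_swap[OF g_meas] in measurable)
   qed (use measurable_pair_swap[OF g_meas] in \<open>simp add: split_beta\<close>)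
   from lborel_pair.integrable_product_swap[OF this] show ?thesis by (simp add: split_beta)
  qed
  define T where "T x = (LINT h|lborel. g x h)" for x
  have T0: "T x >= 0" for x unfolding T_def by (intro integral_nonneg_AE AE_I2 g0)
  have T_int: "intble T"
   using lborel_pair.integrable_fst[OF gint] by (simp add: T_def[abs_def])
  have T_le: "(LINT x|lborel. T x) <= 8 * s^4 * G"
  proof -
   have "(LINT x|lborel. T x) = (LINT h|lborel. LINT x|lborel. g x h)"
    unfolding T_def by (rule lborel_pair.Fubini_integral[OF gint, symmetric])
   also have "... <= (LINT h|lborel. indicator B h * (2 * s^2 * G))"
    using lborel_pair.integrable_snd[OF gint] by (intro integral_mono bint trans(2)) auto
   also have "... = measure lborel B * (2 * s^2 * G)" using B_fin by simp
   also have "... <= 4 * s^2 * (2 * s^2 * G)" using B_measure G0 by (intro mult_right_mono) auto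
   finally show ?thesis by (simp add: power4_eq_xxxx power2_eq_square)
  qed
  have g_slice: "intble (%h. g x h)" for x
  proof -
   obtain C where C: "!!y. norm (th y) <= C" using bdd_support(2)[OF cont zR] by blast
   have "\<bar>th (x + h) - th x\<bar> <= 2 * C" for h using C[of "x + h"] C[of x] by (simp add: abs_le_iff)
   then have "(th (x + h) - th x)^2 <= (2 * C)^2" for h by (metis abs_le_square_iff abs_of_nonneg abs_ge_zero order_trans abs_le_iff)
   then show ?thesis
    by (intro Bintegrable_bound[where g="%h. g x h" and f="%h. indicator B h * (2 * C)^2 :: real"]
      integrable_mult_left integrable_real_indicator)
      (use B_fin in \<open>auto simp: g_def indicator_def\<close>)
  qed
  define e where "e q = (LINT x|lborel. indicator (cell s q) x * th x)" for q
  define E where "E q = (LINT x|lborel. indicator (cell s q) x * (th x)^2)" for q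
  have iq: "intble (%x. indicator (cell s q) x * c x)" if "intble c" for q and c :: "real^2 => real"
   using integrable_mult_indicator[OF _ that, of "cell s q"] by simp
  have ic: "intble (%x. indicator (cell s q) x :: real)" for q
   using fm by (intro integrable_real_indicator) auto
  have cell_le: "2 * s^2 * E q - 2 * (e q)^2 <= (LINT x|lborel. indicator (cell s q) x * T x)" for q
  proof -
   have inner: "(LINT y|lborel. indicator (cell s q) y * (th y - th x)^2) = s^2 * (th x)^2 - 2 * th x * e q + E q" for x
   proof -
    have "(%y. indicator (cell s q) y * (th y - th x)^2)
      = (%y. 1 * (indicator (cell s q) y * (th y)^2) - (2 * th x) * (indicator (cell s q) y * th y) + (th x)^2 * indicator (cell s q) y)"
     by (auto simp: fun_eq_iff power2_eq_square algebra_simps)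
    then show ?thesis
     using fm[of q]
     by (simp only: integral_linear_combination3[OF iq[OF int2] iq[OF int1] ic])
       (simp add: E_def e_def)
   qed
   have "2 * s^2 * E q - 2 * (e q)^2 = (LINT x|lborel. indicator (cell s q) x * (s^2 * (th x)^2 - 2 * th x * e q + E q))"
   proof -
    have "(%x. indicator (cell s q) x * (s^2 * (th x)^2 - 2 * th x * e q + E q))
      = (%x. s^2 * (indicator (cell s q) x * (th x)^2) - (2 * e q) * (indicator (cell s q) x * th x) + E q * indicator (cell s q) x)"
     by (auto simp: fun_eq_iff algebra_simps)
    then show ?thesis
     using fm[of q]
     by (simp only: integral_linear_combination3[OF iq[OF int2] iq[OF int1] ic])
       (simp add: E_def e_def power2_eq_square)
   qed
   also have "... <= (LINT x|lborel. indicator (cell s q) x * T x)"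
   proof (rule integral_mono)
    show "intble (%x. indicator (cell s q) x * (s^2 * (th x)^2 - 2 * th x * e q + E q))"
    proof -
     have "intble (%x. s^2 * (indicator (cell s q) x * (th x)^2) - (2 * e q) * (indicator (cell s q) x * th x) + E q * indicator (cell s q) x)"
      by (intro Bintegrable_add Bintegrable_diff integrable_mult_right iq int1 int2 ic)
     then show ?thesis by (simp add: algebra_simps)
    qed
    show "intble (%x. indicator (cell s q) x * T x)" by (rule iq[OF T_int])
    fix x
    show "indicator (cell s q) x * (s^2 * (th x)^2 - 2 * th x * e q + E q) <= indicator (cell s q) x * T x"
    proof (cases "x \<in> cell s q")
     case True
     have "(LINT y|lborel. indicator (cell s q) y * (th y - th x)^2)
       = (LINT h|lborel. indicator (cell s q) (h + x) * (th (h + x) - th x)^2)"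
      by (rule lborel_integral_shift(1)[symmetric]) measurable
     also have "... <= T x"
      unfolding T_def
     proof (rule integral_mono[OF _ g_slice])
      have le: "indicator (cell s q) (h + x) * (th (h + x) - th x)^2 <= g x h" for h
      proof (cases "h + x \<in> cell s q")
       case True2: True
       have "h \<in> B" using True True2 s by (auto simp: cell_iff B abs_le_iff)
       then show ?thesis using True2 by (simp add: g_def add.commute)
      qed (simp add: g0)
      show "intble (%h. indicator (cell s q) (h + x) * (th (h + x) - th x)^2)"
      proof (rule Bintegrable_bound[OF g_slice[of x]])
       have "(%y. indicator (cell s q) y * (th y - th x)^2) \<in> borel_measurable borel" by measurable
       from measurable_compose[OF _ this, of "%h. h + x" lborel]
       show "(%h. indicator (cell s q) (h + x) * (th (h + x) - th x)^2) \<in> borel_measurable lborel"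
        by simp
       show "AE h in lborel. norm (indicator (cell s q) (h + x) * (th (h + x) - th x)^2) <= norm (g x h)"
        using le g0 by (intro AE_I2) (simp add: abs_mult)
      qed
      show "indicator (cell s q) (h + x) * (th (h + x) - th x)^2 <= g x h" for h by (rule le)
     qed
     finally show ?thesis using True inner[of x] by simp
    qed simp
   qed
   finally show ?thesis .
  qed
  have sumE: "(LINT x|lborel. (th x)^2) = (\<Sum>q\<in>I. E q)"
  proof -
   have "(\<Sum>q\<in>I. indicator (cell s q) x * (th x)^2) = (th x)^2" for x
   proof (cases "x \<in> D")
    case True
    then obtain q where q: "q \<in> I" "x \<in> cell s q" using I(2) by blast
    have "(\<Sum>p\<in>I. indicator (cell s p) x * (th x)^2) = (\<Sum>p\<in>I. if p = q then (th x)^2 else 0)"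
     by (intro sum.cong refl) (simp add: indicator_cell[OF q(2)])
    then show ?thesis using q(1) I(1) by simp
   qed (simp add: z)
   then have "(LINT x|lborel. (th x)^2) = (LINT x|lborel. (\<Sum>q\<in>I. indicator (cell s q) x * (th x)^2))" by simp
   also have "... = (\<Sum>q\<in>I. E q)" unfolding E_def
    by (rule Bintegral_sum) (rule iq[OF int2])
   finally show ?thesis .
  qed
  have sumT: "(\<Sum>q\<in>I. LINT x|lborel. indicator (cell s q) x * T x) <= (LINT x|lborel. T x)"
  proof -
   have "(\<Sum>q\<in>I. LINT x|lborel. indicator (cell s q) x * T x) = (LINT x|lborel. (\<Sum>q\<in>I. indicator (cell s q) x * T x))"
    by (rule Bintegral_sum[symmetric]) (rule iq[OF T_int])
   also have "... <= (LINT x|lborel. T x)"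
   proof (rule integral_mono[OF _ T_int])
    show "intble (%x. \<Sum>q\<in>I. indicator (cell s q) x * T x)"
     by (intro Bintegrable_sum iq T_int)
    fix x
    show "(\<Sum>q\<in>I. indicator (cell s q) x * T x) <= T x"
    proof (cases "\<exists>q\<in>I. x \<in> cell s q")
     case True
     then obtain q where q: "q \<in> I" "x \<in> cell s q" by blast
     have "(\<Sum>p\<in>I. indicator (cell s p) x * T x) = (\<Sum>p\<in>I. if p = q then T x else 0)"
      by (intro sum.cong refl) (simp add: indicator_cell[OF q(2)])
     also have "... = T x" using q(1) I(1) by simp
     finally show ?thesis by (rule eq_refl)
    next
     case False
     then have "(\<Sum>p\<in>I. indicator (cell s p) x * T x) = 0" by (intro sum.neutral) auto
     then show ?thesis using T0 by simp
    qed
   qed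
   finally show ?thesis .
  qed
  have "2 * s^2 * (LINT x|lborel. (th x)^2) - 2 * (\<Sum>q\<in>I. (e q)^2) = (\<Sum>q\<in>I. 2 * s^2 * E q - 2 * (e q)^2)"
   by (simp add: sumE sum_subtractf sum_distrib_left)
  also have "... <= (\<Sum>q\<in>I. LINT x|lborel. indicator (cell s q) x * T x)" by (intro sum_mono cell_le)
  also have "... <= 8 * s^4 * G" using sumT T_le by linarith
  finally have "2 * s^2 * (LINT x|lborel. (th x)^2) <= 2 * s^2 * (4 * s^2 * G + (1 / s^2) * (\<Sum>q\<in>I. (e q)^2))"
   using s by (simp add: distrib_left power4_eq_xxxx power2_eq_square)
  then have "(LINT x|lborel. (th x)^2) <= 4 * s^2 * G + (1 / s^2) * (\<Sum>q\<in>I. (e q)^2)"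
   using s by simp
  then show "(LINT x|lborel. (th x)^2) <= 4 * s^2 * (LINT x|lborel. (\<Sum>j\<in>UNIV. (pd j th x)^2))
    + (\<Sum>q\<in>I. (1 / s^2) * (LINT x|lborel. indicator (cell s q) x * th x)^2)"
   by (simp add: G_def e_def sum_distrib_left)
 qed
qed

section \<open>The closure of the test functions\<close>

lemma test_functionsI:
 assumes "C1_on UNIV et" "compact K" "K \<subseteq> D" "!!x. x \<notin> K ==> et x = 0"
 shows "et \<in> test_functions D"
proof -
 have "closure {x. et x \<noteq> 0} \<subseteq> K"
  using assms(2,4) by (intro closure_minimal compact_imp_closed) auto
 moreover from this have "compact (closure {x. et x \<noteq> 0})"
  using compact_Int_closed[OF assms(2), of "closure {x. et x \<noteq> 0}"] by (simp add: Int_absorb1)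
 ultimately show ?thesis using assms(1,3) by (simp add: test_functions_def subset_trans[OF _ assms(3)])
qed

lemma test_functionsE:
 assumes "et \<in> test_functions D"
 obtains K R where "C1_on UNIV et" "compact K" "K \<subseteq> D" "!!x. x \<notin> K ==> et x = 0"
  "!!x. norm x > R ==> et x = 0"
proof -
 let ?K = "closure {x. et x \<noteq> 0}"
 have K: "C1_on UNIV et" "compact ?K" "?K \<subseteq> D" using assms by (auto simp: test_functions_def)
 have z: "et x = 0" if "x \<notin> ?K" for x using that closure_subset[of "{x. et x \<noteq> 0}"] by auto
 obtain R where "!!x. x \<in> ?K ==> norm x <= R" using compact_imp_bounded[OF K(2)] by (auto simp: bounded_iff)
 then have "et x = 0" if "norm x > R" for x using z[of x] that by (meson not_le)
 then show thesis using that[OF K z] by blast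
qed

lemma C1_on_add:
 assumes "C1_on S u" "C1_on S v"
 shows "C1_on S (%x. u x + v x)"
 by (rule C1_onI[OF has_grad_add[OF C1_on_has_grad[OF assms(1)] C1_on_has_grad[OF assms(2)]]])
   (use assms in \<open>simp_all add: C1_on_def continuous_on_add\<close>)

lemma C1_on_linear:
 assumes "bounded_linear L" "C1_on S u"
 shows "C1_on S (%x. L (u x))"
proof (rule C1_onI[OF has_grad_linear[OF assms(1) C1_on_has_grad[OF assms(2)]]])
 fix j
 have "continuous_on S (pd j u)" using assms(2) by (simp add: C1_on_def)
 then show "continuous_on S (%x. L (pd j u x))" by (rule bounded_linear.continuous_on[OF assms(1)])
qed

lemma C1_on_bilinear:
 assumes B: "bounded_bilinear B" and u: "C1_on S u" and v: "C1_on S v"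
 shows "C1_on S (%x. B (u x) (v x))"
proof (rule C1_onI[OF has_grad_bilinear[OF B C1_on_has_grad[OF u] C1_on_has_grad[OF v]]])
 fix j
 have "continuous_on S (pd j u)" "continuous_on S (pd j v)"
  using u v by (simp_all add: C1_on_def)
 then show "continuous_on S (%x. B (pd j u x) (v x) + B (u x) (pd j v x))"
  by (intro continuous_on_add bounded_bilinear.continuous_on[OF B] C1_on_continuous[OF u] C1_on_continuous[OF v])
qed

lemma partial_deriv_add:
 "u differentiable (at x) ==> v differentiable (at x) ==>
  pd j (%x. u x + v x) x = pd j u x + pd j v x"
 by (rule has_grad_partial_deriv[OF has_grad_add[OF differentiable_has_grad differentiable_has_grad]])

lemma partial_deriv_linear:
 "bounded_linear L ==> u differentiable (at x) ==> pd j (%x. L (u x)) x = L (pd j u x)"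
 by (rule has_grad_partial_deriv[OF has_grad_linear[OF _ differentiable_has_grad]])

lemma C1_on_differentiable: "C1_on S u ==> x \<in> S ==> u differentiable (at x)"
 by (simp add: C1_on_def)

definition grad_pair :: "(real^2 => real) => real^2 => real \<times> (real^2)" where
 "grad_pair et x = (et x, \<chi> j. pd j et x)"

lemma sqint_continuous:
 fixes g :: "'a::euclidean_space => 'b::euclidean_space"
 assumes "cts g" "!!x. norm x > R ==> g x = 0"
 shows "sqint g"
 unfolding sqint_def
proof
 show "g \<in> borel_measurable lborel" using borel_measurable_continuous_onI[OF assms(1)] by simp
 show "intble (%x. (norm (g x))^2)"
  by (rule bdd_support(1)[where R=R]) (auto intro!: continuous_intros assms)
qed

lemma sqint_grad_pair:
 assumes "et \<in> test_functions D"
 shows "sqint (grad_pair et)"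
proof -
 obtain K R where K: "C1_on UNIV et" "compact K" "K \<subseteq> D" "!!x. x \<notin> K ==> et x = 0"
  "!!x. norm x > R ==> et x = 0" using test_functionsE[OF assms] by metis
 have c: "cts (pd j et)" for j using K(1) by (simp add: C1_on_def)
 show ?thesis
 proof (rule sqint_continuous)
  show "cts (grad_pair et)" unfolding grad_pair_def[abs_def]
   by (intro continuous_on_Pair continuous_on_vec_lambda c C1_on_continuous K)
  show "grad_pair et x = 0" if "norm x > R" for x
   using K(5)[OF that] partial_deriv_eq_0[OF K(5) that]
   by (simp add: grad_pair_def zero_prod_def vec_eq_iff)
 qed
qed

lemma grad_pair_add:
 assumes "et \<in> test_functions D" "\<xi> \<in> test_functions D"
 shows "(%x. et x + \<xi> x) \<in> test_functions D"
  "grad_pair (%x. et x + \<xi> x) = (%x. grad_pair et x + grad_pair \<xi> x)"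
proof -
 obtain K where K: "C1_on UNIV et" "compact K" "K \<subseteq> D" "!!x. x \<notin> K ==> et x = 0"
  using test_functionsE[OF assms(1)] by metis
 obtain L where L: "C1_on UNIV \<xi>" "compact L" "L \<subseteq> D" "!!x. x \<notin> L ==> \<xi> x = 0"
  using test_functionsE[OF assms(2)] by metis
 show "(%x. et x + \<xi> x) \<in> test_functions D"
  by (rule test_functionsI[where K="K \<union> L"]) (use K L in \<open>auto intro!: C1_on_add\<close>)
 show "grad_pair (%x. et x + \<xi> x) = (%x. grad_pair et x + grad_pair \<xi> x)"
  using K(1) L(1) by (auto simp: grad_pair_def fun_eq_iff vec_eq_iff partial_deriv_add C1_on_differentiable)
qed

lemma grad_pair_scale:
 assumes "et \<in> test_functions D"
 shows "(%x. c * et x) \<in> test_functions D"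
  "grad_pair (%x. c * et x) = (%x. c *R grad_pair et x)"
proof -
 obtain K where K: "C1_on UNIV et" "compact K" "K \<subseteq> D" "!!x. x \<notin> K ==> et x = 0"
  using test_functionsE[OF assms(1)] by metis
 show "(%x. c * et x) \<in> test_functions D"
  by (rule test_functionsI[OF C1_on_linear[OF bounded_linear_mult_right K(1)] K(2,3)]) (simp add: K(4))
 have "pd j (%x. c * et x) x = c * pd j et x" for j x
  by (rule partial_deriv_linear[OF bounded_linear_mult_right C1_on_differentiable[OF K(1) UNIV_I]])
 then show "grad_pair (%x. c * et x) = (%x. c *R grad_pair et x)"
  by (simp add: grad_pair_def fun_eq_iff vec_eq_iff)
qed

type_synonym pair_field = "(real^2, real \<times> (real^2)) l2"

definition test_space :: "(real^2) set => pair_field set" where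
 "test_space D = (%et. abs_l2 (grad_pair et)) ` test_functions D"

definition H10 :: "(real^2) set => pair_field set" where
 "H10 D = closure (test_space D)"

lemma subspace_test_space: "subspace (test_space D)"
 unfolding subspace_def
proof (intro conjI ballI allI)
 have z: "(%_. 0) \<in> test_functions D"
  by (rule test_functionsI[where K="{}"]) (auto intro!: C1_onI[OF has_grad_const])
 have "grad_pair (%_. 0) = (%_. 0)"
  using has_grad_partial_deriv[OF has_grad_const[of "0::real"]]
  by (auto simp: grad_pair_def fun_eq_iff vec_eq_iff zero_prod_def)
 then show "0 \<in> test_space D" using z by (auto simp: test_space_def zero_l2_def image_iff intro!: bexI[of _ "%_. 0"])
 fix U V c assume "U \<in> test_space D" "V \<in> test_space D"
 then obtain et \<xi> where e: "et \<in> test_functions D" "\<xi> \<in> test_functions D"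
  "U = abs_l2 (grad_pair et)" "V = abs_l2 (grad_pair \<xi>)" by (auto simp: test_space_def)
 show "U + V \<in> test_space D" unfolding test_space_def image_iff
  by (rule bexI[OF _ grad_pair_add(1)[OF e(1,2)]])
    (simp only: e(3,4) grad_pair_add(2)[OF e(1,2)]
     abs_l2_add[OF sqint_grad_pair[OF e(1)] sqint_grad_pair[OF e(2)]])
next
 fix U c assume "U \<in> test_space D"
 then obtain et where e: "et \<in> test_functions D" "U = abs_l2 (grad_pair et)" by (auto simp: test_space_def)
 show "c *R U \<in> test_space D" unfolding test_space_def image_iff
  by (rule bexI[OF _ grad_pair_scale(1)[OF e(1)]])
    (simp only: e(2) grad_pair_scale(2)[OF e(1)] abs_l2_scaleR[OF sqint_grad_pair[OF e(1)]])
qed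

lemma subspace_closure:
 fixes S :: "'a::real_normed_vector set"
 assumes S: "subspace S"
 shows "subspace (closure S)"
 unfolding subspace_def
proof (intro conjI ballI allI)
 show "0 \<in> closure S" using subspace_0[OF S] closure_subset by blast
next
 fix x y assume "x \<in> closure S" "y \<in> closure S"
 then obtain f g where fg: "!!n. f n \<in> S" "f ---> x" "!!n. g n \<in> S" "g ---> y"
  unfolding closure_sequential by blast
 then have "\<forall>n. f n + g n \<in> S" "(%n. f n + g n) ---> x + y"
  by (auto intro: subspace_add[OF S] tendsto_add)
 then show "x + y \<in> closure S" unfolding closure_sequential
  by (intro exI[of _ "%n. f n + g n"] conjI)
next
 fix x c assume "x \<in> closure S"
 then obtain f where f: "!!n. f n \<in> S" "f ---> x" unfolding closure_sequential by blast
 then have "\<forall>n. c *R f n \<in> S" "(%n. c *R f n) ---> c *R x"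
  by (auto intro: subspace_scale[OF S] tendsto_scaleR)
 then show "c *R x \<in> closure S" unfolding closure_sequential
  by (intro exI[of _ "%n. c *R f n"] conjI)
qed

lemma subspace_H10: "subspace (H10 D)" and closed_H10: "closed (H10 D)"
 by (simp_all add: H10_def subspace_closure subspace_test_space)

lemma H10_sequence:
 assumes "U \<in> H10 D"
 obtains et where "!!n. et n \<in> test_functions D" "(%n. abs_l2 (grad_pair (et n))) ---> U"
proof -
 obtain u where u: "!!n. u n \<in> test_space D" "u ---> U"
  using assms by (auto simp: H10_def closure_sequential)
 then have "\<forall>n. \<exists>et. et \<in> test_functions D \<and> u n = abs_l2 (grad_pair et)" by (auto simp: test_space_def)
 then obtain et where "!!n. et n \<in> test_functions D" "!!n. u n = abs_l2 (grad_pair (et n))" by metis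
 moreover from this have "u = (%n. abs_l2 (grad_pair (et n)))" by (simp add: fun_eq_iff)
 ultimately show thesis using that[of et] u(2) by simp
qed

lemma sqint_fst:
 assumes "sqint f" shows "sqint (%x. fst (f x))"
proof (rule sqint_bound)
 have [measurable]: "f \<in> borel_measurable borel" using assms by (simp add: sqint_def)
 show "(%x. fst (f x)) \<in> borel_measurable lborel"
  by (rule measurable_compose[OF _ borel_measurable_continuous_onI[OF continuous_on_fst[OF continuous_on_id]]]) simp
 show "intble (%x. (norm (f x))^2)" using assms by (rule sqint_norm)
 show "(norm (fst (f x)))^2 <= (norm (f x))^2" for x using norm_fst_le[of "fst (f x)" "snd (f x)"] by (simp add: power_mono)
qed

lemma sqint_snd:
 assumes "sqint f" shows "sqint (%x. snd (f x))"
proof (rule sqint_bound)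
 have [measurable]: "f \<in> borel_measurable borel" using assms by (simp add: sqint_def)
 show "(%x. snd (f x)) \<in> borel_measurable lborel"
  by (rule measurable_compose[OF _ borel_measurable_continuous_onI[OF continuous_on_snd[OF continuous_on_id]]]) simp
 show "intble (%x. (norm (f x))^2)" using assms by (rule sqint_norm)
 show "(norm (snd (f x)))^2 <= (norm (f x))^2" for x using norm_snd_le[of "snd (f x)" "fst (f x)"] by (simp add: power_mono)
qed

lemma sqint_pair0:
 assumes "sqint f" shows "sqint (%x. (f x, 0))"
proof (rule sqint_bound)
 have [measurable]: "f \<in> borel_measurable borel" using assms by (simp add: sqint_def)
 have "(%x. (f x, 0)) \<in> borel_measurable borel"
  by (rule measurable_compose[OF _ borel_measurable_continuous_onI[OF continuous_on_Pair[OF continuous_on_id continuous_on_const]], simplified id_def]) simp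
 then show "(%x. (f x, 0)) \<in> borel_measurable lborel" by simp
 show "intble (%x. (norm (f x))^2)" using assms by (rule sqint_norm)
qed (simp add: norm_Pair)

text \<open>The Hilbert space consists of pairs of a function and its gradient; the weak Helmholtz
form at \<open>U\<close> is the inner product with \<open>U - (1 + k^2) value_part
U\<close>.\<close>

lift_definition value_part :: "pair_field => pair_field" is "%f x. (fst (f x), 0)"
 by (auto simp: l2_rel_def intro!: sqint_pair0 sqint_fst)

lemma value_part_abs: "sqint f ==> value_part (abs_l2 f) = abs_l2 (%x. (fst (f x), 0))"
 by (intro value_part.abs_eq) (auto simp: l2_rel_def)

lemma value_part_symmetric: "inner (value_part U) V = inner U (value_part V)"
 by transfer (simp add: inner_prod_def)

lemma value_part_add: "value_part (U + V) = value_part U + value_part V"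
 by transfer (auto simp: l2_rel_def intro!: sqint_pair0 sqint_fst sqint_add)

lemma value_part_scaleR: "value_part (c *R U) = c *R value_part U"
 by transfer (auto simp: l2_rel_def simp flip: real_scaleR_def
   intro!: sqint_pair0 sqint_fst sqint_scaleR)

lemma value_part_idem: "value_part (value_part U) = value_part U"
 by transfer (auto simp: l2_rel_def intro!: sqint_pair0 sqint_fst)

lemma bounded_linear_value_part: "bounded_linear value_part"
proof (rule bounded_linear_intro[where K=1])
 fix U :: pair_field
 have "(norm (value_part U))^2 = inner U (value_part U)"
  by (simp add: power2_norm_eq_inner value_part_symmetric value_part_idem)
 also have "... <= norm U * norm (value_part U)" by (rule norm_cauchy_schwarz)
 finally show "norm (value_part U) <= norm U * 1"
  by (simp add: power2_eq_square mult_le_cancel_right) (metis norm_ge_zero norm_le_zero_iff order.order_iff_strict norm_zero)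
qed (simp_all add: value_part_add value_part_scaleR)

lemma test_function_integrals:
 assumes "et \<in> test_functions D"
 defines "U \<equiv> abs_l2 (grad_pair et)"
 shows "inner (value_part U) U = (LINT x|lborel. (et x)^2)"
  "(norm U)^2 = (LINT x|lborel. (et x)^2) + (LINT x|lborel. (\<Sum>j\<in>UNIV. (pd j et x)^2))"
proof -
 note sq = sqint_grad_pair[OF assms(1)]
 obtain K R where K: "C1_on UNIV et" "!!x. norm x > R ==> et x = 0" using test_functionsE[OF assms(1)] by metis
 have c: "cts (pd j et)" for j using K(1) by (simp add: C1_on_def)
 have 1: "intble (%x. (et x)^2)"
  by (rule bdd_support(1)[where R=R])
    (auto intro!: continuous_intros C1_on_continuous[OF K(1)] simp: K(2))
 have 2: "intble (%x. (\<Sum>j\<in>UNIV. (pd j et x)^2))"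
  by (rule bdd_support(1)[where R=R])
    (auto intro!: continuous_intros c simp: partial_deriv_eq_0[OF K(2)])
 show "inner (value_part U) U = (LINT x|lborel. (et x)^2)"
  unfolding U_def value_part_abs[OF sq]
  by (subst inner_abs_l2[OF sqint_pair0[OF sqint_fst[OF sq]] sq])
    (simp add: grad_pair_def inner_prod_def power2_eq_square)
 have "(norm (grad_pair et x))^2 = (et x)^2 + (\<Sum>j\<in>UNIV. (pd j et x)^2)" for x
  by (simp add: grad_pair_def norm_Pair norm_vec_def L2_set_def sum_nonneg)
 then show "(norm U)^2 = (LINT x|lborel. (et x)^2) + (LINT x|lborel. (\<Sum>j\<in>UNIV. (pd j et x)^2))"
  unfolding U_def norm_abs_l2[OF sq] using 1 2 by simp
qed

text \<open>For \<open>c = 1 + k^2\<close> the form is that of the Helmholtz equation. The side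
\<open>s\<close> of the squares is chosen so that the gradient term of \<open>cell_poincare\<close>
is absorbed.\<close>

theorem H10_solvable:
 fixes D :: "(real^2) set" and c :: real and F :: pair_field
 assumes D: "bounded D" and c: "c > 0"
  and inj: "!!U. U \<in> H10 D ==> (!!V. V \<in> H10 D ==> inner (U - c *R value_part U) V = 0) ==> U = 0"
 shows "\<exists>U\<in>H10 D. \<forall>V\<in>H10 D. inner (U - c *R value_part U) V = inner F V"
proof -
 define s where "s = sqrt (1 / (8 * c))"
 have s: "s > 0" "s^2 = 1 / (8 * c)" using c by (simp_all add: s_def)
 obtain I where I: "finite I" and P: "\<forall>th::real^2 => real. C1_on UNIV th --> (\<forall>x. x \<notin> D --> th x = 0) -->
   (LINT x|lborel. (th x)^2) <= 4 * s^2 * (LINT x|lborel. (\<Sum>j\<in>UNIV. (pd j th x)^2))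
    + (\<Sum>q\<in>I. (1 / s^2) * (LINT x|lborel. indicator (cell s q) x * th x)^2)"
  using cell_poincare[OF s(1) D] by blast
 define ef :: "int \<times> int => real^2 => real \<times> (real^2)"
  where "ef q x = ((sqrt c / s) *R indicator (cell s q) x, 0)" for q x
 define e where "e q = (abs_l2 (ef q) :: pair_field)" for q
 have ef: "sqint (ef q)" for q
  unfolding ef_def[abs_def]
 proof (intro sqint_pair0 sqint_scaleR)
  have "(%x. (norm (indicator (cell s q) x :: real))^2) = indicator (cell s q)"
   by (auto simp: fun_eq_iff indicator_def)
  moreover have "intble (indicator (cell s q) :: real^2 => real)"
   using emeasure_cell[OF s(1), of q] by (intro integrable_real_indicator) auto
  ultimately show "sqint (%x. indicator (cell s q) x :: real)"
   by (simp add: sqint_def)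
 qed
 have main: "c * inner (value_part V) V <= (1/2) * (norm V)^2 + (\<Sum>q\<in>I. (inner (e q) V)^2)" if V: "V \<in> H10 D" for V
 proof -
  let ?S = "{V. c * inner (value_part V) V <= (1/2) * (norm V)^2 + (\<Sum>q\<in>I. (inner (e q) V)^2)}"
  have "closed ?S"
   by (intro closed_Collect_le continuous_intros linear_continuous_on bounded_linear_value_part)
  moreover have "test_space D \<subseteq> ?S"
  proof
   fix U assume "U \<in> test_space D"
   then obtain et where et: "et \<in> test_functions D" "U = abs_l2 (grad_pair et)" by (auto simp: test_space_def)
   note sq = sqint_grad_pair[OF et(1)]
   obtain K where "C1_on UNIV et" "K \<subseteq> D" "!!x. x \<notin> K ==> et x = 0"
    using test_functionsE[OF et(1)] by metis
   then have Pet: "(LINT x|lborel. (et x)^2) <= 4 * s^2 * (LINT x|lborel. (\<Sum>j\<in>UNIV. (pd j et x)^2))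
     + (\<Sum>q\<in>I. (1 / s^2) * (LINT x|lborel. indicator (cell s q) x * et x)^2)"
    using P by blast
   have ie: "inner (e q) U = (sqrt c / s) * (LINT x|lborel. indicator (cell s q) x * et x)" for q
    unfolding et(2) e_def inner_abs_l2[OF ef sq]
    by (simp add: ef_def grad_pair_def inner_prod_def flip: integral_mult_right_zero) (simp add: mult.assoc)
   define A G where "A = (LINT x|lborel. (et x)^2)" and "G = (LINT x|lborel. (\<Sum>j\<in>UNIV. (pd j et x)^2))"
   have A0: "A >= 0" unfolding A_def by (intro integral_nonneg_AE) auto
   have "c * A <= c * (4 * s^2 * G + (\<Sum>q\<in>I. (1 / s^2) * (LINT x|lborel. indicator (cell s q) x * et x)^2))"
    using Pet c by (intro mult_left_mono) (simp_all add: A_def G_def)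
   also have "... = (1/2) * G + (\<Sum>q\<in>I. (inner (e q) U)^2)"
    using c by (simp add: distrib_left s(2) ie power_mult_distrib power_divide sum_distrib_left mult_ac)
   finally show "U \<in> ?S"
    unfolding mem_Collect_eq et(2) test_function_integrals[OF et(1)] A_def[symmetric] G_def[symmetric]
    using A0 by argo
  qed
  ultimately show ?thesis using closure_minimal[of "test_space D" ?S] V by (auto simp: H10_def)
 qed
 show ?thesis
  by (rule compact_perturbation_solvable[OF subspace_H10 closed_H10 bounded_linear_value_part
     value_part_symmetric I main inj])
qed

section \<open>The fundamental lemma of the calculus of variations\<close>

lemma pos_power_has_derivative:
 assumes "n >= 1"
 shows "((%t. max 0 t ^ Suc n) has_real_derivative real (Suc n) * max 0 t ^ n) (at t)"
proof -
 consider "t > 0" | "t < 0" | "t = 0" by linarith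
 then show ?thesis
 proof cases
  case 1
  have "((%t. t ^ Suc n) has_real_derivative real (Suc n) * t ^ n) (at t)"
   using DERIV_pow[of "Suc n" t] by simp
  then have "((%t. max 0 t ^ Suc n) has_real_derivative real (Suc n) * t ^ n) (at t)"
   by (rule has_field_derivative_transform_within_open[where S="{0<..}"]) (use 1 in \<open>auto simp: max_def\<close>)
  then show ?thesis using 1 by (simp add: max_def)
 next
  case 2
  have "((%t. 0 :: real) has_real_derivative 0) (at t)" by simp
  then have "((%t. max 0 t ^ Suc n) has_real_derivative 0) (at t)"
   by (rule has_field_derivative_transform_within_open[where S="{..<0}"]) (use 2 in \<open>auto simp: max_def\<close>)
  moreover have "max 0 t ^ n = 0" using 2 assms by (simp add: max_def)
  ultimately show ?thesis by (simp only: mult_zero_right)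
 next
  case 3
  have "((%h. (max 0 (0 + h) ^ Suc n - max 0 0 ^ Suc n) / h) \<longlongrightarrow> 0) (at (0::real))"
  proof (rule Lim_null_comparison)
   show "((%h::real. \<bar>h\<bar> ^ n) \<longlongrightarrow> 0) (at 0)" using assms by (auto intro!: tendsto_eq_intros)
   show "\<forall>\<^sub>F h in at 0. norm ((max 0 (0 + h) ^ Suc n - max 0 0 ^ Suc n) / h) <= \<bar>h\<bar> ^ n"
    by (intro always_eventually allI) (auto simp: max_def abs_mult power_abs)
  qed
  then have "((%t. max 0 t ^ Suc n) has_real_derivative 0) (at (0::real))" by (simp add: DERIV_def)
  moreover have "max 0 t ^ n = 0" using 3 assms by simp
  ultimately show ?thesis using 3 by (simp only: mult_zero_right)
 qed
qed

lemma has_grad_coordinate: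
 assumes "(\<phi> has_real_derivative d) (at (x $ i))"
 shows "has_grad (%x. \<phi> (x $ i)) (%j. if j = i then d else 0) x"
proof -
 have "((%x. \<phi> (x $ i)) has_derivative (%h. d * (h $ i))) (at x)"
  by (rule has_derivative_compose[OF bounded_linear_imp_has_derivative[OF bounded_linear_vec_nth]
     assms[unfolded has_field_derivative_def]])
 moreover have "(%h::real^2. d * (h $ i)) = (%h. \<Sum>j\<in>UNIV. (h $ j) *R (if j = i then d else 0))"
  by (auto simp: fun_eq_iff if_distrib[where f="%x. _ * x"] cong: if_cong)
 ultimately show ?thesis by (simp add: has_grad_def)
qed

lemma C1_on_coordinate:
 assumes "!!t. (\<phi> has_real_derivative \<phi>' t) (at t)" "cts \<phi>'"
 shows "C1_on UNIV (%x::real^2. \<phi> (x $ i))"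
proof (rule C1_onI[OF has_grad_coordinate[OF assms(1)]])
 fix j
 have "cts (%x::real^2. \<phi>' (x $ i))"
  by (rule continuous_on_compose2[OF assms(2)]) (auto intro!: continuous_intros)
 then show "cts (%x::real^2. if j = i then \<phi>' (x $ i) else 0)"
  by (cases "j = i") simp_all
qed

lemma interval_bump:
 fixes a b :: real
 obtains \<phi> :: "nat => real => real" and \<phi>' where
  "!!n t. (\<phi> n has_real_derivative \<phi>' n t) (at t)" "!!n. cts (\<phi>' n)"
  "!!n t. 0 <= \<phi> n t" "!!n t. \<phi> n t <= 1" "!!n t. t \<notin> {a<..<b} ==> \<phi> n t = 0"
  "!!t. (%n. \<phi> n t) ---> indicator {a<..<b} t"
proof -
 define m where "m t = max 0 (t - a) ^ Suc 1 * max 0 (b - t) ^ Suc 1" for t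
 define m' where "m' t = 2 * max 0 (t - a) * max 0 (b - t)^2 - max 0 (t - a)^2 * (2 * max 0 (b - t))" for t
 have m0: "m t >= 0" for t by (simp add: m_def)
 have m: "(m has_real_derivative m' t) (at t)" for t
 proof -
  have P: "((%t. max 0 t ^ Suc 1) has_real_derivative 2 * max 0 s) (at s)" for s :: real
   using pos_power_has_derivative[of 1 s] by simp
  have 1: "((%t. max 0 (t - a) ^ Suc 1) has_real_derivative 2 * max 0 (t - a) * 1) (at t)"
   by (rule DERIV_chain2[OF P]) (auto intro!: derivative_eq_intros)
  have 2: "((%t. max 0 (b - t) ^ Suc 1) has_real_derivative 2 * max 0 (b - t) * (-1)) (at t)"
   by (rule DERIV_chain2[OF P]) (auto intro!: derivative_eq_intros)
  show ?thesis unfolding m_def[abs_def] m'_def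
   by (rule DERIV_cong[OF DERIV_mult[OF 1 2]]) (simp add: power2_eq_square)
 qed
 have m'_cont: "cts m'" unfolding m'_def by (intro continuous_intros)
 have m_cont: "cts m" by (rule DERIV_continuous_on) (use m in \<open>auto intro: has_field_derivative_at_within\<close>)
 define \<phi> where "\<phi> n t = real n * m t / (1 + real n * m t)" for n t
 define \<phi>' where "\<phi>' n t = real n * m' t / (1 + real n * m t)^2" for n t
 have pos: "1 + real n * m t > 0" for n t using m0[of t] by (simp add: add_pos_nonneg)
 show thesis
 proof (rule that[of \<phi> \<phi>'])
  fix n t
  show "(\<phi> n has_real_derivative \<phi>' n t) (at t)"
   unfolding \<phi>_def[abs_def] \<phi>'_def
   by (rule derivative_eq_intros m refl | use pos[of n t] in \<open>simp add: power2_eq_square field_simps\<close>)+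
  show "cts (\<phi>' n)" unfolding \<phi>'_def
   by (intro continuous_intros m'_cont m_cont) (use pos in \<open>auto simp: less_imp_neq[symmetric]\<close>)
  show "0 <= \<phi> n t" using m0[of t] by (simp add: \<phi>_def)
  show "\<phi> n t <= 1" using pos[of n t] by (simp add: \<phi>_def divide_le_eq)
  show "\<phi> n t = 0" if "t \<notin> {a<..<b}" using that by (auto simp: \<phi>_def m_def max_def)
 next
  fix t
  show "(%n. \<phi> n t) ---> indicator {a<..<b} t"
  proof (cases "t \<in> {a<..<b}")
   case True
   then have mt: "m t > 0" by (simp add: m_def max_def)
   have "(%n. 1 - inverse (1 + real n * m t)) ---> 1 - 0"
    by (intro tendsto_intros tendsto_inverse_0_at_top filterlim_tendsto_add_at_top[OF tendsto_const]
       filterlim_at_top_mult_tendsto_pos[OF tendsto_const mt] filterlim_real_sequentially)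
   moreover have "1 - inverse (1 + real n * m t) = \<phi> n t" for n
    using pos[of n t] by (simp add: \<phi>_def field_simps)
   ultimately show ?thesis using True by simp
  next
   case False
   then have "\<phi> n t = 0" for n by (auto simp: \<phi>_def m_def max_def)
   then show ?thesis using False by simp
  qed
 qed
qed

lemma box_bump:
 fixes a b :: "real^2"
 obtains ze :: "nat => real^2 => real" where
  "!!n. C1_on UNIV (ze n)" "!!n x. \<bar>ze n x\<bar> <= 1" "!!n x. x \<notin> box a b ==> ze n x = 0"
  "!!x. (%n. ze n x) ---> indicator (box a b) x"
proof (rule interval_bump[of "a$1" "b$1"], rule interval_bump[of "a$2" "b$2"])
 fix \<phi> \<phi>' \<psi> \<psi>' :: "nat => real => real"
 assume p: "!!n t. (\<phi> n has_real_derivative \<phi>' n t) (at t)" "!!n. cts (\<phi>' n)"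
  "!!n t. 0 <= \<phi> n t" "!!n t. \<phi> n t <= 1" "!!n t. t \<notin> {a$1<..<b$1} ==> \<phi> n t = 0"
  "!!t. (%n. \<phi> n t) ---> indicator {a$1<..<b$1} t"
 assume q: "!!n t. (\<psi> n has_real_derivative \<psi>' n t) (at t)" "!!n. cts (\<psi>' n)"
  "!!n t. 0 <= \<psi> n t" "!!n t. \<psi> n t <= 1" "!!n t. t \<notin> {a$2<..<b$2} ==> \<psi> n t = 0"
  "!!t. (%n. \<psi> n t) ---> indicator {a$2<..<b$2} t"
 have box: "x \<in> box a b \<longleftrightarrow> x$1 \<in> {a$1<..<b$1} \<and> x$2 \<in> {a$2<..<b$2}" for x
  by (auto simp: mem_box_cart forall_2)
 show thesis
 proof (rule that[of "%n x. \<phi> n (x$1) * \<psi> n (x$2)"])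
  fix n and x :: "real^2"
  show "C1_on UNIV (%x. \<phi> n (x$1) * \<psi> n (x$2))"
   by (intro C1_on_bilinear[OF bounded_bilinear_mult] C1_on_coordinate[OF p(1) p(2)] C1_on_coordinate[OF q(1) q(2)])
  show "\<bar>\<phi> n (x$1) * \<psi> n (x$2)\<bar> <= 1" using p(3,4)[of n "x$1"] q(3,4)[of n "x$2"] by (simp add: abs_mult mult_le_one)
  show "\<phi> n (x$1) * \<psi> n (x$2) = 0" if "x \<notin> box a b" using that p(5)[of "x$1" n] q(5)[of "x$2" n] by (auto simp: box)
 next
  fix x :: "real^2"
  have "(%n. \<phi> n (x$1) * \<psi> n (x$2)) ---> indicator {a$1<..<b$1} (x$1) * indicator {a$2<..<b$2} (x$2)"
   by (intro tendsto_mult p q)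
  also have "indicator {a$1<..<b$1} (x$1) * indicator {a$2<..<b$2} (x$2) = (indicator (box a b) x :: real)"
   by (auto simp: indicator_def box)
  finally show "(%n. \<phi> n (x$1) * \<psi> n (x$2)) ---> indicator (box a b) x" .
 qed
qed

text \<open>Boxes generate the Borel sets and are closed under intersection.\<close>

lemma AE_zero_if_box_integrals_zero:
 fixes f :: "'a::euclidean_space => complex"
 assumes f: "intble f" and z: "!!a b. (LINT x|lborel. indicator (box a b) x *R f x) = 0"
  and zU: "(LINT x|lborel. f x) = 0"
 shows "AE x in lborel. f x = 0"
proof (rule sigma_finite_measure.density_zero[OF sigma_finite_lborel f])
 fix A :: "'a set" assume "A \<in> sets lborel"
 then have A: "A \<in> sigma_sets UNIV (range (%(a, b). box a b))" by (simp add: borel_eq_box)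
 have sets_eq: "B \<in> sigma_sets UNIV (range (%(a, b). box a b)) \<longleftrightarrow> B \<in> sets borel" for B :: "'a set"
  by (simp add: borel_eq_box)
 have int: "intble (%x. indicator B x *R f x)" if "B \<in> sets borel" for B
  using that f by (intro integrable_mult_indicator) auto
 have "Int_stable (range (%(a, b). box a b::'a set))" by (auto simp: Int_stable_def box_Int_box)
 from this subset_UNIV[of "range (%(a, b). box a b :: 'a set)", folded Pow_UNIV] A show "set_lebesgue_integral lborel A f = 0"
  unfolding set_lebesgue_integral_def
 proof (induction rule: sigma_sets_induct_disjoint)
  case (basic B) then show ?case using z by auto
 next
  case empty show ?case by simp
 next
  case (compl B)
  have "(LINT x|lborel. indicator (UNIV - B) x *R f x) = (LINT x|lborel. f x - indicator B x *R f x)"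
   by (intro Bintegral_cong) (auto simp: indicator_def)
  also have "... = 0" using compl f int[of B] by (subst Bintegral_diff) (auto simp: zU sets_eq)
  finally show ?case by simp
 next
  case (union B)
  then have B: "!!i. B i \<in> sets borel" by (auto simp: sets_eq[symmetric])
  have "set_lebesgue_integral lborel (\<Union>i. B i) f = (\<Sum>i. set_lebesgue_integral lborel (B i) f)"
   using union.hyps B f
   by (intro lebesgue_integral_countable_add) (auto simp: set_integrable_def int disjoint_family_on_def)
  then show ?case using union.IH by (simp add: set_lebesgue_integral_def)
 qed
qed

lemma complex_ex_borel:
 fixes g :: "'a::euclidean_space => complex"
 assumes "g \<in> borel_measurable lebesgue"
 obtains f where "f \<in> borel_measurable borel" "AE x in lebesgue. g x = f x"
proof -
 have "(%x. Re (g x)) \<in> borel_measurable lebesgue" "(%x. Im (g x)) \<in> borel_measurable lebesgue"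
  using assms by (auto intro: measurable_compose[OF _ borel_measurable_Re] measurable_compose[OF _ borel_measurable_Im])
 then obtain p q where p: "p \<in> borel_measurable lborel" "AE x in lborel. Re (g x) = p x"
  and q: "q \<in> borel_measurable lborel" "AE x in lborel. Im (g x) = q x"
  by (metis completion_ex_borel_measurable_real)
 have "(%x. Complex (p x) (q x)) \<in> borel_measurable borel"
  using p(1) q(1) by (simp add: borel_measurable_complex_iff)
 moreover have "AE x in lebesgue. g x = Complex (p x) (q x)"
  by (rule AE_completion, use p(2) q(2) in eventually_elim) (simp add: complex_eq_iff)
 ultimately show thesis by (rule that)
qed

lemma integral_lebesgue_on:
 fixes f :: "'a::euclidean_space => 'b::{banach,second_countable_topology}"
 assumes "D \<in> sets borel"
 shows "(LINT x|lebesgue_on D. f x) = (LINT x|lebesgue. indicator D x *R f x)"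
  and "integrable (lebesgue_on D) f \<longleftrightarrow> integrable lebesgue (%x. indicator D x *R f x)"
 using assms by (auto simp: integral_restrict_space integrable_restrict_space)

lemma integral_lebesgue_on_borel:
 fixes f :: "'a::euclidean_space => 'b::{banach,second_countable_topology}"
 assumes D: "D \<in> sets borel" and f: "f \<in> borel_measurable borel"
 shows "(LINT x|lebesgue_on D. f x) = (LINT x|lborel. indicator D x *R f x)"
  and "integrable (lebesgue_on D) f \<longleftrightarrow> intble (%x. indicator D x *R f x)"
proof -
 have "(%x. indicator D x *R f x) \<in> borel_measurable lborel" using D f by simp
 then show "(LINT x|lebesgue_on D. f x) = (LINT x|lborel. indicator D x *R f x)"
  "integrable (lebesgue_on D) f \<longleftrightarrow> intble (%x. indicator D x *R f x)"
  by (simp_all only: integral_lebesgue_on[OF D] integral_completion integrable_completion)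
qed

theorem fundamental_lemma_variations:
 fixes g :: "real^2 => complex"
 assumes D: "open D" and g: "integrable (lebesgue_on D) g"
  and z: "!!et. et \<in> test_functions D ==> (LINT x|lebesgue_on D. g x * of_real (et x)) = 0"
 shows "AE x in lebesgue_on D. g x = 0"
proof -
 have Dm: "D \<in> sets borel" using D by simp
 obtain f where f: "f \<in> borel_measurable borel" "AE x in lebesgue. indicator D x *R g x = f x"
  using complex_ex_borel[of "%x. indicator D x *R g x"] g Dm by (auto simp: integral_lebesgue_on)
 have fi: "integrable lebesgue f"
  using g f(2) by (subst integrable_cong_AE[symmetric, where f="%x. indicator D x *R g x"])
   (use f(1) Dm in \<open>auto simp: integral_lebesgue_on measurable_completion\<close>)
 then have fi: "intble f" using f(1) by (simp add: integrable_completion)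
 have test: "(LINT x|lborel. et x *R f x) = 0" if et: "et \<in> test_functions D" for et
 proof -
  have etm: "et \<in> borel_measurable borel" using et by (auto simp: test_functions_def intro: C1_measurable)
  have "(LINT x|lborel. et x *R f x) = (LINT x|lebesgue. et x *R f x)"
   using etm f(1) by (intro integral_completion[symmetric]) simp
  also have "... = (LINT x|lebesgue. indicator D x *R (g x * of_real (et x)))"
  proof (rule integral_cong_AE)
   show "(%x. et x *R f x) \<in> borel_measurable lebesgue" using etm f(1) by (intro measurable_completion) simp
   have "(%x. et x *R (indicator D x *R g x)) \<in> borel_measurable lebesgue"
    using etm borel_measurable_integrable[OF g[unfolded integral_lebesgue_on(2)[OF Dm]]]
    by (intro borel_measurable_scaleR[OF measurable_completion[of et lborel]]) auto
   then show "(%x. indicator D x *R (g x * of_real (et x))) \<in> borel_measurable lebesgue"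
    by (simp add: scaleR_conv_of_real mult_ac)
   show "AE x in lebesgue. et x *R f x = indicator D x *R (g x * of_real (et x))"
    using f(2) by eventually_elim (simp add: scaleR_conv_of_real mult_ac flip: )
  qed
  also have "... = 0" using z[OF et] by (simp add: integral_lebesgue_on[OF Dm])
  finally show ?thesis .
 qed
 have sub: "(LINT x|lborel. indicator (box a b) x *R f x) = 0" if ab: "cbox a b \<subseteq> D" for a b
 proof (rule box_bump[of a b])
  fix ze :: "nat => real^2 => real"
  assume ze: "!!n. C1_on UNIV (ze n)" "!!n x. \<bar>ze n x\<bar> <= 1" "!!n x. x \<notin> box a b ==> ze n x = 0"
   "!!x. (%n. ze n x) ---> indicator (box a b) x"
  have "ze n \<in> test_functions D" for n
   by (rule test_functionsI[OF ze(1) compact_cbox ab]) (use ze(3) box_subset_cbox in blast)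
  then have "(LINT x|lborel. ze n x *R f x) = 0" for n by (rule test)
  moreover have "(%n. LINT x|lborel. ze n x *R f x) ---> (LINT x|lborel. indicator (box a b) x *R f x)"
  proof (rule integral_dominated_convergence[where w="%x. norm (f x)"])
   show "AE x in lborel. norm (ze n x *R f x) <= norm (f x)" for n
    using mult_right_mono[OF ze(2)[of n] norm_ge_zero] by (auto intro!: AE_I2)
   show "AE x in lborel. (%n. ze n x *R f x) ---> indicator (box a b) x *R f x"
    by (intro AE_I2 tendsto_scaleR ze(4) tendsto_const)
  qed (use fi f(1) C1_measurable(1)[OF ze(1)] in auto)
  ultimately show ?thesis by (simp add: LIMSEQ_const_iff)
 qed
 have loc: "AE x in lborel. x \<in> cbox a b --> f x = 0" if ab: "cbox a b \<subseteq> D" for a b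
 proof -
  have "AE x in lborel. indicator (box a b) x *R f x = 0"
  proof (rule AE_zero_if_box_integrals_zero)
   show "intble (%x. indicator (box a b) x *R f x)" using fi by (intro integrable_mult_indicator) auto
   show "(LINT x|lborel. indicator (box a b) x *R f x) = 0" by (rule sub[OF ab])
   fix c d
   obtain p q where pq: "box c d \<inter> box a b = box p q" by (auto simp: box_Int_box)
   show "(LINT x|lborel. indicator (box c d) x *R indicator (box a b) x *R f x) = 0"
   proof (cases "box p q = {}")
    case False
    then have "cbox p q \<subseteq> cbox a b"
     using pq by (metis Int_lower2 box_subset_cbox closed_cbox closure_box closure_minimal order_trans)
    then have "(LINT x|lborel. indicator (box p q) x *R f x) = 0" using ab by (intro sub) auto
    then show ?thesis by (simp flip: pq indicator_inter_arith)
   next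
    case True
    then have "(%x. indicator (box c d) x *R indicator (box a b) x *R f x) = (%_. 0)"
     using pq by (auto simp: fun_eq_iff indicator_def)
    then show ?thesis by simp
   qed
  qed
  moreover have "AE x in lborel. x \<notin> cbox a b - box a b" by (rule AE_not_in[OF null_sets_cbox_Diff_box])
  ultimately show ?thesis by eventually_elim (auto simp: indicator_def split: if_splits)
 qed
 obtain \<D> where \<D>: "countable \<D>" "\<D> \<subseteq> Pow D" "!!X. X \<in> \<D> ==> \<exists>a b. X = cbox a b" "\<Union>\<D> = D"
  using open_countable_Union_open_cbox[OF D] by metis
 have "AE x in lborel. \<forall>X\<in>\<D>. x \<in> X --> f x = 0"
 proof (subst AE_ball_countable[OF \<D>(1)], intro ballI)
  fix X assume "X \<in> \<D>"
  then obtain a b where "X = cbox a b" "cbox a b \<subseteq> D" using \<D>(2,3) by blast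
  then show "AE x in lborel. x \<in> X --> f x = 0" using loc by blast
 qed
 then have "AE x in lborel. x \<in> D --> f x = 0" by eventually_elim (use \<D>(4) in blast)
 then have "AE x in lebesgue. x \<in> D --> f x = 0" by (rule AE_completion)
 then have "AE x in lebesgue. x \<in> D --> g x = 0" using f(2) by eventually_elim auto
 then show ?thesis using Dm by (simp add: AE_restrict_space_iff)
qed

section \<open>Weak derivatives, the Sobolev norm and traces\<close>

lemma L2_measurable: "u \<in> L2 M ==> u \<in> borel_measurable M"
 and L2_norm: "u \<in> L2 M ==> integrable M (%x. (cmod (u x))^2)"
 by (simp_all add: L2_def)

lemma measurable_cmod_squared:
 "f \<in> borel_measurable M ==> (%x. (cmod (f x))^2) \<in> borel_measurable M"
 by measurable

lemma L2_bound:
 assumes "u \<in> borel_measurable M" "integrable M g" "!!x. (cmod (u x))^2 <= g x"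
 shows "u \<in> L2 M"
proof -
 have "integrable M (%x. (cmod (u x))^2)"
 proof (rule Bintegrable_bound[OF assms(2)])
  show "(%x. (cmod (u x))^2) \<in> borel_measurable M"
   by (rule measurable_cmod_squared[OF assms(1)])
  show "AE x in M. norm ((cmod (u x))^2) <= norm (g x)"
   using order_trans[OF assms(3) abs_ge_self] by simp
 qed
 then show ?thesis using assms(1) by (simp add: L2_def)
qed

lemma L2_add:
 assumes "u \<in> L2 M" "v \<in> L2 M"
 shows "(%x. u x + v x) \<in> L2 M"
proof (rule L2_bound)
 show "(%x. u x + v x) \<in> borel_measurable M" using assms by (intro borel_measurable_add L2_measurable)
 show "integrable M (%x. 2 * (cmod (u x))^2 + 2 * (cmod (v x))^2)"
  using assms by (intro Bintegrable_add integrable_mult_right L2_norm)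
qed (rule norm_add_squared_le)

lemma L2_scale:
 assumes "u \<in> L2 M"
 shows "(%x. c * u x) \<in> L2 M"
proof (rule L2_bound)
 show "(%x. c * u x) \<in> borel_measurable M" by (rule borel_measurable_times[OF borel_measurable_const L2_measurable[OF assms]])
 show "integrable M (%x. (cmod c)^2 * (cmod (u x))^2)"
  using assms by (intro integrable_mult_right L2_norm)
qed (simp add: norm_mult power_mult_distrib)

lemma L2_mult_integrable:
 assumes "u \<in> L2 M" "v \<in> L2 M"
 shows "integrable M (%x. u x * v x)"
proof (rule Bintegrable_bound)
 show "integrable M (%x. (cmod (u x))^2 + (cmod (v x))^2)"
  using assms by (intro Bintegrable_add L2_norm)
 show "(%x. u x * v x) \<in> borel_measurable M" using assms by (intro borel_measurable_times L2_measurable)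
 have "cmod (u x) * cmod (v x) <= (cmod (u x))^2 + (cmod (v x))^2" for x
  using abs_inner_le_squares[of "cmod (u x)" "cmod (v x)"] by simp
 then show "AE x in M. norm (u x * v x) <= norm ((cmod (u x))^2 + (cmod (v x))^2)"
  by (intro AE_I2) (simp add: norm_mult)
qed

lemma borel_measurable_lebesgue_on:
 "f \<in> borel_measurable borel ==> f \<in> borel_measurable (lebesgue_on D)"
 by (intro measurable_restrict_space1 measurable_completion) simp

lemma L2_continuous_bounded:
 fixes u :: "real^2 => complex"
 assumes "open D" "bounded D" "cts u"
 shows "u \<in> L2 (lebesgue_on D)"
proof (rule L2_bound)
 show "u \<in> borel_measurable (lebesgue_on D)"
  using assms(3) by (intro borel_measurable_lebesgue_on borel_measurable_continuous_onI)
 obtain R where R: "!!x. x \<in> D ==> norm x <= R" using assms(2) by (auto simp: bounded_iff)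
 have "intble (%x. indicator (cball 0 R) x *R (cmod (u x))^2)"
  by (intro borel_integrable_compact continuous_intros continuous_on_subset[OF assms(3)]) auto
 from integrable_mult_indicator[OF _ this, of D]
 have "intble (%x. indicator D x *R (cmod (u x))^2)"
 proof -
  assume "D \<in> sets lborel ==> intble (%x. indicator D x *R indicator (cball 0 R) x *R (cmod (u x))^2)"
  moreover have "(%x. indicator D x *R indicator (cball 0 R) x *R (cmod (u x))^2) = (%x. indicator D x *R (cmod (u x))^2)"
   using R by (auto simp: fun_eq_iff indicator_def)
  ultimately show ?thesis using assms(1) by simp
 qed
 moreover have "(%x. (cmod (u x))^2) \<in> borel_measurable borel"
  by (intro borel_measurable_continuous_onI continuous_intros assms(3))
 ultimately show "integrable (lebesgue_on D) (%x. (cmod (u x))^2)"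
  using assms(1) by (simp only: integral_lebesgue_on_borel(2) borel_open)
qed simp

lemma L2_cong_AE:
 assumes "u \<in> L2 M" "u' \<in> borel_measurable M" "AE x in M. u x = u' x"
 shows "u' \<in> L2 M"
proof -
 have "integrable M (%x. (cmod (u' x))^2)"
 proof (rule integrable_cong_AE_imp[OF L2_norm[OF assms(1)]])
  show "(%x. (cmod (u' x))^2) \<in> borel_measurable M"
   by (rule measurable_cmod_squared[OF assms(2)])
  show "AE x in M. (cmod (u x))^2 = (cmod (u' x))^2" using assms(3) by eventually_elim simp
 qed
 then show ?thesis using assms(2) by (simp add: L2_def)
qed

lemma test_function_L2:
 assumes "et \<in> test_functions D" "open D" "bounded D"
 shows "(%x. of_real (et x)) \<in> L2 (lebesgue_on D)" "(%x. of_real (pd j et x)) \<in> L2 (lebesgue_on D)"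
proof -
 have C1: "C1_on UNIV et" using assms(1) by (simp add: test_functions_def)
 then have "cts et" "cts (pd j et)"
  by (auto simp: C1_on_continuous C1_on_def)
 then show "(%x. of_real (et x)) \<in> L2 (lebesgue_on D)" "(%x. of_real (pd j et x)) \<in> L2 (lebesgue_on D)"
  by (auto intro!: L2_continuous_bounded assms continuous_intros)
qed

lemma weak_deriv_unique:
 assumes D: "open D" "bounded D" and v: "is_weak_deriv D j u v" and v': "is_weak_deriv D j u v'"
 shows "AE x in lebesgue_on D. v x = v' x"
proof -
 have L: "v \<in> L2 (lebesgue_on D)" "v' \<in> L2 (lebesgue_on D)" using v v' by (auto simp: is_weak_deriv_def)
 have one: "(%_. 1) \<in> L2 (lebesgue_on D)" by (intro L2_continuous_bounded D continuous_intros)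
 have int: "integrable (lebesgue_on D) v" "integrable (lebesgue_on D) v'"
  using L2_mult_integrable[OF L(1) one] L2_mult_integrable[OF L(2) one] by simp_all
 have "AE x in lebesgue_on D. v x - v' x = 0"
 proof (rule fundamental_lemma_variations[OF D(1)])
  show "integrable (lebesgue_on D) (%x. v x - v' x)" using int by simp
  fix et assume et: "et \<in> test_functions D"
  have "(LINT x|lebesgue_on D. (v x - v' x) * of_real (et x))
    = (LINT x|lebesgue_on D. v x * of_real (et x)) - (LINT x|lebesgue_on D. v' x * of_real (et x))"
   unfolding left_diff_distrib
   by (intro Bintegral_diff L2_mult_integrable L test_function_L2[OF et D])
  also have "... = 0" using v v' et by (simp add: is_weak_deriv_def)
  finally show "(LINT x|lebesgue_on D. (v x - v' x) * of_real (et x)) = 0" .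
 qed
 then show ?thesis by eventually_elim simp
qed

lemma is_weak_deriv_combination:
 assumes D: "open D" "bounded D" and u: "u \<in> L2 (lebesgue_on D)" "u' \<in> L2 (lebesgue_on D)"
  and v: "is_weak_deriv D j u v" and v': "is_weak_deriv D j u' v'"
 shows "is_weak_deriv D j (%x. a * u x + b * u' x) (%x. a * v x + b * v' x)"
 unfolding is_weak_deriv_def
proof (intro conjI ballI)
 have L: "v \<in> L2 (lebesgue_on D)" "v' \<in> L2 (lebesgue_on D)" using v v' by (auto simp: is_weak_deriv_def)
 show "(%x. a * v x + b * v' x) \<in> L2 (lebesgue_on D)" by (intro L2_add L2_scale L)
 fix et assume et: "et \<in> test_functions D"
 note t = test_function_L2[OF et D]
 have lin: "(LINT x|lebesgue_on D. (a * f x + b * g x) * h x)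
   = a * (LINT x|lebesgue_on D. f x * h x) + b * (LINT x|lebesgue_on D. g x * h x)"
  if "f \<in> L2 (lebesgue_on D)" "g \<in> L2 (lebesgue_on D)" "h \<in> L2 (lebesgue_on D)" for f g h
 proof -
  have "(LINT x|lebesgue_on D. (a * f x + b * g x) * h x) = (LINT x|lebesgue_on D. a * (f x * h x) + b * (g x * h x))"
   by (simp add: algebra_simps)
  also have "... = (LINT x|lebesgue_on D. a * (f x * h x)) + (LINT x|lebesgue_on D. b * (g x * h x))"
   by (intro Bintegral_add integrable_mult_right L2_mult_integrable that)
  finally show ?thesis by (simp add: integral_mult_right_zero)
 qed
 show "(LINT x|lebesgue_on D. (a * u x + b * u' x) * of_real (pd j et x)) =
    - (LINT x|lebesgue_on D. (a * v x + b * v' x) * of_real (et x))"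
  unfolding lin[OF u t(2)] lin[OF L t(1)]
  using v v' et by (simp add: is_weak_deriv_def)
qed

lemma is_weak_deriv_cong_AE:
 assumes "u \<in> borel_measurable (lebesgue_on D)" "u' \<in> borel_measurable (lebesgue_on D)"
  "AE x in lebesgue_on D. u x = u' x"
 shows "is_weak_deriv D j u v \<longleftrightarrow> is_weak_deriv D j u' v"
proof -
 have "(LINT x|lebesgue_on D. u x * of_real (pd j et x)) = (LINT x|lebesgue_on D. u' x * of_real (pd j et x))"
  if "et \<in> test_functions D" for et
 proof (rule integral_cong_AE)
  have m: "(%x. cor (pd j et x)) \<in> borel_measurable (lebesgue_on D)"
  proof -
   have [measurable]: "pd j et \<in> borel_measurable borel"
    using that by (intro C1_measurable(2)) (simp add: test_functions_def)
   show ?thesis by (intro borel_measurable_lebesgue_on) measurable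
  qed
  show "(%x. u x * of_real (pd j et x)) \<in> borel_measurable (lebesgue_on D)"
   "(%x. u' x * of_real (pd j et x)) \<in> borel_measurable (lebesgue_on D)"
   using m assms(1,2) by (auto intro: borel_measurable_times)
  show "AE x in lebesgue_on D. u x * of_real (pd j et x) = u' x * of_real (pd j et x)"
   using assms(3) by eventually_elim simp
 qed
 then show ?thesis by (simp add: is_weak_deriv_def)
qed

lemma H1_weak_deriv: "u \<in> H1 D ==> is_weak_deriv D j u (weak_deriv D j u)"
proof -
 assume "u \<in> H1 D"
 then obtain v where "is_weak_deriv D j u v" by (auto simp: H1_def)
 then show ?thesis unfolding weak_deriv_def by (rule someI[of "is_weak_deriv D j u"])
qed

lemma H1_L2: "u \<in> H1 D ==> u \<in> L2 (lebesgue_on D)"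
 by (simp add: H1_def)

lemma H1_norm_eq:
 assumes D: "open D" "bounded D" and v: "!!j. is_weak_deriv D j u (v j)"
 shows "(H1_norm D u)^2 = (LINT x|lebesgue_on D. (cmod (u x))^2) + (\<Sum>j\<in>UNIV. LINT x|lebesgue_on D. (cmod (v j x))^2)"
proof -
 have w: "is_weak_deriv D j u (weak_deriv D j u)" for j
  unfolding weak_deriv_def by (rule someI[of "is_weak_deriv D j u", OF v])
 have "(LINT x|lebesgue_on D. (cmod (weak_deriv D j u x))^2) = (LINT x|lebesgue_on D. (cmod (v j x))^2)" for j
 proof (rule integral_cong_AE)
  show "(%x. (cmod (weak_deriv D j u x))^2) \<in> borel_measurable (lebesgue_on D)"
   "(%x. (cmod (v j x))^2) \<in> borel_measurable (lebesgue_on D)"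
   using w[of j] v[of j] by (auto simp: is_weak_deriv_def dest!: L2_measurable)
  show "AE x in lebesgue_on D. (cmod (weak_deriv D j u x))^2 = (cmod (v j x))^2"
   using weak_deriv_unique[OF D w[of j] v[of j]] by eventually_elim simp
 qed
 then show ?thesis
  unfolding H1_norm_def by (simp add: sum_nonneg integral_nonneg_AE)
qed

lemma H1_norm_nonneg: "H1_norm D u >= 0"
 by (simp add: H1_norm_def sum_nonneg integral_nonneg_AE)

lemma H1_combination:
 assumes D: "open D" "bounded D" and u: "u \<in> H1 D" "u' \<in> H1 D"
 shows "(%x. a * u x + b * u' x) \<in> H1 D"
proof -
 have "is_weak_deriv D j (%x. a * u x + b * u' x) (%x. a * weak_deriv D j u x + b * weak_deriv D j u' x)" for j
  by (intro is_weak_deriv_combination D H1_L2 u H1_weak_deriv)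
 moreover have "(%x. a * u x + b * u' x) \<in> L2 (lebesgue_on D)" by (intro L2_add L2_scale H1_L2 u)
 ultimately show ?thesis by (auto simp: H1_def)
qed

lemma H1_norm_combination:
 assumes D: "open D" "bounded D" and u: "u \<in> H1 D" "u' \<in> H1 D"
 shows "(H1_norm D (%x. a * u x + b * u' x))^2 <= 2 * (cmod a)^2 * (H1_norm D u)^2 + 2 * (cmod b)^2 * (H1_norm D u')^2"
proof -
 let ?M = "lebesgue_on D"
 have est: "(LINT x|?M. (cmod (a * f x + b * g x))^2) <= 2 * (cmod a)^2 * (LINT x|?M. (cmod (f x))^2) + 2 * (cmod b)^2 * (LINT x|?M. (cmod (g x))^2)"
  if "f \<in> L2 ?M" "g \<in> L2 ?M" for f g
 proof -
  have "(LINT x|?M. (cmod (a * f x + b * g x))^2) <= (LINT x|?M. 2 * (cmod a)^2 * (cmod (f x))^2 + 2 * (cmod b)^2 * (cmod (g x))^2)"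
  proof (rule integral_mono)
   show "integrable ?M (%x. (cmod (a * f x + b * g x))^2)" by (intro L2_norm L2_add L2_scale that)
   show "integrable ?M (%x. 2 * (cmod a)^2 * (cmod (f x))^2 + 2 * (cmod b)^2 * (cmod (g x))^2)"
    by (intro Bintegrable_add integrable_mult_right L2_norm that)
   fix x
   show "(cmod (a * f x + b * g x))^2 <= 2 * (cmod a)^2 * (cmod (f x))^2 + 2 * (cmod b)^2 * (cmod (g x))^2"
    using norm_add_squared_le[of "a * f x" "b * g x"] by (simp add: norm_mult power_mult_distrib)
  qed
  also have "... = (LINT x|?M. 2 * (cmod a)^2 * (cmod (f x))^2) + (LINT x|?M. 2 * (cmod b)^2 * (cmod (g x))^2)"
   by (intro Bintegral_add integrable_mult_right L2_norm that)
  finally show ?thesis by (simp only: integral_mult_right_zero)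
 qed
 have w: "weak_deriv D j u \<in> L2 ?M" "weak_deriv D j u' \<in> L2 ?M" for j
  using H1_weak_deriv[OF u(1)] H1_weak_deriv[OF u(2)] by (auto simp: is_weak_deriv_def)
 have "(H1_norm D (%x. a * u x + b * u' x))^2 = (LINT x|?M. (cmod (a * u x + b * u' x))^2)
   + (\<Sum>j\<in>UNIV. LINT x|?M. (cmod (a * weak_deriv D j u x + b * weak_deriv D j u' x))^2)"
  by (intro H1_norm_eq D is_weak_deriv_combination H1_L2 u H1_weak_deriv)
 also have "... <= (2 * (cmod a)^2 * (LINT x|?M. (cmod (u x))^2) + 2 * (cmod b)^2 * (LINT x|?M. (cmod (u' x))^2))
   + (\<Sum>j\<in>UNIV. 2 * (cmod a)^2 * (LINT x|?M. (cmod (weak_deriv D j u x))^2) + 2 * (cmod b)^2 * (LINT x|?M. (cmod (weak_deriv D j u' x))^2))"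
  by (intro add_mono sum_mono est H1_L2 u w)
 also have "... = 2 * (cmod a)^2 * (H1_norm D u)^2 + 2 * (cmod b)^2 * (H1_norm D u')^2"
  unfolding H1_norm_eq[OF D H1_weak_deriv[OF u(1)]] H1_norm_eq[OF D H1_weak_deriv[OF u(2)]]
  by (simp add: sum.distrib sum_distrib_left algebra_simps)
 finally show ?thesis .
qed

lemma C1_weak_deriv:
 fixes u :: "real^2 => complex"
 assumes D: "open D" "bounded D" and u: "C1_on UNIV u"
 shows "is_weak_deriv D j u (pd j u)"
 unfolding is_weak_deriv_def
proof (intro conjI ballI)
 have cu: "cts u" "cts (pd j u)"
  using u by (auto simp: C1_on_continuous C1_on_def)
 show "pd j u \<in> L2 (lebesgue_on D)" by (rule L2_continuous_bounded[OF D cu(2)])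
 fix et assume et: "et \<in> test_functions D"
 obtain K R where K: "C1_on UNIV et" "K \<subseteq> D" "!!x. x \<notin> K ==> et x = 0" "!!x. norm x > R ==> et x = 0"
  using test_functionsE[OF et] by metis
 have supp: "closure {x. et x \<noteq> 0} \<subseteq> D" using et by (simp add: test_functions_def)
 have dz: "pd j et x = 0" if "x \<notin> D" for x
 proof -
  have "open (- closure {x. et x \<noteq> 0})" "x \<in> - closure {x. et x \<noteq> 0}" using supp that by auto
  moreover have "et y = 0" if "y \<in> - closure {x. et x \<noteq> 0}" for y
   using that closure_subset[of "{x. et x \<noteq> 0}"] by auto
  ultimately have "pd j et x = pd j (%_. 0) x" by (intro partial_deriv_cong_open)
  then show ?thesis using has_grad_partial_deriv[OF has_grad_const[of "0::real"]] by simp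
 qed
 have e: "C1_on UNIV (%x. cor (et x))" by (rule C1_on_linear[OF bounded_linear_of_real K(1)])
 have pe: "pd j (%x. cor (et x)) x = of_real (pd j et x)" for x
  by (rule partial_deriv_linear[OF bounded_linear_of_real C1_on_differentiable[OF K(1) UNIV_I]])
 have prod: "C1_on UNIV (%x. u x * of_real (et x))" by (intro C1_on_bilinear[OF bounded_bilinear_mult] u e)
 have pp: "pd j (%x. u x * of_real (et x)) x = pd j u x * of_real (et x) + u x * of_real (pd j et x)" for x
  using has_grad_partial_deriv[OF has_grad_bilinear[OF bounded_bilinear_mult C1_on_has_grad[OF u] C1_on_has_grad[OF e]], of x j]
  by (simp add: pe)
 have c: "cts (%x. cor (et x))" "cts (%x. cor (pd j et x))"
  using K(1) by (intro continuous_on_of_real C1_on_continuous K(1), intro continuous_on_of_real, simp add: C1_on_def)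
 have i1: "intble (%x. pd j u x * of_real (et x))"
  by (rule bdd_support(1)[where R=R]) (auto intro!: continuous_on_mult cu c simp: K)
 have i2: "intble (%x. u x * of_real (pd j et x))"
  by (rule bdd_support(1)[where R=R]) (auto intro!: continuous_on_mult cu c simp: partial_deriv_eq_0[OF K(4)])
 have "0 = (LINT x|lborel. pd j u x * of_real (et x) + u x * of_real (pd j et x))"
  using integral_partial_deriv_eq_0[OF prod, of R j] by (simp add: pp K)
 also have "... = (LINT x|lborel. pd j u x * of_real (et x)) + (LINT x|lborel. u x * of_real (pd j et x))"
  by (rule Bintegral_add[OF i1 i2])
 finally have *: "(LINT x|lborel. u x * of_real (pd j et x)) = - (LINT x|lborel. pd j u x * of_real (et x))"
  by (simp add: eq_neg_iff_add_eq_0 add.commute)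
 have "(%x. indicator D x *R (u x * of_real (pd j et x))) = (%x. u x * of_real (pd j et x))"
  "(%x. indicator D x *R (pd j u x * of_real (et x))) = (%x. pd j u x * of_real (et x))"
  using dz K(2,3) by (auto simp: fun_eq_iff indicator_def)
 moreover have "(%x. u x * of_real (pd j et x)) \<in> borel_measurable borel"
  "(%x. pd j u x * of_real (et x)) \<in> borel_measurable borel"
  using i1 i2 by (auto dest: borel_measurable_integrable)
 ultimately show "(LINT x|lebesgue_on D. u x * of_real (pd j et x)) = - (LINT x|lebesgue_on D. pd j u x * of_real (et x))"
  using D(1) * by (simp only: integral_lebesgue_on_borel borel_open)
qed

lemma C1_H1:
 fixes u :: "real^2 => complex"
 assumes "open D" "bounded D" "C1_on UNIV u"
 shows "u \<in> H1 D"
 using C1_weak_deriv[OF assms] L2_continuous_bounded[OF assms(1,2) C1_on_continuous[OF assms(3)]]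
 by (auto simp: H1_def)

lemma measurable_boundary_measure:
 "f \<in> borel_measurable (boundary_measure D) \<longleftrightarrow> f \<in> borel_measurable (restrict_space borel (frontier D))"
proof -
 have "sets (measure_of UNIV (sets borel) hausdorff1_outer) = sets (borel :: (real^2) measure)"
  using sets.sigma_sets_eq[of "borel :: (real^2) measure"] by (simp add: sets_measure_of_conv)
 note eq = measurable_cong_sets[OF sets_restrict_space_cong[OF this, of "frontier D"] refl[of "sets borel"]]
 show ?thesis unfolding boundary_measure_def eq ..
qed

lemma space_boundary_measure: "space (boundary_measure D) = frontier D"
 unfolding boundary_measure_def space_restrict_space space_measure_of_conv by (rule Int_UNIV_right)

lemma continuous_measurable_boundary:
 fixes u :: "real^2 => complex"
 shows "cts u ==> u \<in> borel_measurable (boundary_measure D)"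
 unfolding measurable_boundary_measure
 by (rule measurable_restrict_space1[OF borel_measurable_continuous_onI])

lemma H1_norm_zero:
 assumes "open D" "bounded D" shows "H1_norm D (%_. 0) = 0"
proof -
 have "(H1_norm D (%_. 0))^2 = (LINT x|lebesgue_on D. (cmod 0)^2) + (\<Sum>j\<in>(UNIV::2 set). LINT x|lebesgue_on D. (cmod 0)^2)"
 proof (rule H1_norm_eq[OF assms])
  show "is_weak_deriv D j (%_. 0) (%_. 0)" for j by (simp add: is_weak_deriv_def L2_def)
 qed
 then show ?thesis by simp
qed

lemma has_trace_C1:
 fixes u :: "real^2 => complex"
 assumes D: "open D" "bounded D" and u: "C1_on UNIV u" and f: "!!x. x \<in> frontier D ==> f x = u x"
 shows "has_trace D u f"
 unfolding has_trace_def
proof (intro conjI exI[of _ "%_. u"] allI)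
 show "u \<in> H1 D" by (rule C1_H1[OF D u])
 have "u \<in> borel_measurable (boundary_measure D)"
  by (rule continuous_measurable_boundary[OF C1_on_continuous[OF u]])
 then show "f \<in> borel_measurable (boundary_measure D)"
  by (subst measurable_cong[of _ _ u]) (simp_all add: space_boundary_measure f)
 show "(%n::nat. H1_norm D (%x. u x - u x)) ---> 0" by (simp add: H1_norm_zero[OF D])
 have "(\<integral>\<^sup>+x. ennreal ((cmod (u x - f x))^2) \<partial>boundary_measure D) = (\<integral>\<^sup>+x. 0 \<partial>boundary_measure D)"
  by (rule nn_integral_cong) (simp add: space_boundary_measure f)
 then show "(%n::nat. \<integral>\<^sup>+x. ennreal ((cmod (u x - f x))^2) \<partial>boundary_measure D) ---> 0" by simp
qed (rule u)

lemma has_trace_combination: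
 assumes D: "open D" "bounded D" and t: "has_trace D u f" and t': "has_trace D u' f'"
 shows "has_trace D (%x. a * u x + b * u' x) (%x. a * f x + b * f' x)"
proof -
 let ?B = "boundary_measure D"
 obtain v where v: "!!n. C1_on UNIV (v n)" "(%n. H1_norm D (%x. u x - v n x)) ---> 0"
  "(%n. \<integral>\<^sup>+x. ennreal ((cmod (v n x - f x))^2) \<partial>?B) ---> 0" "u \<in> H1 D" "f \<in> borel_measurable ?B"
  using t by (auto simp: has_trace_def)
 obtain v' where v': "!!n. C1_on UNIV (v' n)" "(%n. H1_norm D (%x. u' x - v' n x)) ---> 0"
  "(%n. \<integral>\<^sup>+x. ennreal ((cmod (v' n x - f' x))^2) \<partial>?B) ---> 0" "u' \<in> H1 D" "f' \<in> borel_measurable ?B"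
  using t' by (auto simp: has_trace_def)
 have H1v: "(%x. u x - v n x) \<in> H1 D" "(%x. u' x - v' n x) \<in> H1 D" for n
  using H1_combination[OF D v(4) C1_H1[OF D v(1)[of n]], of 1 "-1"]
   H1_combination[OF D v'(4) C1_H1[OF D v'(1)[of n]], of 1 "-1"] by simp_all
 show ?thesis unfolding has_trace_def
 proof (intro conjI exI[of _ "%n x. a * v n x + b * v' n x"] allI)
  show "(%x. a * u x + b * u' x) \<in> H1 D" by (rule H1_combination[OF D v(4) v'(4)])
  show "(%x. a * f x + b * f' x) \<in> borel_measurable ?B"
   using v(5) v'(5) by (intro borel_measurable_add borel_measurable_times) auto
  show "C1_on UNIV (%x. a * v n x + b * v' n x)" for n
   by (intro C1_on_add C1_on_linear[OF bounded_linear_mult_right] v v')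
  show "(%n. H1_norm D (%x. (a * u x + b * u' x) - (a * v n x + b * v' n x))) ---> 0"
  proof -
   have "(%n. (H1_norm D (%x. (a * u x + b * u' x) - (a * v n x + b * v' n x)))^2) ---> 0"
   proof (rule Lim_null_comparison[OF always_eventually[rule_format]])
    fix n
    have eq: "(%x. (a * u x + b * u' x) - (a * v n x + b * v' n x)) = (%x. a * (u x - v n x) + b * (u' x - v' n x))"
     by (simp add: algebra_simps)
    show "norm ((H1_norm D (%x. (a * u x + b * u' x) - (a * v n x + b * v' n x)))^2)
     <= 2 * (cmod a)^2 * (H1_norm D (%x. u x - v n x))^2 + 2 * (cmod b)^2 * (H1_norm D (%x. u' x - v' n x))^2"
     unfolding eq using H1_norm_combination[OF D H1v(1)[of n] H1v(2)[of n], of a b] by simp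
   next
    show "(%n. 2 * (cmod a)^2 * (H1_norm D (%x. u x - v n x))^2 + 2 * (cmod b)^2 * (H1_norm D (%x. u' x - v' n x))^2) ---> 0"
     by (rule tendsto_eq_intros refl v(2) v'(2))+ simp
   qed
   from tendsto_real_sqrt[OF this] show ?thesis by (simp add: H1_norm_nonneg)
  qed
  have m: "v n \<in> borel_measurable ?B" "v' n \<in> borel_measurable ?B" for n
   by (intro continuous_measurable_boundary C1_on_continuous v v')+
  have "(%n. \<integral>\<^sup>+x. ennreal ((cmod ((a * v n x + b * v' n x) - (a * f x + b * f' x)))^2) \<partial>?B) ---> 0"
  proof (rule tendsto_sandwich[OF always_eventually[rule_format] always_eventually[rule_format] tendsto_const])
   fix n
   show "(\<integral>\<^sup>+x. ennreal ((cmod ((a * v n x + b * v' n x) - (a * f x + b * f' x)))^2) \<partial>?B)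
    <= ennreal (2 * (cmod a)^2) * (\<integral>\<^sup>+x. ennreal ((cmod (v n x - f x))^2) \<partial>?B)
     + ennreal (2 * (cmod b)^2) * (\<integral>\<^sup>+x. ennreal ((cmod (v' n x - f' x))^2) \<partial>?B)"
   proof -
    have "(\<integral>\<^sup>+x. ennreal ((cmod ((a * v n x + b * v' n x) - (a * f x + b * f' x)))^2) \<partial>?B)
     <= (\<integral>\<^sup>+x. ennreal (2 * (cmod a)^2) * ennreal ((cmod (v n x - f x))^2) + ennreal (2 * (cmod b)^2) * ennreal ((cmod (v' n x - f' x))^2) \<partial>?B)"
    proof (rule nn_integral_mono)
     fix x
     have "(a * v n x + b * v' n x) - (a * f x + b * f' x) = a * (v n x - f x) + b * (v' n x - f' x)"
      by (simp add: algebra_simps)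
     then have "(cmod ((a * v n x + b * v' n x) - (a * f x + b * f' x)))^2
      <= 2 * (cmod a)^2 * (cmod (v n x - f x))^2 + 2 * (cmod b)^2 * (cmod (v' n x - f' x))^2"
      using norm_add_squared_le[of "a * (v n x - f x)" "b * (v' n x - f' x)"]
      by (simp add: norm_mult power_mult_distrib)
     then show "ennreal ((cmod ((a * v n x + b * v' n x) - (a * f x + b * f' x)))^2)
      <= ennreal (2 * (cmod a)^2) * ennreal ((cmod (v n x - f x))^2) + ennreal (2 * (cmod b)^2) * ennreal ((cmod (v' n x - f' x))^2)"
      by (simp add: ennreal_leI flip: ennreal_mult ennreal_plus)
    qed
    also have "... = ennreal (2 * (cmod a)^2) * (\<integral>\<^sup>+x. ennreal ((cmod (v n x - f x))^2) \<partial>?B)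
     + ennreal (2 * (cmod b)^2) * (\<integral>\<^sup>+x. ennreal ((cmod (v' n x - f' x))^2) \<partial>?B)"
    proof -
     have "(%x. ennreal ((cmod (v n x - f x))^2)) \<in> borel_measurable ?B"
      "(%x. ennreal ((cmod (v' n x - f' x))^2)) \<in> borel_measurable ?B"
      by (intro measurable_compose[OF _ measurable_ennreal] measurable_cmod_squared
        borel_measurable_diff m v(5) v'(5))+
     then show ?thesis by (simp add: nn_integral_add nn_integral_cmult)
    qed
    finally show ?thesis .
   qed
  next
   have "(%n. ennreal (2 * (cmod a)^2) * (\<integral>\<^sup>+x. ennreal ((cmod (v n x - f x))^2) \<partial>?B)
     + ennreal (2 * (cmod b)^2) * (\<integral>\<^sup>+x. ennreal ((cmod (v' n x - f' x))^2) \<partial>?B)) ---> ennreal (2 * (cmod a)^2) * 0 + ennreal (2 * (cmod b)^2) * 0"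
    by (intro tendsto_add ennreal_tendsto_cmult v v') auto
   then show "(%n. ennreal (2 * (cmod a)^2) * (\<integral>\<^sup>+x. ennreal ((cmod (v n x - f x))^2) \<partial>?B)
     + ennreal (2 * (cmod b)^2) * (\<integral>\<^sup>+x. ennreal ((cmod (v' n x - f' x))^2) \<partial>?B)) ---> 0" by simp
  qed simp
  then show "(%n. \<integral>\<^sup>+x. ennreal ((cmod ((a * v n x + b * v' n x) - (a * f x + b * f' x)))^2) \<partial>?B) ---> 0" .
 qed
qed

text \<open>Values on null sets of \<open>D\<close> influence neither the weak derivatives nor the
norm.\<close>

lemma has_trace_cong_AE:
 assumes D: "open D" "bounded D" and t: "has_trace D u f"
  and u': "u' \<in> borel_measurable (lebesgue_on D)" "AE x in lebesgue_on D. u x = u' x"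
 shows "has_trace D u' f"
proof -
 have uH: "u \<in> H1 D" using t by (simp add: has_trace_def)
 have um: "u \<in> borel_measurable (lebesgue_on D)" using H1_L2[OF uH] by (rule L2_measurable)
 have u'H: "u' \<in> H1 D"
  using L2_cong_AE[OF H1_L2[OF uH] u'] H1_weak_deriv[OF uH] is_weak_deriv_cong_AE[OF um u', of _ "weak_deriv D _ u"]
  unfolding H1_def by blast
 have "H1_norm D (%x. u' x - v x) = H1_norm D (%x. u x - v x)" if "v \<in> borel_measurable (lebesgue_on D)" for v
 proof -
  have m: "(%x. u' x - v x) \<in> borel_measurable (lebesgue_on D)" "(%x. u x - v x) \<in> borel_measurable (lebesgue_on D)"
   by (intro borel_measurable_diff u'(1) um that)+
  have ae: "AE x in lebesgue_on D. u' x - v x = u x - v x" using u'(2) by eventually_elim simp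
  have "weak_deriv D j (%x. u' x - v x) = weak_deriv D j (%x. u x - v x)" for j
   unfolding weak_deriv_def by (intro arg_cong[where f=Eps] ext is_weak_deriv_cong_AE[OF m ae])
  moreover have "(LINT x|lebesgue_on D. (cmod (u' x - v x))^2) = (LINT x|lebesgue_on D. (cmod (u x - v x))^2)"
  proof (rule integral_cong_AE)
   show "AE x in lebesgue_on D. (cmod (u' x - v x))^2 = (cmod (u x - v x))^2" using u'(2) by eventually_elim simp
  qed (rule measurable_cmod_squared m)+
  ultimately show ?thesis by (simp add: H1_norm_def)
 qed
 then have eq: "H1_norm D (%x. u' x - v x) = H1_norm D (%x. u x - v x)" if "C1_on UNIV v" for v
  using that by (blast intro: borel_measurable_lebesgue_on C1_measurable(1))
 obtain v where v: "\<forall>n::nat. C1_on UNIV (v n)" "(%n. H1_norm D (%x. u x - v n x)) ---> 0"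
  "(%n. \<integral>\<^sup>+x. ennreal ((cmod (v n x - f x))^2) \<partial>boundary_measure D) ---> 0"
  "f \<in> borel_measurable (boundary_measure D)"
  using t unfolding has_trace_def by blast
 moreover have "(%n. H1_norm D (%x. u' x - v n x)) ---> 0"
  using v(2) by (simp only: eq[OF v(1)[rule_format]])
 ultimately show ?thesis using u'H unfolding has_trace_def by blast
qed

section \<open>Radial functions and the radial Helmholtz operator\<close>

lemma C2_onI:
 assumes S: "open S"
  and u: "!!x. x \<in> S ==> has_grad u (%j. G j x) x"
  and G: "!!x j. x \<in> S ==> has_grad (G j) (%i. H j i x) x"
  and H: "!!i j. continuous_on S (H j i)"
 shows "C2_on S u" "!!x j. x \<in> S ==> pd j (pd j u) x = H j j x"
  "!!x j. x \<in> S ==> pd j u x = G j x"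
proof -
 show p: "pd j u x = G j x" if "x \<in> S" for x j by (rule has_grad_partial_deriv[OF u[OF that]])
 have g: "has_grad (pd j u) (%i. H j i x) x" if "x \<in> S" for x j
  by (rule has_grad_cong_open[OF G[OF that] S that]) (simp add: p)
 show "pd j (pd j u) x = H j j x" if "x \<in> S" for x j
  by (rule has_grad_partial_deriv[OF g[OF that]])
 show "C2_on S u" unfolding C2_on_def
  by (intro conjI allI C1_onI[OF u] C1_onI[OF g] H has_grad_continuous_on[OF G])
qed

lemma C2_on_imp_C1_on: "C2_on S u ==> C1_on S u"
 by (simp add: C2_on_def)

definition laplace :: "(real^2 => 'b::real_normed_vector) => real^2 => 'b" where
 "laplace u x = (\<Sum>j\<in>UNIV. pd j (pd j u) x)"

lemma laplacian_eq: "laplacian u x = laplace u x"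
 by (simp add: laplacian_def laplace_def)

lemma has_grad_radial:
 fixes V :: "real => 'b::real_normed_vector"
 assumes "(V has_vector_derivative V') (at ((x - c) \<bullet> (x - c)))"
 shows "has_grad (%x. V ((x - c) \<bullet> (x - c))) (%j. (2 * (x $ j - c $ j)) *R V') x"
proof -
 have "((%x. (x - c) \<bullet> (x - c)) has_derivative (%h. 2 * ((x - c) \<bullet> h))) (at x)"
  by (auto intro!: derivative_eq_intros simp: inner_commute)
 from has_derivative_compose[OF this assms[unfolded has_vector_derivative_def]]
 have "((%x. V ((x - c) \<bullet> (x - c))) has_derivative (%h. (2 * ((x - c) \<bullet> h)) *R V')) (at x)" .
 moreover have "(2 * ((x - c) \<bullet> h)) *R V' = (\<Sum>j\<in>UNIV. (h $ j) *R ((2 * (x $ j - c $ j)) *R V'))" for h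
  unfolding inner_vec_def by (simp add: sum_distrib_left scaleR_sum_left mult_ac)
 ultimately show ?thesis by (simp add: has_grad_def)
qed

lemma radial_C2:
 fixes V :: "real => 'b::real_normed_vector" and c :: "real^2"
 assumes T: "open T"
  and V: "!!s. s \<in> T ==> (V has_vector_derivative V' s) (at s)"
  and V': "!!s. s \<in> T ==> (V' has_vector_derivative V'' s) (at s)"
  and V'': "continuous_on T V''"
 defines "S \<equiv> {x. (x - c) \<bullet> (x - c) \<in> T}" and "u \<equiv> %x. V ((x - c) \<bullet> (x - c))"
 shows "open S" "C2_on S u"
  "!!x. x \<in> S ==> laplace u x = (4 * ((x - c) \<bullet> (x - c))) *R V'' ((x - c) \<bullet> (x - c)) + 4 *R V' ((x - c) \<bullet> (x - c))"
  "!!x j. x \<in> S ==> pd j u x = (2 * (x $ j - c $ j)) *R V' ((x - c) \<bullet> (x - c))"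
proof -
 have "open ((%x. (x - c) \<bullet> (x - c)) -` T)" by (intro open_vimage T continuous_intros)
 then show S: "open S" by (simp add: S_def vimage_def)
 define G where "G j x = (2 * (x $ j - c $ j)) *R V' ((x - c) \<bullet> (x - c))" for j x
 define H where "H j i x = (if i = j then 2 *R V' ((x - c) \<bullet> (x - c)) else 0)
  + (4 * (x $ j - c $ j) * (x $ i - c $ i)) *R V'' ((x - c) \<bullet> (x - c))" for j i x
 have cV': "continuous_on T V'"
  unfolding continuous_on_eq_continuous_within
  using V' by (blast intro: has_vector_derivative_continuous has_vector_derivative_at_within)
 have u: "has_grad u (%j. G j x) x" if "x \<in> S" for x
  unfolding u_def G_def by (rule has_grad_radial[OF V]) (use that in \<open>simp add: S_def\<close>)
 have G: "has_grad (G j) (%i. H j i x) x" if "x \<in> S" for x j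
 proof -
  have 1: "has_grad (%x. 2 * (x $ j - c $ j)) (%i. if i = j then 2 else 0) x"
   by (rule has_grad_coordinate) (auto intro!: derivative_eq_intros)
  have 2: "has_grad (%x. V' ((x - c) \<bullet> (x - c))) (%i. (2 * (x $ i - c $ i)) *R V'' ((x - c) \<bullet> (x - c))) x"
   by (rule has_grad_radial[OF V']) (use that in \<open>simp add: S_def\<close>)
  have "(%i. (if i = j then 2 else 0) *R V' ((x - c) \<bullet> (x - c)) + (2 * (x $ j - c $ j)) *R ((2 * (x $ i - c $ i)) *R V'' ((x - c) \<bullet> (x - c))))
   = (%i. H j i x)" by (auto simp: H_def fun_eq_iff algebra_simps)
  with has_grad_bilinear[OF bounded_bilinear_scaleR 1 2] show ?thesis unfolding G_def[abs_def] by simp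
 qed
 have H: "continuous_on S (H j i)" for i j
 proof -
  have "continuous_on S (%x. V' ((x - c) \<bullet> (x - c)))" "continuous_on S (%x. V'' ((x - c) \<bullet> (x - c)))"
   by (rule continuous_on_compose2[OF cV'] continuous_on_compose2[OF V''], auto simp: S_def intro!: continuous_intros)+
  then show ?thesis unfolding H_def[abs_def] by (cases "i = j") (auto intro!: continuous_intros)
 qed
 show "C2_on S u" by (rule C2_onI(1)[OF S u G H])
 show "pd j u x = (2 * (x $ j - c $ j)) *R V' ((x - c) \<bullet> (x - c))" if "x \<in> S" for x j
  using C2_onI(3)[OF S u G H that] by (simp add: G_def)
 fix x assume x: "x \<in> S"
 have "laplace u x = (\<Sum>j\<in>UNIV. H j j x)" unfolding laplace_def by (simp add: C2_onI(2)[OF S u G H x])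
 also have "... = 4 *R V' ((x - c) \<bullet> (x - c)) + (\<Sum>j\<in>UNIV. (4 * (x $ j - c $ j) * (x $ j - c $ j)) *R V'' ((x - c) \<bullet> (x - c)))"
  by (simp add: H_def sum.distrib) (simp add: UNIV_2 flip: scaleR_add_left)
 also have "(\<Sum>j\<in>UNIV. (4 * (x $ j - c $ j) * (x $ j - c $ j)) *R V'' ((x - c) \<bullet> (x - c)))
   = (4 * ((x - c) \<bullet> (x - c))) *R V'' ((x - c) \<bullet> (x - c))"
 proof -
  have "(\<Sum>j\<in>UNIV. 4 * (x $ j - c $ j) * (x $ j - c $ j)) = 4 * ((x - c) \<bullet> (x - c))"
   by (simp only: inner_vec_def sum_distrib_left mult.assoc inner_real_def vector_minus_component)
  then show ?thesis by (simp only: scaleR_sum_left[symmetric])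
 qed
 finally show "laplace u x = (4 * ((x - c) \<bullet> (x - c))) *R V'' ((x - c) \<bullet> (x - c)) + 4 *R V' ((x - c) \<bullet> (x - c))"
  by (simp add: add.commute)
qed

lemma antiderivative_exists:
 fixes g :: "real => real"
 assumes "cts g"
 shows "\<exists>G. G t0 = 0 \<and> (\<forall>x. (G has_real_derivative g x) (at x))"
proof -
 have "\<exists>F. \<forall>x::real. -\<infinity> < ereal x --> ereal x < \<infinity> --> (F has_vector_derivative g x) (at x)"
  by (rule einterval_antiderivative) (use assms in \<open>auto simp: continuous_on_eq_continuous_at\<close>)
 then obtain F where F: "!!x. (F has_real_derivative g x) (at x)"
  by (auto simp: has_real_derivative_iff_has_vector_derivative)
 have "((%x. F x - F t0) has_real_derivative g x) (at x)" for x
  using DERIV_diff[OF F[of x] DERIV_const[of "F t0"]] by simp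
 then show ?thesis by (intro exI[of _ "%x. F x - F t0"]) simp
qed

lemma deriv_zero_const:
 fixes R :: "real => real"
 assumes "!!x. (R has_real_derivative g x) (at x)" "convex U" "!!x. x \<in> U ==> g x = 0" "s \<in> U" "t \<in> U"
 shows "R s = R t"
proof -
 have "\<exists>c. \<forall>x\<in>U. R x = c"
 proof (rule has_derivative_zero_constant[OF assms(2)])
  fix x assume "x \<in> U"
  then have "(R has_real_derivative 0) (at x within U)"
   using assms(1)[of x] assms(3) by (auto intro: has_field_derivative_at_within)
  then show "(R has_derivative (%h. 0)) (at x within U)" by (simp add: has_field_derivative_def lambda_zero)
 qed
 then show ?thesis using assms(4,5) by auto
qed

text \<open>Reduction of order: with \<open>V = j q\<close> the radial Helmholtz equation for
\<open>V\<close> determines the derivative of \<open>q\<close> as \<open>R / (4 s j^2)\<close>,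
where \<open>R\<close> is a primitive of \<open>j f\<close>. As \<open>R\<close> vanishes outside
\<open>{a..b}\<close>, neither the zero of \<open>s\<close> nor possible zeros of \<open>j\<close>
beyond \<open>s0\<close> matter, and \<open>V\<close> vanishes beyond \<open>b\<close>.\<close>

lemma radial_equation_solvable:
 fixes j j' j'' f R :: "real => real"
 assumes j: "!!s. (j has_real_derivative j' s) (at s)" "!!s. (j' has_real_derivative j'' s) (at s)"
   "cts j''"
  and ode: "!!s. 4 * s * j'' s + 4 * j' s + ka * j s = 0"
  and jpos: "!!s. 0 < s ==> s < s0 ==> j s > 0"
  and ab: "0 < a" "a < b" "b < s0"
  and f: "cts f" "!!s. s \<notin> {a..b} ==> f s = 0"
  and R: "!!s. (R has_real_derivative j s * f s) (at s)" "R a = 0" "R b = 0"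
 shows "\<exists>V V' V''. (\<forall>s. (V has_real_derivative V' s) (at s)) \<and> (\<forall>s. (V' has_real_derivative V'' s) (at s)) \<and>
  cts V'' \<and> (\<forall>s\<ge>b. V s = 0) \<and> (\<forall>s. 4 * s * V'' s + 4 * V' s + ka * V s = f s)"
proof -
 have cj: "cts j" "cts j'"
  by (rule DERIV_continuous_on, use j in \<open>blast intro: has_field_derivative_at_within\<close>)+
 have fa: "f a = 0" and fb: "f b = 0"
 proof -
  have "isCont f a" "isCont f b" using f(1) by (auto simp: continuous_on_eq_continuous_at)
  have "\<forall>\<^sub>F s in at_left a. f s = 0" unfolding eventually_at_left_field by (intro exI[of _ "a - 1"]) (auto intro!: f(2))
  then have "(f \<longlongrightarrow> 0) (at_left a)" by (rule tendsto_eventually)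
  moreover have "(f \<longlongrightarrow> f a) (at_left a)" using \<open>isCont f a\<close> by (simp add: isCont_def filterlim_at_split)
  ultimately show "f a = 0" using tendsto_unique[OF trivial_limit_at_left_real] by blast
  have "\<forall>\<^sub>F s in at_right b. f s = 0" unfolding eventually_at_right_field by (intro exI[of _ "b + 1"]) (auto intro!: f(2))
  then have "(f \<longlongrightarrow> 0) (at_right b)" by (rule tendsto_eventually)
  moreover have "(f \<longlongrightarrow> f b) (at_right b)" using \<open>isCont f b\<close> by (simp add: isCont_def filterlim_at_split)
  ultimately show "f b = 0" using tendsto_unique[OF trivial_limit_at_right_real] by blast
 qed
 have f_le: "f s = 0" if "s <= a" for s using that fa f(2)[of s] by (cases "s = a") auto
 have f_ge: "f s = 0" if "s >= b" for s using that fb f(2)[of s] by (cases "s = b") auto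
 have R_le: "R s = 0" if "s <= a" for s
  using deriv_zero_const[OF R(1), of "{..a}" s a] that R(2) f_le by auto
 have R_ge: "R s = 0" if "s >= b" for s
  using deriv_zero_const[OF R(1), of "{b..}" s b] that R(3) f_ge by auto
 define B where "B = {a/2<..<s0}"
 have jB: "j s > 0" "s > 0" if "s \<in> B" for s using that ab jpos[of s] by (auto simp: B_def)
 define S where "S s = (if s \<in> B then R s / (4 * s * (j s)^2) else 0)" for s
 define S' where "S' s = (if s \<in> B then ((j s * f s) * (4 * s * (j s)^2) - R s * (4 * (j s)^2 + 8 * s * j s * j' s)) / (4 * s * (j s)^2)^2 else 0)" for s
 have S_le: "S s = 0" "S' s = 0" if "s <= a" for s using that R_le[of s] f_le[of s] by (auto simp: S_def S'_def)
 have S_ge: "S s = 0" "S' s = 0" if "s >= b" for s using that R_ge[of s] f_ge[of s] by (auto simp: S_def S'_def)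
 have cover: "s < a \<or> s > b \<or> s \<in> B" for s using ab by (auto simp: B_def)
 have S: "(S has_real_derivative S' s) (at s)" for s
  using cover[of s]
 proof (elim disjE)
  assume s: "s < a"
  have "((%_. 0) has_real_derivative 0) (at s)" by simp
  then have "(S has_real_derivative 0) (at s)"
   by (rule has_field_derivative_transform_within_open[where S="{..<a}"]) (use s S_le in auto)
  then show ?thesis using s by (simp add: S_le)
 next
  assume s: "s > b"
  have "((%_. 0) has_real_derivative 0) (at s)" by simp
  then have "(S has_real_derivative 0) (at s)"
   by (rule has_field_derivative_transform_within_open[where S="{b<..}"]) (use s S_ge in auto)
  then show ?thesis using s by (simp add: S_ge)
 next
  assume s: "s \<in> B"
  have d: "((%s. 4 * s * (j s)^2) has_real_derivative 4 * (j s)^2 + 8 * s * j s * j' s) (at s)"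
   by (auto intro!: derivative_eq_intros j simp: power2_eq_square)
  have "4 * s * (j s)^2 \<noteq> 0" using jB[OF s] by simp
  from DERIV_divide[OF R(1) d this]
  have "((%s. R s / (4 * s * (j s)^2)) has_real_derivative S' s) (at s)"
   using s by (simp add: S'_def power2_eq_square)
  then show ?thesis
   by (rule has_field_derivative_transform_within_open[where S=B]) (use s in \<open>auto simp: S_def B_def\<close>)
 qed
 have cR: "cts R"
  by (rule DERIV_continuous_on, use R in \<open>blast intro: has_field_derivative_at_within\<close>)
 have S'_cont: "cts S'"
 proof -
  have "continuous_on B S'"
  proof (rule continuous_on_cong[THEN iffD2, OF refl])
   show "continuous_on B (%s. ((j s * f s) * (4 * s * (j s)^2) - R s * (4 * (j s)^2 + 8 * s * j s * j' s)) / (4 * s * (j s)^2)^2)"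
    by (intro continuous_intros continuous_on_subset[OF cj(1)] continuous_on_subset[OF cj(2)]
      continuous_on_subset[OF f(1)] continuous_on_subset[OF cR]) (use jB in \<open>auto simp: less_imp_neq[symmetric]\<close>)
  qed (simp add: S'_def)
  moreover have "continuous_on {..<a} S'"
   by (rule continuous_on_cong[THEN iffD2, OF refl _ continuous_on_const[of _ 0]]) (simp add: S_le)
  moreover have "continuous_on {b<..} S'"
   by (rule continuous_on_cong[THEN iffD2, OF refl _ continuous_on_const[of _ 0]]) (simp add: S_ge)
  ultimately have "isCont S' s" for s
   using cover[of s] by (auto simp: continuous_on_eq_continuous_at B_def)
  then show ?thesis by (simp add: continuous_on_eq_continuous_at)
 qed
 have cS: "cts S"
  by (rule DERIV_continuous_on, use S in \<open>blast intro: has_field_derivative_at_within\<close>)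
 obtain Q where Q: "Q b = 0" "!!s. (Q has_real_derivative S s) (at s)"
  using antiderivative_exists[OF cS] by metis
 have Q_ge: "Q s = 0" if "s >= b" for s
  using deriv_zero_const[OF Q(2), of "{b..}" s b] that Q(1) S_ge by auto
 have cQ: "cts Q"
  by (rule DERIV_continuous_on, use Q in \<open>blast intro: has_field_derivative_at_within\<close>)
 let ?V = "%s. j s * Q s" and ?V' = "%s. j' s * Q s + j s * S s"
  and ?V'' = "%s. j'' s * Q s + 2 * j' s * S s + j s * S' s"
 show ?thesis
 proof (rule exI[of _ ?V], rule exI[of _ ?V'], rule exI[of _ ?V''], intro conjI allI impI)
  fix s
  show "(?V has_real_derivative ?V' s) (at s)"
   by (auto intro!: derivative_eq_intros j Q simp: algebra_simps)
  show "(?V' has_real_derivative ?V'' s) (at s)"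
   by (auto intro!: derivative_eq_intros j Q S simp: algebra_simps)
  show "?V s = 0" if "s >= b" using Q_ge[OF that] by simp
  have "4 * s * ?V'' s + 4 * ?V' s + ka * ?V s
    = Q s * (4 * s * j'' s + 4 * j' s + ka * j s) + (8 * s * j' s * S s + 4 * s * j s * S' s + 4 * j s * S s)"
   by (simp add: algebra_simps)
  also have "... = 8 * s * j' s * S s + 4 * s * j s * S' s + 4 * j s * S s" by (simp add: ode)
  also have "... = f s"
   using cover[of s]
  proof (elim disjE)
   assume s: "s \<in> B"
   let ?N = "4 * s * (j s)^2"
   have nz: "j s \<noteq> 0" "s \<noteq> 0" using jB[OF s] by auto
   have S_eq: "S s = R s / ?N" using s by (simp add: S_def)
   have S'_eq: "S' s = (j s * f s) / ?N - R s * (4 * (j s)^2 + 8 * s * j s * j' s) / ?N^2"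
    using s nz by (simp add: S'_def diff_divide_distrib power2_eq_square)
   have "4 * s * j s * S' s = f s - R s * (4 * (j s)^2 + 8 * s * j s * j' s) / (?N * j s)"
    unfolding S'_eq using nz by (simp add: field_simps power2_eq_square)
   moreover have "8 * s * j' s * S s + 4 * j s * S s = R s * (4 * (j s)^2 + 8 * s * j s * j' s) / (?N * j s)"
    unfolding S_eq using nz by (simp add: field_simps power2_eq_square)
   ultimately show ?thesis by simp
  qed (simp_all add: S_le S_ge f_le f_ge)
  finally show "4 * s * ?V'' s + 4 * ?V' s + ka * ?V s = f s" .
 next
  show "cts ?V''" by (intro continuous_intros j(3) cj cQ cS S'_cont)
 qed
qed

section \<open>Bessel functions and the fundamental solution\<close>

lemma entire_series_summable:
 fixes c :: "nat => real"
 assumes "!!n. \<bar>c n\<bar> <= K ^ n / fact n" "K >= 0"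
 shows "summable (%n. c n * y ^ n)"
proof (rule summable_comparison_test')
 show "summable (%n. inverse (fact n) * (K * \<bar>y\<bar>) ^ n)" by (rule summable_exp)
 fix n
 have "\<bar>c n\<bar> * \<bar>y\<bar> ^ n <= K ^ n / fact n * \<bar>y\<bar> ^ n" by (intro mult_right_mono assms) simp
 then show "norm (c n * y ^ n) <= inverse (fact n) * (K * \<bar>y\<bar>) ^ n"
  by (simp add: abs_mult power_abs power_mult_distrib field_simps)
qed

definition pser :: "(nat => real) => real => real" where
 "pser c s = (\<Sum>n. c n * s ^ n)"

lemma pser_facts:
 assumes c: "!!y::real. summable (%n. c n * y ^ n)"
 shows "(pser c has_real_derivative pser (diffs c) s) (at s)"
  "(pser (diffs c) has_real_derivative pser (diffs (diffs c)) s) (at s)"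
  "cts (pser (diffs (diffs c)))"
  "(%n. (real n + 1)^2 * c (Suc n) * s ^ n) sums (s * pser (diffs (diffs c)) s + pser (diffs c) s)"
  "(%n. c n * s ^ n) sums pser c s" "(%n. diffs c n * s ^ n) sums pser (diffs c) s"
proof -
 have c1: "summable (%n. diffs c n * y ^ n)" for y by (rule termdiff_converges_all[OF c])
 have c2: "summable (%n. diffs (diffs c) n * y ^ n)" for y by (rule termdiff_converges_all[OF c1])
 show "(pser c has_real_derivative pser (diffs c) s) (at s)"
  "(pser (diffs c) has_real_derivative pser (diffs (diffs c)) s) (at s)"
  unfolding pser_def[abs_def] by (rule termdiffs_strong_converges_everywhere[OF c] termdiffs_strong_converges_everywhere[OF c1])+
 have "(pser (diffs (diffs c)) has_real_derivative pser (diffs (diffs (diffs c))) s) (at s)" for s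
  unfolding pser_def[abs_def] by (rule termdiffs_strong_converges_everywhere[OF c2])
 then show "cts (pser (diffs (diffs c)))"
  by (intro DERIV_continuous_on) (blast intro: has_field_derivative_at_within)
 show s0: "(%n. c n * s ^ n) sums pser c s" and s1: "(%n. diffs c n * s ^ n) sums pser (diffs c) s"
  unfolding pser_def using c c1 by (auto intro: summable_sums)
 have "(%n. s * (diffs (diffs c) n * s ^ n)) sums (s * pser (diffs (diffs c)) s)"
  unfolding pser_def by (intro sums_mult summable_sums c2)
 moreover have "s * (diffs (diffs c) n * s ^ n) = (real (Suc n) * diffs c (Suc n) * s ^ Suc n)" for n
  by (simp add: diffs_def)
 ultimately have "(%n. real (Suc n) * diffs c (Suc n) * s ^ Suc n) sums (s * pser (diffs (diffs c)) s)" by simp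
 then have "(%n. real n * diffs c n * s ^ n) sums (s * pser (diffs (diffs c)) s)"
  by (subst (asm) sums_Suc_iff) simp
 from sums_add[OF this s1] show "(%n. (real n + 1)^2 * c (Suc n) * s ^ n) sums (s * pser (diffs (diffs c)) s + pser (diffs c) s)"
  by (rule sums_cong[THEN iffD1, rotated]) (simp add: diffs_def power2_eq_square algebra_simps)
qed

definition jcoef :: "real => nat => real" where
 "jcoef ka n = (-1) ^ n * (ka / 4) ^ n / (fact n)^2"

definition lcoef :: "real => nat => real" where
 "lcoef ka n = jcoef ka n * harm n"

lemma jcoef_Suc: "4 * (real n + 1)^2 * jcoef ka (Suc n) = - ka * jcoef ka n"
proof -
 define X where "X = (real n + 1)^2"
 have X: "X \<noteq> 0" by (simp add: X_def add_nonneg_eq_0_iff)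
 have F: "(fact (Suc n) :: real)^2 = X * (fact n)^2" by (simp add: X_def power_mult_distrib add.commute)
 show ?thesis unfolding jcoef_def F X_def[symmetric] power_Suc using X by (simp add: field_simps)
qed

lemma summable_jcoef: "ka >= 0 ==> summable (%n. jcoef ka n * y ^ n)"
proof (rule entire_series_summable[where K="ka / 4"])
 fix n assume "ka >= 0"
 then have "\<bar>jcoef ka n\<bar> = (ka / 4) ^ n / (fact n)^2" by (simp add: jcoef_def abs_mult power_abs)
 also have "... <= (ka / 4) ^ n / fact n"
  using \<open>ka >= 0\<close> by (intro divide_left_mono) (simp_all add: power2_eq_square mult_le_cancel_left1 fact_ge_1)
 finally show "\<bar>jcoef ka n\<bar> <= (ka / 4) ^ n / fact n" .
qed simp

lemma summable_lcoef: "ka >= 0 ==> summable (%n. lcoef ka n * y ^ n)"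
proof (rule entire_series_summable[where K="ka / 2"])
 fix n assume k: "ka >= 0"
 have h: "(harm n :: real) <= fact n"
 proof (induction n)
  case (Suc n)
  have "harm (Suc n) = harm n + inverse (real (Suc n))" by (simp add: harm_Suc)
  also have "... <= fact n + real n * fact n"
  proof (cases "n = 0")
   case False
   have "inverse (real (Suc n)) <= 1" by (simp add: inverse_le_1_iff)
   also have "1 <= real n * fact n" using False fact_ge_1[of n, where ?'a=real] mult_mono[of 1 "real n" 1 "fact n"] by simp
   finally show ?thesis using Suc.IH by simp
  qed (simp add: harm_def)
  also have "... = fact (Suc n)" by (simp add: algebra_simps)
  finally show ?case .
 qed (simp add: harm_def)
 have "\<bar>lcoef ka n\<bar> = (ka / 4) ^ n * harm n / (fact n)^2"
  using k harm_nonneg[of n, where ?'a=real] by (simp add: lcoef_def jcoef_def abs_mult power_abs)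
 also have "... <= (ka / 4) ^ n * fact n / (fact n)^2"
  using k h by (intro divide_right_mono mult_left_mono) auto
 also have "... = (ka / 4) ^ n / fact n" by (simp add: power2_eq_square)
 also have "... <= (ka / 2) ^ n / fact n" using k by (intro divide_right_mono power_mono) auto
 finally show "\<bar>lcoef ka n\<bar> <= (ka / 2) ^ n / fact n" .
qed simp

text \<open>The Bessel function \<open>J\<^sub>0 (k |x|)\<close> as a function of \<open>s =
|x|^2\<close>, with \<open>k^2\<close> as first argument, together with its derivatives in
\<open>s\<close>; \<open>lf\<close> is the harmonic series in \<open>Y\<^sub>0\<close>.\<close>

definition jf :: "real => real => real" where "jf ka = pser (jcoef ka)"
definition jf' :: "real => real => real" where "jf' ka = pser (diffs (jcoef ka))"
definition jf'' :: "real => real => real" where "jf'' ka = pser (diffs (diffs (jcoef ka)))"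
definition lf :: "real => real => real" where "lf ka = pser (lcoef ka)"
definition lf' :: "real => real => real" where "lf' ka = pser (diffs (lcoef ka))"
definition lf'' :: "real => real => real" where "lf'' ka = pser (diffs (diffs (lcoef ka)))"

lemma jf_deriv:
 assumes "ka >= 0"
 shows "(jf ka has_real_derivative jf' ka s) (at s)" "(jf' ka has_real_derivative jf'' ka s) (at s)"
  "cts (jf'' ka)"
 using pser_facts[OF summable_jcoef[OF assms]] by (simp_all add: jf_def jf'_def jf''_def)

lemma lf_deriv:
 assumes "ka >= 0"
 shows "(lf ka has_real_derivative lf' ka s) (at s)" "(lf' ka has_real_derivative lf'' ka s) (at s)"
  "cts (lf'' ka)"
 using pser_facts[OF summable_lcoef[OF assms]] by (simp_all add: lf_def lf'_def lf''_def)

lemma jf_ode: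
 assumes "ka >= 0"
 shows "4 * s * jf'' ka s + 4 * jf' ka s + ka * jf ka s = 0"
proof -
 note P = pser_facts(4-6)[OF summable_jcoef[OF assms], of s]
 have "(%n. 4 * ((real n + 1)^2 * jcoef ka (Suc n) * s ^ n) + ka * (jcoef ka n * s ^ n))
   sums (4 * (s * jf'' ka s + jf' ka s) + ka * jf ka s)"
  unfolding jf_def jf'_def jf''_def by (intro sums_add sums_mult P)
 moreover have "4 * ((real n + 1)^2 * jcoef ka (Suc n) * s ^ n) + ka * (jcoef ka n * s ^ n) = 0" for n
  using arg_cong[OF jcoef_Suc[of n ka], of "%x. x * s ^ n"] by (simp add: algebra_simps)
 ultimately have "(%n. 0) sums (4 * (s * jf'' ka s + jf' ka s) + ka * jf ka s)" by simp
 then have "4 * (s * jf'' ka s + jf' ka s) + ka * jf ka s = 0" by (rule sums_unique2[OF _ sums_zero])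
 then show ?thesis by (simp add: algebra_simps)
qed

text \<open>The series \<open>lf\<close> carries the harmonic numbers of \<open>Y\<^sub>0\<close>;
the right-hand side cancels against the derivative of the logarithm.\<close>

lemma lf_ode:
 assumes "ka >= 0"
 shows "4 * s * lf'' ka s + 4 * lf' ka s + ka * lf ka s = 4 * jf' ka s"
proof -
 note P = pser_facts(4-6)[OF summable_lcoef[OF assms], of s]
 note Q = pser_facts(6)[OF summable_jcoef[OF assms], of s]
 have "(%n. 4 * ((real n + 1)^2 * lcoef ka (Suc n) * s ^ n) + ka * (lcoef ka n * s ^ n))
   sums (4 * (s * lf'' ka s + lf' ka s) + ka * lf ka s)"
  unfolding lf_def lf'_def lf''_def by (intro sums_add sums_mult P)
 moreover have "4 * ((real n + 1)^2 * lcoef ka (Suc n) * s ^ n) + ka * (lcoef ka n * s ^ n)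
   = 4 * (diffs (jcoef ka) n * s ^ n)" for n
 proof -
  have hS: "(harm (Suc n) :: real) = harm n + 1 / (real n + 1)"
   by (simp add: harm_Suc inverse_eq_divide add.commute)
  define T where "T = 4 * (real n + 1)^2 * jcoef ka (Suc n)"
  have T: "ka * jcoef ka n = - T" by (simp add: T_def jcoef_Suc)
  have "4 * (real n + 1)^2 * lcoef ka (Suc n) + ka * lcoef ka n
   = T * (harm n + 1 / (real n + 1)) + (ka * jcoef ka n) * harm n"
   unfolding lcoef_def hS T_def by (simp only: mult_ac)
  also have "... = T / (real n + 1)" unfolding T by (simp add: distrib_left)
  also have "... = 4 * diffs (jcoef ka) n"
   by (simp add: T_def diffs_def power2_eq_square add.commute)
  finally have "4 * (real n + 1)^2 * lcoef ka (Suc n) + ka * lcoef ka n = 4 * diffs (jcoef ka) n" .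
  from arg_cong[OF this, of "%x. x * s ^ n"] show ?thesis by (simp add: algebra_simps)
 qed
 ultimately have "(%n. 4 * (diffs (jcoef ka) n * s ^ n)) sums (4 * (s * lf'' ka s + lf' ka s) + ka * lf ka s)" by simp
 from sums_unique2[OF this sums_mult[OF Q, of 4]] show ?thesis by (simp add: jf'_def algebra_simps)
qed

lemma jf_0: "jf ka 0 = 1"
 using powser_zero[of "jcoef ka"] by (simp add: jf_def pser_def jcoef_def)

lemma jf_continuous: "ka >= 0 ==> cts (jf ka)"
 by (intro DERIV_continuous_on) (blast intro: jf_deriv has_field_derivative_at_within)

lemma jf_near_1:
 assumes "ka >= 0" "e > 0"
 obtains s0 where "s0 > 0" "!!s. \<bar>s\<bar> < s0 ==> \<bar>jf ka s - 1\<bar> < e"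
proof -
 have "isCont (jf ka) 0" using jf_continuous[OF assms(1)] by (simp add: continuous_on_eq_continuous_at)
 then obtain d where "d > 0" "!!s. dist s 0 < d ==> dist (jf ka s) (jf ka 0) < e"
  using assms(2) unfolding continuous_at_eps_delta by (metis)
 then show thesis using that[of d] by (simp add: jf_0 dist_real_def)
qed

text \<open>As a function of the squared distance, \<open>J\<^sub>0\<close> is an entire power
series; this removes the singularity of the norm at the origin.\<close>

lemma bessel_J_0_eq: "bessel_J 0 (k * norm v) = jf (k^2) (v \<bullet> v)" for v :: "'a::real_inner"
proof -
 have "(-1) ^ m / (fact m * fact (m + 0)) * (k * norm v / 2) ^ (2 * m + 0) = jcoef (k^2) m * (v \<bullet> v) ^ m" for m
 proof -
  have "(k * norm v / 2) ^ (2 * m) = ((k^2 / 4) * (v \<bullet> v)) ^ m"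
   by (simp add: power_mult power_mult_distrib power_divide power2_norm_eq_inner)
  then show ?thesis
   by (simp only: jcoef_def add_0_right power_mult_distrib) (simp add: power2_eq_square)
 qed
 then show ?thesis by (simp add: bessel_J_def bessel_J_nat_def jf_def pser_def)
qed

text \<open>The function \<open>Y\<^sub>0 (k |x|)\<close> in terms of \<open>s = |x|^2\<close>, and
its derivatives.\<close>

definition Yf :: "real => real => real" where
 "Yf k s = 2 / pi * ((ln s / 2 + (ln (k / 2) + euler_mascheroni)) * jf (k^2) s - lf (k^2) s)"
definition Yf' :: "real => real => real" where
 "Yf' k s = 2 / pi * (jf (k^2) s / (2 * s) + (ln s / 2 + (ln (k / 2) + euler_mascheroni)) * jf' (k^2) s - lf' (k^2) s)"
definition Yf'' :: "real => real => real" where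
 "Yf'' k s = 2 / pi * (jf' (k^2) s / s - jf (k^2) s / (2 * s^2)
   + (ln s / 2 + (ln (k / 2) + euler_mascheroni)) * jf'' (k^2) s - lf'' (k^2) s)"

lemma Yf_deriv:
 assumes "s > 0"
 shows "(Yf k has_real_derivative Yf' k s) (at s)" "(Yf' k has_real_derivative Yf'' k s) (at s)"
proof -
 define ka A where "ka = k^2" and "A = ln (k / 2) + (euler_mascheroni :: real)"
 have k: "ka >= 0" by (simp add: ka_def)
 show "(Yf k has_real_derivative Yf' k s) (at s)"
  unfolding Yf_def[abs_def] Yf'_def ka_def[symmetric] A_def[symmetric] using assms
  by (auto intro!: derivative_eq_intros jf_deriv[OF k] lf_deriv[OF k] simp: field_simps)
 show "(Yf' k has_real_derivative Yf'' k s) (at s)"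
  unfolding Yf'_def[abs_def] Yf''_def ka_def[symmetric] A_def[symmetric] using assms
  by (auto intro!: derivative_eq_intros jf_deriv[OF k] lf_deriv[OF k] simp: field_simps power2_eq_square)
qed

lemma Yf''_continuous: "continuous_on {0<..} (Yf'' k)"
proof -
 have k: "k^2 >= 0" by simp
 have "cts (jf (k^2))" "cts (jf' (k^2))"
  by (intro DERIV_continuous_on, use jf_deriv[OF k] in \<open>blast intro: has_field_derivative_at_within\<close>)+
 then show ?thesis
  unfolding Yf''_def[abs_def]
  by (intro continuous_intros continuous_on_subset[OF jf_deriv(3)[OF k]] continuous_on_subset[OF lf_deriv(3)[OF k]])
    (auto elim: continuous_on_subset)
qed

lemma Yf_ode:
 assumes "s > 0"
 shows "4 * s * Yf'' k s + 4 * Yf' k s + k^2 * Yf k s = 0"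
proof -
 have k: "k^2 >= 0" by simp
 define A where "A = ln s / 2 + (ln (k / 2) + euler_mascheroni)"
 have "4 * s * Yf'' k s + 4 * Yf' k s + k^2 * Yf k s
  = 2 / pi * (A * (4 * s * jf'' (k^2) s + 4 * jf' (k^2) s + k^2 * jf (k^2) s)
    - (4 * s * lf'' (k^2) s + 4 * lf' (k^2) s + k^2 * lf (k^2) s) + 4 * jf' (k^2) s)"
  unfolding Yf_def Yf'_def Yf''_def A_def[symmetric] using assms
  by (simp add: field_simps power2_eq_square)
 then show ?thesis unfolding jf_ode[OF k] lf_ode[OF k] by simp
qed

text \<open>The fundamental solution as a function of the squared distance, and its
derivatives.\<close>

definition Phi :: "real => real => complex" where "Phi k s = Complex (- Yf k s / 4) (jf (k^2) s / 4)"
definition Phi' :: "real => real => complex" where "Phi' k s = Complex (- Yf' k s / 4) (jf' (k^2) s / 4)"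
definition Phi'' :: "real => real => complex" where "Phi'' k s = Complex (- Yf'' k s / 4) (jf'' (k^2) s / 4)"

lemma has_vector_derivative_Complex:
 assumes "(f has_real_derivative f') (at s)" "(g has_real_derivative g') (at s)"
 shows "((%s. Complex (f s) (g s)) has_vector_derivative Complex f' g') (at s)"
proof -
 have "((%s. of_real (f s) + \<i> * of_real (g s)) has_vector_derivative (of_real f' + \<i> * of_real g')) (at s)"
  using assms by (intro has_vector_derivative_add has_vector_derivative_mult_right has_vector_derivative_of_real)
   (simp_all add: has_real_derivative_iff_has_vector_derivative)
 then show ?thesis by (simp add: Complex_eq)
qed

lemma Phi_deriv:
 assumes "s > 0"
 shows "(Phi k has_vector_derivative Phi' k s) (at s)" "(Phi' k has_vector_derivative Phi'' k s) (at s)"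
 unfolding Phi_def[abs_def] Phi'_def[abs_def] Phi''_def using assms
 by (auto intro!: has_vector_derivative_Complex DERIV_cdivide DERIV_minus Yf_deriv jf_deriv)

lemma continuous_on_Complex:
 "continuous_on S f ==> continuous_on S g ==> continuous_on S (%x. Complex (f x) (g x))"
 unfolding Complex_eq by (intro continuous_intros)

lemma Phi''_continuous: "continuous_on {0<..} (Phi'' k)"
 unfolding Phi''_def[abs_def]
 by (intro continuous_on_Complex continuous_intros Yf''_continuous continuous_on_subset[OF jf_deriv(3)]) auto

lemma Phi_ode:
 assumes "s > 0"
 shows "of_real (4 * s) * Phi'' k s + 4 * Phi' k s + of_real (k^2) * Phi k s = 0"
 using Yf_ode[OF assms, of k] jf_ode[of "k^2" s]
 by (simp add: Phi_def Phi'_def Phi''_def complex_eq_iff field_simps)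

lemma fund_sol_eq:
 assumes k: "k > 0" and "x \<noteq> y"
 shows "fund_sol k x y = Phi k ((x - y) \<bullet> (x - y))"
proof -
 let ?v = "x - y"
 have v: "norm ?v > 0" using assms(2) by simp
 have ln: "ln (k * norm ?v / 2) = ln (?v \<bullet> ?v) / 2 + ln (k / 2)"
 proof -
  have "ln (?v \<bullet> ?v) = 2 * ln (norm ?v)"
   using v by (simp add: power2_norm_eq_inner[symmetric] ln_realpow)
  moreover have "ln (k * norm ?v / 2) = ln (k / 2) + ln (norm ?v)"
   using k v ln_mult_pos[of "k / 2" "norm ?v"] by simp
  ultimately show ?thesis by simp
 qed
 have "(-1) ^ m * harm m / (fact m)^2 * (k * norm ?v / 2) ^ (2 * m) = lcoef (k^2) m * (?v \<bullet> ?v) ^ m" for m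
 proof -
  have "(k * norm ?v / 2) ^ (2 * m) = ((k^2 / 4) * (?v \<bullet> ?v)) ^ m"
   by (simp add: power_mult power_mult_distrib power_divide power2_norm_eq_inner)
  then show ?thesis
   by (simp only: lcoef_def jcoef_def power_mult_distrib) simp
 qed
 then have "bessel_Y0 (k * norm ?v) = Yf k (?v \<bullet> ?v)"
  unfolding bessel_Y0_def Yf_def bessel_J_0_eq ln by (simp add: lf_def pser_def algebra_simps)
 then show ?thesis
  unfolding fund_sol_def hankel1_0_def bessel_J_0_eq Phi_def by (simp add: complex_eq_iff)
qed

section \<open>Weak solutions of the Helmholtz equation\<close>

text \<open>Twice continuously differentiable functions with compact support in
\<open>D\<close>.\<close>

definition C2c :: "(real^2) set => (real^2 => real) => bool" where
 "C2c D ze \<longleftrightarrow> C2_on UNIV ze \<and> (\<exists>K. compact K \<and> K \<subseteq> D \<and> (\<forall>x. x \<notin> K --> ze x = 0))"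

lemma partial_deriv_eq_0_outside:
 assumes K: "compact K" "!!x. x \<notin> K ==> ze x = 0" and x: "x \<notin> K"
 shows "pd j ze x = 0"
proof -
 have "open (- K)" using K(1) by (simp add: compact_imp_closed open_Compl)
 then have "pd j ze x = pd j (%_. 0) x"
  by (rule partial_deriv_cong_open) (use K x in auto)
 then show ?thesis using has_grad_partial_deriv[OF has_grad_const] by simp
qed

lemma C2cE:
 assumes "C2c D ze"
 obtains K R where "C2_on UNIV ze" "compact K" "K \<subseteq> D" "!!x. x \<notin> K ==> ze x = 0"
  "!!x. norm x > R ==> x \<notin> K"
proof -
 obtain K where K: "C2_on UNIV ze" "compact K" "K \<subseteq> D" "!!x. x \<notin> K ==> ze x = 0"
  using assms by (auto simp: C2c_def)
 obtain R where "!!x. x \<in> K ==> norm x <= R" using compact_imp_bounded[OF K(2)] by (auto simp: bounded_iff)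
 then have "!!x. norm x > R ==> x \<notin> K" by force
 with K show thesis by (rule that)
qed

lemma C2c_test_function:
 assumes "C2c D ze"
 shows "ze \<in> test_functions D" "pd j ze \<in> test_functions D"
proof -
 obtain K where K: "C2_on UNIV ze" "compact K" "K \<subseteq> D" "!!x. x \<notin> K ==> ze x = 0"
  using assms by (auto simp: C2c_def)
 show "ze \<in> test_functions D" by (rule test_functionsI[OF _ K(2-4)]) (use K(1) in \<open>simp add: C2_on_def\<close>)
 show "pd j ze \<in> test_functions D"
  by (rule test_functionsI[OF _ K(2,3) partial_deriv_eq_0_outside[OF K(2,4)]]) (use K(1) in \<open>simp_all add: C2_on_def\<close>)
qed

lemma laplace_continuous: "C2_on S u ==> continuous_on S (laplace u)"
 unfolding laplace_def[abs_def] by (intro continuous_on_sum) (simp add: C2_on_def C1_on_def)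

lemma laplace_eq_0_outside:
 assumes "compact K" "!!x. x \<notin> K ==> ze x = 0" "x \<notin> K"
 shows "laplace ze x = 0"
 unfolding laplace_def
 by (intro sum.neutral ballI partial_deriv_eq_0_outside[OF assms(1) partial_deriv_eq_0_outside[OF assms(1,2)] assms(3)])

lemma integral_divergence_form:
 fixes a :: "real^2 => complex" and ze :: "real^2 => real"
 assumes a: "C1_on UNIV a" and z: "C1_on UNIV ze" "!!x. norm x > R ==> ze x = 0"
 shows "(LINT x|lborel. a x * of_real (pd j ze x)) = - (LINT x|lborel. pd j a x * of_real (ze x))"
proof -
 have e: "C1_on UNIV (%x. cor (ze x))" by (rule C1_on_linear[OF bounded_linear_of_real z(1)])
 have pe: "pd j (%x. cor (ze x)) x = of_real (pd j ze x)" for x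
  by (rule partial_deriv_linear[OF bounded_linear_of_real C1_on_differentiable[OF z(1) UNIV_I]])
 have prod: "C1_on UNIV (%x. a x * of_real (ze x))" by (rule C1_on_bilinear[OF bounded_bilinear_mult a e])
 have pp: "pd j (%x. a x * of_real (ze x)) x = pd j a x * of_real (ze x) + a x * of_real (pd j ze x)" for x
  using has_grad_partial_deriv[OF has_grad_bilinear[OF bounded_bilinear_mult C1_on_has_grad[OF a] C1_on_has_grad[OF e]], of x j]
  by (simp add: pe)
 have c: "cts a" "cts (pd j a)"
  "cts (%x. cor (ze x))" "cts (%x. cor (pd j ze x))"
  using a z(1) C1_on_continuous[OF a] C1_on_continuous[OF z(1)] by (simp_all add: C1_on_def continuous_on_of_real)
 have i1: "intble (%x. pd j a x * of_real (ze x))"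
  by (rule bdd_support(1)[where R=R]) (auto intro!: continuous_on_mult c simp: z(2))
 have i2: "intble (%x. a x * of_real (pd j ze x))"
  by (rule bdd_support(1)[where R=R]) (auto intro!: continuous_on_mult c simp: partial_deriv_eq_0[OF z(2)])
 have "0 = (LINT x|lborel. pd j a x * of_real (ze x) + a x * of_real (pd j ze x))"
  using integral_partial_deriv_eq_0[OF prod, of R j] by (simp add: pp z(2))
 also have "... = (LINT x|lborel. pd j a x * of_real (ze x)) + (LINT x|lborel. a x * of_real (pd j ze x))"
  by (rule Bintegral_add[OF i1 i2])
 finally show ?thesis by (simp add: eq_neg_iff_add_eq_0 add.commute)
qed

lemma green_second:
 fixes a :: "real^2 => complex" and ze :: "real^2 => real"
 assumes a: "C2_on UNIV a" and z: "C2c UNIV ze"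
 shows "(LINT x|lborel. a x * of_real (laplace ze x)) = (LINT x|lborel. laplace a x * of_real (ze x))"
proof -
 obtain K R where K: "C2_on UNIV ze" "compact K" "!!x. x \<notin> K ==> ze x = 0" "!!x. norm x > R ==> x \<notin> K"
  using C2cE[OF z] by metis
 have zR: "ze x = 0" "pd j ze x = 0" "pd i (pd j ze) x = 0"
  if "norm x > R" for x i j
  by (rule K(3)[OF K(4)[OF that]])
    (rule partial_deriv_eq_0_outside[OF K(2,3) K(4)[OF that]]
    partial_deriv_eq_0_outside[OF K(2) partial_deriv_eq_0_outside[OF K(2,3)] K(4)[OF that]], assumption?)+
 have aC: "C1_on UNIV a" "C1_on UNIV (pd j a)" for j using a by (auto simp: C2_on_def)
 have zC: "C1_on UNIV ze" "C1_on UNIV (pd j ze)" for j using K(1) by (auto simp: C2_on_def)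
 have c: "cts a" "cts ze" by (rule C1_on_continuous[OF aC(1)] C1_on_continuous[OF zC(1)])+
 have c2: "cts (pd j (pd j a))" "cts (pd j (pd j ze))" for j
  using aC(2) zC(2) by (simp_all add: C1_on_def)
 have i1: "intble (%x. a x * of_real (pd j (pd j ze) x))" for j
  by (rule bdd_support(1)[where R=R]) (auto intro!: continuous_on_mult continuous_on_of_real c c2 simp: zR)
 have i2: "intble (%x. pd j (pd j a) x * of_real (ze x))" for j
  by (rule bdd_support(1)[where R=R]) (auto intro!: continuous_on_mult continuous_on_of_real c c2 simp: zR)
 have "(LINT x|lborel. a x * of_real (laplace ze x)) = (\<Sum>j\<in>UNIV. LINT x|lborel. a x * of_real (pd j (pd j ze) x))"
  unfolding laplace_def of_real_sum sum_distrib_left by (rule Bintegral_sum) (rule i1)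
 also have "... = (\<Sum>j\<in>UNIV. LINT x|lborel. pd j (pd j a) x * of_real (ze x))"
  by (intro sum.cong refl)
    (simp add: integral_divergence_form[OF aC(1) zC(2) zR(2)] integral_divergence_form[OF aC(2) zC(1) zR(1)])
 also have "... = (LINT x|lborel. laplace a x * of_real (ze x))"
  unfolding laplace_def sum_distrib_right by (rule Bintegral_sum[symmetric]) (rule i2)
 finally show ?thesis .
qed

definition weak_helmholtz :: "real => (real^2) set => (real^2 => complex) => bool" where
 "weak_helmholtz k D u \<longleftrightarrow> (\<forall>ze. C2c D ze --> (LINT x|lborel. u x * of_real (laplace ze x + k^2 * ze x)) = 0)"

lemma helmholtz_green:
 fixes a :: "real^2 => complex" and ze :: "real^2 => real"
 assumes a: "C2_on UNIV a" and z: "C2c UNIV ze"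
 shows "(LINT x|lborel. a x * of_real (laplace ze x + k^2 * ze x))
  = (LINT x|lborel. (laplace a x + of_real (k^2) * a x) * of_real (ze x))"
proof -
 obtain K R where K: "C2_on UNIV ze" "compact K" "!!x. x \<notin> K ==> ze x = 0" "!!x. norm x > R ==> x \<notin> K"
  using C2cE[OF z] by metis
 have ca: "cts a" using a by (simp add: C2_on_def C1_on_continuous)
 have cz: "cts ze" using K(1) by (simp add: C2_on_def C1_on_continuous)
 have i1: "intble (%x. a x * of_real (laplace ze x))"
  by (rule bdd_support(1)[where R=R])
    (auto intro!: continuous_on_mult continuous_on_of_real ca laplace_continuous[OF K(1)] simp: laplace_eq_0_outside[OF K(2,3) K(4)])
 have i2: "intble (%x. a x * of_real (ze x))"
  by (rule bdd_support(1)[where R=R])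
    (auto intro!: continuous_on_mult continuous_on_of_real ca cz simp: K(3,4))
 have i3: "intble (%x. laplace a x * of_real (ze x))"
  by (rule bdd_support(1)[where R=R])
    (auto intro!: continuous_on_mult continuous_on_of_real laplace_continuous[OF a] cz simp: K(3,4))
 have "(LINT x|lborel. a x * of_real (laplace ze x + k^2 * ze x))
   = (LINT x|lborel. a x * of_real (laplace ze x) + of_real (k^2) * (a x * of_real (ze x)))"
  by (simp add: algebra_simps)
 also have "... = (LINT x|lborel. a x * of_real (laplace ze x)) + of_real (k^2) * (LINT x|lborel. a x * of_real (ze x))"
  by (subst Bintegral_add[OF i1 integrable_mult_right[OF i2]]) (simp only: integral_mult_right_zero)
 also have "... = (LINT x|lborel. laplace a x * of_real (ze x) + of_real (k^2) * (a x * of_real (ze x)))"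
  unfolding green_second[OF a z]
  by (subst Bintegral_add[OF i3 integrable_mult_right[OF i2]]) (simp only: integral_mult_right_zero)
 also have "... = (LINT x|lborel. (laplace a x + of_real (k^2) * a x) * of_real (ze x))" by (simp add: algebra_simps)
 finally show ?thesis .
qed

lemma classical_weak_helmholtz:
 "C2_on UNIV a ==> (!!x. laplace a x + of_real (k^2) * a x = 0) ==> weak_helmholtz k UNIV a"
 unfolding weak_helmholtz_def
proof (intro allI impI)
 fix ze assume a: "C2_on UNIV a" "!!x. laplace a x + of_real (k^2) * a x = 0" and z: "C2c UNIV ze"
 show "(LINT x|lborel. a x * of_real (laplace ze x + k^2 * ze x)) = 0"
  unfolding helmholtz_green[OF a(1) z] a(2) by simp
qed

definition bump3 :: "real => real" where "bump3 t = max 0 t ^ 3"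

lemma bump3_deriv:
 "(bump3 has_real_derivative 3 * max 0 t ^ 2) (at t)"
 "((%t. 3 * max 0 t ^ 2) has_real_derivative 6 * max 0 t) (at t)"
proof -
 show "(bump3 has_real_derivative 3 * max 0 t ^ 2) (at t)"
  using pos_power_has_derivative[of 2 t] by (simp add: bump3_def[abs_def] eval_nat_numeral)
 have "((%t. max 0 t ^ 2) has_real_derivative 2 * max 0 t) (at t)"
  using pos_power_has_derivative[of 1 t] by (simp add: eval_nat_numeral)
 from DERIV_cmult[OF this, of 3] show "((%t. 3 * max 0 t ^ 2) has_real_derivative 6 * max 0 t) (at t)" by simp
qed

text \<open>A bump in \<open>s = |y|^2\<close> that is positive exactly on the annulus \<open>ep / 2
< |y| < ep\<close>.\<close>

definition qf :: "real => real => real" where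
 "qf ep s = bump3 (s - ep^2 / 4) * bump3 (ep^2 - s)"
definition qf' :: "real => real => real" where
 "qf' ep s = 3 * max 0 (s - ep^2 / 4) ^ 2 * bump3 (ep^2 - s) - bump3 (s - ep^2 / 4) * (3 * max 0 (ep^2 - s) ^ 2)"
definition qf'' :: "real => real => real" where
 "qf'' ep s = 6 * max 0 (s - ep^2 / 4) * bump3 (ep^2 - s) - 2 * (3 * max 0 (s - ep^2 / 4) ^ 2) * (3 * max 0 (ep^2 - s) ^ 2)
   + bump3 (s - ep^2 / 4) * (6 * max 0 (ep^2 - s))"

lemma qf_facts:
 shows "(qf ep has_real_derivative qf' ep s) (at s)" "(qf' ep has_real_derivative qf'' ep s) (at s)"
  "cts (qf'' ep)" "cts (qf ep)" "qf ep s >= 0"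
  "s \<notin> {ep^2/4<..<ep^2} ==> qf ep s = 0" "s \<in> {ep^2/4<..<ep^2} ==> qf ep s > 0"
proof -
 have l: "((%s. s - ep^2 / 4) has_real_derivative 1) (at s)" and r: "((%s. ep^2 - s) has_real_derivative -1) (at s)" for s
  by (auto intro!: derivative_eq_intros)
 note d1 = DERIV_chain2[OF bump3_deriv(1) l] DERIV_chain2[OF bump3_deriv(1) r]
 note d2 = DERIV_chain2[OF bump3_deriv(2) l] DERIV_chain2[OF bump3_deriv(2) r]
 show 1: "(qf ep has_real_derivative qf' ep s) (at s)" for s
  unfolding qf_def[abs_def] qf'_def by (rule DERIV_cong[OF DERIV_mult[OF d1(1) d1(2)]]) simp
 show "(qf' ep has_real_derivative qf'' ep s) (at s)"
  unfolding qf'_def[abs_def] qf''_def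
  by (rule DERIV_cong[OF DERIV_diff[OF DERIV_mult[OF d2(1) d1(2)] DERIV_mult[OF d1(1) d2(2)]]]) simp
 show "cts (qf'' ep)" unfolding qf''_def[abs_def] bump3_def by (intro continuous_intros)
 show "cts (qf ep)" unfolding qf_def[abs_def] bump3_def by (intro continuous_intros)
 show "qf ep s >= 0" by (simp add: qf_def bump3_def)
 show "s \<notin> {ep^2/4<..<ep^2} ==> qf ep s = 0" by (auto simp: qf_def bump3_def max_def)
 show "s \<in> {ep^2/4<..<ep^2} ==> qf ep s > 0" by (auto simp: qf_def bump3_def max_def)
qed

lemma radial_test_function:
 fixes V V' V'' :: "real => real" and x :: "real^2"
 assumes V: "!!s. (V has_real_derivative V' s) (at s)" "!!s. (V' has_real_derivative V'' s) (at s)"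
  "cts V''" "\<forall>s\<ge>b. V s = 0" and b: "b = \<rho>^2" "\<rho> >= 0" and D: "cball x \<rho> \<subseteq> D"
 defines "ze \<equiv> %y. V ((y - x) \<bullet> (y - x))"
 shows "C2c D ze" "laplace ze y = 4 * ((y - x) \<bullet> (y - x)) * V'' ((y - x) \<bullet> (y - x)) + 4 * V' ((y - x) \<bullet> (y - x))"
proof -
 have V1: "!!s. s \<in> UNIV ==> (V has_vector_derivative V' s) (at s)" "!!s. s \<in> UNIV ==> (V' has_vector_derivative V'' s) (at s)"
  using V(1,2) by (simp_all add: has_real_derivative_iff_has_vector_derivative)
 note R = radial_C2[OF open_UNIV V1 V(3), where c=x]
 show "C2c D ze" unfolding C2c_def
 proof (intro conjI exI[of _ "cball x \<rho>"] allI impI D compact_cball)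
  show "C2_on UNIV ze" using R(2) by (simp add: ze_def)
  fix y assume "y \<notin> cball x \<rho>"
  then have "\<rho> <= norm (y - x)" by (simp add: dist_norm norm_minus_commute)
  then have "\<rho>^2 <= (norm (y - x))^2" using b(2) by (intro power_mono)
  then show "ze y = 0" unfolding ze_def using V(4) by (simp add: b(1) power2_norm_eq_inner)
 qed
 show "laplace ze y = 4 * ((y - x) \<bullet> (y - x)) * V'' ((y - x) \<bullet> (y - x)) + 4 * V' ((y - x) \<bullet> (y - x))"
  using R(3)[where x=y] by (simp add: ze_def)
qed

lemma jf_radial_helmholtz:
 fixes c :: "real^2" and k :: real
 defines "a \<equiv> %x. cor (jf (k^2) ((x - c) \<bullet> (x - c)))"
 shows "C2_on UNIV a" "laplace a x + of_real (k^2) * a x = 0"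
proof -
 have k: "k^2 >= 0" by simp
 have V: "!!s. s \<in> UNIV ==> ((%s. cor (jf (k^2) s)) has_vector_derivative of_real (jf' (k^2) s)) (at s)"
  "!!s. s \<in> UNIV ==> ((%s. cor (jf' (k^2) s)) has_vector_derivative of_real (jf'' (k^2) s)) (at s)"
  using jf_deriv(1,2)[OF k] by (auto intro!: has_vector_derivative_of_real simp: has_real_derivative_iff_has_vector_derivative)
 have c: "cts (%s. cor (jf'' (k^2) s))" by (intro continuous_on_of_real jf_deriv(3)[OF k])
 note R = radial_C2[OF open_UNIV V c, where c=c]
 show "C2_on UNIV a" using R(2) by (simp add: a_def)
 let ?s = "(x - c) \<bullet> (x - c)"
 have "laplace a x + of_real (k^2) * a x = of_real (4 * ?s * jf'' (k^2) ?s + 4 * jf' (k^2) ?s + k^2 * jf (k^2) ?s)"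
  using R(3)[where x=x] by (simp add: a_def scaleR_conv_of_real)
 then show "laplace a x + of_real (k^2) * a x = 0" by (simp only: jf_ode[OF k] of_real_0)
qed

definition mass :: "real => real => real" where
 "mass k ep = (LINT y|lborel. qf ep ((y::real^2) \<bullet> y) * jf (k^2) (y \<bullet> y))"

text \<open>The weight is supported in an annulus, where the radial equation has no singularity, and
its integral against \<open>J\<^sub>0\<close> is one, as the mean value property of Helmholtz
solutions demands.\<close>

definition moll :: "real => real => real^2 => real" where
 "moll k ep y = qf ep (y \<bullet> y) / mass k ep"

text \<open>On the disc of radius \<open>r0\<close> the Bessel function is bounded away from zero,
so that mollifiers can be normalised against it.\<close>

definition admissible :: "real => real => bool" where
 "admissible k r0 \<longleftrightarrow> r0 > 0 \<and> (\<forall>s. \<bar>s\<bar> < r0^2 --> jf (k^2) s > 1/2)"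

lemma admissible_exists: "\<exists>r0. admissible k r0"
proof -
 obtain s0 where s0: "s0 > 0" "!!s. \<bar>s\<bar> < s0 ==> \<bar>jf (k^2) s - 1\<bar> < 1/2"
  using jf_near_1[of "k^2" "1/2"] by (metis half_gt_zero_iff zero_le_power2 zero_less_one)
 have "jf (k^2) s > 1/2" if "\<bar>s\<bar> < s0" for s using s0(2)[OF that] by arith
 then show ?thesis using s0(1) by (intro exI[of _ "sqrt s0"]) (simp add: admissible_def)
qed

lemma radial_bump_support:
 fixes y :: "real^2"
 assumes "ep > 0" "norm y > ep"
 shows "qf ep (y \<bullet> y) = 0"
proof -
 have "ep^2 <= (norm y)^2" using assms by (intro power_mono) auto
 then show ?thesis by (intro qf_facts(6)) (simp add: power2_norm_eq_inner)
qed

lemma qf_radial_continuous: "cts (%y::real^2. qf ep (y \<bullet> y))"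
 by (rule continuous_on_compose2[OF qf_facts(4)]) (auto intro!: continuous_intros)

text \<open>The constants make the difference of the two bumps orthogonal to
\<open>J\<^sub>0\<close>. By \<open>radial_equation_solvable\<close> this difference is then the
Helmholtz operator applied to a test function, which a weak solution annihilates.\<close>

lemma annular_means_proportional:
 assumes r0: "admissible k r0" and e: "0 < ep" "ep < r0" and d: "0 < \<delta>" "\<delta> < r0"
 shows "\<exists>A B. A > 0 \<and> B > 0 \<and> (\<forall>D u x. open D --> weak_helmholtz k D u --> cball x ep \<subseteq> D --> cball x \<delta> \<subseteq> D -->
   (LINT y|lborel. u y * of_real (A * qf ep ((y - x) \<bullet> (y - x)) - B * qf \<delta> ((y - x) \<bullet> (y - x)))) = 0)"
proof -
 define ka where "ka = k^2"
 have ka: "ka >= 0" by (simp add: ka_def)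
 have jpos: "jf ka s > 0" if "0 < s" "s < r0^2" for s
 proof -
  have "jf ka s > 1/2" using r0 that unfolding admissible_def ka_def by auto
  then show ?thesis by linarith
 qed
 have c: "cts (%s. jf ka s * qf ep s)" for ep by (intro continuous_on_mult jf_continuous[OF ka] qf_facts(4))
 have "\<exists>R. \<forall>ep. R ep 0 = 0 \<and> (\<forall>s. (R ep has_real_derivative jf ka s * qf ep s) (at s))"
  by (rule choice) (intro allI antiderivative_exists c)
 then obtain R where R: "!!ep. R ep 0 = 0" "!!ep s. (R ep has_real_derivative jf ka s * qf ep s) (at s)" by blast
 have Rle: "R ep s = 0" if "s <= ep^2/4" for ep s
  using deriv_zero_const[OF R(2), of "{..ep^2/4}" ep s 0] that R(1) qf_facts(6) by auto
 have Rge: "R ep s = R ep (ep^2)" if "s >= ep^2" for ep s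
  using deriv_zero_const[OF R(2), of "{ep^2..}" ep s "ep^2"] that qf_facts(6) by auto
 have Rpos: "R ep (ep^2) > 0" if "0 < ep" "ep < r0" for ep
 proof -
  have lt: "ep^2/4 < ep^2" using that by simp
  obtain z where z: "ep^2/4 < z" "z < ep^2" "R ep (ep^2) - R ep (ep^2/4) = (ep^2 - ep^2/4) * (jf ka z * qf ep z)"
   using MVT2[OF lt, of "R ep" "%s. jf ka s * qf ep s"] R(2) by blast
  have "ep^2 < r0^2" using that by (intro power_strict_mono) auto
  moreover have "0 <= ep^2/4" by simp
  ultimately have "0 < z" "z < r0^2" using z(1,2) by linarith+
  then have "jf ka z * qf ep z > 0" using z(1,2) by (intro mult_pos_pos jpos qf_facts(7)) auto
  moreover have "ep^2 - ep^2/4 > 0" using lt by simp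
  ultimately have "R ep (ep^2) - R ep (ep^2/4) > 0" unfolding z(3) by (rule mult_pos_pos[rotated])
  then show ?thesis by (simp add: Rle)
 qed
 define A B where "A = R \<delta> (\<delta>^2)" and "B = R ep (ep^2)"
 define \<rho> where "\<rho> = max ep \<delta>"
 define f where "f s = A * qf ep s - B * qf \<delta> s" for s
 define a b where "a = min (ep^2) (\<delta>^2) / 4" and "b = \<rho>^2"
 have \<rho>: "\<rho> > 0" "ep <= \<rho>" "\<delta> <= \<rho>" "\<rho> < r0" using e d by (auto simp: \<rho>_def)
 have sq: "ep^2 <= b" "\<delta>^2 <= b" "b < r0^2" unfolding b_def using \<rho> e d
  by (auto intro!: power_mono power_strict_mono)
 have a: "0 < a" "a <= ep^2/4" "a <= \<delta>^2/4" using e d by (auto simp: a_def)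
 have "\<exists>V V' V''. (\<forall>s. (V has_real_derivative V' s) (at s)) \<and> (\<forall>s. (V' has_real_derivative V'' s) (at s)) \<and>
  cts V'' \<and> (\<forall>s\<ge>b. V s = 0) \<and> (\<forall>s. 4 * s * V'' s + 4 * V' s + ka * V s = f s)"
 proof (rule radial_equation_solvable[where j="jf ka" and j'="jf' ka" and j''="jf'' ka" and ?s0.0="r0^2" and a=a and R="%s. A * R ep s - B * R \<delta> s"])
  show "a < b" using a(2) sq(1) zero_less_power[OF e(1), of 2] by linarith
  show "cts f" unfolding f_def[abs_def] by (intro continuous_intros qf_facts(4))
  show "f s = 0" if "s \<notin> {a..b}" for s
  proof -
   have "s \<notin> {ep^2/4<..<ep^2}" "s \<notin> {\<delta>^2/4<..<\<delta>^2}" using that a sq by auto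
   then show ?thesis by (simp add: f_def qf_facts(6))
  qed
  show "((%s. A * R ep s - B * R \<delta> s) has_real_derivative jf ka s * f s) (at s)" for s
   by (rule DERIV_cong[OF DERIV_diff[OF DERIV_cmult[OF R(2)] DERIV_cmult[OF R(2)]]]) (simp add: f_def algebra_simps)
  show "A * R ep a - B * R \<delta> a = 0" using a by (simp add: Rle)
  show "A * R ep b - B * R \<delta> b = 0" using Rge[OF sq(1)] Rge[OF sq(2)] by (simp add: A_def B_def)
 qed (use jf_deriv[OF ka] jf_ode[OF ka] jpos a sq in auto)
 then obtain V V' V'' where V: "!!s. (V has_real_derivative V' s) (at s)" "!!s. (V' has_real_derivative V'' s) (at s)"
  "cts V''" "\<forall>s\<ge>b. V s = 0" "!!s. 4 * s * V'' s + 4 * V' s + ka * V s = f s" by blast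
 show ?thesis
 proof (rule exI[of _ A], rule exI[of _ B], intro conjI allI impI)
  show "A > 0" "B > 0" using Rpos e d by (auto simp: A_def B_def)
  fix D u and x :: "real^2" assume D: "open D" "weak_helmholtz k D u" "cball x ep \<subseteq> D" "cball x \<delta> \<subseteq> D"
  then have "cball x \<rho> \<subseteq> D" by (auto simp: \<rho>_def max_def)
  note T = radial_test_function[OF V(1-4) b_def order_less_imp_le[OF \<rho>(1)] this]
  have "(LINT y|lborel. u y * of_real (laplace (%y. V ((y - x) \<bullet> (y - x))) y + k^2 * V ((y - x) \<bullet> (y - x)))) = 0"
   using D(2) T(1) by (simp add: weak_helmholtz_def)
  then show "(LINT y|lborel. u y * of_real (A * qf ep ((y - x) \<bullet> (y - x)) - B * qf \<delta> ((y - x) \<bullet> (y - x)))) = 0"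
   unfolding T(2) ka_def[symmetric] V(5) f_def .
 qed
qed

lemma bump_jf_integrable: "ep > 0 ==> intble (%y::real^2. qf ep (y \<bullet> y) * jf (k^2) (y \<bullet> y))"
proof (rule bdd_support(1)[where R=ep])
 have "cts (%y::real^2. jf (k^2) (y \<bullet> y))"
  by (rule continuous_on_compose2[OF jf_continuous]) (auto intro!: continuous_intros)
 then show "cts (%y::real^2. qf ep (y \<bullet> y) * jf (k^2) (y \<bullet> y))"
  by (intro continuous_on_mult qf_radial_continuous)
qed (simp add: radial_bump_support)

lemma bump_integral_positive:
 assumes "ep > 0"
 shows "(LINT y|lborel. qf ep ((y::real^2) \<bullet> y)) > 0"
proof -
 let ?f = "%y::real^2. qf ep (y \<bullet> y)"
 have int: "intble ?f"
  by (rule bdd_support(1)[OF qf_radial_continuous, where R=ep]) (simp add: radial_bump_support[OF assms])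
 have "(LINT y|lborel. ?f y) \<noteq> 0"
 proof
  assume "(LINT y|lborel. ?f y) = 0"
  then have ae: "AE y in lborel. ?f y = 0"
   using int by (subst (asm) integral_nonneg_eq_0_iff_AE) (auto simp: qf_facts(5))
  have op: "open {y. ?f y \<noteq> 0}"
   using open_Collect_neq[OF qf_radial_continuous continuous_on_const] .
  have "{y. ?f y \<noteq> 0} = {}"
  proof (rule ccontr)
   assume ne: "{y. ?f y \<noteq> 0} \<noteq> {}"
   have "{y. ?f y \<noteq> 0} \<in> null_sets lborel"
    using ae op by (subst AE_iff_null_sets) auto
   then have "negligible {y. ?f y \<noteq> 0}" by (simp add: negligible_iff_null_sets null_sets_completionI)
   then show False using open_not_negligible[OF op ne] by simp
  qed
  moreover have "?f (axis 1 (3/4 * ep)) > 0"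
   using assms by (intro qf_facts(7)) (simp add: inner_axis_axis power2_eq_square)
  ultimately show False by force
 qed
 moreover have "(LINT y|lborel. ?f y) >= 0" by (intro integral_nonneg_AE) (auto simp: qf_facts(5))
 ultimately show ?thesis by linarith
qed

lemma mass_lower_bound:
 assumes r0: "admissible k r0" and e: "0 < ep" "ep < r0"
  and t: "!!s. 0 <= s ==> s < ep^2 ==> \<bar>jf (k^2) s - 1\<bar> <= t"
 shows "mass k ep > 0" "(LINT y|lborel. moll k ep y) <= 2" "\<bar>(LINT y|lborel. moll k ep y) - 1\<bar> <= 2 * t"
proof -
 let ?f = "%y::real^2. qf ep (y \<bullet> y)"
 define I where "I = (LINT y|lborel. ?f y)"
 have int: "intble ?f"
  by (rule bdd_support(1)[OF qf_radial_continuous, where R=ep]) (simp add: radial_bump_support[OF e(1)])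
 note intj = bump_jf_integrable[OF e(1), of k]
 have I: "I > 0" unfolding I_def by (rule bump_integral_positive[OF e(1)])
 have inner: "0 <= y \<bullet> y \<and> y \<bullet> y < ep^2" if "?f y \<noteq> 0" for y :: "real^2" using qf_facts(6)[of "y \<bullet> y" ep] that by auto
 have lower: "(1/2) * I <= mass k ep"
  unfolding I_def mass_def integral_mult_right_zero[symmetric]
 proof (rule integral_mono[OF integrable_mult_right[OF int] intj])
  fix y :: "real^2"
  show "1/2 * ?f y <= ?f y * jf (k^2) (y \<bullet> y)"
  proof (cases "?f y = 0")
   case False
   have "ep^2 < r0^2" using e by (intro power_strict_mono) auto
   then have "1/2 <= jf (k^2) (y \<bullet> y)" using inner[OF False] r0 by (simp add: admissible_def less_imp_le)
   from mult_right_mono[OF this qf_facts(5)[of ep "y \<bullet> y"]] show ?thesis by (simp only: mult.commute)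
  qed simp
 qed
 then show m: "mass k ep > 0" using I by linarith
 have moll: "(LINT y|lborel. moll k ep y) = I / mass k ep" by (simp add: moll_def I_def)
 show "(LINT y|lborel. moll k ep y) <= 2" unfolding moll using lower m by (simp add: divide_le_eq)
 have "\<bar>I - mass k ep\<bar> <= t * I"
 proof -
  have "I - mass k ep = (LINT y|lborel. ?f y - ?f y * jf (k^2) (y \<bullet> y))"
   unfolding I_def mass_def by (rule Bintegral_diff[OF int intj, symmetric])
  also have "\<bar>...\<bar> <= (LINT y|lborel. t * ?f y)"
  proof (rule integral_abs_bound_integral)
   show "intble (%y::real^2. ?f y - ?f y * jf (k^2) (y \<bullet> y))" by (rule Bintegrable_diff[OF int intj])
   show "intble (%y. t * ?f y)" by (rule integrable_mult_right[OF int])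
   fix y :: "real^2"
   show "\<bar>?f y - ?f y * jf (k^2) (y \<bullet> y)\<bar> <= t * ?f y"
   proof (cases "?f y = 0")
    case False
    have "\<bar>?f y - ?f y * jf (k^2) (y \<bullet> y)\<bar> = ?f y * \<bar>jf (k^2) (y \<bullet> y) - 1\<bar>"
    proof -
     have "?f y - ?f y * jf (k^2) (y \<bullet> y) = ?f y * (1 - jf (k^2) (y \<bullet> y))" by (simp add: right_diff_distrib)
     then show ?thesis using qf_facts(5)[of ep "y \<bullet> y"] by (simp add: abs_mult abs_minus_commute)
    qed
    also have "... <= ?f y * t" using inner[OF False] by (intro mult_left_mono t qf_facts(5)) auto
    finally show ?thesis by (simp add: mult.commute)
   qed simp
  qed
  finally show ?thesis by (simp add: I_def)
 qed
 then have "\<bar>I / mass k ep - 1\<bar> <= t * I / mass k ep" using m by (simp add: field_simps abs_le_iff)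
 also have "... <= t * 2"
 proof -
  have t0: "t >= 0" using t[of 0] e(1) abs_ge_zero order_trans by fastforce
  have "I / mass k ep <= 2" using lower m by (simp add: divide_le_eq)
  from mult_left_mono[OF this t0] show ?thesis by simp
 qed
 finally show "\<bar>(LINT y|lborel. moll k ep y) - 1\<bar> <= 2 * t" unfolding moll by (simp add: mult.commute)
qed

section \<open>Convolution\<close>

lemma uniformly_continuous_bounded_support:
 fixes p :: "'a::euclidean_space => 'b::real_normed_vector"
 assumes p: "cts p" and z: "!!x. norm x > R ==> p x = 0" and e: "e > 0"
 shows "\<exists>d>0. \<forall>x y. norm (x - y) < d --> norm (p x - p y) < e"
proof -
 have "uniformly_continuous_on (cball 0 (R + 1)) p"
  by (intro compact_uniformly_continuous continuous_on_subset[OF p]) auto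
 then obtain d where d: "d > 0" "!!x y. norm x <= R + 1 ==> norm y <= R + 1 ==> norm (x - y) < d ==> norm (p x - p y) < e"
  using e by (force simp: uniformly_continuous_on_def dist_norm norm_minus_commute)
 show ?thesis
 proof (intro exI[of _ "min d 1"] conjI allI impI)
  fix x y :: 'a assume xy: "norm (x - y) < min d 1"
  have "norm x <= norm y + norm (x - y)" "norm y <= norm x + norm (x - y)"
   using norm_triangle_sub[of x y] norm_triangle_sub[of y x] by (simp_all add: norm_minus_commute)
  then have "norm x <= R + 1 \<and> norm y <= R + 1 \<or> norm x > R \<and> norm y > R" using xy by linarith
  then show "norm (p x - p y) < e" using d(2)[of x y] xy z[of x] z[of y] e by auto
 qed (use d in auto)
qed

definition conv :: "(real^2 => complex) => (real^2 => real) => real^2 => complex" where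
 "conv u p x = (LINT y|lborel. u y * of_real (p (x - y)))"

lemma integrable_mult_bounded:
 fixes u :: "real^2 => complex"
 assumes u: "intble u" and p: "p \<in> borel_measurable borel" "!!x. \<bar>p x\<bar> <= B"
 shows "intble (%y. u y * of_real (p y))"
proof (rule Bintegrable_bound)
 show "intble (%y. B * norm (u y))" using u by (intro integrable_mult_right integrable_norm)
 have [measurable]: "u \<in> borel_measurable borel" using u by (auto dest: borel_measurable_integrable)
 note [measurable] = p(1)
 show "(%y. u y * of_real (p y)) \<in> borel_measurable lborel" by measurable
 have "norm (u y * of_real (p y)) <= B * norm (u y)" for y
  using mult_right_mono[OF p(2)[of y] norm_ge_zero[of "u y"]] by (simp add: norm_mult mult.commute)
 then show "AE y in lborel. norm (u y * of_real (p y)) <= norm (B * norm (u y))"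
  by (intro AE_I2) (use order_trans abs_ge_self in \<open>simp add: order_trans[OF _ abs_ge_self]\<close>)
qed

lemma conv_integrand_integrable:
 fixes u :: "real^2 => complex"
 assumes u: "intble u" and p: "cts p" "!!x. norm x > R ==> p x = 0"
 shows "intble (%y. u y * of_real (p (x - y)))"
proof -
 obtain B where B: "!!x. norm (p x) <= B" using bdd_support(2)[OF p] by blast
 have "cts (%y. p (x - y))"
  by (rule continuous_on_compose2[OF p(1)]) (auto intro!: continuous_intros)
 then show ?thesis
  using B by (intro integrable_mult_bounded[OF u borel_measurable_continuous_onI]) auto
qed

lemma conv_continuous:
 fixes u :: "real^2 => complex"
 assumes u: "intble u" and p: "cts p" "!!x. norm x > R ==> p x = 0"
 shows "cts (conv u p)"
 unfolding continuous_on_iff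
proof (intro ballI allI impI)
 fix x :: "real^2" and e :: real assume e: "e > 0"
 define I where "I = (LINT y|lborel. norm (u y))"
 have I: "I >= 0" unfolding I_def by (intro integral_nonneg_AE) auto
 define e' where "e' = e / (I + 1)"
 have e': "e' > 0" using e I by (simp add: e'_def)
 obtain d where d: "d > 0" "!!x y. norm (x - y) < d ==> norm (p x - p y) < e'"
  using uniformly_continuous_bounded_support[OF p e'] by blast
 note int = conv_integrand_integrable[OF u p]
 show "\<exists>d>0. \<forall>x'\<in>UNIV. dist x' x < d --> dist (conv u p x') (conv u p x) < e"
 proof (intro exI[of _ d] conjI ballI impI d(1))
  fix x' assume x': "dist x' x < d"
  have "norm (conv u p x' - conv u p x) = norm (LINT y|lborel. u y * of_real (p (x' - y)) - u y * of_real (p (x - y)))"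
   unfolding conv_def by (simp only: Bintegral_diff[OF int int])
  also have "... <= (LINT y|lborel. e' * norm (u y))"
  proof (rule Bintegral_norm_bound_integral)
   show "intble (%y. u y * of_real (p (x' - y)) - u y * of_real (p (x - y)))"
    by (intro Bintegrable_diff int)
   show "intble (%y. e' * norm (u y))" using u by (intro integrable_mult_right integrable_norm)
   fix y
   have "\<bar>p (x' - y) - p (x - y)\<bar> <= e'" using d(2)[of "x' - y" "x - y"] x' by (simp add: dist_norm less_imp_le)
   then show "norm (u y * of_real (p (x' - y)) - u y * of_real (p (x - y))) <= e' * norm (u y)"
    using mult_right_mono[of "\<bar>p (x' - y) - p (x - y)\<bar>" e' "norm (u y)"]
    by (simp add: norm_mult mult.commute flip: right_diff_distrib of_real_diff)
  qed
  also have "... = e' * I" by (simp add: I_def)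
  also have "... < e" using e I by (simp add: e'_def field_simps)
  finally show "dist (conv u p x') (conv u p x) < e" by (simp add: dist_norm)
 qed
qed

lemma uniform_differentiability:
 fixes p :: "real^2 => real"
 assumes p: "C1_on UNIV p" "!!x. norm x > R ==> p x = 0" and e: "e > 0"
 shows "\<exists>d>0. \<forall>z h. norm h < d --> \<bar>p (z + h) - p z - (\<Sum>j\<in>UNIV. h $ j * pd j p z)\<bar> <= e * norm h"
proof -
 have c: "cts (pd j p)" for j using p(1) by (simp add: C1_on_def)
 have "\<exists>d>0. \<forall>x y. norm (x - y) < d --> norm (pd j p x - pd j p y) < e / 2" for j
  using e by (intro uniformly_continuous_bounded_support[OF c partial_deriv_eq_0[OF p(2)]]) auto
 then obtain d where d: "!!j. d j > 0" "!!j x y. norm (x - y) < d j ==> norm (pd j p x - pd j p y) < e / 2"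
  by metis
 define d0 where "d0 = min (d 1) (d 2)"
 have d0: "d0 > 0" "!!j. d0 <= d j" using d(1) exhaust_2 by (auto simp: d0_def) (metis exhaust_2 min.cobounded1 min.cobounded2)
 show ?thesis
 proof (intro exI[of _ d0] conjI d0 allI impI)
  fix z h :: "real^2" assume h: "norm h < d0"
  define g where "g v = p (z + v) - (\<Sum>j\<in>UNIV. v $ j * pd j p z)" for v
  define g' where "g' v k = (\<Sum>j\<in>UNIV. k $ j * (pd j p (z + v) - pd j p z))" for v k :: "real^2"
  have D: "(g has_derivative g' v) (at v within ball 0 d0)" for v
  proof -
   have "(p has_derivative (%h. \<Sum>j\<in>UNIV. (h $ j) *R pd j p (z + v))) (at (z + v))"
    using C1_on_has_grad[OF p(1), of "z + v"] by (simp add: has_grad_def)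
   then have "((%v. p (z + v)) has_derivative (%h. \<Sum>j\<in>UNIV. (h $ j) *R pd j p (z + v))) (at v)"
    by (rule has_derivative_compose[rotated]) (auto intro!: derivative_eq_intros)
   moreover have "((%v. \<Sum>j\<in>UNIV. v $ j * pd j p z) has_derivative (%h. \<Sum>j\<in>UNIV. h $ j * pd j p z)) (at v)"
    by (intro bounded_linear_imp_has_derivative bounded_linear_sum bounded_linear_mult_left[THEN bounded_linear_compose] bounded_linear_vec_nth)
   ultimately have "(g has_derivative (%h. (\<Sum>j\<in>UNIV. (h $ j) *R pd j p (z + v)) - (\<Sum>j\<in>UNIV. h $ j * pd j p z))) (at v)"
    unfolding g_def[abs_def] by (rule has_derivative_diff)
   moreover have "(%h. (\<Sum>j\<in>UNIV. (h $ j) *R pd j p (z + v)) - (\<Sum>j\<in>UNIV. h $ j * pd j p z)) = g' v"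
    by (auto simp: g'_def fun_eq_iff right_diff_distrib sum_subtractf)
   ultimately show ?thesis by (simp add: has_derivative_at_withinI)
  qed
  have "norm (g h - g 0) <= e * norm (h - 0)"
  proof (rule differentiable_bound[OF convex_ball D])
   fix v :: "real^2" assume v: "v \<in> ball 0 d0"
   show "onorm (g' v) <= e"
   proof (rule onorm_bound)
    fix k :: "real^2"
    have "norm (g' v k) <= (\<Sum>j\<in>(UNIV::2 set). norm k * (e / 2))"
     unfolding g'_def
    proof (rule sum_norm_le)
     fix j :: 2
     have "norm (pd j p (z + v) - pd j p z) <= e / 2"
      using d(2)[of "z + v" z j] v d0(2)[of j] by (simp add: less_imp_le)
     then show "norm (k $ j * (pd j p (z + v) - pd j p z)) <= norm k * (e / 2)"
      unfolding norm_mult by (intro mult_mono component_le_norm_cart[of k j, folded real_norm_def]) auto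
    qed
    also have "... = e * norm k" by simp
    finally show "norm (g' v k) <= e * norm k" .
   qed (use e in simp)
  qed (use h d0 in auto)
  then show "\<bar>p (z + h) - p z - (\<Sum>j\<in>UNIV. h $ j * pd j p z)\<bar> <= e * norm h"
   by (simp add: g_def algebra_simps)
 qed
qed

lemma conv_has_grad:
 fixes u :: "real^2 => complex"
 assumes u: "intble u" and p: "C1_on UNIV p" "!!x. norm x > R ==> p x = 0"
 shows "has_grad (conv u p) (%j. conv u (pd j p) x) x"
 unfolding has_grad_def has_derivative_at_alt
proof (intro conjI allI impI)
 let ?D = "%h. \<Sum>j\<in>UNIV. (h $ j) *R conv u (pd j p) x"
 show "bounded_linear ?D"
  by (intro bounded_linear_sum bounded_linear_scaleR_left[THEN bounded_linear_compose] bounded_linear_vec_nth)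
 fix e :: real assume e: "e > 0"
 define I where "I = (LINT y|lborel. norm (u y))"
 have I: "I >= 0" unfolding I_def by (intro integral_nonneg_AE) auto
 define e' where "e' = e / (I + 1)"
 have e': "e' > 0" "e' * I <= e" using e I by (simp_all add: e'_def field_simps)
 obtain d where d: "d > 0" "!!z h. norm h < d ==> \<bar>p (z + h) - p z - (\<Sum>j\<in>UNIV. h $ j * pd j p z)\<bar> <= e' * norm h"
  using uniform_differentiability[OF p e'(1)] by blast
 have cp: "cts p" by (rule C1_on_continuous[OF p(1)])
 have cpj: "cts (pd j p)" for j using p(1) by (simp add: C1_on_def)
 note int = conv_integrand_integrable[OF u cp p(2)]
 note intj = conv_integrand_integrable[OF u cpj partial_deriv_eq_0[OF p(2)]]
 show "\<exists>d>0. \<forall>y. norm (y - x) < d --> norm (conv u p y - conv u p x - ?D (y - x)) <= e * norm (y - x)"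
 proof (intro exI[of _ d] conjI d(1) allI impI)
  fix y assume y: "norm (y - x) < d"
  define h where "h = y - x"
  have D: "?D h = (LINT t|lborel. (\<Sum>j\<in>UNIV. of_real (h $ j) * (u t * of_real (pd j p (x - t)))))"
   unfolding conv_def scaleR_conv_of_real integral_mult_right_zero[symmetric]
   by (rule Bintegral_sum[symmetric]) (intro integrable_mult_right intj)
  have intS: "intble (%t. \<Sum>j\<in>UNIV. of_real (h $ j) * (u t * of_real (pd j p (x - t))))"
   by (intro Bintegrable_sum integrable_mult_right intj)
  have "conv u p y - conv u p x - ?D h
    = (LINT t|lborel. u t * of_real (p (y - t)) - u t * of_real (p (x - t))
      - (\<Sum>j\<in>UNIV. of_real (h $ j) * (u t * of_real (pd j p (x - t)))))"
   unfolding D unfolding conv_def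
   by (simp only: Bintegral_diff[OF Bintegrable_diff[OF int int] intS]
     Bintegral_diff[OF int int])
  also have "norm ... <= (LINT t|lborel. (e' * norm h) * norm (u t))"
  proof (rule Bintegral_norm_bound_integral)
   show "intble (%t. u t * of_real (p (y - t)) - u t * of_real (p (x - t))
      - (\<Sum>j\<in>UNIV. of_real (h $ j) * (u t * of_real (pd j p (x - t)))))"
    by (intro Bintegrable_diff int intS)
   show "intble (%t. (e' * norm h) * norm (u t))" using u by (intro integrable_mult_right integrable_norm)
   fix t
   have "u t * of_real (p (y - t)) - u t * of_real (p (x - t))
      - (\<Sum>j\<in>UNIV. of_real (h $ j) * (u t * of_real (pd j p (x - t))))
     = u t * of_real (p ((x - t) + h) - p (x - t) - (\<Sum>j\<in>UNIV. h $ j * pd j p (x - t)))"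
    by (simp add: h_def algebra_simps sum_distrib_left)
   then show "norm (u t * of_real (p (y - t)) - u t * of_real (p (x - t))
      - (\<Sum>j\<in>UNIV. of_real (h $ j) * (u t * of_real (pd j p (x - t))))) <= (e' * norm h) * norm (u t)"
    using mult_right_mono[OF d(2)[of h "x - t"] norm_ge_zero[of "u t"]] y
    by (simp only: norm_mult norm_of_real h_def mult.commute)
  qed
  also have "... = e' * I * norm h" by (simp add: I_def)
  also have "... <= e * norm h" using e'(2) by (intro mult_right_mono) auto
  finally show "norm (conv u p y - conv u p x - ?D (y - x)) <= e * norm (y - x)" by (simp add: h_def)
 qed
qed

lemma conv_C2:
 fixes u :: "real^2 => complex"
 assumes u: "intble u" and p: "C2_on UNIV p" "compact K" "!!x. x \<notin> K ==> p x = 0"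
 shows "C2_on UNIV (conv u p)" "laplace (conv u p) x = conv u (laplace p) x"
proof -
 obtain R where R: "!!x. x \<in> K ==> norm x <= R" using compact_imp_bounded[OF p(2)] by (auto simp: bounded_iff)
 have K: "norm x > R ==> x \<notin> K" for x using R by force
 have C: "C1_on UNIV p" "C1_on UNIV (pd j p)" "cts (pd i (pd j p))" for i j
  using p(1) by (auto simp: C2_on_def C1_on_def)
 have z1: "norm x > R ==> p x = 0" for x using p(3) K by blast
 note z2 = partial_deriv_eq_0[OF z1]
 note z3 = partial_deriv_eq_0[OF z2]
 note I = C2_onI[OF open_UNIV conv_has_grad[OF u C(1) z1] conv_has_grad[OF u C(2) z2]
   continuous_on_subset[OF conv_continuous[OF u C(3) z3] subset_UNIV]]
 show "C2_on UNIV (conv u p)" by (rule I(1))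
 have int: "intble (%y. u y * of_real (pd j (pd j p) (x - y)))" for j
  by (rule conv_integrand_integrable[OF u C(3) z3])
 have "laplace (conv u p) x = (\<Sum>j\<in>UNIV. conv u (pd j (pd j p)) x)"
  unfolding laplace_def by (intro sum.cong refl I(2)) auto
 also have "... = conv u (laplace p) x"
  unfolding conv_def laplace_def of_real_sum sum_distrib_left
  by (rule Bintegral_sum[symmetric]) (rule int)
 finally show "laplace (conv u p) x = conv u (laplace p) x" .
qed

section \<open>Mean value properties of weak solutions\<close>

lemma dot_commute_diff: "(x - y) \<bullet> (x - y) = (y - x) \<bullet> (y - (x::'a::real_inner))"
 by (simp add: inner_simps inner_commute)

lemma moll_C2c:
 assumes e: "ep > 0" and D: "cball x ep \<subseteq> D"
 shows "C2c D (%y. moll k ep (x - y))" "laplace (%y. moll k ep (x - y)) y = laplace (moll k ep) (x - y)"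
  "C2c UNIV (moll k ep)"
proof -
 let ?m = "mass k ep"
 have V: "((%s. qf ep s / ?m) has_real_derivative qf' ep s / ?m) (at s)" "((%s. qf' ep s / ?m) has_real_derivative qf'' ep s / ?m) (at s)" for s
  by (intro DERIV_cdivide qf_facts)+
 have V2: "cts (%s. qf'' ep s / ?m)"
  unfolding divide_inverse by (intro continuous_on_mult qf_facts continuous_on_const)
 have V3: "\<forall>s\<ge>ep^2. qf ep s / ?m = 0" by (simp add: qf_facts(6))
 have eq: "(%y. moll k ep (x - y)) = (%y. qf ep ((y - x) \<bullet> (y - x)) / ?m)"
  by (simp add: moll_def fun_eq_iff dot_commute_diff[of x])
 have eq0: "moll k ep = (%y. qf ep ((y - 0) \<bullet> (y - 0)) / ?m)" by (simp add: moll_def fun_eq_iff)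
 note T = radial_test_function[OF V V2 V3 refl order_less_imp_le[OF e]]
 show "C2c D (%y. moll k ep (x - y))" unfolding eq by (rule T(1)[OF D])
 show "C2c UNIV (moll k ep)" unfolding eq0 by (rule T(1)[OF subset_UNIV])
 show "laplace (%y. moll k ep (x - y)) y = laplace (moll k ep) (x - y)"
  unfolding eq T(2)[OF D] unfolding eq0 T(2)[OF subset_UNIV] by (simp add: dot_commute_diff[of x])
qed

lemma moll_support: "ep > 0 ==> norm y > ep ==> moll k ep y = 0"
 by (simp add: moll_def radial_bump_support)

lemma moll_continuous: "cts (moll k ep)"
 unfolding moll_def[abs_def] divide_inverse by (intro continuous_on_mult qf_radial_continuous continuous_on_const)

lemma mass_pos:
 assumes "admissible k r0" "0 < ep" "ep < r0"
 shows "mass k ep > 0"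
proof -
 have "continuous_on {0..ep^2} (%s. \<bar>jf (k^2) s - 1\<bar>)"
  by (intro continuous_intros continuous_on_subset[OF jf_continuous]) auto
 then have "bounded ((%s. \<bar>jf (k^2) s - 1\<bar>) ` {0..ep^2})"
  by (intro compact_imp_bounded compact_continuous_image) auto
 then obtain t where t: "\<forall>s\<in>{0..ep^2}. norm \<bar>jf (k^2) s - 1\<bar> <= t" by (auto simp: bounded_iff)
 show ?thesis by (rule mass_lower_bound(1)[OF assms, of t]) (use t in auto)
qed

text \<open>The ratio of the constants in \<open>annular_means_proportional\<close> is identified by
inserting the entire solution \<open>J\<^sub>0\<close>.\<close>

lemma conv_moll_independent:
 assumes r0: "admissible k r0" and e: "0 < ep" "ep < r0" and d: "0 < \<delta>" "\<delta> < r0"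
  and D: "open D" "weak_helmholtz k D u" "cball x ep \<subseteq> D" "cball x \<delta> \<subseteq> D" and u: "intble u"
 shows "conv u (moll k ep) x = conv u (moll k \<delta>) x"
proof -
 obtain A B where AB: "A > 0" "B > 0" "!!D u x. open D ==> weak_helmholtz k D u ==> cball x ep \<subseteq> D ==> cball x \<delta> \<subseteq> D ==>
   (LINT y|lborel. u y * of_real (A * qf ep ((y - x) \<bullet> (y - x)) - B * qf \<delta> ((y - x) \<bullet> (y - x)))) = 0"
  using annular_means_proportional[OF r0 e d] by blast
 have split: "(LINT y|lborel. u y * of_real (A * qf ep ((y - x) \<bullet> (y - x)) - B * qf \<delta> ((y - x) \<bullet> (y - x))))
   = of_real A * (LINT y|lborel. u y * of_real (qf ep ((y - x) \<bullet> (y - x)))) - of_real B * (LINT y|lborel. u y * of_real (qf \<delta> ((y - x) \<bullet> (y - x))))"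
  if i: "!!ep. ep > 0 ==> intble (%y. u y * of_real (qf ep ((y - x) \<bullet> (y - x))))" for u :: "real^2 => complex" and x
 proof -
  have "(LINT y|lborel. u y * of_real (A * qf ep ((y - x) \<bullet> (y - x)) - B * qf \<delta> ((y - x) \<bullet> (y - x))))
   = (LINT y|lborel. of_real A * (u y * of_real (qf ep ((y - x) \<bullet> (y - x)))) - of_real B * (u y * of_real (qf \<delta> ((y - x) \<bullet> (y - x)))))"
   by (simp add: algebra_simps)
  also have "... = (LINT y|lborel. of_real A * (u y * of_real (qf ep ((y - x) \<bullet> (y - x))))) - (LINT y|lborel. of_real B * (u y * of_real (qf \<delta> ((y - x) \<bullet> (y - x)))))"
   by (intro Bintegral_diff integrable_mult_right i e d)
  finally show ?thesis by (simp only: integral_mult_right_zero)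
 qed
 have m: "mass k ep > 0" "mass k \<delta> > 0" by (rule mass_pos[OF r0 e] mass_pos[OF r0 d])+
 have iu: "intble (%y. u y * of_real (qf ep ((y - x) \<bullet> (y - x))))" if "ep > 0" for ep
  using conv_integrand_integrable[OF u qf_radial_continuous radial_bump_support[OF that], where x=x]
  by (simp only: dot_commute_diff[of x])
 have 1: "of_real A * (LINT y|lborel. u y * of_real (qf ep ((y - x) \<bullet> (y - x)))) = of_real B * (LINT y|lborel. u y * of_real (qf \<delta> ((y - x) \<bullet> (y - x))))"
  using AB(3)[OF D] split[OF iu] by simp
 have 2: "A * mass k ep = B * mass k \<delta>"
 proof -
  let ?j = "%y::real^2. cor (jf (k^2) ((y - 0) \<bullet> (y - 0)))"
  have w: "weak_helmholtz k UNIV ?j" by (rule classical_weak_helmholtz) (rule jf_radial_helmholtz)+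
  have "(%y. ?j y * of_real (qf ep ((y - 0) \<bullet> (y - 0)))) = (%y. of_real (qf ep (y \<bullet> y) * jf (k^2) (y \<bullet> y)))" for ep
   by (simp add: mult.commute)
  note eq = this
  have E: "(LINT y|lborel. cor (g y)) = of_real (LINT y|lborel. g y)" for g :: "real^2 => real" by simp
  have ij: "intble (%y. ?j y * of_real (qf ep ((y - 0) \<bullet> (y - 0))))" if "ep > 0" for ep
   unfolding eq by (intro integrable_of_real bump_jf_integrable that)
  have "of_real A * (LINT y|lborel. ?j y * of_real (qf ep ((y - 0) \<bullet> (y - 0)))) = of_real B * (LINT y|lborel. ?j y * of_real (qf \<delta> ((y - 0) \<bullet> (y - 0))))"
   using AB(3)[OF open_UNIV w, of 0] split[of ?j 0, OF ij] by simp
  then have "cor (A * mass k ep) = of_real (B * mass k \<delta>)"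
   unfolding eq mass_def of_real_mult[of A] of_real_mult[of B] E[symmetric] .
  then show ?thesis by (simp only: of_real_eq_iff)
 qed
 have c: "conv u (moll k ep) x = (LINT y|lborel. u y * of_real (qf ep ((y - x) \<bullet> (y - x)))) / of_real (mass k ep)" for ep
  unfolding conv_def moll_def dot_commute_diff[of x] by simp
 define X Y where "X = (LINT y|lborel. u y * of_real (qf ep ((y - x) \<bullet> (y - x))))" and "Y = (LINT y|lborel. u y * of_real (qf \<delta> ((y - x) \<bullet> (y - x))))"
 have "cor (A * mass k ep) * (X * of_real (mass k \<delta>)) = of_real (A * mass k ep) * (Y * of_real (mass k ep))"
 proof -
  have "cor (A * mass k ep) * (X * of_real (mass k \<delta>)) = (of_real A * X) * of_real (mass k ep * mass k \<delta>)" by simp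
  also have "... = (of_real B * Y) * of_real (mass k ep * mass k \<delta>)" using 1 by (simp add: X_def Y_def)
  also have "... = of_real (B * mass k \<delta>) * (Y * of_real (mass k ep))" by simp
  finally show ?thesis by (simp only: 2)
 qed
 moreover have "cor (A * mass k ep) \<noteq> 0" using AB(1) m by simp
 ultimately have "X * of_real (mass k \<delta>) = Y * of_real (mass k ep)" by (simp only: mult_cancel_left) simp
 then show ?thesis unfolding c X_def[symmetric] Y_def[symmetric] using m by (simp add: field_simps)
qed

lemma conv_moll_helmholtz:
 assumes e: "0 < ep" and D: "weak_helmholtz k D u" "cball x ep \<subseteq> D" and u: "intble u"
 shows "laplace (conv u (moll k ep)) x + of_real (k^2) * conv u (moll k ep) x = 0"
proof -
 note M = moll_C2c[OF e D(2), of k]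
 obtain K where K: "C2_on UNIV (moll k ep)" "compact K" "!!x. x \<notin> K ==> moll k ep x = 0"
  using M(3) by (auto simp: C2c_def)
 obtain R where R: "!!x. norm x > R ==> x \<notin> K" using C2cE[OF M(3)] compact_imp_bounded[OF K(2)]
  unfolding bounded_iff by (metis not_le)
 have i1: "intble (%y. u y * of_real (laplace (moll k ep) (x - y)))"
  by (rule conv_integrand_integrable[OF u laplace_continuous[OF K(1)]]) (rule laplace_eq_0_outside[OF K(2,3) R])
 have i2: "intble (%y. u y * of_real (moll k ep (x - y)))"
  by (rule conv_integrand_integrable[OF u moll_continuous moll_support[OF e]])
 have L: "laplace (conv u (moll k ep)) x = conv u (laplace (moll k ep)) x"
  by (rule conv_C2(2)[OF u K(1,2)]) (rule K(3))
 have "laplace (conv u (moll k ep)) x + of_real (k^2) * conv u (moll k ep) x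
   = (LINT y|lborel. u y * of_real (laplace (moll k ep) (x - y)) + of_real (k^2) * (u y * of_real (moll k ep (x - y))))"
  unfolding L conv_def[of u "laplace (moll k ep)" x] conv_def[of u "moll k ep" x]
  by (subst Bintegral_add[OF i1 integrable_mult_right[OF i2]]) (simp only: integral_mult_right_zero)
 also have "... = (LINT y|lborel. u y * of_real (laplace (%y. moll k ep (x - y)) y + k^2 * moll k ep (x - y)))"
  unfolding M(2) by (simp add: algebra_simps)
 also have "... = 0" using D(1) M(1) by (simp add: weak_helmholtz_def)
 finally show ?thesis .
qed

text \<open>The convolution is moved to the test function, where uniform continuity applies. The
total mass of the mollifier is not one but tends to one, since \<open>J\<^sub>0\<close> tends to one
at the origin.\<close>

lemma mollification_converges:
 fixes u :: "real^2 => complex" and ze :: "real^2 => real"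
 assumes r0: "admissible k r0" and u: "intble u"
  and z: "cts ze" "!!x. norm x > R ==> ze x = 0" and et: "et > 0"
 shows "\<exists>e0>0. \<forall>ep. 0 < ep --> ep < e0 -->
  norm ((LINT x|lborel. conv u (moll k ep) x * of_real (ze x)) - (LINT x|lborel. u x * of_real (ze x))) <= et"
proof -
 define I where "I = (LINT y|lborel. norm (u y))"
 have I: "I >= 0" unfolding I_def by (intro integral_nonneg_AE) auto
 obtain B where B: "!!x. norm (ze x) <= B" using bdd_support(2)[OF z] by blast
 have B0: "B >= 0" using B[of 0] norm_ge_zero order_trans by blast
 define t where "t = et / ((I + 1) * (2 + 2 * B + 1))"
 have t: "t > 0" using et I B0 by (simp add: t_def)
 have t2: "(2 * t + B * (2 * t)) * I <= et"
 proof -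
  have "(2 * t + B * (2 * t)) * I <= (t * (2 + 2 * B + 1)) * (I + 1)"
   using t B0 I by (intro mult_mono) (auto simp: algebra_simps)
  also have "... = et"
  proof -
   have "(I + 1) * (2 + 2 * B + 1) \<noteq> 0" using I B0 by simp
   then have "t * ((I + 1) * (2 + 2 * B + 1)) = et" unfolding t_def by simp
   then show ?thesis by (simp only: mult_ac)
  qed
  finally show ?thesis .
 qed
 obtain d where d: "d > 0" "!!x y. norm (x - y) < d ==> norm (ze x - ze y) < t"
  using uniformly_continuous_bounded_support[OF z t] by blast
 obtain s0 where s0: "s0 > 0" "!!s. \<bar>s\<bar> < s0 ==> \<bar>jf (k^2) s - 1\<bar> < t"
  using jf_near_1[of "k^2" t] t by (metis zero_le_power2)
 define e0 where "e0 = min (min d (sqrt s0)) r0"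
 have r0p: "r0 > 0" using r0 by (simp add: admissible_def)
 show ?thesis
 proof (rule exI[of _ e0], intro conjI allI impI)
  show "e0 > 0" using d s0 r0p by (simp add: e0_def)
  fix ep assume e: "0 < ep" "ep < e0"
  then have er: "ep < r0" and ed: "ep < d" and es: "ep < sqrt s0" by (auto simp: e0_def)
  have "ep^2 < (sqrt s0)^2" using e es by (intro power_strict_mono) auto
  then have es2: "ep^2 < s0" using s0 by simp
  have "\<bar>jf (k^2) s - 1\<bar> <= t" if "0 <= s" "s < ep^2" for s using s0(2)[of s] that es2 by simp
  note M = mass_lower_bound[OF r0 e(1) er this]
  let ?p = "moll k ep"
  have p0: "?p y >= 0" for y using M(1) qf_facts(5)[of ep] by (simp add: moll_def)
  have pint: "intble ?p" by (rule bdd_support(1)[OF moll_continuous moll_support[OF e(1)]])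
  obtain C where C: "!!x. norm (?p x) <= C" using bdd_support(2)[OF moll_continuous moll_support[OF e(1)]] by blast
  have zi: "intble ze" by (rule bdd_support(1)[OF z])
  have um[measurable]: "u \<in> borel_measurable borel" using u by (auto dest: borel_measurable_integrable)
  note zm[measurable] = borel_measurable_continuous_onI[OF z(1)] and pm[measurable] = borel_measurable_continuous_onI[OF moll_continuous, of k ep]
  define F where "F x y = u y * of_real (?p (x - y)) * of_real (ze x)" for x y
  have Fm: "(%(x, y). F x y) \<in> borel_measurable (lborel \<Otimes>\<^sub>M lborel)"
  proof -
   have "(%q::(real^2)\<times>(real^2). ?p (fst q - snd q)) \<in> borel_measurable borel"
    by (intro borel_measurable_continuous_onI continuous_on_compose2[OF moll_continuous]) (auto intro!: continuous_intros)
   then have [measurable]: "(%q::(real^2)\<times>(real^2). ?p (fst q - snd q)) \<in> borel_measurable (borel \<Otimes>\<^sub>M borel)" by (simp add: borel_prod)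
   have "(%q. u (snd q) * of_real (?p (fst q - snd q)) * of_real (ze (fst q))) \<in> borel_measurable (borel \<Otimes>\<^sub>M borel)"
    by measurable
   then have "(%q. u (snd q) * of_real (?p (fst q - snd q)) * of_real (ze (fst q))) \<in> borel_measurable (lborel \<Otimes>\<^sub>M lborel)"
    by (simp add: borel_prod lborel_prod)
   then show ?thesis by (simp add: F_def split_beta)
  qed
  have Fle: "norm (F x y) <= (C * norm (u y)) * norm (ze x)" for x y
   unfolding F_def norm_mult norm_of_real
   using mult_right_mono[OF mult_left_mono[OF C[of "x - y"] norm_ge_zero[of "u y"]] norm_ge_zero[of "ze x"]]
   by (simp add: mult_ac)
  have Fx: "intble (%y. F x y)" for x
   unfolding F_def by (intro integrable_mult_left conv_integrand_integrable[OF u moll_continuous moll_support[OF e(1)]])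
  have Fint: "integrable (lborel \<Otimes>\<^sub>M lborel) (%(x, y). F x y)"
  proof (rule lborel_pair.Fubini_integrable[OF Fm])
   show "AE x in lborel. intble (%y. case (x, y) of (x, y) => F x y)" by (simp add: Fx)
   show "intble (%x. LINT y|lborel. norm (case (x, y) of (x, y) => F x y))"
   proof (rule Bintegrable_bound)
    show "intble (%x. (C * I) * norm (ze x))" using zi by (intro integrable_mult_right integrable_norm)
    have "(%x. LINT y|lborel. norm (F x y)) \<in> borel_measurable lborel"
     using Fm by (intro lborel.borel_measurable_lebesgue_integral) (simp add: split_beta)
    then show "(%x. LINT y|lborel. norm (case (x, y) of (x, y) => F x y)) \<in> borel_measurable lborel" by simp
    show "AE x in lborel. norm (LINT y|lborel. norm (case (x, y) of (x, y) => F x y)) <= norm ((C * I) * norm (ze x))"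
    proof (rule AE_I2)
     fix x
     have "(LINT y|lborel. norm (F x y)) <= (LINT y|lborel. (C * norm (u y)) * norm (ze x))"
      using u by (intro integral_mono Fle integrable_norm[OF Fx] integrable_mult_left integrable_mult_right integrable_norm)
     then have "(LINT y|lborel. norm (F x y)) <= (C * I) * norm (ze x)" by (simp add: I_def)
     moreover have "0 <= (LINT y|lborel. norm (F x y))" by (intro integral_nonneg_AE) auto
     ultimately show "norm (LINT y|lborel. norm (case (x, y) of (x, y) => F x y)) <= norm ((C * I) * norm (ze x))" by simp
    qed
   qed
  qed
  define g where "g y = (LINT z|lborel. ?p z * ze (z + y))" for y
  have gi: "intble (%z. ?p z * ze (z + y))" for y
  proof (rule bdd_support(1)[where R=ep])
   show "cts (%z. ?p z * ze (z + y))"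
    by (intro continuous_on_mult moll_continuous continuous_on_compose2[OF z(1)]) (auto intro!: continuous_intros)
  qed (simp add: moll_support[OF e(1)])
  have gF: "(LINT x|lborel. F x y) = u y * of_real (g y)" for y
  proof -
   have "(LINT x|lborel. F x y) = u y * (LINT x|lborel. of_real (?p (x - y) * ze x))"
    unfolding F_def by (simp add: mult.assoc)
   also have "(LINT x|lborel. cor (?p (x - y) * ze x)) = of_real (LINT x|lborel. ?p (x - y) * ze x)"
    by (rule integral_complex_of_real)
   also have "(LINT x|lborel. ?p (x - y) * ze x) = (LINT z|lborel. ?p (z + y - y) * ze (z + y))"
    by (rule lborel_integral_shift(1)[symmetric]) measurable
   finally show ?thesis by (simp add: g_def)
  qed
  have g_close: "\<bar>g y - ze y\<bar> <= 2 * t + B * (2 * t)" for y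
  proof -
   have i2: "intble (%z. ?p z * ze y)" by (intro integrable_mult_left pint)
   have "\<bar>(LINT z|lborel. ?p z * ze (z + y)) - (LINT z|lborel. ?p z * ze y)\<bar> = \<bar>LINT z|lborel. ?p z * ze (z + y) - ?p z * ze y\<bar>"
    by (simp only: Bintegral_diff[OF gi i2])
   also have "... <= (LINT z|lborel. ?p z * t)"
   proof (rule integral_abs_bound_integral)
    show "intble (%z. ?p z * ze (z + y) - ?p z * ze y)" by (rule Bintegrable_diff[OF gi i2])
    show "intble (%z. ?p z * t)" by (intro integrable_mult_left pint)
    fix z
    show "\<bar>?p z * ze (z + y) - ?p z * ze y\<bar> <= ?p z * t"
    proof (cases "norm z > ep")
     case False
     have "\<bar>ze (z + y) - ze y\<bar> <= t" using d(2)[of "z + y" y] False ed by (simp add: less_imp_le)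
     from mult_left_mono[OF this p0[of z]] show ?thesis using p0[of z] by (simp add: abs_mult flip: right_diff_distrib)
    qed (simp add: moll_support[OF e(1)])
   qed
   also have "... = (LINT z|lborel. ?p z) * t" by simp
   also have "... <= 2 * t" using M(2) t by (intro mult_right_mono) auto
   finally have a: "\<bar>g y - (LINT z|lborel. ?p z) * ze y\<bar> <= 2 * t" by (simp add: g_def)
   have "\<bar>(LINT z|lborel. ?p z) * ze y - ze y\<bar> = \<bar>ze y\<bar> * \<bar>(LINT z|lborel. ?p z) - 1\<bar>"
    by (simp add: abs_mult[symmetric] algebra_simps)
   also have "... <= B * (2 * t)" using B[of y] M(3) B0 by (intro mult_mono) auto
   finally show ?thesis using a by linarith
  qed
  have ug: "intble (%y. u y * of_real (g y))"
   using lborel_pair.integrable_snd[OF Fint] by (simp add: gF)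
  have uz: "intble (%y. u y * of_real (ze y))"
   by (rule integrable_mult_bounded[OF u zm, of B]) (use B in auto)
  have "(LINT x|lborel. conv u ?p x * of_real (ze x)) = (LINT x|lborel. LINT y|lborel. F x y)"
   by (simp add: F_def conv_def)
  also have "... = (LINT y|lborel. LINT x|lborel. F x y)" by (rule lborel_pair.Fubini_integral[OF Fint, symmetric])
  finally have "(LINT x|lborel. conv u ?p x * of_real (ze x)) - (LINT x|lborel. u x * of_real (ze x))
    = (LINT y|lborel. u y * of_real (g y) - u y * of_real (ze y))"
   by (simp only: gF Bintegral_diff[OF ug uz])
  also have "norm ... <= (LINT y|lborel. (2 * t + B * (2 * t)) * norm (u y))"
  proof (rule Bintegral_norm_bound_integral)
   show "intble (%y. u y * of_real (g y) - u y * of_real (ze y))" by (rule Bintegrable_diff[OF ug uz])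
   show "intble (%y. (2 * t + B * (2 * t)) * norm (u y))" using u by (intro integrable_mult_right integrable_norm)
   fix y
   have "norm (u y * of_real (g y) - u y * of_real (ze y)) = \<bar>g y - ze y\<bar> * norm (u y)"
    by (simp add: norm_mult mult.commute flip: right_diff_distrib of_real_diff)
   also have "... <= (2 * t + B * (2 * t)) * norm (u y)" by (intro mult_right_mono g_close) simp
   finally show "norm (u y * of_real (g y) - u y * of_real (ze y)) <= (2 * t + B * (2 * t)) * norm (u y)" .
  qed
  also have "... = (2 * t + B * (2 * t)) * I" by (simp add: I_def)
  also note t2
  finally show "norm ((LINT x|lborel. conv u ?p x * of_real (ze x)) - (LINT x|lborel. u x * of_real (ze x))) <= et" .
 qed
qed

section \<open>Interior regularity\<close>

lemma C1_on_local:
 assumes "!!x. x \<in> D ==> \<exists>S v. open S \<and> x \<in> S \<and> C1_on S v \<and> (\<forall>y\<in>S. u y = v y)"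
 shows "C1_on D u"
 unfolding C1_on_def
proof (intro conjI ballI allI)
 fix x assume "x \<in> D"
 then obtain S v where S: "open S" "x \<in> S" "C1_on S v" "\<forall>y\<in>S. u y = v y" using assms by blast
 have "has_grad u (%j. pd j v x) x"
  by (rule has_grad_cong_open[OF C1_on_has_grad[OF S(3,2)] S(1,2)]) (simp add: S(4))
 then show "u differentiable (at x)" by (rule has_grad_differentiable)
next
 fix j
 have "isCont (pd j u) x" if "x \<in> D" for x
 proof -
  obtain S v where S: "open S" "x \<in> S" "C1_on S v" "\<forall>y\<in>S. u y = v y" using assms \<open>x \<in> D\<close> by blast
  have "pd j u y = pd j v y" if "y \<in> S" for y
   by (rule partial_deriv_cong_open[OF S(1) that]) (simp add: S(4))
  moreover have "continuous_on S (pd j v)" using S(3) by (simp add: C1_on_def)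
  ultimately have "continuous_on S (pd j u)" by (simp cong: continuous_on_cong)
  then show ?thesis using S(1,2) by (simp add: continuous_on_eq_continuous_at)
 qed
 then show "continuous_on D (pd j u)" by (simp add: continuous_at_imp_continuous_on)
qed

lemma C2_on_local:
 assumes "!!x. x \<in> D ==> \<exists>S v. open S \<and> x \<in> S \<and> C2_on S v \<and> (\<forall>y\<in>S. u y = v y)"
 shows "C2_on D u"
 unfolding C2_on_def
proof (intro conjI allI C1_on_local)
 fix x assume "x \<in> D"
 then obtain S v where S: "open S" "x \<in> S" "C2_on S v" "\<forall>y\<in>S. u y = v y" using assms by blast
 then show "\<exists>S v. open S \<and> x \<in> S \<and> C1_on S v \<and> (\<forall>y\<in>S. u y = v y)"
  using C2_on_imp_C1_on by blast
 fix j
 have "\<forall>y\<in>S. pd j u y = pd j v y"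
  using S partial_deriv_cong_open[OF S(1)] by blast
 moreover have "C1_on S (pd j v)" using S(3) by (simp add: C2_on_def)
 ultimately show "\<exists>S v. open S \<and> x \<in> S \<and> C1_on S v \<and> (\<forall>y\<in>S. pd j u y = v y)"
  using S(1,2) by blast
qed

lemma C1_on_subset: "C1_on S u ==> T \<subseteq> S ==> C1_on T u"
 unfolding C1_on_def by (meson continuous_on_subset subsetD)

lemma C2_on_subset: "C2_on S u ==> T \<subseteq> S ==> C2_on T u"
 unfolding C2_on_def by (meson C1_on_subset)

lemma laplace_cong_open:
 assumes "open S" "x \<in> S" "!!y. y \<in> S ==> u y = v y"
 shows "laplace u x = laplace v x"
 unfolding laplace_def
 by (intro sum.cong refl partial_deriv_cong_open[OF assms(1,2)] partial_deriv_cong_open[OF assms(1) _ assms(3)])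

text \<open>All mollifications agree wherever they are defined, and they converge weakly to
\<open>u\<close>.\<close>

lemma AE_eq_mollification:
 fixes u :: "real^2 => complex"
 assumes r0: "admissible k r0" and D: "open D" "weak_helmholtz k D u" and u: "intble u"
  and d: "0 < \<delta>" "\<delta> < r0" and S: "open S" "!!x. x \<in> S ==> cball x \<delta> \<subseteq> D" "bounded S"
 shows "AE x in lborel. x \<in> S --> conv u (moll k \<delta>) x = u x"
proof -
 let ?w = "conv u (moll k \<delta>)"
 have Sm: "S \<in> sets borel" using S(1) by simp
 have wc: "cts ?w" by (rule conv_continuous[OF u moll_continuous moll_support[OF d(1)]])
 have um: "u \<in> borel_measurable borel" using u by (auto dest: borel_measurable_integrable)
 have wm: "?w \<in> borel_measurable borel" by (rule borel_measurable_continuous_onI[OF wc])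
 have dm: "(%x. ?w x - u x) \<in> borel_measurable borel" by (intro borel_measurable_diff um wm)
 have wS: "intble (%x. indicator S x *R ?w x)"
 proof -
  have one: "(%_. 1) \<in> L2 (lebesgue_on S)" by (intro L2_continuous_bounded S continuous_intros)
  have "integrable (lebesgue_on S) (%x. ?w x * 1)"
   by (intro L2_mult_integrable one L2_continuous_bounded S wc)
  then show ?thesis using integral_lebesgue_on_borel(2)[OF Sm wm] by simp
 qed
 have uS: "intble (%x. indicator S x *R u x)" using u Sm by (intro integrable_mult_indicator) auto
 have "AE x in lebesgue_on S. ?w x - u x = 0"
 proof (rule fundamental_lemma_variations[OF S(1)])
  show "integrable (lebesgue_on S) (%x. ?w x - u x)"
   using Bintegrable_diff[OF wS uS] integral_lebesgue_on_borel(2)[OF Sm dm]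
   by (simp add: scaleR_diff_right)
  fix ze assume ze: "ze \<in> test_functions S"
  obtain K R where K: "C1_on UNIV ze" "K \<subseteq> S" "!!x. x \<notin> K ==> ze x = 0" "!!x. norm x > R ==> ze x = 0"
   using test_functionsE[OF ze] by metis
  have zc: "cts ze" by (rule C1_on_continuous[OF K(1)])
  have zm: "ze \<in> borel_measurable borel" by (rule C1_measurable[OF K(1)])
  obtain B where B: "!!x. norm (ze x) <= B" using bdd_support(2)[OF zc K(4)] by blast
  have uz: "intble (%x. u x * of_real (ze x))" by (rule integrable_mult_bounded[OF u zm]) (use B in simp)
  have wz: "intble (%x. ?w x * of_real (ze x))"
   by (rule bdd_support(1)[where R=R]) (auto intro!: continuous_on_mult continuous_on_of_real wc zc simp: K(4))
  have "norm ((LINT x|lborel. ?w x * of_real (ze x)) - (LINT x|lborel. u x * of_real (ze x))) <= et" if et: "et > 0" for et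
  proof -
   obtain e0 where e0: "e0 > 0" "!!ep. 0 < ep ==> ep < e0 ==>
    norm ((LINT x|lborel. conv u (moll k ep) x * of_real (ze x)) - (LINT x|lborel. u x * of_real (ze x))) <= et"
    using mollification_converges[OF r0 u zc K(4) et] by blast
   define ep where "ep = min (e0 / 2) \<delta>"
   have e: "0 < ep" "ep < e0" "ep <= \<delta>" using e0(1) d by (auto simp: ep_def)
   have "conv u (moll k ep) x * of_real (ze x) = ?w x * of_real (ze x)" for x
   proof (cases "x \<in> S")
    case True
    have "cball x ep \<subseteq> D" using S(2)[OF True] subset_cball[OF e(3), of x] by blast
    then have "conv u (moll k ep) x = ?w x"
     using e d by (intro conv_moll_independent[OF r0 _ _ _ _ D _ S(2)[OF True] u]) auto
    then show ?thesis by simp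
   next
    case False
    then have "ze x = 0" using K(2,3) by blast
    then show ?thesis by simp
   qed
   then have "(%x. conv u (moll k ep) x * of_real (ze x)) = (%x. ?w x * of_real (ze x))" by (rule ext)
   then show ?thesis using e0(2)[OF e(1,2)] by (simp only:)
  qed
  then have "norm ((LINT x|lborel. ?w x * of_real (ze x)) - (LINT x|lborel. u x * of_real (ze x))) <= 0"
   by (rule field_le_epsilon[of _ 0, simplified])
  then have "(LINT x|lborel. ?w x * of_real (ze x) - u x * of_real (ze x)) = 0"
   by (simp add: Bintegral_diff[OF wz uz])
  moreover have "(%x. indicator S x *R ((?w x - u x) * of_real (ze x))) = (%x. ?w x * of_real (ze x) - u x * of_real (ze x))"
   using K(2,3) by (auto simp: fun_eq_iff indicator_def left_diff_distrib)
  moreover have "(%x. (?w x - u x) * of_real (ze x)) \<in> borel_measurable borel"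
   using dm zm by (intro borel_measurable_times) auto
  ultimately show "(LINT x|lebesgue_on S. (?w x - u x) * of_real (ze x)) = 0"
   by (simp only: integral_lebesgue_on_borel(1)[OF Sm])
 qed
 then have "AE x in lebesgue. x \<in> S --> ?w x - u x = 0" using Sm by (simp add: AE_restrict_space_iff)
 then have "AE x in lborel. x \<in> S --> ?w x - u x = 0"
  using dm Sm by (subst (asm) AE_completion_iff)
 then show ?thesis by eventually_elim simp
qed

text \<open>A weak solution is locally equal to its mollification, which is smooth; the radius does
not matter, so the local versions fit together.\<close>

theorem weyl_helmholtz:
 fixes u :: "real^2 => complex"
 assumes r0: "admissible k r0" and D: "open D" "weak_helmholtz k D u" and u: "intble u"
 shows "\<exists>w. C2_on D w \<and> (\<forall>x\<in>D. laplacian w x + of_real (k^2) * w x = 0) \<and> (AE x in lborel. x \<in> D --> w x = u x) \<and>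
  (\<forall>x ep. 0 < ep --> ep < r0 --> cball x ep \<subseteq> D --> w x = conv u (moll k ep) x)"
proof -
 have r0p: "r0 > 0" using r0 by (simp add: admissible_def)
 have ex: "\<exists>ep>0. ep < r0 \<and> cball x (2 * ep) \<subseteq> D" if "x \<in> D" for x
 proof -
  from D(1)[unfolded open_contains_cball, rule_format, OF that]
  obtain e where e: "e > 0" "cball x e \<subseteq> D" by blast
  show ?thesis
  proof (intro exI[of _ "min (e / 2) (r0 / 2)"] conjI)
   have "cball x (2 * min (e / 2) (r0 / 2)) \<subseteq> cball x e" by (rule subset_cball) auto
   then show "cball x (2 * min (e / 2) (r0 / 2)) \<subseteq> D" using e(2) by blast
  qed (use e r0p in auto)
 qed
 then have "\<exists>\<rho>. \<forall>x\<in>D. \<rho> x > 0 \<and> \<rho> x < r0 \<and> cball x (2 * \<rho> x) \<subseteq> D" by (intro bchoice) blast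
 then obtain \<rho> where \<rho>: "!!x. x \<in> D ==> \<rho> x > 0" "!!x. x \<in> D ==> \<rho> x < r0" "!!x. x \<in> D ==> cball x (2 * \<rho> x) \<subseteq> D" by blast
 define w where "w x = conv u (moll k (\<rho> x)) x" for x
 have w_eq: "w x = conv u (moll k ep) x" if "0 < ep" "ep < r0" "cball x ep \<subseteq> D" for x ep
 proof -
  have x: "x \<in> D" using that by auto
  have "\<rho> x <= 2 * \<rho> x" using \<rho>(1)[OF x] by simp
  from subset_trans[OF subset_cball[OF this] \<rho>(3)[OF x]] have "cball x (\<rho> x) \<subseteq> D" .
  then show ?thesis unfolding w_def by (intro conv_moll_independent[OF r0 \<rho>(1,2)[OF x] that(1,2) D _ that(3) u])
 qed
 define S where "S x = ball x (\<rho> x)" for x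
 have S: "open (S x)" "bounded (S x)" for x by (simp_all add: S_def)
 have xS: "x \<in> S x" if "x \<in> D" for x using \<rho>(1)[OF that] by (simp add: S_def)
 have cS: "cball y (\<rho> x) \<subseteq> D" if "x \<in> D" "y \<in> S x" for x y
 proof -
  have "cball y (\<rho> x) \<subseteq> cball x (2 * \<rho> x)"
  proof
   fix z assume "z \<in> cball y (\<rho> x)"
   then show "z \<in> cball x (2 * \<rho> x)" using that(2) dist_triangle[of x z y] by (simp add: S_def)
  qed
  then show ?thesis using \<rho>(3)[OF that(1)] by blast
 qed
 have wS: "w y = conv u (moll k (\<rho> x)) y" if "x \<in> D" "y \<in> S x" for x y
  by (rule w_eq[OF \<rho>(1,2)[OF that(1)] cS[OF that]])
 have C2: "C2_on UNIV (conv u (moll k ep))" if e: "ep > 0" for ep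
 proof -
  obtain K where K: "C2_on UNIV (moll k ep)" "compact K" "!!x. x \<notin> K ==> moll k ep x = 0"
   using moll_C2c(3)[OF e subset_UNIV] by (auto simp: C2c_def)
  show ?thesis by (rule conv_C2(1)[OF u K(1,2)]) (rule K(3))
 qed
 show ?thesis
 proof (intro exI[of _ w] conjI ballI allI impI)
  show "C2_on D w"
  proof (rule C2_on_local)
   fix x assume x: "x \<in> D"
   show "\<exists>S v. open S \<and> x \<in> S \<and> C2_on S v \<and> (\<forall>y\<in>S. w y = v y)"
    by (intro exI[of _ "S x"] exI[of _ "conv u (moll k (\<rho> x))"] conjI S xS[OF x] C2_on_subset[OF C2[OF \<rho>(1)[OF x]]])
      (auto simp: wS[OF x])
  qed
  show "laplacian w x + of_real (k^2) * w x = 0" if x: "x \<in> D" for x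
  proof -
   have "laplacian w x = laplace (conv u (moll k (\<rho> x))) x"
    unfolding laplacian_eq by (rule laplace_cong_open[OF S(1) xS[OF x]]) (rule wS[OF x])
   then show ?thesis
    using conv_moll_helmholtz[OF \<rho>(1)[OF x] D(2) cS[OF x xS[OF x]] u] wS[OF x xS[OF x]] by simp
  qed
  show "w x = conv u (moll k ep) x" if "0 < ep" "ep < r0" "cball x ep \<subseteq> D" for x ep by (rule w_eq[OF that])
  obtain F' where F': "F' \<subseteq> S ` D" "countable F'" "\<Union>F' = \<Union>(S ` D)"
   using Lindelof[of "S ` D"] S(1) by blast
  have "AE x in lborel. \<forall>X\<in>F'. x \<in> X --> w x = u x"
  proof (subst AE_ball_countable[OF F'(2)], intro ballI)
   fix X assume "X \<in> F'"
   then obtain x where x: "x \<in> D" "X = S x" using F'(1) by blast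
   have "AE y in lborel. y \<in> S x --> conv u (moll k (\<rho> x)) y = u y"
    by (rule AE_eq_mollification[OF r0 D u \<rho>(1,2)[OF x(1)] S(1) cS[OF x(1)] S(2)])
   then show "AE y in lborel. y \<in> X --> w y = u y"
    by eventually_elim (use wS[OF x(1)] x(2) in simp)
  qed
  then show "AE x in lborel. x \<in> D --> w x = u x"
  proof eventually_elim
   fix x assume *: "\<forall>X\<in>F'. x \<in> X --> w x = u x"
   show "x \<in> D --> w x = u x"
   proof
    assume "x \<in> D"
    then have "x \<in> \<Union>F'" using xS F'(3) by blast
    then show "w x = u x" using * by blast
   qed
  qed
 qed
qed

section \<open>The Dirichlet problem\<close>

lemma sqint_of_real_L2:
 fixes \<phi> :: "real^2 => real"
 assumes \<phi>: "sqint \<phi>" and D: "D \<in> sets borel"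
 shows "(%x. cor (\<phi> x)) \<in> L2 (lebesgue_on D)"
  and "(LINT x|lebesgue_on D. (cmod (of_real (\<phi> x)))^2) <= (LINT x|lborel. (norm (\<phi> x))^2)"
  and "bounded D ==> intble (%x. indicator D x *R \<phi> x)"
proof -
 have m: "\<phi> \<in> borel_measurable borel" using sqint_measurable[OF \<phi>] by simp
 have i: "intble (%x. (norm (\<phi> x))^2)" by (rule sqint_norm[OF \<phi>])
 have eqn: "(cmod (of_real (\<phi> x)))^2 = (norm (\<phi> x))^2" for x by simp
 have m2: "(%x. (norm (\<phi> x))^2) \<in> borel_measurable borel" using i by (auto dest: borel_measurable_integrable)
 have i2: "intble (%x. indicator D x *R (norm (\<phi> x))^2)" using i D by (intro integrable_mult_indicator) auto
 have "integrable (lebesgue_on D) (%x. (cmod (of_real (\<phi> x)))^2)"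
  unfolding eqn integral_lebesgue_on_borel(2)[OF D m2] by (rule i2)
 then show L: "(%x. cor (\<phi> x)) \<in> L2 (lebesgue_on D)"
  unfolding L2_def using m by (auto intro!: borel_measurable_lebesgue_on borel_measurable_of_real)
 have "(LINT x|lebesgue_on D. (cmod (of_real (\<phi> x)))^2) = (LINT x|lborel. indicator D x *R (norm (\<phi> x))^2)"
  unfolding eqn by (rule integral_lebesgue_on_borel(1)[OF D m2])
 also have "... <= (LINT x|lborel. (norm (\<phi> x))^2)"
  by (rule integral_mono[OF i2 i]) (simp add: indicator_def)
 finally show "(LINT x|lebesgue_on D. (cmod (of_real (\<phi> x)))^2) <= (LINT x|lborel. (norm (\<phi> x))^2)" .
 assume bD: "bounded D"
 have "emeasure lborel D < \<infinity>" using emeasure_bounded_finite[OF bD] by simp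
 then have iD: "intble (indicator D :: real^2 => real)" using D by (intro integrable_real_indicator) auto
 show "intble (%x. indicator D x *R \<phi> x)"
 proof (rule Bintegrable_bound[OF Bintegrable_add[OF iD i]])
  show "(%x. indicator D x *R \<phi> x) \<in> borel_measurable lborel" using m D by simp
  have "\<bar>\<phi> x\<bar> <= 1 + (\<phi> x)^2" for x
   using abs_inner_le_squares[of "\<phi> x" 1] by simp
  then show "AE x in lborel. norm (indicator D x *R \<phi> x) <= norm (indicator D x + (norm (\<phi> x))^2)"
   by (intro AE_I2) (auto simp: indicator_def)
 qed
qed

lemma H10_orthogonal:
 assumes U: "U \<in> H10 D" and Z: "!!et. et \<in> test_functions D ==> inner (abs_l2 (grad_pair et)) Z = 0"
 shows "inner U Z = 0"
proof -
 obtain et where et: "!!n. et n \<in> test_functions D" "(%n. abs_l2 (grad_pair (et n))) ---> U"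
  using H10_sequence[OF U] by metis
 have "(%n. inner (abs_l2 (grad_pair (et n))) Z) ---> inner U Z" by (intro tendsto_inner et(2) tendsto_const)
 then show ?thesis by (simp add: Z[OF et(1)] LIMSEQ_const_iff)
qed

lemma sqint_component:
 "sqint f ==> sqint (%x. snd (f x) $ j)" for f :: "real^2 => real \<times> (real^2)"
proof -
 assume f: "sqint f"
 have s: "sqint (%x. snd (f x))" by (rule sqint_snd[OF f])
 show ?thesis
 proof (rule sqint_bound[OF _ sqint_norm[OF s]])
  show "(%x. snd (f x) $ j) \<in> borel_measurable lborel"
   by (rule measurable_compose[OF sqint_measurable[OF s] borel_measurable_continuous_onI])
     (intro continuous_intros)
  show "(norm (snd (f x) $ j))^2 <= (norm (snd (f x)))^2" for x
   using component_le_norm_cart[of "snd (f x)" j] by (intro power_mono) simp_all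
 qed
qed

lemma sqint_test: "et \<in> test_functions D ==> sqint et"
 using sqint_fst[OF sqint_grad_pair] by (simp add: grad_pair_def)

lemma sqint_partial_test: "et \<in> test_functions D ==> sqint (pd j et)"
 using sqint_component[OF sqint_grad_pair, of et D j] by (simp add: grad_pair_def)

lemma test_in_H10: "et \<in> test_functions D ==> abs_l2 (grad_pair et) \<in> H10 D"
 using closure_subset[of "test_space D"] by (auto simp: H10_def test_space_def)

lemma H10_weak_derivative:
 assumes f: "sqint f" "abs_l2 f \<in> H10 D" and ze: "ze \<in> test_functions D"
 shows "(LINT x|lborel. fst (f x) * pd j ze x) = - (LINT x|lborel. snd (f x) $ j * ze x)"
proof -
 define z where "z x = (pd j ze x, ze x *R (axis j 1 :: real^2))" for x
 have sz: "sqint z"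
 proof -
  obtain K R where K: "C1_on UNIV ze" "!!x. norm x > R ==> ze x = 0" using test_functionsE[OF ze] by metis
  have c: "cts ze" "cts (pd j ze)"
   using K(1) by (simp_all add: C1_on_continuous) (simp add: C1_on_def)
  show ?thesis
  proof (rule sqint_continuous)
   show "cts z" unfolding z_def[abs_def]
    by (intro continuous_on_Pair continuous_on_scaleR c continuous_on_const)
   show "z x = 0" if "norm x > R" for x
    using K(2)[OF that] partial_deriv_eq_0[OF K(2) that] by (simp add: z_def zero_prod_def)
  qed
 qed
 have inner_z: "inner (abs_l2 g) (abs_l2 z) = (LINT x|lborel. fst (g x) * pd j ze x) + (LINT x|lborel. snd (g x) $ j * ze x)"
  if g: "sqint g" for g :: "real^2 => real \<times> (real^2)"
 proof -
  have i1: "intble (%x. fst (g x) * pd j ze x)"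
   using sqint_inner[OF sqint_fst[OF g] sqint_partial_test[OF ze]] by simp
  have i2: "intble (%x. snd (g x) $ j * ze x)"
   using sqint_inner[OF sqint_component[OF g] sqint_test[OF ze]] by simp
  have "inner (g x) (z x) = fst (g x) * pd j ze x + snd (g x) $ j * ze x" for x
   by (simp add: z_def inner_prod_def inner_axis mult.commute)
  then show ?thesis unfolding inner_abs_l2[OF g sz] using i1 i2 by simp
 qed
 have "inner (abs_l2 f) (abs_l2 z) = 0"
 proof (rule H10_orthogonal[OF f(2)])
  fix et assume et: "et \<in> test_functions D"
  obtain R where K: "C1_on UNIV et" "!!x. norm x > R ==> et x = 0" using test_functionsE[OF et] by metis
  have z1: "C1_on UNIV ze" using ze by (simp add: test_functions_def)
  have "(LINT x|lborel. cor (ze x) * of_real (pd j et x)) = - (LINT x|lborel. pd j (%x. cor (ze x)) x * of_real (et x))"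
   by (rule integral_divergence_form[OF C1_on_linear[OF bounded_linear_of_real z1] K])
  moreover have "pd j (%x. cor (ze x)) x = of_real (pd j ze x)" for x
   by (rule partial_deriv_linear[OF bounded_linear_of_real C1_on_differentiable[OF z1 UNIV_I]])
  ultimately have "cor (LINT x|lborel. ze x * pd j et x) = of_real (- (LINT x|lborel. pd j ze x * et x))"
   by (simp only: of_real_mult[symmetric] integral_complex_of_real of_real_minus)
  then have "(LINT x|lborel. ze x * pd j et x) = - (LINT x|lborel. pd j ze x * et x)"
   by (simp only: of_real_eq_iff)
  then show "inner (abs_l2 (grad_pair et)) (abs_l2 z) = 0"
   unfolding inner_z[OF sqint_grad_pair[OF et]] by (simp add: grad_pair_def mult.commute)
 qed
 then show ?thesis unfolding inner_z[OF f(1)] by simp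
qed

text \<open>An approximating sequence of test functions for \<open>f\<close> also witnesses the
vanishing trace.\<close>

lemma H10_has_trace:
 assumes D: "open D" "bounded D" and f: "sqint f" "abs_l2 f \<in> H10 D"
 shows "has_trace D (%x. cor (fst (f x))) (%_. 0)"
proof -
 have Dm: "D \<in> sets borel" using D(1) by simp
 have wd: "is_weak_deriv D j (%x. cor (fst (g x))) (%x. cor (snd (g x) $ j))"
  if g: "sqint g" "abs_l2 g \<in> H10 D" for g j
  unfolding is_weak_deriv_def
 proof (intro conjI ballI)
  show "(%x. cor (snd (g x) $ j)) \<in> L2 (lebesgue_on D)"
   by (rule sqint_of_real_L2(1)[OF sqint_component[OF g(1)] Dm])
  fix et assume et: "et \<in> test_functions D"
  obtain K where K: "compact K" "K \<subseteq> D" "!!x. x \<notin> K ==> et x = 0" using test_functionsE[OF et] by metis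
  have ind: "indicator D x *R cor (a * et x) = of_real (a * et x)"
   "indicator D x *R cor (a * pd j et x) = of_real (a * pd j et x)" for a x
  proof -
   have "et x = 0 \<and> pd j et x = 0" if "x \<notin> D"
   proof
    have xK: "x \<notin> K" using that K(2) by blast
    show "et x = 0" by (rule K(3)[OF xK])
    show "pd j et x = 0" by (rule partial_deriv_eq_0_outside[OF K(1) _ xK]) (rule K(3))
   qed
   then show "indicator D x *R cor (a * et x) = of_real (a * et x)"
    "indicator D x *R cor (a * pd j et x) = of_real (a * pd j et x)"
    by (auto simp: indicator_def)
  qed
  have m: "(%x. fst (g x)) \<in> borel_measurable borel" "(%x. snd (g x) $ j) \<in> borel_measurable borel"
   "et \<in> borel_measurable borel" "pd j et \<in> borel_measurable borel"
   using sqint_measurable[OF sqint_fst[OF g(1)]]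
    sqint_measurable[OF sqint_component[OF g(1)]]
    sqint_measurable[OF sqint_test[OF et]]
    sqint_measurable[OF sqint_partial_test[OF et]] by simp_all
  have m': "(%x. cor (fst (g x) * pd j et x)) \<in> borel_measurable borel"
   by (rule measurable_compose[OF _ borel_measurable_of_real]) (intro borel_measurable_times m)
  have m'': "(%x. cor (snd (g x) $ j * et x)) \<in> borel_measurable borel"
   by (rule measurable_compose[OF _ borel_measurable_of_real]) (intro borel_measurable_times m)
  have "(LINT x|lebesgue_on D. cor (fst (g x) * pd j et x)) = of_real (LINT x|lborel. fst (g x) * pd j et x)"
   unfolding integral_lebesgue_on_borel(1)[OF Dm m'] ind by (rule integral_complex_of_real)
  also have "... = of_real (- (LINT x|lborel. snd (g x) $ j * et x))" by (simp only: H10_weak_derivative[OF g et])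
  also have "... = - (LINT x|lebesgue_on D. cor (snd (g x) $ j * et x))"
   by (subst integral_lebesgue_on_borel(1)[OF Dm m'']) (simp only: ind integral_complex_of_real of_real_minus)
  finally show "(LINT x|lebesgue_on D. cor (fst (g x)) * of_real (pd j et x)) =
    - (LINT x|lebesgue_on D. cor (snd (g x) $ j) * of_real (et x))" by (simp only: of_real_mult)
 qed
 have fst_L2: "(%x. cor (fst (f x))) \<in> L2 (lebesgue_on D)"
  by (rule sqint_of_real_L2(1)[OF sqint_fst[OF f(1)] Dm])
 obtain et where et: "!!n. et n \<in> test_functions D" "(%n. abs_l2 (grad_pair (et n))) ---> abs_l2 f"
  using H10_sequence[OF f(2)] by metis
 show ?thesis unfolding has_trace_def
 proof (intro conjI exI[of _ "%n x. cor (et n x)"] allI)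
  show "(%x. cor (fst (f x))) \<in> H1 D" using wd[OF f] fst_L2 by (auto simp: H1_def)
  show "(%_. 0) \<in> borel_measurable (boundary_measure D)" by simp
  show "C1_on UNIV (%x. cor (et n x))" for n
   by (rule C1_on_linear[OF bounded_linear_of_real]) (use et(1)[of n] in \<open>simp add: test_functions_def\<close>)
  have le: "(H1_norm D (%x. cor (fst (f x)) - of_real (et n x)))^2 <= (norm (abs_l2 f - abs_l2 (grad_pair (et n))))^2" for n
  proof -
   note sg = sqint_grad_pair[OF et(1)[of n]]
   define d where "d x = f x - grad_pair (et n) x" for x
   have sd: "sqint d" unfolding d_def[abs_def] by (rule sqint_diff[OF f(1) sg])
   have dH: "abs_l2 d \<in> H10 D"
   proof -
    have "abs_l2 (grad_pair (et n)) \<in> H10 D"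
     by (rule test_in_H10[OF et(1)])
    then have "abs_l2 f - abs_l2 (grad_pair (et n)) \<in> H10 D" using f(2) subspace_diff[OF subspace_H10] by blast
    then show ?thesis by (simp add: abs_l2_diff[OF f(1) sg] d_def[abs_def])
   qed
   have "(H1_norm D (%x. cor (fst (d x))))^2
    = (LINT x|lebesgue_on D. (cmod (of_real (fst (d x))))^2) + (\<Sum>j\<in>UNIV. LINT x|lebesgue_on D. (cmod (of_real (snd (d x) $ j)))^2)"
    by (rule H1_norm_eq[OF D wd[OF sd dH]])
   also have "... <= (LINT x|lborel. (norm (fst (d x)))^2) + (\<Sum>j\<in>UNIV. LINT x|lborel. (norm (snd (d x) $ j))^2)"
    by (intro add_mono sum_mono sqint_of_real_L2(2)[OF _ Dm] sqint_fst sd sqint_component)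
   also have "... = (LINT x|lborel. (norm (d x))^2)"
   proof -
    have "(norm (d x))^2 = (norm (fst (d x)))^2 + (\<Sum>j\<in>UNIV. (norm (snd (d x) $ j))^2)" for x
     by (cases "d x") (simp add: norm_Pair norm_vec_def L2_set_def sum_nonneg)
    then have "(LINT x|lborel. (norm (d x))^2) = (LINT x|lborel. (norm (fst (d x)))^2 + (\<Sum>j\<in>UNIV. (norm (snd (d x) $ j))^2))" by (simp only:)
    also have "... = (LINT x|lborel. (norm (fst (d x)))^2) + (LINT x|lborel. (\<Sum>j\<in>UNIV. (norm (snd (d x) $ j))^2))"
     by (intro Bintegral_add Bintegrable_sum sqint_norm sqint_fst sd sqint_component)
    also have "(LINT x|lborel. (\<Sum>j\<in>UNIV. (norm (snd (d x) $ j))^2)) = (\<Sum>j\<in>UNIV. LINT x|lborel. (norm (snd (d x) $ j))^2)"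
     by (intro Bintegral_sum sqint_norm sd sqint_component)
    finally show ?thesis by simp
   qed
   also have "... = (norm (abs_l2 d))^2" by (rule norm_abs_l2[OF sd, symmetric])
   finally show ?thesis unfolding abs_l2_diff[OF f(1) sg] d_def[abs_def] by (simp add: grad_pair_def)
  qed
  have "(%n. (norm (abs_l2 f - abs_l2 (grad_pair (et n))))^2) ---> (norm (abs_l2 f - abs_l2 f))^2"
   by (intro tendsto_intros et(2))
  then have lim: "(%n. (norm (abs_l2 f - abs_l2 (grad_pair (et n))))^2) ---> 0" by simp
  have "(%n. (H1_norm D (%x. cor (fst (f x)) - of_real (et n x)))^2) ---> 0"
   by (rule Lim_null_comparison[OF always_eventually lim]) (use le in simp)
  from tendsto_real_sqrt[OF this]
  show "(%n. H1_norm D (%x. cor (fst (f x)) - of_real (et n x))) ---> 0" by (simp add: H1_norm_nonneg)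
  have "et n x = 0" if "x \<in> frontier D" for n x
  proof -
   obtain K where K: "K \<subseteq> D" "!!x. x \<notin> K ==> et n x = 0" using test_functionsE[OF et(1)[of n]] by metis
   have "x \<notin> D" using that D(1) by (simp add: frontier_def interior_open)
   then show ?thesis using K by blast
  qed
  then have "(\<integral>\<^sup>+x. ennreal ((cmod (of_real (et n x) - 0))^2) \<partial>boundary_measure D) = (\<integral>\<^sup>+x. 0 \<partial>boundary_measure D)" for n
   by (intro nn_integral_cong) (simp add: space_boundary_measure)
  then show "(%n. \<integral>\<^sup>+x. ennreal ((cmod (of_real (et n x) - 0))^2) \<partial>boundary_measure D) ---> 0" by simp
 qed
qed

text \<open>The weak form of \<open>laplace u + k^2 u = p\<close> with \<open>u\<close> in the
closure of the test functions; \<open>f\<close> represents \<open>u\<close> and its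
gradient.\<close>

definition solves :: "real => (real^2) set => (real^2 => real) => (real^2 => real \<times> (real^2)) => bool" where
 "solves k D p f \<longleftrightarrow> sqint f \<and> abs_l2 f \<in> H10 D \<and>
  (\<forall>V\<in>H10 D. inner (abs_l2 f - (1 + k^2) *R value_part (abs_l2 f)) V = - inner (abs_l2 (%x. (p x, 0))) V)"

lemma solves_weak:
 assumes s: "solves k D p f" and p: "sqint p" and ze: "C2c D ze"
 shows "(LINT x|lborel. fst (f x) * (laplace ze x + k^2 * ze x)) = (LINT x|lborel. p x * ze x)"
proof -
 have f: "sqint f" "abs_l2 f \<in> H10 D" using s by (auto simp: solves_def)
 note t = C2c_test_function[OF ze]
 note sg = sqint_grad_pair[OF t(1)]
 have VH: "abs_l2 (grad_pair ze) \<in> H10 D" by (rule test_in_H10[OF t(1)])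
 have i0: "intble (%x. fst (f x) * ze x)"
  using sqint_inner[OF sqint_fst[OF f(1)] sqint_test[OF t(1)]] by simp
 have ij: "intble (%x. snd (f x) $ j * pd j ze x)" for j
  using sqint_inner[OF sqint_component[OF f(1)] sqint_partial_test[OF t(1)]] by simp
 have ijj: "intble (%x. fst (f x) * pd j (pd j ze) x)" for j
  using sqint_inner[OF sqint_fst[OF f(1)] sqint_partial_test[OF t(2)]] by simp
 have 1: "inner (abs_l2 f) (abs_l2 (grad_pair ze)) = (LINT x|lborel. fst (f x) * ze x) + (\<Sum>j\<in>UNIV. LINT x|lborel. snd (f x) $ j * pd j ze x)"
 proof -
  have "inner (f x) (grad_pair ze x) = fst (f x) * ze x + (\<Sum>j\<in>UNIV. snd (f x) $ j * pd j ze x)" for x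
   by (simp add: grad_pair_def inner_prod_def inner_vec_def)
  then have "inner (abs_l2 f) (abs_l2 (grad_pair ze)) = (LINT x|lborel. fst (f x) * ze x + (\<Sum>j\<in>UNIV. snd (f x) $ j * pd j ze x))"
   by (simp only: inner_abs_l2[OF f(1) sg])
  also have "... = (LINT x|lborel. fst (f x) * ze x) + (LINT x|lborel. (\<Sum>j\<in>UNIV. snd (f x) $ j * pd j ze x))"
   by (intro Bintegral_add i0 Bintegrable_sum ij)
  also have "(LINT x|lborel. (\<Sum>j\<in>UNIV. snd (f x) $ j * pd j ze x)) = (\<Sum>j\<in>UNIV. LINT x|lborel. snd (f x) $ j * pd j ze x)"
   by (intro Bintegral_sum ij)
  finally show ?thesis .
 qed
 have 2: "inner (value_part (abs_l2 f)) (abs_l2 (grad_pair ze)) = (LINT x|lborel. fst (f x) * ze x)"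
  unfolding value_part_abs[OF f(1)] inner_abs_l2[OF sqint_pair0[OF sqint_fst[OF f(1)]] sg]
  by (simp add: grad_pair_def inner_prod_def)
 have 3: "inner (abs_l2 (%x. (p x, 0))) (abs_l2 (grad_pair ze)) = (LINT x|lborel. p x * ze x)"
  unfolding inner_abs_l2[OF sqint_pair0[OF p] sg] by (simp add: grad_pair_def inner_prod_def)
 have 4: "(LINT x|lborel. snd (f x) $ j * pd j ze x) = - (LINT x|lborel. fst (f x) * pd j (pd j ze) x)" for j
  using H10_weak_derivative[OF f t(2), of j j] by simp
 have "inner (abs_l2 f - (1 + k^2) *R value_part (abs_l2 f)) (abs_l2 (grad_pair ze)) = - inner (abs_l2 (%x. (p x, 0))) (abs_l2 (grad_pair ze))"
  using s VH by (simp add: solves_def)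
 then have "(\<Sum>j\<in>UNIV. LINT x|lborel. fst (f x) * pd j (pd j ze) x) + k^2 * (LINT x|lborel. fst (f x) * ze x) = (LINT x|lborel. p x * ze x)"
  unfolding inner_diff_left inner_scaleR_left 1 2 3 4 by (simp add: sum_negf algebra_simps)
 moreover have "(LINT x|lborel. fst (f x) * (laplace ze x + k^2 * ze x))
   = (LINT x|lborel. (\<Sum>j\<in>UNIV. fst (f x) * pd j (pd j ze) x) + k^2 * (fst (f x) * ze x))"
  by (simp add: laplace_def distrib_left sum_distrib_left mult_ac)
 moreover have "... = (LINT x|lborel. (\<Sum>j\<in>UNIV. fst (f x) * pd j (pd j ze) x)) + (LINT x|lborel. k^2 * (fst (f x) * ze x))"
  by (intro Bintegral_add integrable_mult_right i0 Bintegrable_sum ijj)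
 moreover have "(LINT x|lborel. (\<Sum>j\<in>UNIV. fst (f x) * pd j (pd j ze) x)) = (\<Sum>j\<in>UNIV. LINT x|lborel. fst (f x) * pd j (pd j ze) x)"
  by (intro Bintegral_sum ijj)
 ultimately show ?thesis by simp
qed

text \<open>Both sides are the symmetric form evaluated at the two solutions.\<close>

lemma solves_symmetric:
 assumes f: "solves k D p f" and g: "solves k D q g" and p: "sqint p" and q: "sqint q"
 shows "(LINT x|lborel. p x * fst (g x)) = (LINT x|lborel. q x * fst (f x))"
proof -
 let ?c = "1 + k^2"
 have "inner (abs_l2 f - ?c *R value_part (abs_l2 f)) (abs_l2 g) = inner (abs_l2 g - ?c *R value_part (abs_l2 g)) (abs_l2 f)"
  by (simp only: inner_diff_left inner_scaleR_left value_part_symmetric[of "abs_l2 f" "abs_l2 g"]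
    inner_commute[of "abs_l2 g" "abs_l2 f"] inner_commute[of "abs_l2 f" "value_part (abs_l2 g)"])
 then have "inner (abs_l2 (%x. (p x, 0))) (abs_l2 g) = inner (abs_l2 (%x. (q x, 0))) (abs_l2 f)"
  using f g by (simp add: solves_def)
 then show ?thesis
  using f g inner_abs_l2[OF sqint_pair0[OF p], of g] inner_abs_l2[OF sqint_pair0[OF q], of f]
  unfolding solves_def by (simp only: inner_prod_def fst_conv snd_conv inner_zero_left add_0_right inner_real_def)
qed

text \<open>The part of \<open>f\<close> outside \<open>D\<close> is orthogonal to every test
function, hence to itself.\<close>

lemma H10_vanishes_outside:
 assumes D: "open D" and f: "sqint f" "abs_l2 f \<in> H10 D"
 shows "AE x in lborel. x \<notin> D --> fst (f x) = 0"
proof -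
 have Dm: "D \<in> sets borel" using D by simp
 define z where "z x = (indicator (- D) x *R fst (f x), 0 :: real^2)" for x
 have s1: "sqint (%x. indicator (- D) x *R fst (f x))"
 proof (rule sqint_bound[OF _ sqint_norm[OF sqint_fst[OF f(1)]]])
  show "(%x. indicator (- D) x *R fst (f x)) \<in> borel_measurable lborel"
   using sqint_measurable[OF sqint_fst[OF f(1)]] Dm by (intro borel_measurable_scaleR borel_measurable_indicator) auto
 qed (simp add: indicator_def)
 have sz: "sqint z" unfolding z_def[abs_def] by (rule sqint_pair0[OF s1])
 have "inner (abs_l2 f) (abs_l2 z) = 0"
 proof (rule H10_orthogonal[OF f(2)])
  fix et assume et: "et \<in> test_functions D"
  obtain K where K: "K \<subseteq> D" "!!x. x \<notin> K ==> et x = 0" using test_functionsE[OF et] by metis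
  have "inner (grad_pair et x) (z x) = 0" for x using K by (auto simp: grad_pair_def z_def inner_prod_def indicator_def)
  then show "inner (abs_l2 (grad_pair et)) (abs_l2 z) = 0" unfolding inner_abs_l2[OF sqint_grad_pair[OF et] sz] by simp
 qed
 then have "(LINT x|lborel. inner (f x) (z x)) = 0" by (simp add: inner_abs_l2[OF f(1) sz])
 moreover have "inner (f x) (z x) = indicator (- D) x * (fst (f x))^2" for x by (simp add: z_def inner_prod_def power2_eq_square)
 ultimately have "AE x in lborel. indicator (- D) x * (fst (f x))^2 = 0"
  using sqint_inner[OF f(1) sz] by (subst (asm) integral_nonneg_eq_0_iff_AE) auto
 then show ?thesis by eventually_elim (auto simp: indicator_def)
qed

locale cavity =
 fixes k :: real and D :: "(real^2) set"
 assumes open_D: "open D" and bounded_D: "bounded D" and regular: "\<not> dirichlet_eigenvalue D (k^2)"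
begin

lemma D_borel: "D \<in> sets borel" using open_D by simp

lemma classical_representative:
 assumes r0: "admissible k r0" and u: "weak_helmholtz k D u" "intble u" "has_trace D u f"
 shows "\<exists>w. helmholtz_dirichlet D k f w \<and> (AE x in lborel. x \<in> D --> w x = u x) \<and>
  (\<forall>x ep. 0 < ep --> ep < r0 --> cball x ep \<subseteq> D --> w x = conv u (moll k ep) x)"
proof -
 obtain w where w: "C2_on D w" "\<forall>x\<in>D. laplacian w x + of_real (k^2) * w x = 0" "AE x in lborel. x \<in> D --> w x = u x"
  "\<forall>x ep. 0 < ep --> ep < r0 --> cball x ep \<subseteq> D --> w x = conv u (moll k ep) x"
  using weyl_helmholtz[OF r0 open_D u(1,2)] by blast
 have "AE x in lebesgue. x \<in> D --> w x = u x" by (rule AE_completion[OF w(3)])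
 then have ae: "AE x in lebesgue_on D. u x = w x"
  using D_borel by (subst AE_restrict_space_iff) (auto elim!: eventually_mono)
 have wm: "w \<in> borel_measurable (lebesgue_on D)"
  by (rule continuous_imp_measurable_on_sets_lebesgue)
    (use w(1) D_borel in \<open>auto intro: C1_on_continuous C2_on_imp_C1_on\<close>)
 have tr: "has_trace D w f" by (rule has_trace_cong_AE[OF open_D bounded_D u(3) wm ae])
 then have "w \<in> H1 D" by (simp add: has_trace_def)
 then have "helmholtz_dirichlet D k f w" using w(1,2) tr by (simp add: helmholtz_dirichlet_def)
 then show ?thesis using w(3,4) by blast
qed

lemma trace_zero_unique:
 assumes u: "weak_helmholtz k D u" "intble u" "has_trace D u (%_. 0)"
 shows "AE x in lborel. x \<in> D --> u x = 0"
proof -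
 obtain r0 where r0: "admissible k r0" using admissible_exists by blast
 obtain w where w: "helmholtz_dirichlet D k (%_. 0) w" "AE x in lborel. x \<in> D --> w x = u x"
  using classical_representative[OF r0 u] by blast
 have "\<forall>x\<in>D. - laplacian w x = of_real (k^2) * w x"
  using w(1) unfolding helmholtz_dirichlet_def by (metis add.commute add_eq_0_iff)
 then have "w x = 0" if "x \<in> D" for x
  using regular w(1) that unfolding dirichlet_eigenvalue_def helmholtz_dirichlet_def by blast
 then show ?thesis using w(2) by (auto elim!: eventually_mono)
qed

lemma indicator_weak:
 fixes v :: real
 assumes "C2c D ze"
 shows "indicator D x *R v * (laplace ze x + k^2 * ze x) = v * (laplace ze x + k^2 * ze x)"
proof (cases "x \<in> D")
 case False
 obtain K where K: "compact K" "K \<subseteq> D" "!!x. x \<notin> K ==> ze x = 0" using assms unfolding C2c_def by metis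
 have "x \<notin> K" using False K(2) by blast
 then show ?thesis using laplace_eq_0_outside[OF K(1,3)] K(3) by simp
qed simp

lemma solves_indicator_trace:
 assumes f: "sqint f" "abs_l2 f \<in> H10 D"
 shows "has_trace D (%x. cor (indicator D x *R fst (f x))) (%_. 0)"
proof (rule has_trace_cong_AE[OF open_D bounded_D H10_has_trace[OF open_D bounded_D f]])
 show "(%x. cor (indicator D x *R fst (f x))) \<in> borel_measurable (lebesgue_on D)"
  using sqint_measurable[OF sqint_fst[OF f(1)]] D_borel
  by (intro borel_measurable_lebesgue_on measurable_compose[OF _ borel_measurable_of_real] borel_measurable_scaleR borel_measurable_indicator) simp_all
 show "AE x in lebesgue_on D. cor (fst (f x)) = cor (indicator D x *R fst (f x))"
  by (rule AE_I2) simp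
qed

text \<open>A weak eigenfunction would have a classical representative with vanishing trace, which
\<open>regular\<close> excludes.\<close>

lemma homogeneous_trivial:
 assumes s: "solves k D (%_. 0) f"
 shows "abs_l2 f = 0"
proof -
 have f: "sqint f" "abs_l2 f \<in> H10 D" using s by (auto simp: solves_def)
 have z0: "sqint (%_. 0 :: real)" by (simp add: sqint_def)
 let ?u = "%x. cor (indicator D x *R fst (f x))"
 have wh: "weak_helmholtz k D ?u" unfolding weak_helmholtz_def
 proof (intro allI impI)
  fix ze assume z: "C2c D ze"
  have "(LINT x|lborel. ?u x * of_real (laplace ze x + k^2 * ze x)) = of_real (LINT x|lborel. fst (f x) * (laplace ze x + k^2 * ze x))"
   unfolding of_real_mult[symmetric] indicator_weak[OF z] by (rule integral_complex_of_real)
  then show "(LINT x|lborel. ?u x * of_real (laplace ze x + k^2 * ze x)) = 0"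
   unfolding solves_weak[OF s z0 z] by simp
 qed
 have iu: "intble ?u"
  by (rule integrable_of_real[OF sqint_of_real_L2(3)[OF sqint_fst[OF f(1)] D_borel bounded_D]])
 have "AE x in lborel. fst (f x) = 0"
  using trace_zero_unique[OF wh iu solves_indicator_trace[OF f]] H10_vanishes_outside[OF open_D f]
  by eventually_elim (auto simp: indicator_def split: if_splits)
 then have "AE x in lborel. inner (fst (f x), 0 :: real^2) (f x) = 0" by eventually_elim (simp add: inner_prod_def)
 then have "(LINT x|lborel. inner (fst (f x), 0 :: real^2) (f x)) = 0" by (rule integral_eq_zero_AE)
 then have v: "inner (value_part (abs_l2 f)) (abs_l2 f) = 0"
  unfolding value_part_abs[OF f(1)] inner_abs_l2[OF sqint_pair0[OF sqint_fst[OF f(1)]] f(1)] .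
 have "inner (abs_l2 (%_. (0::real, 0::real^2))) (abs_l2 f) = 0"
  by (simp add: inner_abs_l2[OF sqint_pair0[OF z0] f(1)] inner_prod_def)
 moreover have "inner (abs_l2 f - (1 + k^2) *R value_part (abs_l2 f)) (abs_l2 f) = - inner (abs_l2 (%_. (0::real, 0::real^2))) (abs_l2 f)"
  using s f(2) by (simp add: solves_def)
 ultimately have "inner (abs_l2 f) (abs_l2 f) = 0" unfolding inner_diff_left inner_scaleR_left v by simp
 then show ?thesis by simp
qed

lemma solves_exists:
 assumes p: "sqint p"
 shows "\<exists>f. solves k D p f"
proof -
 have c: "1 + k^2 > 0" by (simp add: add_pos_nonneg)
 have "U = 0" if U: "U \<in> H10 D" "!!V. V \<in> H10 D ==> inner (U - (1 + k^2) *R value_part U) V = 0" for U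
 proof -
  obtain f where f: "sqint f" "U = abs_l2 f" by (rule l2_cases)
  have z0: "sqint (%_. 0 :: real)" by (simp add: sqint_def)
  have z: "inner (abs_l2 (%_. (0::real, 0::real^2))) V = 0" for V :: pair_field
  proof -
   obtain g where g: "sqint g" "V = abs_l2 g" by (rule l2_cases)
   show ?thesis unfolding g(2) by (simp add: inner_abs_l2[OF sqint_pair0[OF z0] g(1)] inner_prod_def)
  qed
  have "solves k D (%_. 0) f" using U f unfolding solves_def by (simp add: z[simplified])
  then show ?thesis using homogeneous_trivial f(2) by simp
 qed
 from H10_solvable[OF bounded_D c this, of "- abs_l2 (%x. (p x, 0))"]
 obtain U where U: "U \<in> H10 D" "!!V. V \<in> H10 D ==> inner (U - (1 + k^2) *R value_part U) V = inner (- abs_l2 (%x. (p x, 0))) V"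
  by blast
 obtain f where f: "sqint f" "U = abs_l2 f" by (rule l2_cases)
 have "solves k D p f" using f U by (simp add: solves_def)
 then show ?thesis by blast
qed

text \<open>The indicator only changes the chosen representative on a null set, because solutions
vanish almost everywhere outside \<open>D\<close>.\<close>

definition solf :: "(real^2 => real) => real^2 => real" where
 "solf p x = indicator D x *R fst ((SOME f. solves k D p f) x)"

text \<open>The symmetry of the solution operator is what later gives the field at a point as an
integral against a fixed function.\<close>

lemma solf_facts:
 assumes p: "sqint p"
 shows solf_square: "sqint (solf p)"
  and solf_integrable: "intble (solf p)"
  and solf_trace: "has_trace D (%x. cor (solf p x)) (%_. 0)"
  and solf_weak: "C2c D ze ==> (LINT x|lborel. solf p x * (laplace ze x + k^2 * ze x)) = (LINT x|lborel. p x * ze x)"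
  and solf_symmetric: "sqint q ==> (LINT x|lborel. p x * solf q x) = (LINT x|lborel. q x * solf p x)"
proof -
 define S where "S q = (SOME f. solves k D q f)" for q
 have S: "solves k D q (S q)" if "sqint q" for q
  unfolding S_def using solves_exists[OF that] by (rule someI_ex)
 have f: "sqint (S q)" "abs_l2 (S q) \<in> H10 D" if "sqint q" for q
  using S[OF that] by (auto simp: solves_def)
 have e: "solf q = (%x. indicator D x *R fst (S q x))" for q by (simp add: fun_eq_iff solf_def S_def)
 have m: "(%x. indicator D x *R fst (S q x)) \<in> borel_measurable lborel" if "sqint q" for q
  using sqint_measurable[OF sqint_fst[OF f(1)[OF that]]] D_borel
  by (intro borel_measurable_scaleR borel_measurable_indicator) simp_all
 show "sqint (solf p)" unfolding e
  by (rule sqint_bound[OF m[OF p] sqint_norm[OF sqint_fst[OF f(1)[OF p]]]])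
    (simp add: indicator_def)
 show "intble (solf p)" unfolding e
  by (rule sqint_of_real_L2(3)[OF sqint_fst[OF f(1)[OF p]] D_borel bounded_D])
 show "has_trace D (%x. cor (solf p x)) (%_. 0)" unfolding e
  by (rule solves_indicator_trace[OF f[OF p]])
 show "C2c D ze ==> (LINT x|lborel. solf p x * (laplace ze x + k^2 * ze x)) = (LINT x|lborel. p x * ze x)"
  unfolding e by (simp only: indicator_weak solves_weak[OF S[OF p] p])
 have *: "(LINT x|lborel. g x * solf q x) = (LINT x|lborel. g x * fst (S q x))" if "sqint q" "sqint g" for q g
 proof (rule integral_cong_AE)
  show "(%x. g x * solf q x) \<in> borel_measurable lborel" "(%x. g x * fst (S q x)) \<in> borel_measurable lborel"
   unfolding e by (intro borel_measurable_times sqint_measurable[OF that(2)] m[OF that(1)]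
     sqint_measurable[OF sqint_fst[OF f(1)[OF that(1)]]])+
  show "AE x in lborel. g x * solf q x = g x * fst (S q x)"
   using H10_vanishes_outside[OF open_D f[OF that(1)]] by eventually_elim (auto simp: e indicator_def)
 qed
 show "(LINT x|lborel. p x * solf q x) = (LINT x|lborel. q x * solf p x)" if q: "sqint q"
  unfolding *[OF p q] *[OF q p] by (rule solves_symmetric[OF S[OF p] S[OF q] p q])
qed

definition csol :: "(real^2 => complex) => real^2 => complex" where
 "csol f x = Complex (solf (%x. Re (f x)) x) (solf (%x. Im (f x)) x)"

lemma integrable_square_mult:
 "sqint p ==> sqint q ==> intble (%x. p x * q x)" for p q :: "real^2 => real"
 using sqint_inner by fastforce

lemma integral_Complex:
 assumes f: "intble (%x. Re (f x) * p x)" "intble (%x. Im (f x) * p x)"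
 shows "(LINT x|lborel. f x * cor (p x)) = Complex (LINT x|lborel. Re (f x) * p x) (LINT x|lborel. Im (f x) * p x)"
proof -
 have "f x * cor (p x) = of_real (Re (f x) * p x) + \<i> * of_real (Im (f x) * p x)" for x by (simp add: complex_eq_iff)
 then have "(LINT x|lborel. f x * cor (p x)) = (LINT x|lborel. of_real (Re (f x) * p x) + \<i> * of_real (Im (f x) * p x))" by presburger
 also have "... = (LINT x|lborel. of_real (Re (f x) * p x)) + (LINT x|lborel. \<i> * cor (Im (f x) * p x))"
  by (intro Bintegral_add integrable_mult_right integrable_of_real f)
 also have "... = of_real (LINT x|lborel. Re (f x) * p x) + \<i> * of_real (LINT x|lborel. Im (f x) * p x)"
  unfolding integral_mult_right_zero integral_complex_of_real ..
 finally show ?thesis by (simp add: complex_eq_iff)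
qed

lemma csol_facts:
 assumes f: "sqint (%x. Re (f x))" "sqint (%x. Im (f x))"
 shows csol_integrable: "intble (csol f)"
  and csol_trace: "has_trace D (csol f) (%_. 0)"
  and csol_weak: "C2c D ze ==> (LINT x|lborel. csol f x * of_real (laplace ze x + k^2 * ze x)) = (LINT x|lborel. f x * of_real (ze x))"
  and csol_symmetric: "sqint p ==> (LINT x|lborel. csol f x * of_real (p x)) = (LINT x|lborel. f x * of_real (solf p x))"
proof -
 have e: "csol f = (%x. 1 * of_real (solf (%x. Re (f x)) x) + \<i> * of_real (solf (%x. Im (f x)) x))"
  by (simp add: fun_eq_iff csol_def complex_eq_iff)
 show "intble (csol f)" unfolding e
  by (intro Bintegrable_add integrable_mult_right integrable_of_real solf_integrable f)
 have "has_trace D (csol f) (%_. 1 * 0 + \<i> * 0)" unfolding e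
  by (rule has_trace_combination[OF open_D bounded_D solf_trace[OF f(1)] solf_trace[OF f(2)]])
 then show "has_trace D (csol f) (%_. 0)" by simp
 show "(LINT x|lborel. csol f x * of_real (p x)) = (LINT x|lborel. f x * of_real (solf p x))" if p: "sqint p"
 proof -
  have "(LINT x|lborel. csol f x * of_real (p x)) = Complex (LINT x|lborel. solf (%x. Re (f x)) x * p x) (LINT x|lborel. solf (%x. Im (f x)) x * p x)"
   by (subst integral_Complex) (auto simp: csol_def intro: integrable_square_mult solf_square f p)
  also have "... = Complex (LINT x|lborel. Re (f x) * solf p x) (LINT x|lborel. Im (f x) * solf p x)"
   using solf_symmetric[OF f(1) p] solf_symmetric[OF f(2) p] by (simp add: mult.commute)
  also have "... = (LINT x|lborel. f x * of_real (solf p x))"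
   by (rule integral_Complex[symmetric]) (intro integrable_square_mult solf_square f p)+
  finally show ?thesis .
 qed
 assume ze: "C2c D ze"
 note t = C2c_test_function[OF ze]
 have sL: "sqint (%x. laplace ze x + k^2 * ze x)"
 proof (rule sqint_add)
  show "sqint (laplace ze)"
  proof -
   obtain K R where K: "C2_on UNIV ze" "compact K" "!!x. x \<notin> K ==> ze x = 0" "!!x. norm x > R ==> x \<notin> K"
    using C2cE[OF ze] by metis
   show ?thesis
    by (rule sqint_continuous[OF laplace_continuous[OF K(1)], of R]) (rule laplace_eq_0_outside[OF K(2,3) K(4)])
  qed
  show "sqint (%x. k^2 * ze x)" using sqint_scaleR[OF sqint_test[OF t(1)], of "k^2"] by simp
 qed
 have "(LINT x|lborel. csol f x * of_real (laplace ze x + k^2 * ze x)) = Complex (LINT x|lborel. solf (%x. Re (f x)) x * (laplace ze x + k^2 * ze x)) (LINT x|lborel. solf (%x. Im (f x)) x * (laplace ze x + k^2 * ze x))"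
  by (subst integral_Complex) (simp_all only: csol_def complex.sel integrable_square_mult[OF solf_square[OF f(1)] sL] integrable_square_mult[OF solf_square[OF f(2)] sL])
 also have "... = Complex (LINT x|lborel. Re (f x) * ze x) (LINT x|lborel. Im (f x) * ze x)"
  by (simp only: solf_weak[OF f(1) ze] solf_weak[OF f(2) ze])
 also have "... = (LINT x|lborel. f x * of_real (ze x))"
  by (rule integral_Complex[symmetric]) (rule integrable_square_mult[OF f(1) sqint_test[OF t(1)]] integrable_square_mult[OF f(2) sqint_test[OF t(1)]])+
 finally show "(LINT x|lborel. csol f x * of_real (laplace ze x + k^2 * ze x)) = (LINT x|lborel. f x * of_real (ze x))" .
qed

end

section \<open>Cut-off potentials and parameter integrals\<close>

lemma C2_on_scaleR:
 fixes u :: "real^2 => real" and v :: "real^2 => 'b::real_normed_vector"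
 assumes S: "open S" and u: "C2_on S u" and v: "C2_on S v"
 shows "C2_on S (%x. u x *R v x)"
  and "x \<in> S ==> laplace (%x. u x *R v x) x = laplace u x *R v x
   + 2 *R (\<Sum>j\<in>UNIV. pd j u x *R pd j v x) + u x *R laplace v x"
proof -
 note B = bounded_bilinear_scaleR
 have C: "C1_on S u" "C1_on S v" "C1_on S (pd j u)" "C1_on S (pd j v)" for j
  using u v by (simp_all add: C2_on_def)
 have pd: "pd j (%x. f x *R g x) x = pd j f x *R g x + f x *R pd j g x"
  if "C1_on S f" "C1_on S g" "x \<in> S" for j f g x
  using has_grad_partial_deriv[OF has_grad_bilinear[OF B C1_on_has_grad[OF that(1,3)] C1_on_has_grad[OF that(2,3)]]] by simp
 let ?G = "%j x. pd j u x *R v x + u x *R pd j v x"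
 have g: "C1_on S (?G j)" for j
  by (rule C1_on_add[OF C1_on_bilinear[OF B C(3) C(2)] C1_on_bilinear[OF B C(1) C(4)]])
 have G: "C1_on S (pd j (%x. u x *R v x))" for j
 proof (rule C1_on_local)
  fix x assume "x \<in> S"
  then show "\<exists>S' g. open S' \<and> x \<in> S' \<and> C1_on S' g \<and> (\<forall>y\<in>S'. pd j (%x. u x *R v x) y = g y)"
   using S g[of j] pd[OF C(1,2)] by blast
 qed
 then show "C2_on S (%x. u x *R v x)" unfolding C2_on_def using C1_on_bilinear[OF B C(1,2)] by blast
 assume x: "x \<in> S"
 have "pd j (pd j (%x. u x *R v x)) x = pd j (pd j u) x *R v x
   + 2 *R (pd j u x *R pd j v x) + u x *R pd j (pd j v) x" for j
 proof -
  have "pd j (pd j (%x. u x *R v x)) x = pd j (?G j) x"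
   by (rule partial_deriv_cong_open[OF S x]) (rule pd[OF C(1,2)])
  also have "... = (pd j (pd j u) x *R v x + pd j u x *R pd j v x)
    + (pd j u x *R pd j v x + u x *R pd j (pd j v) x)"
   by (rule has_grad_partial_deriv[OF has_grad_add[OF has_grad_bilinear[OF B C1_on_has_grad[OF C(3) x] C1_on_has_grad[OF C(2) x]]
     has_grad_bilinear[OF B C1_on_has_grad[OF C(1) x] C1_on_has_grad[OF C(4) x]]]])
  finally show ?thesis by (simp only: scaleR_2 add.assoc)
 qed
 then show "laplace (%x. u x *R v x) x = laplace u x *R v x
   + 2 *R (\<Sum>j\<in>UNIV. pd j u x *R pd j v x) + u x *R laplace v x"
  unfolding laplace_def by (simp only: sum.distrib scaleR_sum_left scaleR_sum_right)
qed

lemma radial_product_C2: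
 fixes V V' V'' :: "real => 'b::real_normed_vector" and c :: "real^2" and X X' X'' :: "real => real"
 assumes X: "!!s. (X has_real_derivative X' s) (at s)" "!!s. (X' has_real_derivative X'' s) (at s)" "cts X''"
  and T: "open T" and V: "!!s. s \<in> T ==> (V has_vector_derivative V' s) (at s)"
  "!!s. s \<in> T ==> (V' has_vector_derivative V'' s) (at s)" "continuous_on T V''"
 defines "S \<equiv> {x. (x - c) \<bullet> (x - c) \<in> T}" and "u \<equiv> %x. X (x \<bullet> x) *R V ((x - c) \<bullet> (x - c))"
 shows "C2_on S u"
  "!!x. x \<in> S ==> laplace u x = (4 * (x \<bullet> x) * X'' (x \<bullet> x) + 4 * X' (x \<bullet> x)) *R V ((x - c) \<bullet> (x - c))
   + (8 * X' (x \<bullet> x)) *R ((x \<bullet> (x - c)) *R V' ((x - c) \<bullet> (x - c)))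
   + X (x \<bullet> x) *R ((4 * ((x - c) \<bullet> (x - c))) *R V'' ((x - c) \<bullet> (x - c)) + 4 *R V' ((x - c) \<bullet> (x - c)))"
  "!!x. x \<in> S ==> has_grad u (%j. X' (x \<bullet> x) *R ((2 * x $ j) *R V ((x - c) \<bullet> (x - c)))
   + X (x \<bullet> x) *R ((2 * (x $ j - c $ j)) *R V' ((x - c) \<bullet> (x - c)))) x"
proof -
 have X1: "!!s. s \<in> UNIV ==> (X has_vector_derivative X' s) (at s)" "!!s. s \<in> UNIV ==> (X' has_vector_derivative X'' s) (at s)"
  using X(1,2) by (simp_all add: has_real_derivative_iff_has_vector_derivative)
 note R0 = radial_C2[OF open_UNIV X1 X(3), where c=0, simplified]
 note R = radial_C2[OF T V, where c=c, folded S_def]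
 have c0: "C2_on S (%x. X (x \<bullet> x))" using C2_on_subset[OF R0(2)] by simp
 have o: "open S" by (rule R(1)) simp_all
 have cV: "C2_on S (%x. V ((x - c) \<bullet> (x - c)))" by (rule R(2)) simp_all
 show "C2_on S u" unfolding u_def by (rule C2_on_scaleR(1)[OF o c0 cV])
 fix x assume x: "x \<in> S"
 have R3: "laplace (%x. V ((x - c) \<bullet> (x - c))) x = (4 * ((x - c) \<bullet> (x - c))) *R V'' ((x - c) \<bullet> (x - c)) + 4 *R V' ((x - c) \<bullet> (x - c))"
  by (rule R(3)) (use x in simp_all)
 have R4: "pd j (%x. V ((x - c) \<bullet> (x - c))) x = (2 * (x $ j - c $ j)) *R V' ((x - c) \<bullet> (x - c))" for j
  by (rule R(4)) (use x in simp_all)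
 have "(\<Sum>j\<in>UNIV. ((2 * x $ j) * X' (x \<bullet> x)) *R ((2 * (x $ j - c $ j)) *R V' ((x - c) \<bullet> (x - c))))
   = (\<Sum>j\<in>UNIV. 4 * (x $ j * (x $ j - c $ j)) * X' (x \<bullet> x)) *R V' ((x - c) \<bullet> (x - c))"
  by (simp add: scaleR_sum_left algebra_simps)
 also have "... = (4 * X' (x \<bullet> x)) *R ((x \<bullet> (x - c)) *R V' ((x - c) \<bullet> (x - c)))"
  by (simp add: inner_vec_def sum_distrib_left sum_distrib_right algebra_simps)
 finally have S: "(\<Sum>j\<in>UNIV. ((2 * x $ j) * X' (x \<bullet> x)) *R ((2 * (x $ j - c $ j)) *R V' ((x - c) \<bullet> (x - c))))
   = (4 * X' (x \<bullet> x)) *R ((x \<bullet> (x - c)) *R V' ((x - c) \<bullet> (x - c)))" .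
 have P0: "pd j (%x. X (x \<bullet> x)) x = (2 * x $ j) * X' (x \<bullet> x)" for j by (simp add: R0)
 have L0: "laplace (%x. X (x \<bullet> x)) x = 4 * (x \<bullet> x) * X'' (x \<bullet> x) + 4 * X' (x \<bullet> x)" by (simp add: R0)
 show "laplace u x = (4 * (x \<bullet> x) * X'' (x \<bullet> x) + 4 * X' (x \<bullet> x)) *R V ((x - c) \<bullet> (x - c))
   + (8 * X' (x \<bullet> x)) *R ((x \<bullet> (x - c)) *R V' ((x - c) \<bullet> (x - c)))
   + X (x \<bullet> x) *R ((4 * ((x - c) \<bullet> (x - c))) *R V'' ((x - c) \<bullet> (x - c)) + 4 *R V' ((x - c) \<bullet> (x - c)))"
  unfolding u_def C2_on_scaleR(2)[OF o c0 cV x] R3 R4 P0 L0 S by (simp only: scaleR_scaleR) (simp add: mult_ac)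
 have g0: "has_grad (%x. X (x \<bullet> x)) (%j. (2 * x $ j) *R X' (x \<bullet> x)) x"
  using has_grad_radial[OF X1(1), of x 0] by simp
 have g: "has_grad (%x. V ((x - c) \<bullet> (x - c))) (%j. (2 * (x $ j - c $ j)) *R V' ((x - c) \<bullet> (x - c))) x"
  by (rule has_grad_radial[OF V(1)]) (use x in \<open>simp add: S_def\<close>)
 show "has_grad u (%j. X' (x \<bullet> x) *R ((2 * x $ j) *R V ((x - c) \<bullet> (x - c)))
   + X (x \<bullet> x) *R ((2 * (x $ j - c $ j)) *R V' ((x - c) \<bullet> (x - c)))) x"
  using has_grad_bilinear[OF bounded_bilinear_scaleR g0 g] unfolding u_def by (simp add: mult_ac)
qed

text \<open>The primitive of a bump on \<open>{a..b}\<close>, divided by its total mass.\<close>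

lemma cutoff_exists:
 fixes a b :: real
 assumes "a < b"
 shows "\<exists>X X' X''. (\<forall>s. (X has_real_derivative X' s) (at s)) \<and> (\<forall>s. (X' has_real_derivative X'' s) (at s)) \<and>
  cts X'' \<and> (\<forall>s\<le>a. X s = 0) \<and> (\<forall>s\<ge>b. X s = (1::real))"
proof -
 define g where "g s = bump3 ((s - a) * (b - s))" for s
 define g' where "g' s = 3 * max 0 ((s - a) * (b - s)) ^ 2 * (b + a - 2 * s)" for s
 have dg: "(g has_real_derivative g' s) (at s)" for s
  unfolding g_def[abs_def] g'_def
  by (rule DERIV_chain2[OF bump3_deriv(1)]) (auto intro!: derivative_eq_intros)
 have cg: "cts g" by (rule DERIV_continuous_on[where D=g']) (auto intro: has_field_derivative_at_within dg)
 have cg': "cts g'" unfolding g'_def by (intro continuous_intros)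
 have g0: "g s = 0" if "s <= a \<or> b <= s" for s
 proof -
  have "(s - a) * (b - s) <= 0" using that assms by (auto simp: mult_le_0_iff)
  then show ?thesis by (simp add: g_def bump3_def)
 qed
 obtain G where G: "G a = 0" "!!s. (G has_real_derivative g s) (at s)" using antiderivative_exists[OF cg] by metis
 have "G a < G b"
 proof (rule DERIV_pos_imp_increasing_open[OF assms])
  show "\<exists>y. (G has_real_derivative y) (at x) \<and> y > 0" if "a < x" "x < b" for x
   using G(2)[of x] that by (intro exI[of _ "g x"]) (simp add: g_def bump3_def)
  show "continuous_on {a..b} G" by (rule DERIV_continuous_on) (rule has_field_derivative_at_within[OF G(2)])
 qed
 then have Gb: "G b \<noteq> 0" using G(1) by simp
 show ?thesis
 proof (rule exI[of _ "%s. G s / G b"], rule exI[of _ "%s. g s / G b"], rule exI[of _ "%s. g' s / G b"], intro conjI allI impI)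
  show "((%s. G s / G b) has_real_derivative g s / G b) (at s)" "((%s. g s / G b) has_real_derivative g' s / G b) (at s)" for s
   by (intro DERIV_cdivide G(2) dg)+
  show "cts (%s. g' s / G b)" by (intro continuous_intros cg') (use Gb in auto)
  show "G s / G b = 0" if "s <= a" for s
   using deriv_zero_const[OF G(2) convex_real_interval(2)[of a], of s a] g0 that G(1) by simp
  show "G s / G b = 1" if "s >= b" for s
   using deriv_zero_const[OF G(2) convex_real_interval(1)[of b], of s b] g0 that Gb by simp
 qed
qed

lemma continuous_AE_eq:
 fixes u v :: "real^2 => complex"
 assumes D: "open D" and c: "continuous_on D u" "continuous_on D v" and ae: "AE x in lborel. x \<in> D --> u x = v x" and x: "x \<in> D"
 shows "u x = v x"
proof -
 let ?N = "D \<inter> (%x. u x - v x) -` (- {0})"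
 have o: "open ?N" by (rule continuous_open_preimage[OF _ D]) (auto intro!: continuous_on_diff c)
 have "AE x in lebesgue. x \<notin> ?N" using AE_completion[OF ae] by eventually_elim auto
 then have "negligible ?N"
  unfolding negligible_iff_null_sets by (rule AE_iff_null_sets[THEN iffD2, rotated]) (use o in \<open>simp add: open_closed\<close>)
 then have "?N = {}" using o open_not_negligible by blast
 then show ?thesis using x by auto
qed

text \<open>The entire solution is a weak solution on a ball, so the regularity theorem reproduces
it by its mollification.\<close>

lemma mean_value_jf:
 assumes r0: "admissible k r0" "0 < ep" "ep < r0"
 shows "(LINT x|lborel. jf (k^2) ((x - c) \<bullet> (x - c)) * moll k ep (y - x)) = jf (k^2) ((y - c) \<bullet> (y - (c::real^2)))"
proof -
 define a where "a x = cor (jf (k^2) ((x - c) \<bullet> (x - c)))" for x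
 have a: "C2_on UNIV a" "!!x. laplace a x + of_real (k^2) * a x = 0"
  using jf_radial_helmholtz[of k c] by (simp_all add: a_def[abs_def])
 have ca: "cts a" by (rule C1_on_continuous[OF C2_on_imp_C1_on[OF a(1)]])
 define B where "B = ball y r0"
 have oB: "open B" by (simp add: B_def)
 define u where "u x = indicator B x *R a x" for x
 have cB: "cball y ep \<subseteq> B" using r0 by (auto simp: B_def)
 have iu: "intble u"
 proof -
  have "intble (%x. indicator (cball y r0) x *R a x)"
   by (rule borel_integrable_compact) (auto intro: continuous_on_subset[OF ca])
  from integrable_mult_indicator[OF _ this, of B] show ?thesis
   by (rule Bintegrable_cong[THEN iffD1, rotated 2]) (auto simp: u_def B_def indicator_def)
 qed
 have wh: "weak_helmholtz k B u" unfolding weak_helmholtz_def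
 proof (intro allI impI)
  fix ze assume z: "C2c B ze"
  obtain K where K: "C2_on UNIV ze" "compact K" "K \<subseteq> B" "!!x. x \<notin> K ==> ze x = 0" using z unfolding C2c_def by metis
  have zU: "C2c UNIV ze" using K by (auto simp: C2c_def)
  have "u x * of_real (laplace ze x + k^2 * ze x) = a x * of_real (laplace ze x + k^2 * ze x)" for x
  proof (cases "x \<in> B")
   case False
   then have "x \<notin> K" using K(3) by blast
   then show ?thesis using laplace_eq_0_outside[OF K(2,4)] K(4) by simp
  qed (simp add: u_def)
  then show "(LINT x|lborel. u x * of_real (laplace ze x + k^2 * ze x)) = 0"
   by (simp only: helmholtz_green[OF a(1) zU] a(2) mult_zero_left integral_zero)
 qed
 obtain w where w: "C2_on B w" "AE x in lborel. x \<in> B --> w x = u x"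
  "!!x ep. 0 < ep ==> ep < r0 ==> cball x ep \<subseteq> B ==> w x = conv u (moll k ep) x"
  using weyl_helmholtz[OF r0(1) oB wh iu] by blast
 have "w y = a y"
 proof (rule continuous_AE_eq[where D=B])
  show "AE x in lborel. x \<in> B --> w x = a x" using w(2) by eventually_elim (simp add: u_def)
 qed (use r0 in \<open>auto simp: B_def intro: continuous_on_subset[OF ca] C1_on_continuous[OF C2_on_imp_C1_on[OF w(1)[unfolded B_def]]]\<close>)
 then have "a y = conv u (moll k ep) y" using w(3)[OF r0(2,3) cB] by simp
 also have "... = (LINT x|lborel. of_real (jf (k^2) ((x - c) \<bullet> (x - c)) * moll k ep (y - x)))" unfolding conv_def
 proof (rule Bintegral_cong[OF refl])
  show "u x * of_real (moll k ep (y - x)) = of_real (jf (k^2) ((x - c) \<bullet> (x - c)) * moll k ep (y - x))" for x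
  proof (cases "x \<in> B")
   case False
   then have "norm (y - x) > ep" using r0 by (simp add: B_def dist_norm)
   then show ?thesis by (simp add: moll_support[OF r0(2)])
  qed (simp add: u_def a_def)
 qed
 also have "... = of_real (LINT x|lborel. jf (k^2) ((x - c) \<bullet> (x - c)) * moll k ep (y - x))" by (rule integral_complex_of_real)
 finally show ?thesis by (simp add: a_def)
qed

text \<open>The potentials are singular on the measurement circle; the cut-off removes a
neighbourhood of the disc.\<close>

lemma continuous_cut:
 fixes c :: "real^2 => real" and G :: "real => real^2 => complex"
 assumes c: "cts c" "!!x. norm x < r1 ==> c x = 0" and r: "r < r1"
  and G: "continuous_on (UNIV \<times> {x. norm x > r}) (%(t, x). G t x)"
 shows "cts (%(t, x). c x *R G t x)"
proof -
 have U: "UNIV = (UNIV \<times> {x. norm x > r}) \<union> (UNIV \<times> {x. norm x < r1})" using r by auto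
 show ?thesis
  unfolding U
 proof (rule continuous_on_open_Un)
  show "open (UNIV \<times> {x::real^2. norm x > r} :: (real \<times> (real^2)) set)" "open (UNIV \<times> {x::real^2. norm x < r1} :: (real \<times> (real^2)) set)"
   by (intro open_Times open_UNIV open_Collect_less continuous_intros)+
  show "continuous_on (UNIV \<times> {x. norm x > r}) (%(t, x). c x *R G t x)"
   unfolding case_prod_unfold
   by (intro continuous_on_scaleR continuous_on_compose2[OF c(1)] G[unfolded case_prod_unfold] continuous_intros) auto
  show "continuous_on (UNIV \<times> {x. norm x < r1}) (%(t, x). c x *R G t x)"
   by (rule continuous_on_eq[OF continuous_on_const[of _ 0]]) (auto simp: c(2))
 qed
qed

lemma parameter_integral_eq:
 fixes g :: "real => real^2 => complex"
 assumes g: "cts (%(t, x). g t x)"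
 shows "(LINT t:{a..b}|lborel. g t x) = integral (cbox a b) (%t. g t x)" "(%t. g t x) integrable_on cbox a b"
  "continuous_on S (%t. g t x)"
proof -
 show c: "continuous_on S (%t. g t x)" for S
 proof -
  have "continuous_on S (%s. (%(t, x). g t x) (s, x))"
   by (rule continuous_on_compose2[OF g]) (auto intro!: continuous_intros)
  then show ?thesis by simp
 qed
 have "set_integrable lborel {a..b} (%t. g t x)" by (rule borel_integrable_atLeastAtMost'[OF c])
 from set_borel_integral_eq_integral(2)[OF this]
 show "(LINT t:{a..b}|lborel. g t x) = integral (cbox a b) (%t. g t x)" by (simp add: cbox_interval)
 show "(%t. g t x) integrable_on cbox a b" by (rule integrable_continuous[OF c])
qed

lemma swap_continuous:
 fixes g :: "real => real^2 => complex"
 assumes g: "cts (%(t, x). g t x)"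
 shows "continuous_on A (%p. g (snd p) (fst p))"
proof -
 have "continuous_on A (%p. (%(t, x). g t x) (snd p, fst p))"
  by (rule continuous_on_compose2[OF g]) (auto intro!: continuous_intros)
 then show ?thesis by simp
qed

lemma parameter_integral_continuous:
 fixes g :: "real => real^2 => complex"
 assumes g: "cts (%(t, x). g t x)"
 shows "cts (%x. LINT t:{a..b}|lborel. g t x)"
 unfolding parameter_integral_eq(1)[OF g]
 by (rule integral_continuous_on_param) (use swap_continuous[OF g] in \<open>simp add: case_prod_unfold\<close>)

text \<open>Differentiation under the integral; the partial derivatives are packed into one bounded
linear map.\<close>

lemma parameter_integral_C1:
 fixes g :: "real => real^2 => complex"
 assumes g: "cts (%(t, x). g t x)" and d: "!!t x. has_grad (g t) (%j. h j t x) x"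
  and h: "!!j. cts (%(t, x). h j t x)"
 shows "C1_on UNIV (%x. LINT t:{a..b}|lborel. g t x)"
proof -
 define L where "L x t = (\<Sum>j\<in>UNIV. blinfun_scaleR_left (h j t x) o\<^sub>L blinfun_inner_left (axis j 1 :: real^2))" for x t
 have L: "blinfun_apply (L x t) v = (\<Sum>j\<in>UNIV. (v $ j) *R h j t x)" for x t v
  by (simp add: L_def blinfun.sum_left inner_axis inner_commute)
 have cL: "continuous_on A (%(x, t). L x t)" for A
 proof -
  have "continuous_on A (%p. h j (snd p) (fst p))" for j
   by (rule swap_continuous[OF h])
  then show ?thesis unfolding L_def case_prod_unfold by (intro continuous_intros) simp
 qed
 show ?thesis
 proof (rule C1_onI)
 fix x
 have "((%x. integral (cbox a b) (%t. g t x)) has_derivative blinfun_apply (integral (cbox a b) (L x))) (at x within UNIV)"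
 proof (rule leibniz_rule[where fx=L])
  have "blinfun_apply (L x t) = (%v. \<Sum>j\<in>UNIV. (v $ j) *R h j t x)" for x t by (rule ext) (rule L)
  then show "((%x. g t x) has_derivative blinfun_apply (L x t)) (at x within UNIV)" for x t
   using d[of t x] by (simp only: has_grad_def)
 qed (rule parameter_integral_eq(2)[OF g] cL UNIV_I convex_UNIV)+
 moreover have "blinfun_apply (integral (cbox a b) (L x)) = (%v. \<Sum>j\<in>UNIV. (v $ j) *R (LINT t:{a..b}|lborel. h j t x))"
 proof
  fix v
  have "continuous_on (cbox a b) (%t. (%(x, t). L x t) (x, t))"
   by (rule continuous_on_compose2[OF cL[of UNIV]]) (auto intro!: continuous_intros)
  then have "blinfun_apply (integral (cbox a b) (L x)) v = integral (cbox a b) (%t. blinfun_apply (L x t) v)"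
   by (intro blinfun_apply_integral integrable_continuous) simp
  also have "... = (\<Sum>j\<in>UNIV. (v $ j) *R integral (cbox a b) (%t. h j t x))"
   unfolding L by (subst integral_sum) ((rule finite | rule integrable_cmul[OF parameter_integral_eq(2)[OF h]] | simp)+)
  finally show "blinfun_apply (integral (cbox a b) (L x)) v = (\<Sum>j\<in>UNIV. (v $ j) *R (LINT t:{a..b}|lborel. h j t x))"
   by (simp only: parameter_integral_eq(1)[OF h])
 qed
 ultimately show "has_grad (%x. LINT t:{a..b}|lborel. g t x) (%j. LINT t:{a..b}|lborel. h j t x) x"
  unfolding has_grad_def parameter_integral_eq(1)[OF g] by (simp only:)
next
 fix j
 show "cts (%x. LINT t:{a..b}|lborel. h j t x)" by (rule parameter_integral_continuous[OF h])
 qed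
qed

lemma parameter_integral_fubini:
 fixes g :: "real => real^2 => complex" and L :: "real^2 => real"
 assumes g: "cts (%(t, x). g t x)" "!!t x. norm x > R ==> g t x = 0" and L: "intble L"
 shows "(LINT x|lborel. (LINT t:{a..b}|lborel. g t x) * of_real (L x)) = (LINT t:{a..b}|lborel. (LINT x|lborel. g t x * of_real (L x)))"
  and "set_integrable lborel {a..b} (%t. LINT x|lborel. g t x * of_real (L x))"
proof -
 have "compact ((%(t, x). g t x) ` ({a..b} \<times> cball 0 R))"
  by (intro compact_continuous_image continuous_on_subset[OF g(1)] compact_Times) auto
 from compact_imp_bounded[OF this, unfolded bounded_iff]
 obtain B where B0: "\<forall>z\<in>(%(t, x). g t x) ` ({a..b} \<times> cball 0 R). cmod z <= B" by (elim exE)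
 have B: "cmod (g t x) <= B" if "t \<in> {a..b}" "x \<in> cball 0 R" for t x
  using B0[rule_format, OF imageI[of "(t, x)"]] that by simp
 have B': "cmod (g t x) <= \<bar>B\<bar>" if "t \<in> {a..b}" for t x
  using B[OF that, of x] g(2)[of x t] by (cases "norm x > R") auto
 define F where "F = (%p. indicator {a..b} (fst p) *R (g (fst p) (snd p) * cor (L (snd p))))"
 have m: "F \<in> borel_measurable (lborel \<Otimes>\<^sub>M lborel)"
 proof -
  have "(%p. g (fst p) (snd p)) \<in> borel_measurable (lborel \<Otimes>\<^sub>M lborel)"
   unfolding lborel_prod using borel_measurable_continuous_onI[OF g(1)] by (simp add: case_prod_unfold)
  moreover have "(%p. cor (L (snd p))) \<in> borel_measurable (lborel \<Otimes>\<^sub>M lborel)"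
   using borel_measurable_integrable[OF L] by (intro measurable_compose[OF _ borel_measurable_of_real] measurable_compose[OF measurable_snd]) simp
  moreover have "(%p. indicator {a..b} (fst p) :: real) \<in> borel_measurable ((lborel::real measure) \<Otimes>\<^sub>M (lborel :: (real^2) measure))"
   by (rule measurable_compose[OF measurable_fst]) simp
  ultimately show ?thesis unfolding F_def by (intro borel_measurable_scaleR borel_measurable_times)
 qed
 have ind: "intble (indicator {a..b} :: real => real)" using emeasure_bounded_finite[of "{a..b}"] by (intro integrable_real_indicator) simp_all
 have "integrable (lborel \<Otimes>\<^sub>M lborel) F"
 proof (rule Bintegrable_bound[OF _ m])
  show "integrable (lborel \<Otimes>\<^sub>M lborel) (%p. indicator {a..b} (fst p) * (\<bar>B\<bar> * \<bar>L (snd p)\<bar>))"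
  proof (rule lborel_pair.Fubini_integrable)
   show "(%p. indicator {a..b} (fst p) * (\<bar>B\<bar> * \<bar>L (snd p)\<bar>)) \<in> borel_measurable ((lborel::real measure) \<Otimes>\<^sub>M (lborel :: (real^2) measure))"
    using borel_measurable_integrable[OF L] by measurable
  qed (use ind in \<open>auto simp: abs_mult L\<close>)
  show "AE p in lborel \<Otimes>\<^sub>M lborel. norm (F p) <= norm (indicator {a..b} (fst p) * (\<bar>B\<bar> * \<bar>L (snd p)\<bar>))"
   by (rule AE_I2) (auto simp: F_def norm_mult indicator_def intro!: mult_right_mono B')
 qed
 note iF = this
 then have "integrable (lborel \<Otimes>\<^sub>M lborel) (%(t, x). F (t, x))" by simp
 from lborel_pair.Fubini_integral[OF this]
 have "(LINT x|lborel. LINT t|lborel. F (t, x)) = (LINT t|lborel. LINT x|lborel. F (t, x))" .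
 moreover have "(LINT t|lborel. F (t, x)) = (LINT t:{a..b}|lborel. g t x) * of_real (L x)" for x
  unfolding F_def set_lebesgue_integral_def fst_conv snd_conv mult_scaleR_left[symmetric] by (rule integral_mult_left_zero)
 moreover have F1: "(LINT x|lborel. F (t, x)) = indicator {a..b} t *R (LINT x|lborel. g t x * of_real (L x))" for t
  unfolding F_def fst_conv snd_conv by (rule integral_scaleR_right)
 ultimately show "(LINT x|lborel. (LINT t:{a..b}|lborel. g t x) * of_real (L x)) = (LINT t:{a..b}|lborel. (LINT x|lborel. g t x * of_real (L x)))"
  unfolding set_lebesgue_integral_def by simp
 show "set_integrable lborel {a..b} (%t. LINT x|lborel. g t x * of_real (L x))"
  using lborel_pair.integrable_fst'[OF iF] by (simp only: F1 set_integrable_def)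
qed

context cavity
begin

lemma classical_unique:
 assumes u: "helmholtz_dirichlet D k f u" and w: "helmholtz_dirichlet D k f w" and x: "x \<in> D"
 shows "u x = w x"
proof -
 define v where "v x = 1 * u x + (- 1) * w x" for x
 have C: "C1_on D u" "C1_on D w" "C1_on D (pd j u)" "C1_on D (pd j w)" for j
  using u w by (simp_all add: helmholtz_dirichlet_def C2_on_def)
 have lin: "has_grad (%x. 1 * p x + (- 1) * q x) (%j. 1 * pd j p x + (- 1) * pd j q x) x"
  if "C1_on D p" "C1_on D q" "x \<in> D" for p q :: "real^2 => complex" and x
  by (rule has_grad_add[OF has_grad_linear[OF bounded_linear_mult_right C1_on_has_grad[OF that(1,3)]]
     has_grad_linear[OF bounded_linear_mult_right C1_on_has_grad[OF that(2,3)]]])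
 have cont: "continuous_on D (%x. 1 * pd i (pd j u) x + (- 1) * pd i (pd j w) x)" for i j
  using C(3,4) by (intro continuous_intros) (simp_all add: C1_on_def)
 note V = C2_onI[OF open_D lin[OF C(1,2)] lin[OF C(3,4)] cont]
 have v2: "C2_on D v" unfolding v_def[abs_def] by (rule V(1))
 have "v \<in> H1 D" unfolding v_def[abs_def]
  by (rule H1_combination[OF open_D bounded_D]) (use u w in \<open>simp_all add: helmholtz_dirichlet_def\<close>)
 moreover have "\<forall>x\<in>D. - laplacian v x = of_real (k^2) * v x"
 proof
  fix x assume x: "x \<in> D"
  have "pd j (pd j v) x = pd j (pd j u) x - pd j (pd j w) x" for j
  proof -
   have "pd j (pd j (%x. 1 * u x + (- 1) * w x)) x = 1 * pd j (pd j u) x + (- 1) * pd j (pd j w) x"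
    by (rule V(2)) (use x in simp_all)
   then show ?thesis by (simp add: v_def[abs_def])
  qed
  then have "laplacian v x = laplacian u x - laplacian w x" by (simp add: laplacian_def sum_subtractf)
  moreover have "laplacian u x = - of_real (k^2) * u x" "laplacian w x = - of_real (k^2) * w x"
   using u w x unfolding helmholtz_dirichlet_def by (simp_all add: eq_neg_iff_add_eq_0)
  ultimately show "- laplacian v x = of_real (k^2) * v x" by (simp add: v_def algebra_simps)
 qed
 moreover have "has_trace D v (%_. 0)"
  using has_trace_combination[OF open_D bounded_D, of u f w f 1 "- 1"] u w
  by (simp add: helmholtz_dirichlet_def v_def[abs_def])
 ultimately have "v x = 0" using regular v2 x unfolding dirichlet_eigenvalue_def by blast
 then show ?thesis by (simp add: v_def)
qed

text \<open>The function \<open>F\<close> carries the boundary data and \<open>f\<close> is its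
defect in the Helmholtz equation; subtracting \<open>F\<close> from the solution with source
\<open>f\<close> leaves a field with boundary values \<open>- F\<close>.\<close>

lemma corrected_solution:
 fixes f F g :: "real^2 => complex"
 assumes f: "cts f" "!!x. norm x > R ==> f x = 0" and F: "C1_on UNIV F"
  and w: "!!ze. C2c D ze ==> (LINT x|lborel. F x * of_real (laplace ze x + k^2 * ze x)) = (LINT x|lborel. f x * of_real (ze x))"
  and g: "!!x. x \<in> frontier D ==> g x = F x"
 defines "u \<equiv> %x. csol f x - indicator D x *R F x"
 shows "weak_helmholtz k D u" "intble u" "has_trace D u (%x. - g x)"
  "sqint (%x. Re (f x))" "sqint (%x. Im (f x))"
proof -
 show sq: "sqint (%x. Re (f x))" "sqint (%x. Im (f x))"
  by (rule sqint_continuous[where R=R]; use f in \<open>auto intro!: continuous_intros\<close>)+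
 have cF: "cts F" by (rule C1_on_continuous[OF F])
 obtain R' where "\<forall>x\<in>D. norm x <= R'" using bounded_D unfolding bounded_iff by (elim exE)
 then have R': "D \<subseteq> cball 0 R'" by auto
 have iF: "intble (%x. indicator D x *R F x)"
 proof -
  have "intble (%x. indicator (cball 0 R') x *R F x)"
   by (rule borel_integrable_compact) (auto intro: continuous_on_subset[OF cF])
  from integrable_mult_indicator[OF _ this, of D] show ?thesis
   by (rule Bintegrable_cong[THEN iffD1, rotated 2]) (use R' open_D in \<open>auto simp: indicator_def\<close>)
 qed
 show iu: "intble u" unfolding u_def
  by (rule Bintegrable_diff[OF csol_integrable[OF sq] iF])
 show "weak_helmholtz k D u" unfolding weak_helmholtz_def
 proof (intro allI impI)
  fix ze assume z: "C2c D ze"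
  obtain K R where K: "C2_on UNIV ze" "compact K" "K \<subseteq> D" "!!x. x \<notin> K ==> ze x = 0" "!!x. norm x > R ==> x \<notin> K"
   using C2cE[OF z] by metis
  let ?z = "%x. laplace ze x + k^2 * ze x"
  have z0: "?z x = 0" if "x \<notin> K" for x using laplace_eq_0_outside[OF K(2,4) that] K(4)[OF that] by simp
  have cz: "cts ?z" using laplace_continuous[OF K(1)] C1_on_continuous[OF C2_on_imp_C1_on[OF K(1)]] by (intro continuous_intros)
  obtain B where B: "!!x. norm (?z x) <= B" using bdd_support(2)[OF cz, of R] z0 K(5) by blast
  have i1: "intble (%x. csol f x * of_real (?z x))"
   by (rule integrable_mult_bounded[OF csol_integrable[OF sq] borel_measurable_continuous_onI[OF cz]]) (use B in simp)
  have i2: "intble (%x. F x * of_real (?z x))"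
   by (rule bdd_support(1)[where R=R]) (intro continuous_on_mult cF continuous_on_of_real cz, simp only: z0[OF K(5)] of_real_0 mult_zero_right)
  have "u x * of_real (?z x) = csol f x * of_real (?z x) - F x * of_real (?z x)" for x
  proof (cases "x \<in> D")
   case False
   then have "x \<notin> K" using K(3) by blast
   then show ?thesis unfolding z0[OF \<open>x \<notin> K\<close>] by simp
  qed (simp add: u_def algebra_simps)
  then have "(LINT x|lborel. u x * of_real (?z x)) = (LINT x|lborel. csol f x * of_real (?z x) - F x * of_real (?z x))" by (simp only:)
  also have "... = 0" by (simp only: Bintegral_diff[OF i1 i2] csol_weak[OF sq z] w[OF z] diff_self)
  finally show "(LINT x|lborel. u x * of_real (?z x)) = 0" .
 qed
 have "has_trace D (%x. 1 * csol f x + (- 1) * F x) (%x. 1 * 0 + (- 1) * g x)"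
  by (rule has_trace_combination[OF open_D bounded_D csol_trace[OF sq] has_trace_C1[OF open_D bounded_D F g]])
 then have t: "has_trace D (%x. csol f x - F x) (%x. - g x)" by simp
 show "has_trace D u (%x. - g x)"
 proof (rule has_trace_cong_AE[OF open_D bounded_D t])
  show "u \<in> borel_measurable (lebesgue_on D)"
   using borel_measurable_integrable[OF iu] by (intro borel_measurable_lebesgue_on) simp
  show "AE x in lebesgue_on D. csol f x - F x = u x" by (rule AE_I2) (simp add: u_def)
 qed
qed

end

section \<open>Fields of sources on the measurement circle\<close>

locale near_field = cavity +
 fixes r r1 r2 r0 \<delta> :: real and X X' X'' :: "real => real" and us :: "real^2 => real^2 => complex"
 assumes k: "k > 0" and r: "0 < r" "r < r1" "r1 < r2" "cball 0 r2 \<subseteq> D"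
  and X: "!!s. (X has_real_derivative X' s) (at s)" "!!s. (X' has_real_derivative X'' s) (at s)" "cts X''"
   "!!s. s <= r1^2 ==> X s = 0" "!!s. s >= r2^2 ==> X s = 1"
  and d: "admissible k r0" "0 < \<delta>" "\<delta> < r0" "\<delta> < r1 - r"
  and us: "!!y. y \<in> sphere 0 r ==> helmholtz_dirichlet D k (%x. - fund_sol k x y) (%x. us x y)"
begin

text \<open>The point of the measurement circle at angle \<open>t\<close>.\<close>

definition cp :: "real => real^2" where "cp t = vector [r * cos t, r * sin t]"

lemma cp_nth: "cp t $ 1 = r * cos t" "cp t $ 2 = r * sin t" by (simp_all add: cp_def)

lemma cp_inner: "cp s \<bullet> cp t = r^2 * cos (s - t)"
 by (simp add: inner_vec_def UNIV_2 cp_nth cos_diff power2_eq_square algebra_simps)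

lemma norm_cp: "norm (cp t) = r"
 using r(1) by (simp add: norm_eq_sqrt_inner cp_inner)

lemma continuous_cp: "continuous_on S cp"
proof -
 have "cp = (%t. r *R (cos t *R axis 1 1 + sin t *R axis 2 1))"
  by (rule ext) (simp add: vec_eq_iff forall_2 cp_nth axis_def)
 then show ?thesis by (simp only:) (intro continuous_intros)
qed

lemma cp_dist: "norm x > r ==> (x - cp t) \<bullet> (x - cp t) > 0"
 using norm_cp[of t] by (auto simp: inner_gt_zero_iff)

lemma X'_zero: "s < r1^2 \<or> r2^2 < s ==> X' s = 0" and X''_zero: "s < r1^2 \<or> r2^2 < s ==> X'' s = 0"
proof -
 have 1: "X' s = 0" if "s < r1^2 \<or> r2^2 < s" for s
 proof (rule DERIV_local_const[OF X(1)[of s]])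
  show "0 < (if s < r1^2 then r1^2 - s else s - r2^2)" using that by auto
  show "\<forall>y. \<bar>s - y\<bar> < (if s < r1^2 then r1^2 - s else s - r2^2) --> X s = X y"
   using that X(4,5) by (auto simp: abs_if split: if_splits)
 qed
 have 2: "X'' s = 0" if "s < r1^2 \<or> r2^2 < s" for s
 proof (rule DERIV_local_const[OF X(2)[of s]])
  show "0 < (if s < r1^2 then r1^2 - s else s - r2^2)" using that by auto
  show "\<forall>y. \<bar>s - y\<bar> < (if s < r1^2 then r1^2 - s else s - r2^2) --> X' s = X' y"
   using that 1 by (auto simp: abs_if split: if_splits)
 qed
 show "s < r1^2 \<or> r2^2 < s ==> X' s = 0" "s < r1^2 \<or> r2^2 < s ==> X'' s = 0" by (fact 1, fact 2)
qed

lemma inside: "norm x < r1 ==> x \<bullet> x < r1^2" and outside: "norm x > r2 ==> x \<bullet> x > r2^2" for x :: "real^2"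
 using r by (simp_all add: dot_square_norm power_strict_mono)

lemma cut_zero:
 "norm x < r1 ==> X (x \<bullet> x) = 0" "norm x < r1 \<or> norm x > r2 ==> X' (x \<bullet> x) = 0"
 "norm x < r1 \<or> norm x > r2 ==> X'' (x \<bullet> x) = 0" "norm x > r2 ==> X (x \<bullet> x) = 1" for x :: "real^2"
 using inside[of x] outside[of x] X(4,5)[of "x \<bullet> x"] X'_zero[of "x \<bullet> x"] X''_zero[of "x \<bullet> x"] by auto

lemma cut_continuous: "continuous_on S (%x::real^2. X (x \<bullet> x))" "continuous_on S (%x::real^2. X' (x \<bullet> x))"
  "continuous_on S (%x::real^2. X'' (x \<bullet> x))"
proof -
 have c: "cts X" "cts X'"
  by (rule DERIV_continuous_on, rule has_field_derivative_at_within, rule X(1) X(2))+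
 show "continuous_on S (%x::real^2. X (x \<bullet> x))" "continuous_on S (%x::real^2. X' (x \<bullet> x))"
  "continuous_on S (%x::real^2. X'' (x \<bullet> x))"
  by (rule continuous_on_compose2[OF c(1)] continuous_on_compose2[OF c(2)] continuous_on_compose2[OF X(3)]; auto intro!: continuous_intros)+
qed

text \<open>The potential of a source at \<open>cp t\<close>, cut off near the disc;
\<open>dph\<close> is its gradient, and \<open>fs\<close> is what remains when the Helmholtz
operator is applied to it.\<close>

definition ph :: "real => real^2 => complex" where
 "ph t x = X (x \<bullet> x) *R Phi k ((x - cp t) \<bullet> (x - cp t))"

definition dph :: "2 => real => real^2 => complex" where
 "dph j t x = X' (x \<bullet> x) *R ((2 * x $ j) *R Phi k ((x - cp t) \<bullet> (x - cp t)))
   + X (x \<bullet> x) *R ((2 * (x $ j - cp t $ j)) *R Phi' k ((x - cp t) \<bullet> (x - cp t)))"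

definition fs :: "real => real^2 => complex" where
 "fs t x = (4 * (x \<bullet> x) * X'' (x \<bullet> x) + 4 * X' (x \<bullet> x)) *R Phi k ((x - cp t) \<bullet> (x - cp t))
   + (8 * X' (x \<bullet> x)) *R ((x \<bullet> (x - cp t)) *R Phi' k ((x - cp t) \<bullet> (x - cp t)))"

lemma jointly_continuous:
 "cts (%(t, x). ph t x)" "cts (%(t, x). dph j t x)" "cts (%(t, x). fs t x)"
proof -
 let ?S = "UNIV \<times> {x::real^2. norm x > r} :: (real \<times> (real^2)) set"
 have c: "continuous_on ?S (%p. cp (fst p))" by (rule continuous_on_compose2[OF continuous_cp[of UNIV]]) (auto intro!: continuous_intros)
 have P: "continuous_on {0<..} (Phi k)" "continuous_on {0<..} (Phi' k)"
  by (intro continuous_at_imp_continuous_on ballI has_vector_derivative_continuous, rule Phi_deriv, simp)+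
 have q: "continuous_on ?S (%p. (snd p - cp (fst p)) \<bullet> (snd p - cp (fst p)))" by (intro continuous_intros c)
 have G: "continuous_on ?S (%p. Phi k ((snd p - cp (fst p)) \<bullet> (snd p - cp (fst p))))"
  "continuous_on ?S (%p. Phi' k ((snd p - cp (fst p)) \<bullet> (snd p - cp (fst p))))"
  by (rule continuous_on_compose2[OF P(1) q] continuous_on_compose2[OF P(2) q]; use cp_dist in force)+
 have cut: "cts (%(t, x). c x *R G t x)"
  if "cts c" "!!x. norm x < r1 ==> c x = 0" "continuous_on ?S (%p. G (fst p) (snd p))"
  for c and G :: "real => real^2 => complex"
  by (rule continuous_cut[OF that(1,2) r(2)]) (use that(3) in \<open>simp_all add: case_prod_unfold\<close>)
 show "cts (%(t, x). ph t x)" unfolding ph_def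
  by (rule cut) (simp_all add: cut_continuous cut_zero G)
 have "cts (%p. (%(t, x). X' (x \<bullet> x) *R ((2 * x $ j) *R Phi k ((x - cp t) \<bullet> (x - cp t)))) p
   + (%(t, x). X (x \<bullet> x) *R ((2 * (x $ j - cp t $ j)) *R Phi' k ((x - cp t) \<bullet> (x - cp t)))) p)"
  by (intro continuous_on_add cut cut_continuous cut_zero disjI1; (intro continuous_intros G c)?)
 then show "cts (%(t, x). dph j t x)" unfolding dph_def by (simp add: case_prod_unfold)
 have "cts (%p. (%(t, x). (4 * (x \<bullet> x) * X'' (x \<bullet> x) + 4 * X' (x \<bullet> x)) *R Phi k ((x - cp t) \<bullet> (x - cp t))) p
   + (%(t, x). (8 * X' (x \<bullet> x)) *R ((x \<bullet> (x - cp t)) *R Phi' k ((x - cp t) \<bullet> (x - cp t)))) p)"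
  by (intro continuous_on_add cut; (intro continuous_intros cut_continuous G c)?) (simp_all add: cut_zero)
 then show "cts (%(t, x). fs t x)" unfolding fs_def by (simp add: case_prod_unfold)
qed

lemma fs_zero: "norm x < r1 \<or> norm x > r2 ==> fs t x = 0"
 by (simp add: fs_def cut_zero)

lemma jointly_continuous_snd: "cts (%(t, x). g t x) ==> cts (g t)"
 for g :: "real => real^2 => complex"
proof -
 assume g: "cts (%(t, x). g t x)"
 have "cts (%x. (%(t, x). g t x) (t, x))"
  by (rule continuous_on_compose2[OF g]) (auto intro!: continuous_intros)
 then show ?thesis by simp
qed

text \<open>Where the cut-off is constant the product solves the Helmholtz equation, so only the
commutator with the cut-off remains.\<close>

lemma C2_cut:
 fixes V V' V'' :: "real => 'b::real_normed_vector" and t :: real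
 assumes V: "!!s. s > 0 ==> (V has_vector_derivative V' s) (at s)"
  "!!s. s > 0 ==> (V' has_vector_derivative V'' s) (at s)" "continuous_on {0<..} V''"
  and ode: "!!s. s > 0 ==> (4 * s) *R V'' s + 4 *R V' s + k^2 *R V s = 0"
 defines "u \<equiv> %x. X (x \<bullet> x) *R V ((x - cp t) \<bullet> (x - cp t))"
 shows "C2_on UNIV u"
  "laplace u x + k^2 *R u x = (4 * (x \<bullet> x) * X'' (x \<bullet> x) + 4 * X' (x \<bullet> x)) *R V ((x - cp t) \<bullet> (x - cp t))
   + (8 * X' (x \<bullet> x)) *R ((x \<bullet> (x - cp t)) *R V' ((x - cp t) \<bullet> (x - cp t)))"
  "has_grad u (%j. X' (x \<bullet> x) *R ((2 * x $ j) *R V ((x - cp t) \<bullet> (x - cp t)))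
   + X (x \<bullet> x) *R ((2 * (x $ j - cp t $ j)) *R V' ((x - cp t) \<bullet> (x - cp t)))) x"
proof -
 let ?S = "{x. (x - cp t) \<bullet> (x - cp t) \<in> {0<..}}"
 have VT: "!!s. s \<in> {0<..} ==> (V has_vector_derivative V' s) (at s)" "!!s. s \<in> {0<..} ==> (V' has_vector_derivative V'' s) (at s)"
  using V(1,2) by simp_all
 note P = radial_product_C2[OF X(1-3) open_greaterThan, where V=V and V'=V' and V''=V'' and c="cp t", OF VT V(3), folded u_def]
 have oS: "open {x::real^2. norm x > r}" by (intro open_Collect_less continuous_intros)
 have z: "u y = 0" if "y \<in> ball 0 r1" for y using that by (simp add: u_def cut_zero)
 have C0: "C2_on S (%_::real^2. 0::'b)" if "open S" for S
  by (rule C2_onI(1)[OF that has_grad_const has_grad_const]) (rule continuous_on_const)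
 show "C2_on UNIV u"
 proof (rule C2_on_local)
  fix x :: "real^2"
  show "\<exists>S v. open S \<and> x \<in> S \<and> C2_on S v \<and> (\<forall>y\<in>S. u y = v y)"
  proof (cases "norm x < r1")
   case True
   show ?thesis by (rule exI[of _ "ball 0 r1"], rule exI[of _ "%_. 0"]) (use True z C0 in simp)
  next
   case False
   have "C2_on {x. norm x > r} u"
   proof (rule C2_on_subset)
    show "C2_on ?S u" by (rule P(1)) simp_all
   qed (use cp_dist in auto)
   then show ?thesis using False r(2) oS by (intro exI[of _ "{x. norm x > r}"] exI[of _ u]) auto
  qed
 qed
 show "laplace u x + k^2 *R u x = (4 * (x \<bullet> x) * X'' (x \<bullet> x) + 4 * X' (x \<bullet> x)) *R V ((x - cp t) \<bullet> (x - cp t))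
   + (8 * X' (x \<bullet> x)) *R ((x \<bullet> (x - cp t)) *R V' ((x - cp t) \<bullet> (x - cp t)))"
 proof (cases "norm x < r1")
  case True
  have "laplace u x = laplace (%_. 0) x" by (rule laplace_cong_open[OF open_ball[of 0 r1]]) (use True z in auto)
  also have "... = 0"
  proof -
   have "pd j (%_. 0 :: 'b) = (%_. 0)" for j by (rule ext) (rule has_grad_partial_deriv[OF has_grad_const])
   then show ?thesis by (simp add: laplace_def)
  qed
  finally show ?thesis using True by (simp add: cut_zero u_def)
 next
  case False
  then have s: "(x - cp t) \<bullet> (x - cp t) > 0" using cp_dist[of x t] r by simp
  have L: "laplace u x = (4 * (x \<bullet> x) * X'' (x \<bullet> x) + 4 * X' (x \<bullet> x)) *R V ((x - cp t) \<bullet> (x - cp t))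
   + (8 * X' (x \<bullet> x)) *R ((x \<bullet> (x - cp t)) *R V' ((x - cp t) \<bullet> (x - cp t)))
   + X (x \<bullet> x) *R ((4 * ((x - cp t) \<bullet> (x - cp t))) *R V'' ((x - cp t) \<bullet> (x - cp t)) + 4 *R V' ((x - cp t) \<bullet> (x - cp t)))"
   by (rule P(2)) (use s in simp_all)
  have "X (x \<bullet> x) *R ((4 * ((x - cp t) \<bullet> (x - cp t))) *R V'' ((x - cp t) \<bullet> (x - cp t)) + 4 *R V' ((x - cp t) \<bullet> (x - cp t)))
   + k^2 *R u x = X (x \<bullet> x) *R ((4 * ((x - cp t) \<bullet> (x - cp t))) *R V'' ((x - cp t) \<bullet> (x - cp t)) + 4 *R V' ((x - cp t) \<bullet> (x - cp t)) + k^2 *R V ((x - cp t) \<bullet> (x - cp t)))"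
   unfolding u_def by (simp only: scaleR_add_right scaleR_left_commute[of "k^2"])
  also have "... = 0" by (simp only: ode[OF s] scaleR_zero_right)
  finally show ?thesis unfolding L by (simp only: add.assoc add_0_right)
 qed
 show "has_grad u (%j. X' (x \<bullet> x) *R ((2 * x $ j) *R V ((x - cp t) \<bullet> (x - cp t)))
   + X (x \<bullet> x) *R ((2 * (x $ j - cp t $ j)) *R V' ((x - cp t) \<bullet> (x - cp t)))) x"
 proof (cases "norm x < r1")
  case True
  have "has_grad u (%_. 0) x" by (rule has_grad_cong_open[OF has_grad_const open_ball[of 0 r1]]) (use True z in auto)
  then show ?thesis using True by (simp add: cut_zero)
 next
  case False
  then have s: "(x - cp t) \<bullet> (x - cp t) > 0" using cp_dist[of x t] r by simp
  show ?thesis by (rule P(3)) (use s in simp_all)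
 qed
qed

lemma ph_facts:
 shows ph_C2: "C2_on UNIV (ph t)" and ph_eq: "laplace (ph t) x + of_real (k^2) * ph t x = fs t x"
  and ph_grad: "has_grad (ph t) (%j. dph j t x) x"
proof -
 have ode: "(4 * s) *R Phi'' k s + 4 *R Phi' k s + k^2 *R Phi k s = 0" if "s > 0" for s
  using Phi_ode[OF that, of k] by (simp add: scaleR_conv_of_real)
 show "C2_on UNIV (ph t)" unfolding ph_def[abs_def] by (rule C2_cut(1)[OF Phi_deriv Phi''_continuous ode])
 have "laplace (ph t) x + k^2 *R ph t x = fs t x"
  unfolding ph_def[abs_def] fs_def by (rule C2_cut(2)[OF Phi_deriv Phi''_continuous ode])
 then show "laplace (ph t) x + of_real (k^2) * ph t x = fs t x" by (simp add: scaleR_conv_of_real)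
 show "has_grad (ph t) (%j. dph j t x) x"
  unfolding ph_def[abs_def] dph_def by (rule C2_cut(3)[OF Phi_deriv Phi''_continuous ode])
qed

end

lemma weighted_continuous:
 fixes g :: "real => real^2 => complex"
 assumes g: "cts (%(t, x). g t x)" and e: "cts e"
 shows "cts (%(t, x). g t x * e t)"
proof -
 have "cts (%p. (%(t, x). g t x) p * e (fst p))"
  by (intro continuous_on_mult g continuous_on_compose2[OF e] continuous_intros) auto
 then show ?thesis by (simp add: case_prod_unfold)
qed

context near_field
begin

text \<open>The superposition of cut-off potentials with density \<open>e\<close> on the circle, and
of their sources.\<close>

definition Fe :: "(real => complex) => real^2 => complex" where
 "Fe e x = of_real r * (LINT t:{0..2*pi}|lborel. ph t x * e t)"

definition fe :: "(real => complex) => real^2 => complex" where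
 "fe e x = of_real r * (LINT t:{0..2*pi}|lborel. fs t x * e t)"

lemma Fe_C1:
 assumes e: "cts e"
 shows "C1_on UNIV (Fe e)"
 unfolding Fe_def[abs_def]
 by (rule C1_on_linear[OF bounded_linear_mult_right], rule parameter_integral_C1[where h="%j t x. dph j t x * e t"])
   (rule weighted_continuous jointly_continuous e has_grad_linear[OF bounded_linear_mult_left ph_grad])+

lemma fe_continuous: "cts e ==> cts (fe e)"
 unfolding fe_def[abs_def]
 by (intro continuous_intros parameter_integral_continuous weighted_continuous jointly_continuous)

lemma fe_zero: "norm x > r2 ==> fe e x = 0"
 by (simp add: fe_def fs_zero)

lemma ph_weak:
 assumes z: "C2c D ze"
 shows "(LINT x|lborel. ph t x * of_real (laplace ze x + k^2 * ze x)) = (LINT x|lborel. fs t x * of_real (ze x))"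
proof -
 have "C2c UNIV ze" using z by (auto simp: C2c_def)
 from helmholtz_green[OF ph_C2 this] show ?thesis by (simp only: ph_eq)
qed

text \<open>Fubini reduces the claim to a single source point.\<close>

lemma Fe_weak:
 assumes e: "cts e" and z: "C2c D ze"
 shows "(LINT x|lborel. Fe e x * of_real (laplace ze x + k^2 * ze x)) = (LINT x|lborel. fe e x * of_real (ze x))"
proof -
 obtain K R where K: "C2_on UNIV ze" "compact K" "!!x. x \<notin> K ==> ze x = 0" "!!x. norm x > R ==> x \<notin> K"
  using C2cE[OF z] by metis
 let ?z = "%x. laplace ze x + k^2 * ze x"
 have z0: "?z x = 0" if "norm x > R" for x using laplace_eq_0_outside[OF K(2,3) K(4)[OF that]] K(3)[OF K(4)[OF that]] by simp
 have cze: "cts ze" by (rule C1_on_continuous[OF C2_on_imp_C1_on[OF K(1)]])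
 have cz: "cts ?z" using laplace_continuous[OF K(1)] cze by (intro continuous_intros)
 \<comment> \<open>The source potential has unbounded support, so the test function is moved under the inner integral.\<close>
 have cut: "indicator (cball 0 R) x = (1::real) \<or> ?z x = 0" for x
 proof (cases "norm x > R")
  case True show ?thesis by (rule disjI2[OF z0[OF True]])
 qed (simp add: indicator_def)
 have cP: "cts (%(t, x). ph t x * e t * of_real (?z x))"
 proof -
  have "cts (%p. (%(t, x). ph t x * e t) p * of_real (?z (snd p)))"
   by (intro continuous_on_mult weighted_continuous jointly_continuous e continuous_on_of_real continuous_on_compose2[OF cz] continuous_intros) auto
  then show ?thesis by (simp add: case_prod_unfold)
 qed
 have iB: "intble (indicator (cball 0 R) :: real^2 => real)"
  using emeasure_bounded_finite[of "cball (0::real^2) R"] by (intro integrable_real_indicator) simp_all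
 have ize: "intble ze" by (rule bdd_support(1)[OF cze, of R]) (simp add: K(3,4))
 have "(LINT x|lborel. Fe e x * of_real (?z x)) = (LINT x|lborel. of_real r * ((LINT t:{0..2*pi}|lborel. ph t x * e t * of_real (?z x)) * of_real (indicator (cball 0 R) x)))"
 proof (rule Bintegral_cong[OF refl])
  show "Fe e x * of_real (?z x) = of_real r * ((LINT t:{0..2*pi}|lborel. ph t x * e t * of_real (?z x)) * of_real (indicator (cball 0 R) x))" for x
  proof -
   have "(LINT t:{0..2*pi}|lborel. ph t x * e t * of_real (?z x)) = (LINT t:{0..2*pi}|lborel. ph t x * e t) * of_real (?z x)"
    by (rule set_integral_mult_left)
   note eq = this
   show ?thesis using cut[of x]
   proof (elim disjE)
    assume i: "indicator (cball 0 R) x = (1::real)"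
    show ?thesis unfolding eq Fe_def by (simp only: i of_real_1 mult_1_right mult.assoc)
   next
    assume z: "?z x = 0"
    show ?thesis unfolding eq by (simp only: z of_real_0 mult_zero_left mult_zero_right)
   qed
  qed
 qed
 also have "... = of_real r * (LINT t:{0..2*pi}|lborel. LINT x|lborel. ph t x * e t * of_real (?z x) * of_real (indicator (cball 0 R) x))"
  unfolding integral_mult_right_zero by (subst parameter_integral_fubini(1)[OF cP _ iB, of R]) (simp_all only: z0 of_real_0 mult_zero_right)
 also have "(LINT t:{0..2*pi}|lborel. LINT x|lborel. ph t x * e t * of_real (?z x) * of_real (indicator (cball 0 R) x))
   = (LINT t:{0..2*pi}|lborel. LINT x|lborel. fs t x * e t * of_real (ze x))"
 proof -
  have "(LINT x|lborel. ph t x * e t * of_real (?z x) * of_real (indicator (cball 0 R) x)) = (LINT x|lborel. fs t x * e t * of_real (ze x))" for t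
  proof -
   have "ph t x * e t * of_real (?z x) * of_real (indicator (cball 0 R) x) = e t * (ph t x * of_real (?z x))" for x
    using cut[of x]
   proof (elim disjE)
    assume i: "indicator (cball 0 R) x = (1::real)"
    show ?thesis by (simp only: i of_real_1 mult_1_right mult_1_left mult_ac)
   next
    assume z: "?z x = 0"
    show ?thesis by (simp only: z of_real_0 mult_zero_left mult_zero_right)
   qed
   then have "(LINT x|lborel. ph t x * e t * of_real (?z x) * of_real (indicator (cball 0 R) x)) = e t * (LINT x|lborel. ph t x * of_real (?z x))"
    by (simp only: integral_mult_right_zero)
   also have "... = (LINT x|lborel. e t * (fs t x * of_real (ze x)))" by (simp only: ph_weak[OF z] integral_mult_right_zero)
   finally show ?thesis by (simp only: mult_ac)
  qed
  then show ?thesis by (simp only:)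
 qed
 also have "... = (LINT x|lborel. (LINT t:{0..2*pi}|lborel. fs t x * e t) * of_real (ze x))"
  by (rule parameter_integral_fubini(1)[OF weighted_continuous[OF jointly_continuous(3) e] _ ize, of r2, symmetric]) (simp add: fs_zero)
 also have "of_real r * ... = (LINT x|lborel. fe e x * of_real (ze x))"
  by (simp only: fe_def mult.assoc integral_mult_right_zero)
 finally show ?thesis .
qed

lemma frontier_norm: "x \<in> frontier D ==> norm x > r2"
proof -
 assume "x \<in> frontier D"
 then have "x \<notin> D" using open_D by (simp add: frontier_def interior_open)
 then show ?thesis using r(4) by force
qed

lemma ph_frontier: "x \<in> frontier D ==> ph t x = fund_sol k x (cp t)"
proof -
 assume "x \<in> frontier D"
 then have x: "norm x > r2" by (rule frontier_norm)
 then have "x \<noteq> cp t" using norm_cp[of t] r by auto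
 then show ?thesis using x by (simp add: ph_def cut_zero fund_sol_eq[OF k])
qed

lemma Fe_frontier: "x \<in> frontier D ==> single_layer_op k r \<psi> x = Fe (%t. \<psi> (cp t)) x"
 by (simp add: single_layer_op_def circle_integral_def Fe_def ph_frontier flip: cp_def)

lemma Fe_trace: "cts e ==> has_trace D (Fe e) (Fe e)"
 by (rule has_trace_C1[OF open_D bounded_D Fe_C1]) simp_all

text \<open>The mollifier that reproduces weak solutions at \<open>cp s\<close>.\<close>

definition mo :: "real => real^2 => real" where "mo s x = moll k \<delta> (cp s - x)"

lemma mo_support: "norm x >= r1 ==> mo s x = 0"
proof -
 assume "norm x >= r1"
 then have "norm (cp s - x) > \<delta>" using norm_triangle_ineq2[of x "cp s"] norm_cp[of s] d(4) by (simp add: norm_minus_commute)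
 then show ?thesis by (simp add: mo_def moll_support[OF d(2)])
qed

lemma mo_continuous: "cts (mo s)"
 unfolding mo_def[abs_def] by (rule continuous_on_compose2[OF moll_continuous]) (auto intro!: continuous_intros)

lemma mo_sqint: "sqint (mo s)"
 by (rule sqint_continuous[OF mo_continuous, of r1]) (simp add: mo_support)

lemma mo_cball: "cball (cp s) \<delta> \<subseteq> D"
proof
 fix x assume "x \<in> cball (cp s) \<delta>"
 then have "norm x <= r + \<delta>" using norm_triangle_ineq2[of x "cp s"] norm_cp[of s] by (simp add: dist_norm norm_minus_commute)
 then show "x \<in> D" using r d by auto
qed

lemma fs_sqint: "sqint (%x. Re (fs t x))" "sqint (%x. Im (fs t x))"
 by (rule sqint_continuous[where R=r2]; use jointly_continuous_snd[OF jointly_continuous(3)] in \<open>auto intro!: continuous_intros simp: fs_zero\<close>)+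

lemma fe_sqint:
 assumes "cts e"
 shows "sqint (%x. Re (fe e x))" "sqint (%x. Im (fe e x))"
 by (rule sqint_continuous[where R=r2]; use fe_continuous[OF assms] in \<open>auto intro!: continuous_intros simp: fe_zero\<close>)+

text \<open>Near the circle the cut-off potential vanishes, so the mollifier reproducing the field
at \<open>cp s\<close> sees only the solution with source \<open>fs t\<close>. Symmetry then moves
the solution operator onto the mollifier, which does not depend on \<open>t\<close>.\<close>

lemma us_value: "us (cp s) (cp t) = (LINT x|lborel. fs t x * of_real (solf (mo s) x))"
proof -
 let ?u = "%x. csol (fs t) x - indicator D x *R ph t x"
 have cs: "cts (fs t)" by (rule jointly_continuous_snd[OF jointly_continuous(3)])
 have u: "weak_helmholtz k D ?u" "intble ?u" "has_trace D ?u (%x. - fund_sol k x (cp t))"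
  by (rule corrected_solution[OF cs, where R=r2 and g="%x. fund_sol k x (cp t)"]; (rule C2_on_imp_C1_on[OF ph_C2] | erule ph_weak | simp add: fs_zero ph_frontier))+
 obtain w where w: "helmholtz_dirichlet D k (%x. - fund_sol k x (cp t)) w"
  "\<forall>x ep. 0 < ep --> ep < r0 --> cball x ep \<subseteq> D --> w x = conv ?u (moll k ep) x"
  using classical_representative[OF d(1) u] by blast
 have "cp s \<in> D" using mo_cball[of s] d(2) by auto
 then have "us (cp s) (cp t) = w (cp s)"
  by (rule classical_unique[OF us w(1), rotated]) (simp add: norm_cp)
 also have "... = conv ?u (moll k \<delta>) (cp s)" using w(2) d(2,3) mo_cball by blast
 also have "... = (LINT x|lborel. csol (fs t) x * of_real (mo s x))"
  unfolding conv_def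
 proof (rule Bintegral_cong[OF refl])
  show "?u x * of_real (moll k \<delta> (cp s - x)) = csol (fs t) x * of_real (mo s x)" for x
   by (cases "norm x < r1") (simp_all add: ph_def cut_zero mo_support flip: mo_def)
 qed
 also have "... = (LINT x|lborel. fs t x * of_real (solf (mo s) x))"
  by (rule csol_symmetric[OF fs_sqint mo_sqint])
 finally show ?thesis .
qed

text \<open>The near field operator, on densities given as functions of the angle.\<close>

definition Ne :: "(real => complex) => real => complex" where
 "Ne e s = of_real r * (LINT t:{0..2*pi}|lborel. us (cp s) (cp t) * e t)"

lemma near_field_value:
 assumes e: "cts e"
 shows "Ne e s = (LINT x|lborel. csol (fe e) x * of_real (mo s x))"
  and "set_integrable lborel {0..2*pi} (%t. us (cp s) (cp t) * e t)"
proof -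
 let ?v = "solf (mo s)"
 have iv: "intble ?v" by (rule solf_integrable[OF mo_sqint])
 note F = parameter_integral_fubini[OF weighted_continuous[OF jointly_continuous(3) e] _ iv, of r2]
 have "us (cp s) (cp t) * e t = (LINT x|lborel. fs t x * e t * of_real (?v x))" for t
 proof -
  have "(LINT x|lborel. fs t x * e t * of_real (?v x)) = (LINT x|lborel. fs t x * of_real (?v x) * e t)" by (simp only: mult_ac)
  also have "... = (LINT x|lborel. fs t x * of_real (?v x)) * e t" by (rule integral_mult_left_zero)
  finally show ?thesis by (simp only: us_value)
 qed
 note eq = this
 show "set_integrable lborel {0..2*pi} (%t. us (cp s) (cp t) * e t)"
  unfolding eq by (rule F(2)) (simp add: fs_zero)
 have "Ne e s = of_real r * (LINT t:{0..2*pi}|lborel. LINT x|lborel. fs t x * e t * of_real (?v x))"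
  unfolding Ne_def eq ..
 also have "(LINT t:{0..2*pi}|lborel. LINT x|lborel. fs t x * e t * of_real (?v x)) = (LINT x|lborel. (LINT t:{0..2*pi}|lborel. fs t x * e t) * of_real (?v x))"
  by (rule F(1)[symmetric]) (simp add: fs_zero)
 also have "of_real r * ... = (LINT x|lborel. fe e x * of_real (?v x))"
  by (simp only: fe_def mult.assoc integral_mult_right_zero)
 also have "... = (LINT x|lborel. csol (fe e) x * of_real (mo s x))"
  by (rule csol_symmetric[OF fe_sqint[OF e] mo_sqint, symmetric])
 finally show "Ne e s = (LINT x|lborel. csol (fe e) x * of_real (mo s x))" .
qed

lemma near_field_continuous:
 assumes e: "cts e"
 shows "continuous_on S (Ne e)"
proof -
 have "cts (conv (csol (fe e)) (moll k \<delta>))"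
  by (rule conv_continuous[OF csol_integrable[OF fe_sqint[OF e]] moll_continuous moll_support[OF d(2)]])
 then have "continuous_on S (%s. conv (csol (fe e)) (moll k \<delta>) (cp s))"
  by (rule continuous_on_compose2[OF _ continuous_cp]) simp
 then show ?thesis unfolding conv_def mo_def[symmetric] near_field_value(1)[OF e, symmetric] .
qed

text \<open>If the boundary data are also the trace of zero, the corrected solution has trace zero
and vanishes in \<open>D\<close>.\<close>

lemma near_field_vanishes:
 assumes e: "cts e" and t0: "has_trace D (%_. 0) (Fe e)"
 shows "Ne e s = 0"
proof -
 let ?u = "%x. csol (fe e) x - indicator D x *R Fe e x"
 note C = corrected_solution[OF fe_continuous[OF e] fe_zero Fe_C1[OF e] Fe_weak[OF e], where g="Fe e"]
 have u: "weak_helmholtz k D ?u" "intble ?u" "has_trace D ?u (%x. - Fe e x)"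
  by (rule C; (assumption | simp))+
 have "has_trace D ?u (%_. 0)"
  using has_trace_combination[OF open_D bounded_D u(3) t0, of 1 1] by simp
 then have z: "AE x in lborel. x \<in> D --> ?u x = 0" by (rule trace_zero_unique[OF u(1,2)])
 show ?thesis unfolding near_field_value(1)[OF e]
 proof (rule integral_eq_zero_AE)
  show "AE x in lborel. csol (fe e) x * of_real (mo s x) = 0"
   using z
  proof eventually_elim
   case (elim x)
   show ?case
   proof (cases "norm x < r1")
    case True
    then have "x \<in> D" using r by auto
    moreover have "Fe e x = 0" using True by (simp add: Fe_def ph_def cut_zero)
    ultimately show ?thesis using elim by simp
   qed (simp add: mo_support)
  qed
 qed
qed

text \<open>The imaginary part of the source \<open>fs t\<close> is the Helmholtz operator applied
to \<open>(X - 1) J\<^sub>0 / 4\<close>, which is a test function because \<open>J\<^sub>0\<close>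
has no singularity. The weak equation for the mollifier turns its pairing with the source into a
mean value of \<open>- J\<^sub>0 / 4\<close>.\<close>

lemma near_field_imaginary_part: "Im (us (cp s) (cp t)) = - jf (k^2) (2 * r^2 * (1 - cos (s - t))) / 4"
proof -
 define V V' V'' where "V s = jf (k^2) s / 4" and "V' s = jf' (k^2) s / 4" and "V'' s = jf'' (k^2) s / 4" for s
 define ze where "ze x = (X (x \<bullet> x) - 1) *R V ((x - cp t) \<bullet> (x - cp t))" for x
 have kk: "k^2 >= 0" by simp
 have dV: "(V has_vector_derivative V' s) (at s)" "(V' has_vector_derivative V'' s) (at s)" for s
  unfolding V_def[abs_def] V'_def[abs_def] V''_def has_real_derivative_iff_has_vector_derivative[symmetric]
  by (intro DERIV_cdivide jf_deriv[OF kk])+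
 have cV: "cts V''" unfolding V''_def by (intro continuous_intros jf_deriv(3)[OF kk]) simp
 have dX: "((%s. X s - 1) has_real_derivative X' s) (at s)" for s using X(1)[of s] by (auto intro!: derivative_eq_intros)
 note P = radial_product_C2[OF dX X(2,3) open_UNIV dV cV, where c="cp t", folded ze_def]
 have z2: "C2_on UNIV ze" using P(1) by (simp add: ze_def[abs_def])
 have zD: "C2c D ze" unfolding C2c_def
  using z2 r(4) by (intro conjI exI[of _ "cball 0 r2"]) (auto simp: ze_def cut_zero)
 have zf: "laplace ze x + k^2 * ze x = Im (fs t x)" for x
 proof -
  let ?s = "(x - cp t) \<bullet> (x - cp t)"
  have L: "laplace ze x = (4 * (x \<bullet> x) * X'' (x \<bullet> x) + 4 * X' (x \<bullet> x)) *R V ?s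
   + (8 * X' (x \<bullet> x)) *R ((x \<bullet> (x - cp t)) *R V' ?s) + (X (x \<bullet> x) - 1) *R ((4 * ?s) *R V'' ?s + 4 *R V' ?s)"
   using P(2)[of x] by (simp add: ze_def[abs_def])
  have "(4 * ?s) * V'' ?s + 4 * V' ?s + k^2 * V ?s = 0"
   using jf_ode[OF kk, of ?s] by (simp add: V_def V'_def V''_def field_simps)
  then have o: "(4 * ?s) * V'' ?s + 4 * V' ?s = - (k^2 * V ?s)" by linarith
  have c: "c * - (k^2 * v) + k^2 * (c * v) = 0" for c v :: real by (simp add: mult_ac)
  show ?thesis unfolding L real_scaleR_def o ze_def add.assoc c
   by (simp add: fs_def Phi_def Phi'_def V_def V'_def)
 qed
 note sv = solf_square[OF mo_sqint[of s]]
 have "us (cp s) (cp t) = Complex (LINT x|lborel. Re (fs t x) * solf (mo s) x) (LINT x|lborel. Im (fs t x) * solf (mo s) x)"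
  unfolding us_value by (rule integral_Complex) (rule integrable_square_mult[OF fs_sqint(1) sv] integrable_square_mult[OF fs_sqint(2) sv])+
 then have "Im (us (cp s) (cp t)) = (LINT x|lborel. solf (mo s) x * (laplace ze x + k^2 * ze x))" unfolding zf by (simp only: complex.sel mult.commute)
 also have "... = (LINT x|lborel. mo s x * ze x)" by (rule solf_weak[OF mo_sqint zD])
 also have "... = (LINT x|lborel. (- 1/4) * (jf (k^2) ((x - cp t) \<bullet> (x - cp t)) * moll k \<delta> (cp s - x)))"
 proof (rule Bintegral_cong[OF refl])
  show "mo s x * ze x = (- 1/4) * (jf (k^2) ((x - cp t) \<bullet> (x - cp t)) * moll k \<delta> (cp s - x))" for x
   by (cases "norm x < r1") (simp_all add: ze_def V_def cut_zero mo_support flip: mo_def)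
 qed
 also have "... = (- 1/4) * jf (k^2) ((cp s - cp t) \<bullet> (cp s - cp t))"
  by (simp only: integral_mult_right_zero mean_value_jf[OF d(1-3)])
 also have "(cp s - cp t) \<bullet> (cp s - cp t) = 2 * r^2 * (1 - cos (s - t))"
  using cos_minus[of "s - t"] by (simp add: inner_diff_left inner_diff_right cp_inner algebra_simps)
 finally show ?thesis by simp
qed

end

section \<open>Fourier coefficients of the Bessel kernel\<close>

lemma integral_cis:
 "(LINT t:{0..2*pi}|lborel. cis (of_int p * t)) = (if p = 0 then of_real (2 * pi) else 0)"
proof -
 have c: "continuous_on {0..2*pi} (%t. cis (of_int p * t))" by (intro continuous_intros)
 have "(LINT t:{0..2*pi}|lborel. cis (of_int p * t)) = integral {0..2*pi} (%t. cis (of_int p * t))"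
  by (rule set_borel_integral_eq_integral(2)[OF borel_integrable_atLeastAtMost'[OF c]])
 also have "... = (if p = 0 then of_real (2 * pi) else 0)"
 proof (cases "p = 0")
  case True then show ?thesis by (simp add: scaleR_conv_of_real)
 next
  case False
  have "((%t. cis (of_int p * t)) has_integral (cis (of_int p * (2 * pi)) / (\<i> * of_int p) - cis (of_int p * 0) / (\<i> * of_int p))) {0..2*pi}"
  proof (rule fundamental_theorem_of_calculus)
   show "((%t. cis (of_int p * t) / (\<i> * of_int p)) has_vector_derivative cis (of_int p * t)) (at t within {0..2*pi})" for t
    unfolding cis_conv_exp using False
    by (auto intro!: derivative_eq_intros has_vector_derivative_real_field simp: field_simps)
  qed simp
  moreover have "cis (of_int p * (2 * pi)) = 1" using cis_multiple_2pi[of "of_int p"] by (simp add: mult.commute)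
  ultimately show ?thesis using False by (simp add: integral_unique)
 qed
 finally show ?thesis .
qed

text \<open>Writing \<open>w = cis th\<close>, the squared chord \<open>2 - 2 cos th\<close> equals
\<open>- (1 - w)^2 / w\<close>, so its powers follow from the binomial theorem.\<close>

lemma chord_power_expansion:
 "of_real ((2 - 2 * cos th) ^ m) = (\<Sum>j\<le>2*m. (-1) ^ (m + j) * of_nat ((2 * m) choose j) * cis (of_int (int j - int m) * th))"
proof -
 let ?z = "cis th"
 have "of_real (2 - 2 * cos th) = - ((1 - ?z)^2) * cis (- th)"
 proof -
  have "(1 - ?z)^2 * cis (- th) = cis (- th) - 2 * (?z * cis (- th)) + ?z * (?z * cis (- th))" by (simp add: power2_eq_square algebra_simps)
  also have "?z * cis (- th) = 1" by (simp add: cis_mult)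
  finally show ?thesis by (simp add: complex_eq_iff)
 qed
 then have "of_real ((2 - 2 * cos th) ^ m) = (-1) ^ m * (1 - ?z) ^ (2 * m) * cis (- th) ^ m"
  by (simp add: of_real_power power_mult_distrib power_minus[of "(1 - ?z)^2 * cis (- th)"] power_mult[symmetric])
 also have "(1 - ?z) ^ (2 * m) = (\<Sum>j\<le>2*m. of_nat ((2 * m) choose j) * (- ?z) ^ j)"
  using binomial_ring[of "- ?z" 1 "2 * m"] by simp
 also have "(-1) ^ m * ... * cis (- th) ^ m = (\<Sum>j\<le>2*m. (-1) ^ (m + j) * of_nat ((2 * m) choose j) * cis (of_int (int j - int m) * th))"
 proof -
  have "(-1) ^ m * (of_nat ((2 * m) choose j) * (- ?z) ^ j) * cis (- th) ^ m = (-1) ^ (m + j) * of_nat ((2 * m) choose j) * cis (of_int (int j - int m) * th)" for j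
  proof -
   have "cis (of_int (int j - int m) * th) = ?z ^ j * cis (- th) ^ m"
    unfolding Complex.DeMoivre cis_mult by (rule arg_cong[where f=cis]) (simp add: algebra_simps)
   then show ?thesis by (simp add: power_minus[of ?z] power_add)
  qed
  then show ?thesis by (simp only: sum_distrib_left sum_distrib_right)
 qed
 finally show ?thesis .
qed

lemma chord_power_fourier:
 "(LINT t:{0..2*pi}|lborel. of_real ((2 - 2 * cos (s - t)) ^ m) * cis (of_nat n * t))
  = (-1) ^ n * of_nat ((2 * m) choose (m + n)) * of_real (2 * pi) * cis (of_nat n * s)"
proof -
 have i: "set_integrable lborel {0..2*pi} (%t. c * cis (of_int p * t))" for c p
  by (intro borel_integrable_atLeastAtMost' continuous_intros)
 let ?c = "%j. (-1) ^ (m + j) * of_nat ((2 * m) choose j) * cis (of_int (int j - int m) * s)"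
 have "of_real ((2 - 2 * cos (s - t)) ^ m) * cis (of_nat n * t) = (\<Sum>j\<le>2*m. ?c j * cis (of_int (int n + int m - int j) * t))" for t
  unfolding chord_power_expansion sum_distrib_right
 proof (rule sum.cong[OF refl])
  fix j
  have "cis (of_int (int j - int m) * (s - t)) * cis (of_nat n * t) = cis (of_int (int j - int m) * s) * cis (of_int (int n + int m - int j) * t)"
   by (simp add: cis_mult algebra_simps)
  then show "(-1) ^ (m + j) * of_nat ((2 * m) choose j) * cis (of_int (int j - int m) * (s - t)) * cis (of_nat n * t)
   = ?c j * cis (of_int (int n + int m - int j) * t)" by (simp only: mult.assoc)
 qed
 then have "(LINT t:{0..2*pi}|lborel. of_real ((2 - 2 * cos (s - t)) ^ m) * cis (of_nat n * t))
  = (LINT t:{0..2*pi}|lborel. (\<Sum>j\<le>2*m. ?c j * cis (of_int (int n + int m - int j) * t)))" by (simp only:)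
 also have "... = (\<Sum>j\<le>2*m. LINT t:{0..2*pi}|lborel. ?c j * cis (of_int (int n + int m - int j) * t))"
  using i unfolding set_lebesgue_integral_def set_integrable_def scaleR_sum_right by (intro Bintegral_sum) blast
 also have "... = (\<Sum>j\<le>2*m. if j = m + n then ?c j * of_real (2 * pi) else 0)"
  by (intro sum.cong refl) (simp only: set_integral_mult_right integral_cis, auto)
 also have "... = (-1) ^ n * of_nat ((2 * m) choose (m + n)) * of_real (2 * pi) * cis (of_nat n * s)"
 proof (cases "n <= m")
  case True
  have "(-1::complex) ^ (m + (m + n)) = (-1) ^ n"
  proof -
   have "m + (m + n) = 2 * m + n" by simp
   then show ?thesis by (simp only: power_add power_mult) simp
  qed
  then show ?thesis using True by simp
 qed (simp add: binomial_eq_0)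
 finally show ?thesis .
qed

lemma bessel_nat_summable: "summable (%m. \<bar>(-1) ^ m / (fact m * fact (m + n)) * (x / 2) ^ (2 * m + n)\<bar> :: real)"
proof -
 have "summable (%m. inverse (fact m * fact (m + n)) * ((x / 2)^2) ^ m :: real)"
 proof (rule entire_series_summable[where K=1])
  show "\<bar>inverse (fact m * fact (m + n))\<bar> <= 1 ^ m / (fact m :: real)" for m
   using fact_ge_1[of "m + n", where 'a=real] by (simp add: abs_mult field_simps)
 qed simp
 moreover have "\<bar>(-1) ^ m / (fact m * fact (m + n)) * (x / 2) ^ (2 * m + n)\<bar> = \<bar>x / 2\<bar> ^ n * (inverse (fact m * fact (m + n)) * ((x / 2)^2) ^ m)" for m
 proof -
  have "\<bar>(x / 2) ^ (2 * m + n)\<bar> = ((x / 2)^2) ^ m * \<bar>x / 2\<bar> ^ n"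
   by (simp only: power_add power_mult abs_mult power_abs power2_abs)
  then show ?thesis by (simp only: abs_mult abs_divide power_abs) (simp add: field_simps)
 qed
 ultimately show ?thesis by (simp only: summable_mult)
qed

text \<open>Cauchy product and the Vandermonde identity.\<close>

lemma bessel_square_sums:
 "(%l. (-1) ^ l * (x / 2) ^ (2 * l + 2 * n) * real ((2 * n + 2 * l) choose l) / (fact (n + l))^2) sums (bessel_J_nat n x)^2"
proof -
 let ?b = "%m. (-1) ^ m / (fact m * fact (m + n)) * (x / 2) ^ (2 * m + n) :: real"
 have s: "summable (%m. norm (?b m))" using bessel_nat_summable[of n x] by simp
 have v: "(\<Sum>i\<le>l. 1 / (fact i * fact (i + n) * (fact (l - i) * fact (l - i + n)))) = real ((2 * n + 2 * l) choose l) / (fact (n + l))^2" for l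
 proof -
  have "1 / (fact i * fact (i + n) * (fact (l - i) * fact (l - i + n))) = real (((n + l) choose i) * ((n + l) choose (l - i))) / (fact (n + l))^2" if "i <= l" for i
  proof -
   have "n + l - i = l - i + n" "n + l - (l - i) = i + n" using that by simp_all
   then have "real ((n + l) choose i) = fact (n + l) / (fact i * fact (l - i + n))"
    "real ((n + l) choose (l - i)) = fact (n + l) / (fact (l - i) * fact (i + n))"
    using that binomial_fact[of i "n + l", where 'a=real] binomial_fact[of "l - i" "n + l", where 'a=real] by (simp_all add: add.commute)
   note B = this
   show ?thesis unfolding of_nat_mult B power2_eq_square by (simp add: mult_ac)
  qed
  then have "(\<Sum>i\<le>l. 1 / (fact i * fact (i + n) * (fact (l - i) * fact (l - i + n)))) = real (\<Sum>i\<le>l. ((n + l) choose i) * ((n + l) choose (l - i))) / (fact (n + l))^2"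
   by (simp add: sum_divide_distrib)
  also have "(\<Sum>i\<le>l. ((n + l) choose i) * ((n + l) choose (l - i))) = (2 * n + 2 * l) choose l"
   using vandermonde[of "n + l" "n + l" l] by (simp add: mult_2 add_ac)
  finally show ?thesis .
 qed
 have "(\<Sum>i\<le>l. ?b i * ?b (l - i)) = (-1) ^ l * (x / 2) ^ (2 * l + 2 * n) * real ((2 * n + 2 * l) choose l) / (fact (n + l))^2" for l
 proof -
  have "?b i * ?b (l - i) = (-1) ^ l * (x / 2) ^ (2 * l + 2 * n) * (1 / (fact i * fact (i + n) * (fact (l - i) * fact (l - i + n))))" if "i <= l" for i
  proof -
   have "(x / 2) ^ (2 * i + n) * (x / 2) ^ (2 * (l - i) + n) = (x / 2) ^ (2 * l + 2 * n)"
    unfolding power_add[symmetric] using that by (intro arg_cong[where f="%p. (x / 2) ^ p"]) simp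
   moreover have "(-1::real) ^ i * (-1) ^ (l - i) = (-1) ^ l" unfolding power_add[symmetric] using that by simp
   moreover have "?b i * ?b (l - i) = ((-1) ^ i * (-1) ^ (l - i)) * ((x / 2) ^ (2 * i + n) * (x / 2) ^ (2 * (l - i) + n))
    * (1 / (fact i * fact (i + n) * (fact (l - i) * fact (l - i + n))))" by simp
   ultimately show ?thesis by (simp only:)
  qed
  then have "(\<Sum>i\<le>l. ?b i * ?b (l - i)) = (-1) ^ l * (x / 2) ^ (2 * l + 2 * n) * (\<Sum>i\<le>l. 1 / (fact i * fact (i + n) * (fact (l - i) * fact (l - i + n))))"
   by (simp add: sum_distrib_left)
  then show ?thesis unfolding v by simp
 qed
 with Cauchy_product_sums[OF s s] show ?thesis by (simp add: bessel_J_nat_def power2_eq_square)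
qed

text \<open>The kernel is a power series in the squared chord, integrated term by term; the
resulting series is that of \<open>J\<^sub>n (k r)^2\<close>, shifted by \<open>n\<close> because
the lower powers do not reach the frequency \<open>n\<close>.\<close>

lemma jf_fourier:
 assumes ka: "ka = k^2"
 shows "(LINT t:{0..2*pi}|lborel. of_real (jf ka (2 * r^2 * (1 - cos (s - t)))) * cis (of_nat n * t))
  = of_real (2 * pi * (bessel_J_nat n (k * r))^2) * cis (of_nat n * s)"
proof -
 have k0: "ka >= 0" by (simp add: ka)
 let ?u = "%t. 2 - 2 * cos (s - t)"
 let ?g = "%m t. of_real (jcoef ka m * r ^ (2 * m)) * (of_real (?u t ^ m) * cis (of_nat n * t)) :: complex"
 have bound: "norm (indicator {0..2*pi} t *R ?g m t) <= indicator {0..2*pi} t * (\<bar>jcoef ka m\<bar> * (4 * r^2) ^ m)" for m t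
 proof -
  have "\<bar>?u t\<bar> ^ m <= 4 ^ m"
  proof (rule power_mono)
   show "\<bar>?u t\<bar> <= 4" using cos_ge_minus_one[of "s - t"] cos_le_one[of "s - t"] by linarith
  qed simp
  then have "\<bar>jcoef ka m * r ^ (2 * m)\<bar> * \<bar>?u t\<bar> ^ m <= \<bar>jcoef ka m * r ^ (2 * m)\<bar> * 4 ^ m" by (intro mult_left_mono) auto
  moreover have "norm (?g m t) = \<bar>jcoef ka m * r ^ (2 * m)\<bar> * \<bar>?u t\<bar> ^ m"
   by (simp only: norm_mult norm_of_real norm_cis mult_1_right power_abs)
  moreover have "\<bar>jcoef ka m * r ^ (2 * m)\<bar> * 4 ^ m = \<bar>jcoef ka m\<bar> * (4 * r^2) ^ m"
  proof -
   have "\<bar>r ^ (2 * m)\<bar> = (r^2) ^ m" by (simp only: power_mult abs_of_nonneg zero_le_power zero_le_power2)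
   then show ?thesis by (simp only: abs_mult power_mult_distrib mult_ac)
  qed
  ultimately have "norm (?g m t) <= \<bar>jcoef ka m\<bar> * (4 * r^2) ^ m" by (simp only:)
  then show ?thesis by (cases "t \<in> {0..2*pi}") (simp_all only: indicator_simps scaleR_one scaleR_zero_left norm_zero mult_1_left mult_zero_left order_refl not_False_eq_True)
 qed
 have sb: "summable (%m. \<bar>jcoef ka m\<bar> * (4 * r^2) ^ m)"
 proof (rule entire_series_summable[where K="ka / 4"])
  fix m
  have "(ka / 4) ^ m / (fact m)^2 <= (ka / 4) ^ m / fact m"
   using k0 fact_ge_1[of m, where 'a=real] by (intro divide_left_mono) (simp_all add: power2_eq_square)
  then show "\<bar>\<bar>jcoef ka m\<bar>\<bar> <= (ka / 4) ^ m / fact m" using k0 by (simp add: jcoef_def abs_mult power_abs)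
 qed (use k0 in simp)
 have ind: "intble (indicator {0..2*pi} :: real => real)" using emeasure_bounded_finite[of "{0..2*pi}"] by (intro integrable_real_indicator) simp_all
 have gi: "intble (%t. indicator {0..2*pi} t *R ?g m t)" for m
  unfolding set_integrable_def[symmetric] by (intro borel_integrable_atLeastAtMost' continuous_intros)
 have "(%m. LINT t|lborel. indicator {0..2*pi} t *R ?g m t) sums (LINT t|lborel. (\<Sum>m. indicator {0..2*pi} t *R ?g m t))"
 proof (rule sums_integral[OF gi])
  show "AE t in lborel. summable (%m. norm (indicator {0..2*pi} t *R ?g m t))"
  proof (rule AE_I2)
   fix t show "summable (%m. norm (indicator {0..2*pi} t *R ?g m t))"
    by (rule summable_comparison_test'[OF summable_mult[OF sb, of "indicator {0..2*pi} t"], of 0]) (use bound in simp)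
  qed
  show "summable (%m. LINT t|lborel. norm (indicator {0..2*pi} t *R ?g m t))"
  proof (rule summable_comparison_test'[OF summable_mult[OF sb, of "LINT t|lborel. indicator {0..2*pi} t"], of 0])
   fix m
   have "(LINT t|lborel. norm (indicator {0..2*pi} t *R ?g m t)) <= (LINT t|lborel. indicator {0..2*pi} t * (\<bar>jcoef ka m\<bar> * (4 * r^2) ^ m))"
    by (rule integral_mono[OF integrable_norm[OF gi] integrable_mult_left[OF ind] bound])
   also have "... = (LINT t|lborel. indicator {0..2*pi} t) * (\<bar>jcoef ka m\<bar> * (4 * r^2) ^ m)" by (rule integral_mult_left_zero)
   finally show "norm (LINT t|lborel. norm (indicator {0..2*pi} t *R ?g m t)) <= (LINT t|lborel. indicator {0..2*pi} t) * (\<bar>jcoef ka m\<bar> * (4 * r^2) ^ m)"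
    by (simp only: real_norm_def abs_of_nonneg[OF Bintegral_nonneg[OF norm_ge_zero]])
  qed
 qed
 moreover have "(\<Sum>m. indicator {0..2*pi} t *R ?g m t) = indicator {0..2*pi} t *R (of_real (jf ka (2 * r^2 * (1 - cos (s - t)))) * cis (of_nat n * t))" for t
 proof -
  have eq: "2 * r^2 * (1 - cos (s - t)) = r^2 * ?u t" by (simp add: algebra_simps)
  have "(%m. jcoef ka m * (r^2 * ?u t) ^ m) sums jf ka (r^2 * ?u t)"
   using pser_facts(5)[OF summable_jcoef[OF k0]] by (simp add: jf_def)
  then have "(%m. jcoef ka m * r ^ (2 * m) * ?u t ^ m) sums jf ka (2 * r^2 * (1 - cos (s - t)))"
   unfolding eq by (simp only: power_mult_distrib power_mult mult.assoc)
  from sums_scaleR_right[OF sums_mult2[OF sums_of_real[OF this]], of "indicator {0..2*pi} t" "cis (of_nat n * t)"]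
  show ?thesis by (intro sums_unique[symmetric]) (simp add: mult_ac)
 qed
 ultimately have 1: "(%m. LINT t:{0..2*pi}|lborel. ?g m t) sums (LINT t:{0..2*pi}|lborel. of_real (jf ka (2 * r^2 * (1 - cos (s - t)))) * cis (of_nat n * t))"
  by (simp only: set_lebesgue_integral_def)
 let ?a = "%m. jcoef ka m * r ^ (2 * m) * (-1) ^ n * real ((2 * m) choose (m + n))"
 have g: "(LINT t:{0..2*pi}|lborel. ?g m t) = of_real (?a m * (2 * pi)) * cis (of_nat n * s)" for m
  by (simp only: set_integral_mult_right chord_power_fourier) simp
 have "?a sums (bessel_J_nat n (k * r))^2"
 proof (rule sums_iff_shift'[where n=n, THEN iffD1])
  have z: "(\<Sum>i<n. ?a i) = 0" by (intro sum.neutral) (simp add: binomial_eq_0)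
  have "?a (l + n) = (-1) ^ l * (k * r / 2) ^ (2 * l + 2 * n) * real ((2 * n + 2 * l) choose l) / (fact (n + l))^2" for l
  proof -
   have c: "(2 * (l + n)) choose (l + n + n) = (2 * n + 2 * l) choose l"

   proof -
    have e: "2 * (l + n) = 2 * n + 2 * l" "l + n + n = 2 * n + 2 * l - l" by simp_all
    show ?thesis unfolding e by (rule binomial_symmetric[symmetric]) simp
   qed
   have p: "(ka / 4) ^ (l + n) * r ^ (2 * (l + n)) = (k * r / 2) ^ (2 * l + 2 * n)"

   proof -
    have e: "2 * l + 2 * n = 2 * (l + n)" "ka / 4 * r^2 = (k * r / 2)^2" by (simp_all add: ka power2_eq_square)
    show ?thesis unfolding e(1) power_mult power_mult_distrib[symmetric] e(2) ..
   qed
   have m: "(-1::real) ^ (l + n) * (-1) ^ n = (-1) ^ l"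
   proof -
    have "l + n + n = l + 2 * n" by simp
    then show ?thesis by (simp only: power_add[symmetric]) (simp add: power_add power_mult)
   qed
   have "?a (l + n) = ((-1) ^ (l + n) * (-1) ^ n) * ((ka / 4) ^ (l + n) * r ^ (2 * (l + n))) * real ((2 * (l + n)) choose (l + n + n)) / (fact (l + n))^2"
    by (simp add: jcoef_def)
   then show ?thesis unfolding c p m by (simp add: add.commute)
  qed
  then show "(%i. ?a (i + n)) sums ((bessel_J_nat n (k * r))^2 - (\<Sum>i<n. ?a i))"
   using bessel_square_sums[of "k * r" n] z by simp
 qed
 from sums_mult2[OF sums_of_real[OF sums_mult2[OF this, of "2 * pi"]], of "cis (of_nat n * s)"]
 have "(%m. LINT t:{0..2*pi}|lborel. ?g m t) sums (of_real ((bessel_J_nat n (k * r))^2 * (2 * pi)) * cis (of_nat n * s))"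
  unfolding g .
 from sums_unique2[OF 1 this] show ?thesis by (simp add: mult_ac)
qed

section \<open>The trace norm on finite-dimensional families\<close>

lemma has_trace_cong_frontier:
 assumes "has_trace D u f" "!!x. x \<in> frontier D ==> f x = g x"
 shows "has_trace D u g"
proof -
 have "f \<in> borel_measurable (boundary_measure D) \<longleftrightarrow> g \<in> borel_measurable (boundary_measure D)"
  by (rule measurable_cong) (simp add: space_boundary_measure assms(2))
 moreover have "(\<integral>\<^sup>+x. ennreal ((cmod (v x - f x))^2) \<partial>boundary_measure D) = (\<integral>\<^sup>+x. ennreal ((cmod (v x - g x))^2) \<partial>boundary_measure D)" for v
  by (rule nn_integral_cong) (simp add: space_boundary_measure assms(2))
 ultimately show ?thesis using assms(1) unfolding has_trace_def by simp
qed

lemma H_half_norm_cong: "(!!x. x \<in> frontier D ==> f x = g x) ==> H_half_norm D f = H_half_norm D g"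
 unfolding H_half_norm_def by (metis (no_types, lifting) has_trace_cong_frontier)

lemma H_half_norm_bounds:
 assumes "has_trace D u f"
 shows "H_half_norm D f <= H1_norm D u" "0 <= H_half_norm D f"
  "e > 0 ==> \<exists>v. has_trace D v f \<and> H1_norm D v < H_half_norm D f + e"
proof -
 let ?S = "{H1_norm D u | u. has_trace D u f}"
 have bb: "bdd_below ?S" by (rule bdd_belowI[of _ 0]) (auto simp: H1_norm_nonneg)
 have ne: "?S \<noteq> {}" using assms by blast
 show "H_half_norm D f <= H1_norm D u" unfolding H_half_norm_def by (rule cInf_lower[OF _ bb]) (use assms in blast)
 show "0 <= H_half_norm D f" unfolding H_half_norm_def by (rule cInf_greatest[OF ne]) (auto simp: H1_norm_nonneg)
 assume "e > 0"
 then have "Inf ?S < H_half_norm D f + e" by (simp add: H_half_norm_def)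
 from cInf_lessD[OF ne this] show "\<exists>v. has_trace D v f \<and> H1_norm D v < H_half_norm D f + e" by blast
qed

text \<open>A diagonal sequence: the functions \<open>z n\<close> tend to zero in the Sobolev norm,
so their smooth approximations do as well, while their boundary values tend to
\<open>f\<close>.\<close>

lemma has_trace_limit_zero:
 assumes D: "open D" "bounded D" and z: "!!n. has_trace D (z n) f" and lim: "(%n. H1_norm D (z n)) ---> 0"
 shows "has_trace D (%_. 0) f"
proof -
 let ?P = "%n v. C1_on UNIV v \<and> H1_norm D (%x. z n x - v x) < inverse (real (Suc n)) \<and>
   (\<integral>\<^sup>+x. ennreal ((cmod (v x - f x))^2) \<partial>boundary_measure D) < ennreal (inverse (real (Suc n)))"
 have "\<exists>v. C1_on UNIV v \<and> H1_norm D (%x. z n x - v x) < inverse (real (Suc n)) \<and>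
   (\<integral>\<^sup>+x. ennreal ((cmod (v x - f x))^2) \<partial>boundary_measure D) < ennreal (inverse (real (Suc n)))" for n
 proof -
  obtain v where v: "!!m. C1_on UNIV (v m)" "(%m. H1_norm D (%x. z n x - v m x)) ---> 0"
   "(%m. \<integral>\<^sup>+x. ennreal ((cmod (v m x - f x))^2) \<partial>boundary_measure D) ---> 0"
   using z[of n] unfolding has_trace_def by blast
  have e: "0 < inverse (real (Suc n))" "0 < ennreal (inverse (real (Suc n)))" by simp_all
  have "\<forall>\<^sub>F m in sequentially. H1_norm D (%x. z n x - v m x) < inverse (real (Suc n)) \<and>
   (\<integral>\<^sup>+x. ennreal ((cmod (v m x - f x))^2) \<partial>boundary_measure D) < ennreal (inverse (real (Suc n)))"
   by (intro eventually_conj order_tendstoD(2)[OF v(2) e(1)] order_tendstoD(2)[OF v(3) e(2)])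
  then obtain m where "H1_norm D (%x. z n x - v m x) < inverse (real (Suc n)) \<and>
   (\<integral>\<^sup>+x. ennreal ((cmod (v m x - f x))^2) \<partial>boundary_measure D) < ennreal (inverse (real (Suc n)))"
   unfolding eventually_sequentially by blast
  then show ?thesis using v(1) by blast
 qed
 then obtain v where v: "!!n. C1_on UNIV (v n)" "!!n. H1_norm D (%x. z n x - v n x) < inverse (real (Suc n))"
   "!!n. (\<integral>\<^sup>+x. ennreal ((cmod (v n x - f x))^2) \<partial>boundary_measure D) < ennreal (inverse (real (Suc n)))"
  using choice[of ?P] by blast
 have zH: "z n \<in> H1 D" for n using z[of n] by (simp add: has_trace_def)
 have inv: "(%n. inverse (real (Suc n))) ---> 0" by (rule LIMSEQ_inverse_real_of_nat)
 have le: "(H1_norm D (%x. 0 - v n x))^2 <= 2 * (H1_norm D (z n))^2 + 2 * (inverse (real (Suc n)))^2" for n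
 proof -
  have d: "(%x. z n x - v n x) \<in> H1 D"
   using H1_combination[OF D zH[of n] C1_H1[OF D v(1)[of n]], of 1 "-1"] by simp
  have "(H1_norm D (%x. 0 - v n x))^2 <= 2 * (H1_norm D (z n))^2 + 2 * (H1_norm D (%x. z n x - v n x))^2"
   using H1_norm_combination[OF D zH[of n] d, of "-1" 1] by simp
  moreover have "(H1_norm D (%x. z n x - v n x))^2 <= (inverse (real (Suc n)))^2"
   using v(2)[of n] by (intro power_mono H1_norm_nonneg) simp
  ultimately show ?thesis by linarith
 qed
 have "(%n. 2 * (H1_norm D (z n))^2 + 2 * (inverse (real (Suc n)))^2) ---> 2 * 0^2 + 2 * 0^2"
  by (intro tendsto_intros lim inv)
 then have l2: "(%n. 2 * (H1_norm D (z n))^2 + 2 * (inverse (real (Suc n)))^2) ---> 0" by (simp only: zero_power2 mult_zero_right add_0_right)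
 have "(%n. (H1_norm D (%x. 0 - v n x))^2) ---> 0"
  by (rule Lim_null_comparison[OF always_eventually l2]) (simp only: real_norm_def abs_of_nonneg zero_le_power2 le simp_thms)
 from tendsto_real_sqrt[OF this] have 1: "(%n. H1_norm D (%x. 0 - v n x)) ---> 0" by (simp add: H1_norm_nonneg)
 have 2: "(%n. \<integral>\<^sup>+x. ennreal ((cmod (v n x - f x))^2) \<partial>boundary_measure D) ---> 0"
 proof (rule tendsto_sandwich[OF _ _ tendsto_const])
  show "(%n. ennreal (inverse (real (Suc n)))) ---> 0" using tendsto_ennrealI[OF inv] by simp
 qed (use v(3) in \<open>auto intro!: always_eventually less_imp_le\<close>)
 have "(%_. 0) \<in> H1 D"
  by (rule C1_H1[OF D]) (rule C1_onI[OF has_grad_const], rule continuous_on_const)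
 then show ?thesis unfolding has_trace_def using v(1) 1 2 z[of 0] by (auto simp: has_trace_def intro!: exI[of _ v])
qed

lemma H1_sum_bound:
 fixes u :: "'i => real^2 => complex"
 assumes D: "open D" "bounded D" and I: "finite I" "!!i. i \<in> I ==> u i \<in> H1 D"
 shows "\<exists>K\<ge>0. \<forall>c. (%x. \<Sum>i\<in>I. c i * u i x) \<in> H1 D \<and> (H1_norm D (%x. \<Sum>i\<in>I. c i * u i x))^2 <= K * (\<Sum>i\<in>I. (cmod (c i))^2)"
 using I
proof (induction I rule: finite_induct)
 case empty
 have z: "(%_. 0) \<in> H1 D"
  by (rule C1_H1[OF D]) (rule C1_onI[OF has_grad_const], rule continuous_on_const)
 then show ?case using H1_norm_combination[OF D z z, of 0 0] by (intro exI[of _ 0]) simp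
next
 case (insert j I)
 then obtain K where K: "K >= 0" "!!c. (%x. \<Sum>i\<in>I. c i * u i x) \<in> H1 D"
  "!!c. (H1_norm D (%x. \<Sum>i\<in>I. c i * u i x))^2 <= K * (\<Sum>i\<in>I. (cmod (c i))^2)" by auto
 let ?h = "(H1_norm D (u j))^2"
 have uj: "u j \<in> H1 D" by (rule insert.prems) simp
 show ?case
 proof (intro exI[of _ "2 * ?h + 2 * K"] conjI allI)
  show "0 <= 2 * ?h + 2 * K" using K(1) by simp
  fix c
  have e: "(%x. \<Sum>i\<in>insert j I. c i * u i x) = (%x. c j * u j x + 1 * (\<Sum>i\<in>I. c i * u i x))"
   using insert.hyps by simp
  show "(%x. \<Sum>i\<in>insert j I. c i * u i x) \<in> H1 D"
   unfolding e by (rule H1_combination[OF D uj K(2)])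
  let ?s = "\<Sum>i\<in>I. (cmod (c i))^2"
  have s: "?s >= 0" by (simp add: sum_nonneg)
  have "(H1_norm D (%x. \<Sum>i\<in>insert j I. c i * u i x))^2 <= 2 * (cmod (c j))^2 * ?h + 2 * (H1_norm D (%x. \<Sum>i\<in>I. c i * u i x))^2"
   unfolding e using H1_norm_combination[OF D uj K(2), of "c j" 1 c] by simp
  also have "... <= 2 * (cmod (c j))^2 * ?h + 2 * (K * ?s)" using K(3) by simp
  also have "... <= (2 * ?h + 2 * K) * ((cmod (c j))^2 + ?s)"
   using K(1) s by (simp add: algebra_simps add_increasing2)
  finally show "(H1_norm D (%x. \<Sum>i\<in>insert j I. c i * u i x))^2 <= (2 * ?h + 2 * K) * (\<Sum>i\<in>insert j I. (cmod (c i))^2)"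
   using insert.hyps by simp
 qed
qed

lemma finite_positive_bound: "finite I ==> (!!i. i \<in> I ==> f i > 0) ==> \<exists>c>0. \<forall>i\<in>I. c <= (f i :: real)"
proof (induction I rule: finite_induct)
 case (insert j I)
 then obtain c where "c > 0" "\<forall>i\<in>I. c <= f i" by auto
 then show ?case using insert.prems[of j] by (intro exI[of _ "min c (f j)"]) auto
qed (auto intro: exI[of _ 1])

text \<open>Finite-dimensional compactness. If no constant works, normalised coefficients converge
along a subsequence, and the boundary function of the limit is attained by functions of arbitrarily
small norm.\<close>

lemma trace_coercivity:
 fixes u :: "'i => real^2 => complex"
 assumes D: "open D" "bounded D" and I: "finite I" "!!i. i \<in> I ==> has_trace D (u i) (u i)"
  and inj: "!!c. has_trace D (%_. 0) (%x. \<Sum>i\<in>I. of_real (c i) * u i x) ==> (\<Sum>i\<in>I. (c i)^2) = 0"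
 shows "\<exists>c0>0. \<forall>c. c0 * (\<Sum>i\<in>I. (c i)^2) <= (H_half_norm D (%x. \<Sum>i\<in>I. of_real (c i) * u i x))^2"
proof (rule ccontr)
 let ?U = "%c x. \<Sum>i\<in>I. cor (c i) * u i x"
 let ?s = "%c::'i => real. \<Sum>i\<in>I. (c i)^2"
 have uH: "u i \<in> H1 D" if "i \<in> I" for i using I(2)[OF that] by (simp add: has_trace_def)
 obtain K where K: "K >= 0" "!!c. (H1_norm D (?U c))^2 <= K * ?s c"
 proof -
  have "\<exists>K\<ge>0. \<forall>c. (%x. \<Sum>i\<in>I. c i * u i x) \<in> H1 D \<and> (H1_norm D (%x. \<Sum>i\<in>I. c i * u i x))^2 <= K * (\<Sum>i\<in>I. (cmod (c i))^2)"
   by (rule H1_sum_bound[OF D I(1)]) (rule uH)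
  then obtain K where K: "K >= 0" "\<forall>c. (%x. \<Sum>i\<in>I. c i * u i x) \<in> H1 D \<and> (H1_norm D (%x. \<Sum>i\<in>I. c i * u i x))^2 <= K * (\<Sum>i\<in>I. (cmod (c i))^2)" by auto
  have "(H1_norm D (?U c))^2 <= K * ?s c" for c using K(2)[rule_format, of "%i. of_real (c i)"] by simp
  then show ?thesis by (rule that[OF K(1)])
 qed
 have z0: "has_trace D (%_. 0) (%_. 0)"
  by (rule has_trace_C1[OF D]) (rule C1_onI[OF has_grad_const], rule continuous_on_const, rule refl)
 have tr: "has_trace D (?U c) (?U c)" for c
  using I
 proof (induction I rule: finite_induct)
  case (insert j I)
  then have "has_trace D (%x. of_real (c j) * u j x + 1 * (\<Sum>i\<in>I. of_real (c i) * u i x)) (%x. of_real (c j) * u j x + 1 * (\<Sum>i\<in>I. of_real (c i) * u i x))"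
   by (intro has_trace_combination[OF D]) auto
  then show ?case using insert.hyps by simp
 qed (simp add: z0)
 assume neg: "\<not> ?thesis"
 have "\<forall>n. \<exists>c. (H_half_norm D (?U c))^2 < inverse (real (Suc n)) * ?s c"
 proof
  fix n
  have "inverse (real (Suc n)) > 0" by simp
  with neg have "\<not> (\<forall>c. inverse (real (Suc n)) * ?s c <= (H_half_norm D (?U c))^2)" by blast
  then show "\<exists>c. (H_half_norm D (?U c))^2 < inverse (real (Suc n)) * ?s c" by (simp only: not_all not_le)
 qed
 from choice[OF this] obtain a where a: "(H_half_norm D (?U (a n)))^2 < inverse (real (Suc n)) * ?s (a n)" for n by (elim exE) blast
 have sp: "?s (a n) > 0" for n
 proof -
  have "0 < inverse (real (Suc n)) * ?s (a n)" using a[of n] by (meson le_less_trans zero_le_power2)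
  then show ?thesis by (simp add: zero_less_mult_iff)
 qed
 define b where "b n i = a n i / sqrt (?s (a n))" for n i
 have sb: "?s (b n) = 1" for n
  using sp[of n] by (simp add: b_def power_divide sum_divide_distrib[symmetric])
 have "\<forall>n. \<exists>v. has_trace D v (?U (b n)) \<and> (H1_norm D v)^2 <= 2 * inverse (real (Suc n))"
 proof
  fix n
  let ?q = "sqrt (?s (a n))"
  have q: "?q > 0" "?q^2 = ?s (a n)" using sp[of n] by simp_all
  have "H_half_norm D (?U (a n)) < sqrt (inverse (real (Suc n)) * ?s (a n))"
   by (rule real_less_rsqrt[OF a])
  then obtain v where v: "has_trace D v (?U (a n))" "H1_norm D v < sqrt (inverse (real (Suc n)) * ?s (a n))"
   using H_half_norm_bounds(3)[OF tr[of "a n"], of "sqrt (inverse (real (Suc n)) * ?s (a n)) - H_half_norm D (?U (a n))"] by auto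
  have vH: "v \<in> H1 D" using v(1) by (simp add: has_trace_def)
  have "(H1_norm D v)^2 <= (sqrt (inverse (real (Suc n)) * ?s (a n)))^2" using v(2) by (intro power_mono H1_norm_nonneg) simp
  also have "... = inverse (real (Suc n)) * ?s (a n)" using sp[of n] by (intro real_sqrt_pow2 mult_nonneg_nonneg) simp_all
  finally have v2: "(H1_norm D v)^2 <= inverse (real (Suc n)) * ?s (a n)" .
  let ?w = "%x. of_real (1 / ?q) * v x + 0 * v x"
  have "has_trace D ?w (%x. of_real (1 / ?q) * ?U (a n) x + 0 * ?U (a n) x)"
   by (rule has_trace_combination[OF D v(1) v(1)])
  moreover have "of_real (1 / ?q) * ?U (a n) x + 0 * ?U (a n) x = ?U (b n) x" for x
   by (simp add: b_def sum_distrib_left sum_divide_distrib mult_ac)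
  ultimately have t: "has_trace D ?w (?U (b n))" by simp
  have c: "(cmod (of_real (1 / ?q)))^2 = 1 / ?s (a n)" unfolding norm_of_real using q by (simp add: power_divide)
  have "(H1_norm D ?w)^2 <= 2 * (1 / ?s (a n)) * (H1_norm D v)^2"
   using H1_norm_combination[OF D vH vH, of "of_real (1 / ?q)" 0] unfolding c by simp
  also have "... <= 2 * (1 / ?s (a n)) * (inverse (real (Suc n)) * ?s (a n))"
   using sp[of n] by (intro mult_left_mono v2) simp
  also have "... = 2 * inverse (real (Suc n))" using sp[of n] by simp
  finally show "\<exists>v. has_trace D v (?U (b n)) \<and> (H1_norm D v)^2 <= 2 * inverse (real (Suc n))" using t by blast
 qed
 from choice[OF this] obtain v where v: "has_trace D (v n) (?U (b n))" "(H1_norm D (v n))^2 <= 2 * inverse (real (Suc n))" for n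
  by (elim exE) blast
 have "bounded (range (%n. b n i))" if "i \<in> I" for i
 proof -
  have "\<bar>b n i\<bar> <= 1" for n
  proof -
   have "(b n i)^2 <= ?s (b n)" using that I(1) by (intro member_le_sum) auto
   then show ?thesis unfolding sb by (simp add: abs_square_le_1)
  qed
  then show ?thesis unfolding bounded_iff by (intro exI[of _ 1]) auto
 qed
 then obtain \<sigma> where \<sigma>: "strict_mono (\<sigma> :: nat => nat)" "\<forall>i\<in>I. convergent (%n. b (\<sigma> n) i)"
  using bounded_family_convergent_subsequence[OF I(1), of "%i n. b n i"] by blast
 define c where "c i = lim (%n. b (\<sigma> n) i)" for i
 have c: "(%n. b (\<sigma> n) i) ---> c i" if "i \<in> I" for i
  using \<sigma>(2) that by (simp add: c_def convergent_LIMSEQ_iff)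
 have "(%n. ?s (b (\<sigma> n))) ---> ?s c" by (intro tendsto_sum tendsto_power c)
 then have sc: "?s c = 1" unfolding sb by (simp add: LIMSEQ_const_iff)
 let ?d = "%n i. c i - b (\<sigma> n) i"
 let ?z = "%n x. 1 * v (\<sigma> n) x + 1 * ?U (?d n) x"
 have zt: "has_trace D (?z n) (?U c)" for n
 proof -
  have "has_trace D (?z n) (%x. 1 * ?U (b (\<sigma> n)) x + 1 * ?U (?d n) x)"
   by (rule has_trace_combination[OF D v(1) tr])
  moreover have "1 * ?U (b (\<sigma> n)) x + 1 * ?U (?d n) x = ?U c x" for x
   by (simp add: left_diff_distrib sum_subtractf)
  ultimately show ?thesis by simp
 qed
 have le: "(H1_norm D (?z n))^2 <= 4 * inverse (real (Suc (\<sigma> n))) + 2 * (K * ?s (?d n))" for n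
 proof -
  have "v (\<sigma> n) \<in> H1 D" "?U (?d n) \<in> H1 D" using v(1)[of "\<sigma> n"] tr[of "?d n"] by (simp_all add: has_trace_def)
  from H1_norm_combination[OF D this, of 1 1] v(2)[of "\<sigma> n"] K(2)[of "?d n"] show ?thesis by simp
 qed
 have "(%n. 4 * inverse (real (Suc (\<sigma> n))) + 2 * (K * ?s (?d n))) ---> 4 * 0 + 2 * (K * (\<Sum>i\<in>I. (c i - c i)^2))"
  using LIMSEQ_subseq_LIMSEQ[OF LIMSEQ_inverse_real_of_nat \<sigma>(1)]
  by (intro tendsto_add tendsto_mult tendsto_const tendsto_sum tendsto_power tendsto_diff c) (simp_all add: o_def)
 then have l2: "(%n. 4 * inverse (real (Suc (\<sigma> n))) + 2 * (K * ?s (?d n))) ---> 0"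
  by (simp only: diff_self zero_power2 sum.neutral_const mult_zero_right add_0_right)
 have "(%n. (H1_norm D (?z n))^2) ---> 0"
  by (rule Lim_null_comparison[OF always_eventually l2]) (simp only: real_norm_def abs_of_nonneg zero_le_power2 le simp_thms)
 from tendsto_real_sqrt[OF this] have "(%n. H1_norm D (?z n)) ---> 0" by (simp add: H1_norm_nonneg)
 from inj[OF has_trace_limit_zero[OF D zt this]] sc show False by simp
qed

section \<open>The imaging function\<close>

text \<open>Even indices are cosines, odd ones sines; index 1 is the zero function \<open>sin
0\<close> and is left out below.\<close>

definition eb :: "nat => real => real" where
 "eb i t = (if even i then cos (real (i div 2) * t) else sin (real (i div 2) * t))"

lemma eb_continuous: "continuous_on S (eb i)"
 by (cases "even i"; simp add: eb_def[abs_def]; intro continuous_intros)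

lemma set_integral_Re_Im:
 assumes "set_integrable M A f"
 shows "(LINT t:A|M. Re (f t)) = Re (LINT t:A|M. f t)" "(LINT t:A|M. Im (f t)) = Im (LINT t:A|M. f t)"
 using integral_Re[OF assms[unfolded set_integrable_def]] integral_Im[OF assms[unfolded set_integrable_def]]
 by (simp_all add: set_lebesgue_integral_def)

lemma integral_trigonometric:
 "(LINT t:{0..2*pi}|lborel. a * cos (of_int p * t) + b * cos (of_int q * t) + (c * sin (of_int p * t) + d * sin (of_int q * t)))
  = a * (if p = 0 then 2 * pi else 0) + b * (if q = 0 then 2 * pi else 0)"
proof -
 have i: "set_integrable lborel {0..2*pi} f" if "cts f" for f :: "real => real"
  using that by (intro borel_integrable_atLeastAtMost') (rule continuous_on_subset, auto)
 have C: "set_integrable lborel {0..2*pi} (%t. cis (of_int p * t))" for p by (intro borel_integrable_atLeastAtMost' continuous_intros)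
 have cs: "(LINT t:{0..2*pi}|lborel. cos (of_int p * t)) = (if p = 0 then 2 * pi else 0)"
  "(LINT t:{0..2*pi}|lborel. sin (of_int p * t)) = 0" for p
  using set_integral_Re_Im[OF C[of p]] by (simp_all add: integral_cis)
 have "(LINT t:{0..2*pi}|lborel. a * cos (of_int p * t) + b * cos (of_int q * t) + (c * sin (of_int p * t) + d * sin (of_int q * t)))
  = (LINT t:{0..2*pi}|lborel. a * cos (of_int p * t)) + (LINT t:{0..2*pi}|lborel. b * cos (of_int q * t))
   + ((LINT t:{0..2*pi}|lborel. c * sin (of_int p * t)) + (LINT t:{0..2*pi}|lborel. d * sin (of_int q * t)))"
  by (subst set_integral_add(2), (intro i continuous_intros)+, subst set_integral_add(2), (intro i continuous_intros)+,
    subst set_integral_add(2), (intro i continuous_intros)+, rule refl)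
 then show ?thesis by (simp only: set_integral_mult_right cs mult_zero_right add_0_right)
qed

lemma eb_orthogonal:
 assumes "i \<noteq> 1" "j \<noteq> 1"
 shows "(LINT t:{0..2*pi}|lborel. eb i t * eb j t) = (if i = j then if i = 0 then 2 * pi else pi else 0)"
proof -
 let ?m = "int (i div 2)" and ?n = "int (j div 2)"
 let ?p = "?m - ?n" and ?q = "?m + ?n"
 have P: "of_int ?p * t = real (i div 2) * t - real (j div 2) * t" "of_int ?q * t = real (i div 2) * t + real (j div 2) * t" for t
  by (simp_all add: algebra_simps)
 have "\<exists>a b c d. (\<forall>t. eb i t * eb j t = a * cos (of_int ?p * t) + b * cos (of_int ?q * t) + (c * sin (of_int ?p * t) + d * sin (of_int ?q * t)))
  \<and> a * (if ?p = 0 then 2 * pi else 0) + b * (if ?q = 0 then 2 * pi else 0) = (if i = j then if i = 0 then 2 * pi else pi else 0)"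
 proof (cases "even i"; cases "even j")
  assume e: "even i" "even j"
  show ?thesis
   by (rule exI[of _ "1/2"], rule exI[of _ "1/2"], rule exI[of _ 0], rule exI[of _ 0])
     (use e assms in \<open>auto simp: eb_def cos_times_cos algebra_simps elim!: evenE\<close>)
 next
  assume e: "even i" "odd j"
  show ?thesis
   by (rule exI[of _ 0], rule exI[of _ 0], rule exI[of _ "-1/2"], rule exI[of _ "1/2"])
     (use e assms in \<open>auto simp: eb_def cos_times_sin field_simps\<close>)
 next
  assume e: "odd i" "even j"
  show ?thesis unfolding P
   by (rule exI[of _ 0], rule exI[of _ 0], rule exI[of _ "1/2"], rule exI[of _ "1/2"])
     (use e assms in \<open>auto simp: eb_def sin_times_cos odd_pos\<close>)
 next
  assume e: "odd i" "odd j"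
  show ?thesis
   by (rule exI[of _ "1/2"], rule exI[of _ "-1/2"], rule exI[of _ 0], rule exI[of _ 0])
     (use e assms in \<open>auto simp: eb_def sin_times_sin field_simps elim!: oddE\<close>)
 qed
 then obtain a b c d where *: "!!t. eb i t * eb j t = a * cos (of_int ?p * t) + b * cos (of_int ?q * t) + (c * sin (of_int ?p * t) + d * sin (of_int ?q * t))"
  "a * (if ?p = 0 then 2 * pi else 0) + b * (if ?q = 0 then 2 * pi else 0) = (if i = j then if i = 0 then 2 * pi else pi else 0)"
  by blast
 show ?thesis unfolding *(1) integral_trigonometric by (rule *(2))
qed

lemma jf_fourier_real:
 "(LINT t:{0..2*pi}|lborel. jf (k^2) (2 * r^2 * (1 - cos (s - t))) * eb i t) = 2 * pi * (bessel_J_nat (i div 2) (k * r))^2 * eb i s"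
proof -
 let ?f = "%t. cor (jf (k^2) (2 * r^2 * (1 - cos (s - t)))) * cis (of_nat (i div 2) * t)"
 have j: "continuous_on S (%t. jf (k^2) (2 * r^2 * (1 - cos (s - t))))" for S
  by (rule continuous_on_compose2[OF jf_continuous]) (auto intro!: continuous_intros)
 have "set_integrable lborel {0..2*pi} ?f"
  by (intro borel_integrable_atLeastAtMost' continuous_intros j)
 note R = set_integral_Re_Im[OF this, unfolded jf_fourier[OF refl]]
 show ?thesis
 proof (cases "even i")
  case True then show ?thesis using R(1) by (simp add: eb_def)
 next
  case False then show ?thesis using R(2) by (simp add: eb_def)
 qed
qed

lemma set_integral_lincomb:
 fixes g :: "'a => complex"
 assumes "finite I" "!!i. i \<in> I ==> set_integrable M A (%t. g t * e i t)"
 shows "(LINT t:A|M. g t * (\<Sum>i\<in>I. c i * e i t)) = (\<Sum>i\<in>I. c i * (LINT t:A|M. g t * e i t))"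
proof -
 have "(LINT t:A|M. g t * (\<Sum>i\<in>I. c i * e i t)) = (LINT t|M. (\<Sum>i\<in>I. c i * (indicator A t *R (g t * e i t))))"
  unfolding set_lebesgue_integral_def by (simp add: sum_distrib_left scaleR_sum_right mult_ac)
 also have "... = (\<Sum>i\<in>I. LINT t|M. c i * (indicator A t *R (g t * e i t)))"
  by (intro Bintegral_sum integrable_mult_right assms(2)[unfolded set_integrable_def])
 finally show ?thesis unfolding set_lebesgue_integral_def by (simp only: integral_mult_right_zero)
qed

context near_field
begin

text \<open>The density with real coefficients \<open>a\<close>; the factor \<open>- \<i>\<close> is
the one in \<open>\<psi>\<^sub>z\<close>.\<close>

definition wv :: "nat set => (nat => real) => real => complex" where
 "wv I a t = (\<Sum>i\<in>I. of_real (a i) * (- \<i> * of_real (eb i t)))"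

definition qf2 :: "nat => nat => complex" where
 "qf2 i j = (LINT s:{0..2*pi}|lborel. Ne (%t. - \<i> * of_real (eb i t)) s * cnj (- \<i> * of_real (eb j s)))"

lemma basis_continuous: "continuous_on S (%t. - \<i> * cor (eb i t))"
 by (intro continuous_intros eb_continuous)

lemma wv_continuous: "continuous_on S (wv I a)"
 unfolding wv_def[abs_def] by (intro continuous_intros eb_continuous)

lemma Fe_wv:
 assumes "finite I"
 shows "Fe (wv I a) x = (\<Sum>i\<in>I. of_real (a i) * Fe (%t. - \<i> * of_real (eb i t)) x)"
proof -
 have "(LINT t:{0..2*pi}|lborel. ph t x * wv I a t) = (\<Sum>i\<in>I. of_real (a i) * (LINT t:{0..2*pi}|lborel. ph t x * (- \<i> * of_real (eb i t))))"
  unfolding wv_def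
  by (intro set_integral_lincomb[OF assms] borel_integrable_atLeastAtMost' continuous_on_mult basis_continuous parameter_integral_eq(3)[OF jointly_continuous(1)])
 then show ?thesis unfolding Fe_def by (simp only: sum_distrib_left mult.left_commute)
qed

lemma Ne_wv:
 assumes "finite I"
 shows "Ne (wv I a) s = (\<Sum>i\<in>I. of_real (a i) * Ne (%t. - \<i> * of_real (eb i t)) s)"
proof -
 have "(LINT t:{0..2*pi}|lborel. us (cp s) (cp t) * wv I a t) = (\<Sum>i\<in>I. of_real (a i) * (LINT t:{0..2*pi}|lborel. us (cp s) (cp t) * (- \<i> * of_real (eb i t))))"
  unfolding wv_def by (intro set_integral_lincomb[OF assms] near_field_value(2) basis_continuous)
 then show ?thesis unfolding Ne_def by (simp only: sum_distrib_left mult.left_commute)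
qed

lemma quadratic_form:
 assumes I: "finite I"
 shows "(LINT s:{0..2*pi}|lborel. Ne (wv I a) s * cnj (wv I a s)) = (\<Sum>j\<in>I. of_real (a j) * (\<Sum>i\<in>I. of_real (a i) * qf2 i j))"
proof -
 let ?b = "%i t. - \<i> * cor (eb i t)"
 have c: "continuous_on {0..2*pi} (%s. cnj (?b j s))" for j by (intro continuous_intros eb_continuous)
 have cw: "cnj (wv I a s) = (\<Sum>j\<in>I. of_real (a j) * cnj (?b j s))" for s by (simp add: wv_def)
 have 1: "(LINT s:{0..2*pi}|lborel. Ne (wv I a) s * cnj (wv I a s)) = (\<Sum>j\<in>I. of_real (a j) * (LINT s:{0..2*pi}|lborel. Ne (wv I a) s * cnj (?b j s)))"
  unfolding cw by (intro set_integral_lincomb[OF I] borel_integrable_atLeastAtMost' continuous_on_mult c near_field_continuous wv_continuous)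
 have 2: "(LINT s:{0..2*pi}|lborel. Ne (wv I a) s * cnj (?b j s)) = (\<Sum>i\<in>I. of_real (a i) * qf2 i j)" for j
 proof -
  have "(LINT s:{0..2*pi}|lborel. cnj (?b j s) * (\<Sum>i\<in>I. of_real (a i) * Ne (?b i) s)) = (\<Sum>i\<in>I. of_real (a i) * (LINT s:{0..2*pi}|lborel. cnj (?b j s) * Ne (?b i) s))"
   by (intro set_integral_lincomb[OF I] borel_integrable_atLeastAtMost' continuous_on_mult c near_field_continuous basis_continuous)
  then show ?thesis unfolding Ne_wv[OF I] qf2_def by (simp only: mult.commute)
 qed
 show ?thesis unfolding 1 2 ..
qed

lemma Im_qf2:
 assumes "i \<noteq> 1" "j \<noteq> 1"
 shows "Im (qf2 i j) = (if i = j then - (r * pi / 2 * (bessel_J_nat (i div 2) (k * r))^2 * (if i = 0 then 2 * pi else pi)) else 0)"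
proof -
 let ?b = "%i t. - \<i> * cor (eb i t)" and ?J = "(bessel_J_nat (i div 2) (k * r))^2"
 have N: "Im (Ne (?b i) s * cnj (?b j s)) = - (r * pi / 2 * ?J) * (eb i s * eb j s)" for s
 proof -
  let ?E = "%t. cor (eb i t)"
  have cE: "cts ?E" by (intro continuous_intros eb_continuous)
  have "(LINT t:{0..2*pi}|lborel. Im (us (cp s) (cp t) * ?E t)) = (LINT t:{0..2*pi}|lborel. (- 1/4) * (jf (k^2) (2 * r^2 * (1 - cos (s - t))) * eb i t))"
   by (simp add: near_field_imaginary_part)
  also have "... = (- 1/4) * (2 * pi * ?J * eb i s)" by (simp only: set_integral_mult_right jf_fourier_real)
  finally have "Im (LINT t:{0..2*pi}|lborel. us (cp s) (cp t) * ?E t) = - (pi / 2 * ?J * eb i s)"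
   unfolding set_integral_Re_Im(2)[OF near_field_value(2)[OF cE]] by simp
  then have IE: "Im (Ne ?E s) = - (r * pi / 2 * ?J * eb i s)" by (simp add: Ne_def)
  have "(LINT t:{0..2*pi}|lborel. us (cp s) (cp t) * ?b i t) = (LINT t:{0..2*pi}|lborel. - \<i> * (us (cp s) (cp t) * ?E t))"
   by (simp only: mult.left_commute)
  then have "Ne (?b i) s = - \<i> * Ne ?E s" unfolding Ne_def by (simp only: set_integral_mult_right mult.left_commute)
  moreover have "(- \<i> * w) * cnj (- \<i> * cor y) = w * of_real y" for w y by (simp add: complex_eq_iff)
  ultimately have e: "Ne (?b i) s * cnj (?b j s) = Ne ?E s * of_real (eb j s)" by (simp only:)
  show ?thesis unfolding e using IE by simp
 qed
 have "set_integrable lborel {0..2*pi} (%s. Ne (?b i) s * cnj (?b j s))"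
  by (intro borel_integrable_atLeastAtMost' continuous_on_mult near_field_continuous basis_continuous continuous_intros eb_continuous)
 from set_integral_Re_Im(2)[OF this]
 have "Im (qf2 i j) = (LINT s:{0..2*pi}|lborel. - (r * pi / 2 * ?J) * (eb i s * eb j s))" unfolding qf2_def N by simp
 also have "... = - (r * pi / 2 * ?J) * (if i = j then if i = 0 then 2 * pi else pi else 0)"
  by (simp only: set_integral_mult_right eb_orthogonal[OF assms])
 finally show ?thesis by simp
qed

text \<open>The lower bound for the form comes from its imaginary part, which is diagonal; it also
provides the injectivity that \<open>trace_coercivity\<close> needs.\<close>

lemma imaging_bounds:
 assumes I: "finite I" "\<forall>i\<in>I. i \<noteq> 1 \<and> bessel_J_nat (i div 2) (k * r) \<noteq> 0"
 shows "\<exists>c1 c2. c1 > 0 \<and> c2 > 0 \<and> (\<forall>a \<psi>. (\<forall>t. \<psi> (cp t) = wv I a t) -->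
  c1 * (H_half_norm D (single_layer_op k r \<psi>))^2 <= cmod (circle_inner r (near_field_op r us \<psi>) \<psi>) \<and>
  cmod (circle_inner r (near_field_op r us \<psi>) \<psi>) <= c2 * (H_half_norm D (single_layer_op k r \<psi>))^2)"
proof -
 let ?s = "%a. \<Sum>i\<in>I. (a i)^2"
 let ?u = "%i. Fe (%t. - \<i> * of_real (eb i t))"
 let ?Q = "%a. of_real r * (\<Sum>j\<in>I. of_real (a j) * (\<Sum>i\<in>I. of_real (a i) * qf2 i j))"
 let ?H = "%a. H_half_norm D (%x. \<Sum>i\<in>I. cor (a i) * ?u i x)"
 define J where "J i = r * (r * pi / 2 * (bessel_J_nat (i div 2) (k * r))^2 * (if i = 0 then 2 * pi else pi))" for i
 have Jp: "J i > 0" if "i \<in> I" for i using I(2)[rule_format, OF that] r(1) by (simp add: J_def)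
 have "\<exists>c0>0. \<forall>i\<in>I. c0 <= J i" by (rule finite_positive_bound[OF I(1)]) (rule Jp)
 then obtain c0 where c0: "c0 > 0" "\<forall>i\<in>I. c0 <= J i" by blast
 have lower: "c0 * ?s a <= cmod (?Q a)" for a
 proof -
  have "Im (?Q a) = r * (\<Sum>j\<in>I. a j * (\<Sum>i\<in>I. a i * Im (qf2 i j)))" by simp
  also have "... = r * (\<Sum>j\<in>I. a j * (\<Sum>i\<in>I. if i = j then a i * - (r * pi / 2 * (bessel_J_nat (i div 2) (k * r))^2 * (if i = 0 then 2 * pi else pi)) else 0))"
   using I(2) by (intro arg_cong2[where f="(*)"] refl sum.cong) (simp add: Im_qf2)
  also have "... = - (\<Sum>j\<in>I. (a j)^2 * J j)"
   using I(1) by (simp add: sum.delta J_def sum_distrib_left sum_negf[symmetric] power2_eq_square mult_ac)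
  finally have "Im (?Q a) = - (\<Sum>j\<in>I. (a j)^2 * J j)" .
  moreover have "c0 * ?s a <= (\<Sum>j\<in>I. (a j)^2 * J j)"
   unfolding sum_distrib_left by (intro sum_mono) (use c0(2) in \<open>auto simp: mult.commute[of c0] intro!: mult_left_mono\<close>)
  ultimately show ?thesis using abs_Im_le_cmod[of "?Q a"] by linarith
 qed
 define C where "C = r * (\<Sum>j\<in>I. \<Sum>i\<in>I. cmod (qf2 i j)) + 1"
 have C: "C > 0" unfolding C_def using r(1) by (intro add_nonneg_pos mult_nonneg_nonneg sum_nonneg) simp_all
 have upper: "cmod (?Q a) <= C * ?s a" for a
 proof -
  have s0: "?s a >= 0" by (simp add: sum_nonneg)
  have aa: "\<bar>a j\<bar> * \<bar>a i\<bar> <= ?s a" if "i \<in> I" "j \<in> I" for i j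
  proof -
   have "\<bar>a i\<bar> <= sqrt (?s a)" "\<bar>a j\<bar> <= sqrt (?s a)"
    using that I(1) by (auto intro!: real_le_rsqrt member_le_sum)
   then have "\<bar>a j\<bar> * \<bar>a i\<bar> <= sqrt (?s a) * sqrt (?s a)" by (intro mult_mono) (use s0 in auto)
   then show ?thesis using s0 by simp
  qed
  have "cmod (\<Sum>j\<in>I. of_real (a j) * (\<Sum>i\<in>I. of_real (a i) * qf2 i j)) <= (\<Sum>j\<in>I. \<Sum>i\<in>I. \<bar>a j\<bar> * \<bar>a i\<bar> * cmod (qf2 i j))"
   unfolding sum_distrib_left by (intro order_trans[OF norm_sum] sum_mono) (simp add: norm_mult)
  also have "... <= (\<Sum>j\<in>I. \<Sum>i\<in>I. ?s a * cmod (qf2 i j))" by (intro sum_mono mult_right_mono aa) simp_all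
  also have "... = ?s a * (\<Sum>j\<in>I. \<Sum>i\<in>I. cmod (qf2 i j))" by (simp only: sum_distrib_left)
  finally have "cmod (?Q a) <= r * (?s a * (\<Sum>j\<in>I. \<Sum>i\<in>I. cmod (qf2 i j)))" using r(1) by (simp add: norm_mult)
  also have "... <= C * ?s a" using s0 by (simp add: C_def algebra_simps)
  finally show ?thesis .
 qed
 have Q: "circle_inner r (near_field_op r us \<psi>) \<psi> = ?Q a" if "\<forall>t. \<psi> (cp t) = wv I a t" for a \<psi>
 proof -
  have "near_field_op r us \<psi> (cp s) = Ne (wv I a) s" for s
   using that by (simp add: near_field_op_def circle_integral_def Ne_def flip: cp_def)
  then have "circle_inner r (near_field_op r us \<psi>) \<psi> = of_real r * (LINT s:{0..2*pi}|lborel. Ne (wv I a) s * cnj (wv I a s))"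
   using that by (simp add: circle_inner_def circle_integral_def flip: cp_def)
  then show ?thesis by (simp only: quadratic_form[OF I(1)])
 qed
 have H: "H_half_norm D (single_layer_op k r \<psi>) = ?H a" if "\<forall>t. \<psi> (cp t) = wv I a t" for a \<psi>
 proof (rule H_half_norm_cong)
  fix x assume "x \<in> frontier D"
  then have "single_layer_op k r \<psi> x = Fe (wv I a) x" using that by (simp add: Fe_frontier)
  then show "single_layer_op k r \<psi> x = (\<Sum>i\<in>I. cor (a i) * ?u i x)" by (simp only: Fe_wv[OF I(1)])
 qed
 have tr: "has_trace D (?u i) (?u i)" for i by (rule Fe_trace[OF basis_continuous])
 have "\<exists>c>0. \<forall>a. c * ?s a <= (?H a)^2"
 proof (rule trace_coercivity[OF open_D bounded_D I(1) tr])
  fix a assume t0: "has_trace D (%_. 0) (%x. \<Sum>i\<in>I. of_real (a i) * ?u i x)"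
  moreover have "Fe (wv I a) = (%x. \<Sum>i\<in>I. of_real (a i) * ?u i x)" by (rule ext) (simp only: Fe_wv[OF I(1)])
  ultimately have "has_trace D (%_. 0) (Fe (wv I a))" by (simp only:)
  then have "Ne (wv I a) s = 0" for s by (rule near_field_vanishes[OF wv_continuous])
  then have "?Q a = 0" unfolding quadratic_form[OF I(1), symmetric] by simp
  then have "c0 * ?s a <= 0" using lower[of a] by (simp only: norm_zero)
  moreover have "?s a >= 0" by (simp add: sum_nonneg)
  ultimately show "?s a = 0" using c0(1) by (simp add: mult_le_0_iff)
 qed
 then obtain c where c: "c > 0" "!!a. c * ?s a <= (?H a)^2" by blast
 have "\<exists>K\<ge>0. \<forall>c. (%x. \<Sum>i\<in>I. c i * ?u i x) \<in> H1 D \<and> (H1_norm D (%x. \<Sum>i\<in>I. c i * ?u i x))^2 <= K * (\<Sum>i\<in>I. (cmod (c i))^2)"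
  by (rule H1_sum_bound[OF open_D bounded_D I(1)]) (use tr in \<open>simp add: has_trace_def\<close>)
 then obtain K where K: "K >= 0" "!!c. (H1_norm D (%x. \<Sum>i\<in>I. c i * ?u i x))^2 <= K * (\<Sum>i\<in>I. (cmod (c i))^2)" by blast
 have Hle: "(?H a)^2 <= (K + 1) * ?s a" for a
 proof -
  have e: "(%x. \<Sum>i\<in>I. cor (a i) * ?u i x) = Fe (wv I a)" by (rule ext) (simp only: Fe_wv[OF I(1)])
  have t: "has_trace D (Fe (wv I a)) (Fe (wv I a))" by (rule Fe_trace[OF wv_continuous])
  have "(?H a)^2 <= (H1_norm D (Fe (wv I a)))^2" unfolding e by (intro power_mono H_half_norm_bounds(1,2)[OF t])
  also have "... <= K * ?s a" using K(2)[of "%i. of_real (a i)"] unfolding e by simp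
  also have "... <= (K + 1) * ?s a" by (intro mult_right_mono sum_nonneg) simp_all
  finally show ?thesis .
 qed
 show ?thesis
 proof (rule exI[of _ "c0 / (K + 1)"], rule exI[of _ "C / c"], intro conjI allI impI)
  show "c0 / (K + 1) > 0" "C / c > 0" using c0 K(1) C c(1) by simp_all
  fix a \<psi> assume w: "\<forall>t. \<psi> (cp t) = wv I a t"
  have "c0 / (K + 1) * (?H a)^2 <= c0 / (K + 1) * ((K + 1) * ?s a)" using c0(1) K(1) by (intro mult_left_mono Hle) simp_all
  also have "... = c0 * ?s a" using K(1) by simp
  finally show "c0 / (K + 1) * (H_half_norm D (single_layer_op k r \<psi>))^2 <= cmod (circle_inner r (near_field_op r us \<psi>) \<psi>)"
   unfolding H[OF w] Q[OF w] using lower[of a] by linarith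
  have "C * ?s a = C / c * (c * ?s a)" using c(1) by simp
  also have "... <= C / c * (?H a)^2" using C c(1) by (intro mult_left_mono c(2)) simp
  finally show "cmod (circle_inner r (near_field_op r us \<psi>) \<psi>) <= C / c * (H_half_norm D (single_layer_op k r \<psi>))^2"
   unfolding H[OF w] Q[OF w] using upper[of a] by linarith
 qed
qed

end

lemma cos_multiple_cong:
 fixes x y :: real
 assumes "cos x = cos y"
 shows "cos (of_int n * x) = cos (of_int n * y)"
proof -
 have "cos (real m * x) = cos (real m * y) \<and> cos (real (Suc m) * x) = cos (real (Suc m) * y)" for m
 proof (induction m)
  case (Suc m)
  have "cos (real (Suc (Suc m)) * z) = 2 * cos z * cos (real (Suc m) * z) - cos (real m * z)" for z
   using cos_add[of "real (Suc m) * z" z] cos_diff[of "real (Suc m) * z" z] by (simp add: algebra_simps)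
  then show ?case using Suc assms by simp
 qed (use assms in simp)
 from this[of "nat \<bar>n\<bar>"] have "cos (real_of_int \<bar>n\<bar> * x) = cos (real_of_int \<bar>n\<bar> * y)" by simp
 then show ?thesis by (cases "n >= 0") simp_all
qed

lemma bessel_nat_at_0: "n \<noteq> 0 ==> bessel_J_nat n 0 = 0"
 by (simp add: bessel_J_nat_def power_0_left)

lemma sum_split_parity:
 fixes f :: "nat => complex"
 shows "(\<Sum>i<2 * n. f i) = (\<Sum>m<n. f (2 * m) + f (2 * m + 1))"
 by (induction n) (simp_all add: add.assoc)

lemma sum_symmetric:
 fixes f :: "int => complex"
 assumes "!!n. f (- n) = f n"
 shows "(\<Sum>n = - int M..int M. f n) = (\<Sum>n<Suc M. (if n = 0 then 1 else 2) * f (int n))"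
proof (induction M)
 case (Suc M)
 have "{- int (Suc M)..int (Suc M)} = insert (int (Suc M)) (insert (- int (Suc M)) {- int M..int M})" by auto
 then have "(\<Sum>n = - int (Suc M)..int (Suc M). f n) = f (int (Suc M)) + (f (- int (Suc M)) + (\<Sum>n = - int M..int M. f n))" by simp
 then show ?case using Suc assms[of "int (Suc M)"] by simp
qed simp

context near_field
begin

text \<open>The terms for \<open>n\<close> and \<open>- n\<close> agree, as the sign of
\<open>J\<^bsub>- n\<^esub>\<close> cancels in the quotient. For \<open>z = 0\<close> the angle has
no meaning, but there only \<open>n = 0\<close> contributes.\<close>

lemma psi_expansion:
 "\<exists>a. \<forall>t. psi_fun k M z (cp t) = wv {i. i < 2 * Suc M \<and> i \<noteq> 1 \<and> bessel_J_nat (i div 2) (k * r) \<noteq> 0} a t"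
proof -
 obtain \<alpha> where \<alpha>: "!!t. z \<bullet> cp t = norm z * r * cos (t - \<alpha>)"
 proof (cases "z = 0")
  case False
  then have nz: "(norm z)^2 \<noteq> 0" by simp
  have "(norm z)^2 = (z $ 1)^2 + (z $ 2)^2"
   unfolding power2_norm_eq_inner by (simp add: inner_vec_def UNIV_2 power2_eq_square)
  then have "(z $ 1 / norm z)^2 + (z $ 2 / norm z)^2 = 1" using nz by (simp add: power_divide add_divide_distrib[symmetric])
  then obtain \<alpha> where "z $ 1 / norm z = cos \<alpha>" "z $ 2 / norm z = sin \<alpha>" using sincos_total_2pi by metis
  then have "z $ 1 = norm z * cos \<alpha>" "z $ 2 = norm z * sin \<alpha>" using False by (simp_all add: field_simps)
  then show ?thesis by (intro that[of \<alpha>]) (simp add: inner_vec_def UNIV_2 cp_nth cos_diff algebra_simps)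
 qed (use that in simp)
 define \<beta> where "\<beta> n = (if n = 0 then 2 else 8) / (r * pi) * (bessel_J_nat n (k * norm z) / bessel_J_nat n (k * r))" for n
 define a where "a i = \<beta> (i div 2) * eb i \<alpha>" for i
 let ?I = "{i. i < 2 * Suc M \<and> i \<noteq> 1 \<and> bessel_J_nat (i div 2) (k * r) \<noteq> 0}"
 have angle: "bessel_J_nat n (k * norm z) * cos (of_nat n * angle_between (cp t) z) = bessel_J_nat n (k * norm z) * cos (of_nat n * (t - \<alpha>))" for n t
 proof (cases "z = 0")
  case True then show ?thesis using bessel_nat_at_0[of n] by (cases "n = 0") simp_all
 next
  case False
  have "angle_between (cp t) z = arccos (cos (t - \<alpha>))"
   unfolding angle_between_def inner_commute[of "cp t"] \<alpha> norm_cp using False r(1) by simp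
  then have "cos (angle_between (cp t) z) = cos (t - \<alpha>)" by (simp add: cos_arccos_abs)
  from cos_multiple_cong[OF this, of "int n"] show ?thesis by simp
 qed
 have "psi_fun k M z (cp t) = wv ?I a t" for t
 proof -
  let ?T = "%n::int. 4 / (\<i> * of_real r * of_real pi * (1 + (if n = 0 then 1 else 0)))
    * of_real (bessel_J n (k * norm z) / bessel_J n (k * r)) * cor (cos (of_int n * angle_between (cp t) z))"
  have sym: "?T (- n) = ?T n" for n
  proof -
   have "bessel_J (- n) x / bessel_J (- n) y = bessel_J n x / bessel_J n y" for x y
    by (cases "n = 0"; cases "n > 0") (simp_all add: bessel_J_def)
   then show ?thesis by simp
  qed
  have "psi_fun k M z (cp t) = (\<Sum>n = - int M..int M. ?T n)" unfolding psi_fun_def norm_cp ..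
  also have "... = (\<Sum>n<Suc M. (if n = 0 then 1 else 2) * ?T (int n))" by (rule sum_symmetric) (rule sym)
  also have "... = (\<Sum>n<Suc M. - \<i> * of_real (\<beta> n * cos (of_nat n * (t - \<alpha>))))"
  proof (rule sum.cong[OF refl])
   fix n
   have "(if n = 0 then 1 else 2) * (4 / (\<i> * of_real r * of_real pi * (1 + (if int n = 0 then 1 else 0)))) = - \<i> * cor ((if n = 0 then 2 else 8) / (r * pi))"
    using r(1) by (simp add: field_simps)
   then have "(if n = 0 then 1 else 2) * ?T (int n) = - \<i> * of_real ((if n = 0 then 2 else 8) / (r * pi)) * of_real (bessel_J_nat n (k * norm z) / bessel_J_nat n (k * r)) * of_real (cos (of_nat n * angle_between (cp t) z))"
    by (simp only: mult.assoc[symmetric]) (simp add: bessel_J_def)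
   also have "... = - \<i> * of_real ((if n = 0 then 2 else 8) / (r * pi) * ((bessel_J_nat n (k * norm z) * cos (of_nat n * angle_between (cp t) z)) / bessel_J_nat n (k * r)))"
    by simp
   also have "... = - \<i> * of_real (\<beta> n * cos (of_nat n * (t - \<alpha>)))"
    unfolding angle by (simp add: \<beta>_def)
   finally show "(if n = 0 then 1 else 2) * ?T (int n) = - \<i> * of_real (\<beta> n * cos (of_nat n * (t - \<alpha>)))" .
  qed
  also have "... = (\<Sum>i<2 * Suc M. of_real (a i) * (- \<i> * of_real (eb i t)))"
   unfolding sum_split_parity by (intro sum.cong refl) (simp add: a_def eb_def right_diff_distrib cos_diff algebra_simps)
  also have "... = wv ?I a t" unfolding wv_def
  proof (rule sum.mono_neutral_right)
   show "\<forall>i\<in>{..<2 * Suc M} - ?I. of_real (a i) * (- \<i> * of_real (eb i t)) = 0" by (auto simp: a_def \<beta>_def eb_def)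
  qed auto
  finally show ?thesis .
 qed
 then show ?thesis by blast
qed

end

theorem theorem4p2:
  fixes k r :: real and M :: nat and D :: "(real^2) set"
    and us :: "real^2 \<Rightarrow> real^2 \<Rightarrow> complex"
  assumes "k > 0" and "r > 0" and "M > 0"
    and "open D" and "connected D" and "bounded D" and "lipschitz_boundary D"
    and "cball 0 r \<subseteq> D"
    and "\<not> dirichlet_eigenvalue D (k\<^sup>2)"
    and "\<not> dirichlet_eigenvalue (ball 0 r) (k\<^sup>2)"
    and "\<And>y. y \<in> sphere 0 r \<Longrightarrow> helmholtz_dirichlet D k (\<lambda>x. - fund_sol k x y) (\<lambda>x. us x y)"
  shows "\<exists>c1 c2 :: real. c1 > 0 \<and> c2 > 0 \<and>
     (\<forall>z :: real^2.
        c1 * (H_half_norm D (single_layer_op k r (psi_fun k M z)))\<^sup>2 \<le> I_cavity k r M us z \<and>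
        I_cavity k r M us z \<le> c2 * (H_half_norm D (single_layer_op k r (psi_fun k M z)))\<^sup>2)"
proof -
 obtain e where e: "e > 0" "(\<Union>x\<in>cball 0 r. cball x e) \<subseteq> D"
  using compact_subset_open_imp_cball_epsilon_subset[OF compact_cball assms(4,8)] by blast
 have ring: "cball 0 (r + e) \<subseteq> D"
 proof
  fix x :: "real^2" assume x: "x \<in> cball 0 (r + e)"
  show "x \<in> D"
  proof (cases "norm x <= r")
   case False
   let ?y = "(r / norm x) *R x"
   have "norm (?y - x) = norm x - r"
   proof -
    have "?y - x = - ((1 - r / norm x) *R x)" by (simp add: algebra_simps)
    then have "norm (?y - x) = \<bar>1 - r / norm x\<bar> * norm x" by (simp only: norm_minus_cancel norm_scaleR)
    moreover have "r / norm x < 1" using False assms(2) by (simp add: divide_less_eq)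
    ultimately show ?thesis using False assms(2) by (auto simp: left_diff_distrib)
   qed
   then have "x \<in> cball ?y e" "?y \<in> cball 0 r" using x False assms(2) by (auto simp: dist_norm)
   then show ?thesis using e(2) by blast
  qed (use assms(8) in auto)
 qed
 define r1 where "r1 = r + e / 2"
 have "r1^2 < (r + e)^2" using e(1) assms(2) by (intro power_strict_mono) (simp_all add: r1_def)
 from cutoff_exists[OF this] obtain X X' X'' where X: "!!s. (X has_real_derivative X' s) (at s)" "!!s. (X' has_real_derivative X'' s) (at s)"
  "cts X''" "!!s. s <= r1^2 ==> X s = 0" "!!s. s >= (r + e)^2 ==> X s = (1::real)" by blast
 obtain r0 where r0: "admissible k r0" using admissible_exists by blast
 define \<delta> where "\<delta> = min (r0 / 2) (e / 4)"
 have \<delta>: "0 < \<delta>" "\<delta> < r0" "\<delta> < r1 - r" using r0 e(1) by (auto simp: \<delta>_def r1_def admissible_def min_def)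
 interpret near_field k D r r1 "r + e" r0 \<delta> X X' X'' us
  by unfold_locales (use assms e(1) ring X r0 \<delta> in \<open>auto simp: r1_def\<close>)
 let ?I = "{i. i < 2 * Suc M \<and> i \<noteq> 1 \<and> bessel_J_nat (i div 2) (k * r) \<noteq> 0}"
 have "finite ?I" "\<forall>i\<in>?I. i \<noteq> 1 \<and> bessel_J_nat (i div 2) (k * r) \<noteq> 0" by simp_all
 from imaging_bounds[OF this] obtain c1 c2 where c: "c1 > 0" "c2 > 0" "\<forall>a \<psi>. (\<forall>t. \<psi> (cp t) = wv ?I a t) -->
  c1 * (H_half_norm D (single_layer_op k r \<psi>))^2 <= cmod (circle_inner r (near_field_op r us \<psi>) \<psi>) \<and>
  cmod (circle_inner r (near_field_op r us \<psi>) \<psi>) <= c2 * (H_half_norm D (single_layer_op k r \<psi>))^2"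
  by (elim exE conjE)
 have B: "c1 * (H_half_norm D (single_layer_op k r (psi_fun k M z)))^2 <= I_cavity k r M us z \<and>
  I_cavity k r M us z <= c2 * (H_half_norm D (single_layer_op k r (psi_fun k M z)))^2" for z
 proof -
  from psi_expansion[of M z] obtain a where a: "\<forall>t. psi_fun k M z (cp t) = wv ?I a t" by (elim exE)
  show ?thesis unfolding I_cavity_def by (rule c(3)[THEN spec, THEN spec, THEN mp, OF a])
 qed
 show ?thesis by (rule exI[of _ c1], rule exI[of _ c2]) (use B c(1,2) in blast)
qed

end
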